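(* Let $\mathcal A_1$ denote the Airy$_1$ process. For any $c\geq \tfrac32$ there is a constant $C$ (depending on $c$ but not on $L$) such that, for all $L$ large enough, \[ \mathbb{P}\big(\mathcal A_1(s)\leq c \text{ for all } s\in[0,L]\big)=C\,e^{-\kappa(c)L+\mathcal O(e^{-L})}, \] where \[ \kappa(c)=-2\sum_{n=1}^\infty n^{-5/3}\,\mathrm{Ai}'\big(2n^{2/3}c\big), \] and $\mathrm{Ai}'$ is the derivative of the Airy function $\mathrm{Ai}$.
   Context: The Airy$_1$ process $\mathcal A_1=(\mathcal A_1(t))_{t\in\mathbb R}$ is the stationary continuous stochastic process (the large-time limit process of KPZ growth models with flat non-random initial condition, introduced by Sasamoto) whose finite-dimensional distributions are given by Fredholm determinants: for $t_1<\dots<t_m$ and $s_1,\dots,s_m\in\mathbb R$, $\mathbb P(\mathcal A_1(t_k)\le s_k,\ k=1,\dots,m)=\det(\mathbb 1-\chi_s K\chi_s)_{L^2(\{t_1,\dots,t_m\}\times\mathbb R)}$, with $\chi_s(t_k,x)=\mathbb 1_{x>s_k}$ and extended kernel $K(t_i,x;t_j,y)=-\frac{\mathbb 1_{t_j>t_i}}{\sqrt{4\pi(t_j-t_i)}}e^{-\frac{(y-x)^2}{4(t_j-t_i)}}+\mathrm{Ai}\big(x+y+(t_j-t_i)^2\big)e^{(t_j-t_i)(x+y)+\frac23(t_j-t_i)^3}$. Its one-point distribution is $\mathbb P(\mathcal A_1(t)\le s)=F_1(2s)$ with $F_1$ the GOE Tracy–Widom distribution. *)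

theory Defs
  imports "HOL-Probability.Probability" "HOL-Library.Landau_Symbols"
begin

text \<open>Airy function, via its standard (improper, conditionally convergent) integral
  representation Ai(x) = (1/pi) lim_{R->oo} int_0^R cos(t^3/3 + x t) dt.\<close>
definition Airy_Ai :: "real \<Rightarrow> real" where
  "Airy_Ai x = (1 / pi) * Lim at_top (\<lambda>R. integral {0..R} (\<lambda>t. cos (t ^ 3 / 3 + x * t)))"

definition airy1_kernel :: "real \<Rightarrow> real \<Rightarrow> real \<Rightarrow> real \<Rightarrow> real" where
  "airy1_kernel ti x tj y =
     - (if tj > ti then exp (- ((y - x) ^ 2) / (4 * (tj - ti))) / sqrt (4 * pi * (tj - ti)) else 0)
     + Airy_Ai (x + y + (tj - ti) ^ 2) * exp ((tj - ti) * (x + y) + 2 / 3 * (tj - ti) ^ 3)"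

definition detn :: "nat \<Rightarrow> (nat \<Rightarrow> nat \<Rightarrow> real) \<Rightarrow> real" where
  "detn n A = (\<Sum>p | p permutes {..<n}. of_int (sign p) * (\<Prod>i<n. A i (p i)))"

text \<open>Fredholm determinant det(1 - chi_s K chi_s) on L^2({t_0,..,t_(m-1)} x R), where the
  discrete part carries counting measure, via the Fredholm series
  sum_n (-1)^n/n! int det[ (chi_s K chi_s)(z_i,z_j) ]_{i,j<n} dz_1..dz_n.
  A point (t_k, x) is encoded by the index k < m and x.\<close>
definition airy1_fredholm :: "nat \<Rightarrow> (nat \<Rightarrow> real) \<Rightarrow> (nat \<Rightarrow> real) \<Rightarrow> real" where
  "airy1_fredholm m t s =
     (\<Sum>n. (-1) ^ n / fact n *
        (\<Sum>\<kappa> \<in> PiE {..<n} (\<lambda>_. {..<m}).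
           integral\<^sup>L (PiM {..<n} (\<lambda>_. lborel))
             (\<lambda>x. detn n (\<lambda>i j. indicator {s (\<kappa> i)<..} (x i)
                                  * airy1_kernel (t (\<kappa> i)) (x i) (t (\<kappa> j)) (x j)
                                  * indicator {s (\<kappa> j)<..} (x j)))))"

definition is_airy1_process :: "'a measure \<Rightarrow> (real \<Rightarrow> 'a \<Rightarrow> real) \<Rightarrow> bool" where
  "is_airy1_process M X \<longleftrightarrow>
     prob_space M \<and>
     (\<forall>t. X t \<in> borel_measurable M) \<and>
     (\<forall>\<omega>\<in>space M. continuous_on UNIV (\<lambda>t. X t \<omega>)) \<and>
     (\<forall>m t s. m \<ge> 1 \<longrightarrow> (\<forall>i j. i < j \<longrightarrow> j < m \<longrightarrow> t i < t j) \<longrightarrow>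
        measure M {\<omega> \<in> space M. \<forall>k<m. X (t k) \<omega> \<le> s k} = airy1_fredholm m t s)"

definition airy1_kappa :: "real \<Rightarrow> real" where
  "airy1_kappa c = - 2 * (\<Sum>n. real (Suc n) powr (-5/3) * deriv Airy_Ai (2 * real (Suc n) powr (2/3) * c))"

end

theory Submission
  imports Defs "HOL-Complex_Analysis.Complex_Analysis" "Jordan_Normal_Form.Determinant" "HOL-Real_Asymp.Real_Asymp"
begin
text \<open>
  On a time grid the extended kernel is the sum of an Airy part and a strictly triangular heat-kernel part. Dividing out the
  triangular part, whose Fredholm determinant is 1, turns the determinant into that of a kernel on the real line which
  compares the free heat flow with the heat flow killed above \<open>c\<close>. When the mesh goes to 0 the killed flow
  becomes the one with absorbing boundary at \<open>c\<close>, given by reflection, and decomposing at the first passage time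
  rewrites the determinant on the boundary curve of the killed region, parametrised by \<open>s <= L\<close>.

  For \<open>c >= 3/2\<close> the tilted rows of the boundary kernel have mass at most 1/2, so the logarithm of the determinant is
  the sum of the traces of its powers. The derivative of the \<open>n\<close>-th trace in \<open>L\<close> is \<open>n\<close> times the weight of the closed
  paths whose highest point is \<open>L\<close>. Near \<open>L\<close> the kernel is exponentially close to a translation-invariant one, for which the
  cycle lemma identifies this weight as the \<open>n\<close>-fold convolution at 0 divided by \<open>n\<close>. In Laplace variables
  the convolution kernel is \<open>exp (s\<^bsup>3/2\<^esup>/3 - 2 c \<surd>s)\<close>, so its \<open>n\<close>-th power is a rescaled copy of itself, and the value at 0 is
  \<open>- 2 n\<^bsup>-2/3\<^esup> Ai' (2 n\<^bsup>2/3\<^esup> c)\<close>.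
  \<close>

lemmas L1_bound = Bochner_Integration.integrable_bound
  and LINT_cong = Bochner_Integration.integral_cong
  and L1_add = Bochner_Integration.integrable_add
  and L1_diff = Bochner_Integration.integrable_diff
  and L1_sum = Bochner_Integration.integrable_sum
  and LINT_add = Bochner_Integration.integral_add
  and LINT_diff = Bochner_Integration.integral_diff
  and LINT_sum = Bochner_Integration.integral_sum
  and Leb_iff = has_bochner_integral_iff
  and Leb_eq = has_bochner_integral_integral_eq

abbreviation (input) Leb1 :: "('a::euclidean_space => 'b::{banach, second_countable_topology}) => bool" where
  "Leb1 == integrable lborel"
abbreviation (input) Leb_has :: "('a::euclidean_space => 'b::{banach, second_countable_topology}) => 'b => bool" where
  "Leb_has == has_bochner_integral lborel"
abbreviation (input) ind :: "'a set => 'a => 'b::zero_neq_one" where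
  "ind == indicator"
abbreviation (input) bmeas :: "'a measure => ('a => 'b::topological_space) set" where
  "bmeas == borel_measurable"
abbreviation (input) limseq :: "(nat => 'a::topological_space) => 'a => bool" (infixr "---->" 60) where
  "f ----> l == (f \<longlonglongrightarrow> l)"

lemma integrable_dominated:
  fixes f :: "'a => 'b::{banach, second_countable_topology}"
  assumes "integrable M g" "f \<in> bmeas M" "!!x. norm (f x) <= g x"
  shows "integrable M f" by (rule L1_bound[OF assms(1,2)]) (use assms(3) in \<open>auto intro!: AE_I2 order_trans[OF _ abs_ge_self]\<close>)

section \<open>Hadamard's inequality\<close>

definition reflect :: "nat => (nat => real) => (nat => real) => nat => real" where
  "reflect n u x j = x j - 2*(\<Sum>k<n. x k*u k)/(\<Sum>k<n. (u k)^2)*u j"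

lemma sum_squares_reflect: "(\<Sum>j<n. (reflect n u x j)^2) = (\<Sum>j<n. (x j)^2)"
proof -
  define s t where "s = (\<Sum>k<n. (u k)^2)" and "t = (\<Sum>k<n. x k*u k)"
  have "(\<Sum>j<n. (reflect n u x j)^2) = (\<Sum>j<n. (x j)^2 - 4*t/s*(x j*u j) + 4*t^2/s^2*(u j)^2)"
    unfolding reflect_def s_def[symmetric] t_def[symmetric] by (intro sum.cong refl) (simp add: power2_eq_square algebra_simps)
  also have "... = (\<Sum>j<n. (x j)^2) - 4*t/s*t + 4*t^2/s^2 * s"
    unfolding sum.distrib sum_subtractf sum_distrib_left[symmetric] t_def[symmetric] s_def[symmetric] ..
  also have "... = (\<Sum>j<n. (x j)^2)" by (cases "s = 0") (simp_all add: power2_eq_square field_simps)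
  finally show ?thesis .
qed

text \<open>The vector \<open>u\<close> bisects \<open>x\<close> and the first axis, so the reflection maps \<open>x\<close> to that axis.\<close>
lemma reflect_to_axis:
  fixes x :: "nat => real"
  assumes n: "0 < n"
  defines "u \<equiv> %j. x j - (if j = 0 then sqrt (\<Sum>k<n. (x k)^2) else 0)"
  assumes j: "0 < j" "j < n"
  shows "reflect n u x j = 0"
proof -
  define r where "r = sqrt (\<Sum>k<n. (x k)^2)"
  have r_sq: "r^2 = (\<Sum>k<n. (x k)^2)" unfolding r_def by (simp add: sum_nonneg)
  have u: "u j = x j - (if j = 0 then r else 0)" for j unfolding u_def r_def ..
  have "(\<Sum>k<n. x k*u k) = (\<Sum>k<n. (x k)^2 - (if k = 0 then r*x 0 else 0))"
    by (intro sum.cong refl) (auto simp: u power2_eq_square algebra_simps)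
  also have "... = r^2 - r*x 0" unfolding sum_subtractf r_sq using n by simp
  finally have x_u: "(\<Sum>k<n. x k*u k) = r^2 - r*x 0" .
  have "(\<Sum>k<n. (u k)^2) = (\<Sum>k<n. (x k)^2 + (if k = 0 then r^2 - 2*r*x 0 else 0))"
    by (intro sum.cong refl) (auto simp: u power2_eq_square algebra_simps)
  also have "... = 2*(\<Sum>k<n. x k*u k)" unfolding sum.distrib x_u r_sq[symmetric] using n by simp
  finally have u_u: "(\<Sum>k<n. (u k)^2) = 2*(\<Sum>k<n. x k*u k)" .
  show ?thesis
  proof (cases "(\<Sum>k<n. (u k)^2) = 0")
    case True
    then have "u j = 0" using j by (subst (asm) sum_nonneg_eq_0_iff) auto
    then show ?thesis using j unfolding reflect_def by (simp add: u)
  next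
    case False
    then show ?thesis using j unfolding reflect_def u_u by (simp add: u)
  qed
qed

lemma abs_det_reflection_matrix:
  fixes n and u :: "nat => real"
  defines "s \<equiv> \<Sum>k<n. (u k)^2"
  shows "abs (Determinant.det (mat n n (%(i,j). (if i = j then 1 else 0) - 2*u i*u j/s))) = 1"
proof -
  define Q where "Q = mat n n (%(i,j). (if i = j then 1 else 0) - 2*u i*u j/s)"
  have carrier: "Q \<in> carrier_mat n n" unfolding Q_def by simp
  have "Q*Q = 1\<^sub>m n"
  proof (rule eq_matI)
    fix i j assume "i < dim_row (1\<^sub>m n :: real mat)" "j < dim_col (1\<^sub>m n :: real mat)"
    then have ij: "i < n" "j < n" by auto
    have "(Q*Q) $$ (i,j) = (\<Sum>k<n. ((if i = k then 1 else 0) - 2*u i*u k/s)*((if k = j then 1 else 0) - 2*u k*u j/s))"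
      using ij unfolding Q_def by (simp add: scalar_prod_def atLeast0LessThan)
    also have "... = (\<Sum>k<n. (if i = k then if k = j then 1 else 0 else 0)
      - (if i = k then 2*u k*u j/s else 0) - (if k = j then 2*u i*u k/s else 0) + 4*u i*u j/s^2*(u k)^2)"
      by (intro sum.cong refl) (auto simp: algebra_simps power2_eq_square)
    also have "... = (if i = j then 1 else 0) - 2*u i*u j/s - 2*u i*u j/s + 4*u i*u j/s^2 * s"
      unfolding sum.distrib sum_subtractf sum_distrib_left[symmetric] s_def[symmetric] using ij by simp
    also have "... = (if i = j then 1 else 0)" by (cases "s = 0") (simp_all add: field_simps power2_eq_square)
    finally show "(Q*Q) $$ (i,j) = 1\<^sub>m n $$ (i,j)" using ij by simp
  qed (auto simp: Q_def)
  then have "Determinant.det Q*Determinant.det Q = 1" using det_mult[OF carrier carrier] by simp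
  then show ?thesis unfolding Q_def[symmetric] by (metis abs_mult abs_one abs_mult_self_eq real_sqrt_abs2 real_sqrt_one)
qed

lemma abs_det_reflect_rows:
  fixes f :: "nat => nat => real"
  shows "abs (Determinant.det (mat n n (%(i,j). reflect n u (f i) j))) = abs (Determinant.det (mat n n (%(i,j). f i j)))"
proof -
  define s where "s = (\<Sum>k<n. (u k)^2)"
  define q where "q = (%i j. (if i = j then 1 else 0) - 2*u i*u j/s)"
  let ?F = "mat n n (%(i,j). f i j)" and ?Q = "mat n n (%(i,j). q i j)"
  have "mat n n (%(i,j). reflect n u (f i) j) = ?F * ?Q"
  proof (rule eq_matI)
    fix i j assume "i < dim_row (?F * ?Q)" "j < dim_col (?F * ?Q)"
    then have ij: "i < n" "j < n" by auto
    have "(\<Sum>k<n. f i k*q k j) = (\<Sum>k<n. (if k = j then f i k else 0) - 2*u j/s*(f i k*u k))"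
      unfolding q_def by (intro sum.cong refl) (auto simp: algebra_simps)
    also have "... = reflect n u (f i) j" unfolding sum_subtractf sum_distrib_left[symmetric] reflect_def s_def using ij by simp
    finally show "mat n n (%(i,j). reflect n u (f i) j) $$ (i,j) = (?F * ?Q) $$ (i,j)"
      using ij by (simp add: scalar_prod_def atLeast0LessThan)
  qed auto
  then have "Determinant.det (mat n n (%(i,j). reflect n u (f i) j)) = Determinant.det ?F*Determinant.det ?Q"
    using det_mult[of ?F n ?Q] by simp
  then show ?thesis using abs_det_reflection_matrix[where n=n and u=u] by (simp add: abs_mult q_def s_def)
qed

lemma det_first_row_on_axis:
  fixes h :: "nat => nat => 'a::comm_ring_1"
  assumes "!!j. 0 < j ==> j \<le> n ==> h 0 j = 0"
  shows "Determinant.det (mat (Suc n) (Suc n) (%(i,j). h i j))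
  = h 0 0*Determinant.det (mat n n (%(i,j). h (Suc i) (Suc j)))"
proof -
  let ?A = "mat (Suc n) (Suc n) (%(i,j). h i j)"
  have "Determinant.det ?A = (\<Sum>j<Suc n. ?A $$ (0,j)*cofactor ?A 0 j)" by (rule laplace_expansion_row) auto
  also have "... = (\<Sum>j\<in>{0}. ?A $$ (0,j)*cofactor ?A 0 j)" by (rule sum.mono_neutral_right) (use assms in auto)
  also have "... = h 0 0*Determinant.det (mat_delete ?A 0 0)" by (simp add: cofactor_def)
  also have "mat_delete ?A 0 0 = mat n n (%(i,j). h (Suc i) (Suc j))" unfolding mat_delete_def by (rule eq_matI) auto
  finally show ?thesis .
qed

lemma det_square_le_prod_rows:
  fixes f :: "nat => nat => real"
  shows "(Determinant.det (mat n n (%(i,j). f i j)))^2 <= (\<Prod>i<n. \<Sum>j<n. (f i j)^2)"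
proof (induction n arbitrary: f)
  case 0
  then show ?case by simp
next
  case (Suc m)
  define u where "u = (%j. f 0 j - (if j = 0 then sqrt (\<Sum>k<Suc m. (f 0 k)^2) else 0))"
  define h where "h = (%i. reflect (Suc m) u (f i))"
  have axis: "h 0 j = 0" if "0 < j" "j \<le> m" for j using reflect_to_axis[of "Suc m" j "f 0"] that unfolding h_def u_def by simp
  have "(Determinant.det (mat (Suc m) (Suc m) (%(i,j). f i j)))^2
    = (Determinant.det (mat (Suc m) (Suc m) (%(i,j). h i j)))^2"
    using abs_det_reflect_rows[of "Suc m" u f] unfolding h_def by (metis power2_abs)
  also have "... = (h 0 0)^2*(Determinant.det (mat m m (%(i,j). h (Suc i) (Suc j))))^2"
    using det_first_row_on_axis[of m h, OF axis] by (simp add: power_mult_distrib)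
  also have "... <= (h 0 0)^2*(\<Prod>i<m. \<Sum>j<m. (h (Suc i) (Suc j))^2)" by (intro mult_left_mono Suc.IH) auto
  also have "... <= (\<Sum>j<Suc m. (h 0 j)^2)*(\<Prod>i<m. \<Sum>j<Suc m. (h (Suc i) j)^2)"
  proof (intro mult_mono prod_mono conjI)
    show "(h 0 0)^2 <= (\<Sum>j<Suc m. (h 0 j)^2)" by (rule member_le_sum) auto
    show "(\<Sum>j<m. (h (Suc i) (Suc j))^2) <= (\<Sum>j<Suc m. (h (Suc i) j)^2)" for i by (subst sum.lessThan_Suc_shift) auto
  qed (auto intro!: prod_nonneg sum_nonneg simp del: sum.lessThan_Suc)
  also have "... = (\<Prod>i<Suc m. \<Sum>j<Suc m. (f i j)^2)" unfolding prod.lessThan_Suc_shift h_def sum_squares_reflect by simp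
  finally show ?case .
qed

lemma detn_eq_det: "detn n f = Determinant.det (mat n n (%(i,j). f i j))"
proof -
  have "(\<Prod>i<n. f i (p i)) = (\<Prod>i = 0..<n. mat n n (%(i,j). f i j) $$ (i, p i))" if "p permutes {..<n}" for p
    unfolding atLeast0LessThan using permutes_in_image[OF that] by (intro prod.cong refl) auto
  then show ?thesis unfolding detn_def Determinant.det_def by (simp add: atLeast0LessThan)
qed

lemma detn_scale_rows_columns: "detn n (%i j. a i*f i j*b j) = (\<Prod>i<n. a i*b i)*detn n f"
proof -
  have "(\<Prod>i<n. a i*f i (p i)*b (p i)) = (\<Prod>i<n. a i*b i)*(\<Prod>i<n. f i (p i))" if "p permutes {..<n}" for p
    using prod.permute[OF that, of b] by (simp add: prod.distrib comp_def)
  then show ?thesis unfolding detn_def by (simp add: sum_distrib_left mult_ac)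
qed

lemma detn_cong:
  assumes "!!i j. i < n ==> j < n ==> f i j = h i j"
  shows "detn n f = detn n h" unfolding detn_eq_det by (intro arg_cong[of _ _ Determinant.det] eq_matI) (auto simp: assms)

lemma Hadamard_bound:
  fixes f :: "nat => nat => real"
  assumes f: "!!i j. i < n ==> j < n ==> abs (f i j) <= C*a i*b j"
  and C: "0 <= C" and a: "!!i. 0 <= a i" and b: "!!i. 0 <= b i"
  shows "abs (detn n f) <= (C * sqrt n) ^ n*(\<Prod>i<n. a i*b i)"
proof -
  define h where "h = (%i j. f i j/(a i*b j))"
  have h: "abs (h i j) <= C" "f i j = a i*h i j*b j" if "i < n" "j < n" for i j using f[OF that] C a[of i] b[of j] unfolding h_def
    by (cases "a i*b j = 0"; auto simp: abs_mult field_simps less_le)+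
  have "(detn n h)^2 <= (\<Prod>i<n. \<Sum>j<n. (h i j)^2)" unfolding detn_eq_det by (rule det_square_le_prod_rows)
  also have "... <= (\<Prod>i<n. \<Sum>j<n. C^2)"
    by (intro prod_mono conjI sum_mono sum_nonneg) (auto intro!: abs_le_square_iff[THEN iffD1] simp: h C)
  also have "... = ((C * sqrt n) ^ n)^2" by (simp add: power_mult_distrib power2_eq_square mult_ac flip: power_mult_distrib)
  finally have "abs (detn n h) <= (C * sqrt n) ^ n" using C by (simp add: abs_le_square_iff[symmetric])
  moreover have "detn n f = (\<Prod>i<n. a i*b i)*detn n h" unfolding detn_scale_rows_columns[symmetric] by (intro detn_cong h)
  ultimately show ?thesis unfolding abs_mult using a b by (simp add: abs_mult abs_of_nonneg prod_nonneg mult.commute mult_right_mono)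
qed

section \<open>Fredholm determinants of dominated kernels\<close>

lemma Fubini_dominated:
  fixes f :: "'a => 'b => 'c::{banach, second_countable_topology}"
  assumes sigma_finite: "sigma_finite_measure mu" "sigma_finite_measure nu"
  and f: "(%p. f (fst p) (snd p)) \<in> bmeas (mu \<Otimes>\<^sub>M nu)"
  and bound: "!!x y. norm (f x y) <= a x*b y" and a: "integrable mu a" and b: "integrable nu b"
  shows "integrable (mu \<Otimes>\<^sub>M nu) (%p. f (fst p) (snd p))"
  and "(\<integral>x. (\<integral>y. f x y \<partial>nu) \<partial>mu) = (\<integral>y. (\<integral>x. f x y \<partial>mu) \<partial>nu)"
  and "integrable mu (%x. \<integral>y. f x y \<partial>nu)"
proof -
  interpret pair_sigma_finite mu nu using sigma_finite by (simp add: pair_sigma_finite_def)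
  have [measurable]: "a \<in> bmeas mu" "b \<in> bmeas nu" using a b by auto
  have "integrable (mu \<Otimes>\<^sub>M nu) (%p. a (fst p)*b (snd p))"
    by (rule Fubini_integrable) (use a b in \<open>auto simp: abs_mult\<close>)
  then show pair: "integrable (mu \<Otimes>\<^sub>M nu) (%p. f (fst p) (snd p))" by (rule integrable_dominated[OF _ f]) (use bound in auto)
  then have int: "integrable (mu \<Otimes>\<^sub>M nu) (case_prod f)" by (simp add: case_prod_beta')
  from Fubini_integral[OF int] show "(\<integral>x. (\<integral>y. f x y \<partial>nu) \<partial>mu) = (\<integral>y. (\<integral>x. f x y \<partial>mu) \<partial>nu)" by simp
  from integrable_fst'[OF int] show "integrable mu (%x. \<integral>y. f x y \<partial>nu)" by simp
qed

lemma abs_mult_mono: "abs x <= a ==> abs y <= b ==> abs (x*y) <= a*b" for x y a b :: real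
  unfolding abs_mult by (intro mult_mono) (auto intro: order_trans[OF abs_ge_zero])

definition kcomp :: "'b measure => ('a => 'b => real) => ('b => 'c => real) => 'a => 'c => real" where
  "kcomp nu X Y x z = (\<integral>y. X x y*Y y z \<partial>nu)"

definition ktrace :: "'a measure => ('a => 'a => real) => real" where
  "ktrace mu K = (\<integral>x. K x x \<partial>mu)"

text \<open>\<open>kpow mu K n\<close> is the power \<open>K ^ (n + 1)\<close>.\<close>
fun kpow :: "'a measure => ('a => 'a => real) => nat => 'a => 'a => real" where
  "kpow mu K 0 = K"
  | "kpow mu K (Suc n) = kcomp mu (kpow mu K n) K"

definition trpow :: "'a measure => ('a => 'a => real) => nat => real" where
  "trpow mu K n = ktrace mu (kpow mu K n)"

lemma kcomp_scale_left: "kcomp mu (%x y. u*X x y) Y = (%x y. u*kcomp mu X Y x y)" unfolding kcomp_def fun_eq_iff by (simp add: mult.assoc)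

lemma kcomp_scale_right: "kcomp mu X (%x y. u*Y x y) = (%x y. u*kcomp mu X Y x y)"
  unfolding kcomp_def fun_eq_iff by (simp add: mult.left_commute)

lemma kpow_scale: "kpow mu (%x y. u*X x y) n = (%x y. u ^ Suc n*kpow mu X n x y)"
proof (induction n)
  case (Suc n)
  have "kpow mu (%x y. u*X x y) (Suc n) = kcomp mu (%x y. u ^ Suc n*kpow mu X n x y) (%x y. u*X x y)" by (simp only: kpow.simps Suc)
  also have "... = (%x y. u ^ Suc n*(u*kcomp mu (kpow mu X n) X x y))"
    by (simp only: kcomp_scale_left[of mu "u ^ Suc n" "kpow mu X n"] kcomp_scale_right[of mu _ u X])
  finally show ?case by (simp add: mult_ac)
qed simp

lemma ktrace_scale: "ktrace mu (%x y. u*X x y) = u*ktrace mu X" unfolding ktrace_def by simp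

lemma trpow_scale: "trpow mu (%x y. u*X x y) n = u ^ Suc n*trpow mu X n" unfolding trpow_def kpow_scale ktrace_scale ..

definition dominated_by ::
  "real => 'a measure => ('a => real) => 'b measure => ('b => real) => ('a => 'b => real) => bool" where
  "dominated_by C mu g nu k X \<longleftrightarrow> 0 <= C \<and> space mu = UNIV \<and> space nu = UNIV \<and>
  (%p. X (fst p) (snd p)) \<in> bmeas (mu \<Otimes>\<^sub>M nu) \<and> (\<forall>x y. abs (X x y) <= C*g x*k y)"

definition dominated ::
  "'a measure => ('a => real) => 'b measure => ('b => real) => ('a => 'b => real) => bool" where
  "dominated mu g nu k X \<longleftrightarrow> (\<exists>C. dominated_by C mu g nu k X)"

lemma dominated_byD:
  assumes "dominated_by C mu g nu k X"
  shows "0 <= C" "space mu = UNIV" "space nu = UNIV" "abs (X x y) <= C*g x*k y" using assms by (auto simp: dominated_by_def)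

lemma dominated_by_measurable:
  assumes "dominated_by C mu g nu k K" "f \<in> measurable N mu" "h \<in> measurable N nu"
  shows "(%x. K (f x) (h x)) \<in> bmeas N"
proof -
  have "(%x. (f x, h x)) \<in> measurable N (mu \<Otimes>\<^sub>M nu)" using assms(2,3) by (rule measurable_Pair)
  from measurable_compose[OF this, of "%p. K (fst p) (snd p)" borel] assms(1)
  show ?thesis by (simp add: dominated_by_def)
qed

locale weighted_measure = sigma_finite_measure mu for mu :: "'a measure" +
  fixes g k :: "'a => real"
  assumes space_UNIV [simp]: "space mu = UNIV"
  and g_measurable [measurable]: "g \<in> bmeas mu"
  and k_measurable [measurable]: "k \<in> bmeas mu"
  and g_nonneg [simp]: "!!x. 0 <= g x" and k_nonneg [simp]: "!!x. 0 <= k x"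
  and gk_integrable: "integrable mu (%x. g x*k x)"
begin

definition mass :: real where "mass = (\<integral>x. g x*k x \<partial>mu)"

lemma mass_nonneg [simp]: "0 <= mass" unfolding mass_def by (simp add: integral_nonneg_AE)

context
  fixes C D :: real and nu :: "'b measure" and rh :: "'c measure" and g' k' X Y
  assumes X: "dominated_by C nu g' mu k X" and Y: "dominated_by D mu g rh k' Y"
begin

lemma kcomp_integrand_bound: "abs (X x z*Y z y) <= (C*D*g' x*k' y)*(g z*k z)"
  using abs_mult_mono[OF dominated_byD(4)[OF X] dominated_byD(4)[OF Y], of x z z y] by (simp add: mult_ac)

lemma kcomp_integrable: "integrable mu (%z. X x z*Y z y)"
proof (rule L1_bound)
  show "integrable mu (%z. (C*D*g' x*k' y)*(g z*k z))" by (intro integrable_mult_right gk_integrable)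
  show "(%z. X x z*Y z y) \<in> bmeas mu" by (intro borel_measurable_times dominated_by_measurable[OF X] dominated_by_measurable[OF Y])
    (auto simp: dominated_byD(2)[OF X] dominated_byD(3)[OF Y])
  show "AE z in mu. norm (X x z*Y z y) <= norm ((C*D*g' x*k' y)*(g z*k z))"
    using kcomp_integrand_bound[of x _ y] by (auto intro!: AE_I2 order_trans[OF _ abs_ge_self])
qed

lemma dominated_by_kcomp: "dominated_by (C*D*mass) nu g' rh k' (kcomp mu X Y)" unfolding dominated_by_def
proof (intro conjI allI)
  note [measurable] = dominated_by_measurable[OF X] dominated_by_measurable[OF Y]
  show "(%p. kcomp mu X Y (fst p) (snd p)) \<in> bmeas (nu \<Otimes>\<^sub>M rh)" unfolding kcomp_def by measurable
  fix x y
  have "abs (kcomp mu X Y x y) <= (\<integral>z. abs (X x z*Y z y) \<partial>mu)" unfolding kcomp_def by (rule integral_abs_bound)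
  also have "... <= (\<integral>z. (C*D*g' x*k' y)*(g z*k z) \<partial>mu)" using kcomp_integrand_bound[of x _ y]
    by (intro integral_mono integrable_abs kcomp_integrable integrable_mult_right gk_integrable) auto
  also have "... = C*D*mass*g' x*k' y" unfolding mass_def by simp
  finally show "abs (kcomp mu X Y x y) <= C*D*mass*g' x*k' y" .
qed (simp_all add: dominated_byD[OF X] dominated_byD[OF Y])

end

lemma kcomp_assoc_dominated_by:
  assumes rh: "weighted_measure rh g' k'"
  and X: "dominated_by C nu g'' mu k X" and Y: "dominated_by D mu g rh k' Y" and Z: "dominated_by E rh g' sg k'' Z"
  shows "kcomp rh (kcomp mu X Y) Z = kcomp mu X (kcomp rh Y Z)"
proof (intro ext)
  fix x y
  interpret rh: weighted_measure rh g' k' by (rule rh)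
  note [measurable] = dominated_by_measurable[OF X] dominated_by_measurable[OF Y] dominated_by_measurable[OF Z]
  have "kcomp rh (kcomp mu X Y) Z x y = (\<integral>z. (\<integral>w. X x w*Y w z*Z z y \<partial>mu) \<partial>rh)"
    unfolding kcomp_def by (simp add: kcomp_integrable[OF X Y])
  also have "... = (\<integral>w. (\<integral>z. X x w*Y w z*Z z y \<partial>rh) \<partial>mu)"
  proof (rule Fubini_dominated(2)[where a="%z. (C*D*E*g'' x*k'' y)*(g' z*k' z)" and b="%w. g w*k w"])
    fix z w
    show "norm (X x w*Y w z*Z z y) <= (C*D*E*g'' x*k'' y)*(g' z*k' z)*(g w*k w)"
      using abs_mult_mono[OF kcomp_integrand_bound[OF X Y] dominated_byD(4)[OF Z], of x w z z y] by (simp add: mult_ac)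
  qed (use sigma_finite_measure_axioms rh.sigma_finite_measure_axioms dominated_byD(2)[OF X] dominated_byD(3)[OF Z] in
    \<open>auto intro!: integrable_mult_right gk_integrable rh.gk_integrable\<close>)
  also have "... = kcomp mu X (kcomp rh Y Z) x y" unfolding kcomp_def by (simp add: mult.assoc rh.kcomp_integrable[OF Y Z])
  finally show "kcomp rh (kcomp mu X Y) Z x y = kcomp mu X (kcomp rh Y Z) x y" .
qed

lemma ktrace_kcomp_commute_dominated_by:
  assumes nu: "weighted_measure nu g' k'" and X: "dominated_by C mu g nu k' X" and Y: "dominated_by D nu g' mu k Y"
  shows "ktrace mu (kcomp nu X Y) = ktrace nu (kcomp mu Y X)"
proof -
  interpret nu: weighted_measure nu g' k' by (rule nu)
  note [measurable] = dominated_by_measurable[OF X] dominated_by_measurable[OF Y]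
  have "ktrace mu (kcomp nu X Y) = (\<integral>x. (\<integral>z. X x z*Y z x \<partial>nu) \<partial>mu)" unfolding ktrace_def kcomp_def ..
  also have "... = (\<integral>z. (\<integral>x. X x z*Y z x \<partial>mu) \<partial>nu)"
  proof (rule Fubini_dominated(2)[where a="%x. C*D*(g x*k x)" and b="%z. g' z*k' z"])
    show "norm (X x z*Y z x) <= C*D*(g x*k x)*(g' z*k' z)" for x z using nu.kcomp_integrand_bound[OF X Y, of x z x] by (simp add: mult_ac)
  qed (use sigma_finite_measure_axioms nu.sigma_finite_measure_axioms in
    \<open>auto intro!: integrable_mult_right gk_integrable nu.gk_integrable\<close>)
  also have "... = ktrace nu (kcomp mu Y X)" unfolding ktrace_def kcomp_def by (simp add: mult.commute)
  finally show ?thesis .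
qed

lemma dominated_kcomp:
  "dominated nu g' mu k X ==> dominated mu g rh k' Y ==> dominated nu g' rh k' (kcomp mu X Y)"
  unfolding dominated_def using dominated_by_kcomp by blast

lemma kcomp_assoc:
  assumes "weighted_measure rh g' k'"
  and "dominated nu g'' mu k X" "dominated mu g rh k' Y" "dominated rh g' sg k'' Z"
  shows "kcomp rh (kcomp mu X Y) Z = kcomp mu X (kcomp rh Y Z)" using assms kcomp_assoc_dominated_by unfolding dominated_def by blast

lemma ktrace_kcomp_commute:
  assumes "weighted_measure nu g' k'" "dominated mu g nu k' X" "dominated nu g' mu k Y"
  shows "ktrace mu (kcomp nu X Y) = ktrace nu (kcomp mu Y X)" using assms ktrace_kcomp_commute_dominated_by unfolding dominated_def by blast

end

lemma trpow_kcomp_commute: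
  assumes mu: "weighted_measure mu g k" and nu: "weighted_measure nu g' k'"
  and X: "dominated mu g nu k' X" and Y: "dominated nu g' mu k Y"
  shows "trpow mu (kcomp nu X Y) n = trpow nu (kcomp mu Y X) n"
proof -
  interpret mu: weighted_measure mu g k by (rule mu)
  interpret nu: weighted_measure nu g' k' by (rule nu)
  define Z where "Z = rec_nat X (%_ Z. kcomp nu Z (kcomp mu Y X))"
  have Z_0: "Z 0 = X" and Z_Suc: "Z (Suc n) = kcomp nu (Z n) (kcomp mu Y X)" for n by (simp_all add: Z_def)
  note YX = mu.dominated_kcomp[OF Y X] and XY = nu.dominated_kcomp[OF X Y]
  have Z: "dominated mu g nu k' (Z n)" for n by (induction n) (auto simp: Z_0 Z_Suc X intro: nu.dominated_kcomp[OF _ YX])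
  have "kpow mu (kcomp nu X Y) n = kcomp nu (Z n) Y"
  proof (induction n)
    case (Suc n)
    have "kpow mu (kcomp nu X Y) (Suc n) = kcomp nu (Z n) (kcomp mu Y (kcomp nu X Y))" using nu.kcomp_assoc[OF mu Z Y XY] by (simp add: Suc)
    also have "kcomp mu Y (kcomp nu X Y) = kcomp nu (kcomp mu Y X) Y" by (rule mu.kcomp_assoc[OF nu Y X Y, symmetric])
    finally show ?case using nu.kcomp_assoc[OF nu Z YX Y] by (simp add: Z_Suc)
  qed (simp add: Z_0)
  moreover have "kpow nu (kcomp mu Y X) n = kcomp mu Y (Z n)"
  proof (induction n)
    case (Suc n)
    then show ?case using mu.kcomp_assoc[OF nu Y Z YX] by (simp add: Z_Suc)
  qed (simp add: Z_0)
  ultimately show ?thesis unfolding trpow_def using mu.ktrace_kcomp_commute[OF nu Z Y] by simp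
qed

context weighted_measure begin

abbreviation kernel :: "real => ('a => 'a => real) => bool" where
  "kernel C \<equiv> dominated_by C mu g mu k"

lemma kernel_assoc:
  "kernel C X ==> kernel D Y ==> kernel E Z ==> kcomp mu (kcomp mu X Y) Z = kcomp mu X (kcomp mu Y Z)"
  by (rule kcomp_assoc_dominated_by[OF weighted_measure_axioms])

lemma ktrace_kernel_commute: "kernel C X ==> kernel D Y ==> ktrace mu (kcomp mu X Y) = ktrace mu (kcomp mu Y X)"
  by (rule ktrace_kcomp_commute_dominated_by[OF weighted_measure_axioms])

lemma kernelI:
  assumes "0 <= C" "(%p. K (fst p) (snd p)) \<in> bmeas (mu \<Otimes>\<^sub>M mu)" "!!x y. abs (K x y) <= C*g x*k y"
  shows "kernel C K" using assms by (simp add: dominated_by_def)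

lemma kernel_mono: "kernel C K ==> C <= C' ==> kernel C' K"
  unfolding dominated_by_def by (meson g_nonneg k_nonneg mult_right_mono order_trans)

lemma kernel_add: "kernel C X ==> kernel D Y ==> kernel (C + D) (%x y. X x y + Y x y)"
  unfolding dominated_by_def by (auto intro!: order_trans[OF abs_triangle_ineq] add_mono simp: algebra_simps)

lemma kernel_scale: "kernel C X ==> kernel (abs u*C) (%x y. u*X x y)"
  unfolding dominated_by_def by (auto simp: abs_mult mult.assoc intro!: mult_left_mono)

lemma kernel_uminus: "kernel C X ==> kernel C (%x y. - X x y)" unfolding dominated_by_def by auto

lemma kernel_diff: "kernel C X ==> kernel D Y ==> kernel (C + D) (%x y. X x y - Y x y)"
  using kernel_add[of C X D "%x y. - Y x y"] kernel_uminus[of D Y] by simp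

lemma kcomp_add_left: "kernel C X ==> kernel C' X' ==> kernel D Y ==>
  kcomp mu (%x y. X x y + X' x y) Y = (%x y. kcomp mu X Y x y + kcomp mu X' Y x y)"
  unfolding kcomp_def fun_eq_iff by (simp add: distrib_right kcomp_integrable)

lemma kcomp_add_right: "kernel C X ==> kernel D Y ==> kernel D' Y' ==>
  kcomp mu X (%x y. Y x y + Y' x y) = (%x y. kcomp mu X Y x y + kcomp mu X Y' x y)"
  unfolding kcomp_def fun_eq_iff by (simp add: distrib_left kcomp_integrable)

lemma kcomp_diff_left: "kernel C X ==> kernel C' X' ==> kernel D Y ==>
  kcomp mu (%x y. X x y - X' x y) Y = (%x y. kcomp mu X Y x y - kcomp mu X' Y x y)"
  unfolding kcomp_def fun_eq_iff by (simp add: left_diff_distrib kcomp_integrable)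

lemma kcomp_diff_right: "kernel C X ==> kernel D Y ==> kernel D' Y' ==>
  kcomp mu X (%x y. Y x y - Y' x y) = (%x y. kcomp mu X Y x y - kcomp mu X Y' x y)"
  unfolding kcomp_def fun_eq_iff by (simp add: right_diff_distrib kcomp_integrable)

lemma kernel_kpow: "kernel C K ==> kernel (C*(C*mass) ^ n) (kpow mu K n)"
proof (induction n)
  case (Suc n)
  from dominated_by_kcomp[OF Suc.IH[OF Suc.prems] Suc.prems] show ?case by (simp add: mult_ac)
qed simp

lemma kcomp_kpow:
  assumes K: "kernel C K"
  shows "kcomp mu (kpow mu K i) (kpow mu K j) = kpow mu K (Suc (i + j))"
proof (induction j)
  case (Suc j)
  have "kcomp mu (kpow mu K i) (kpow mu K (Suc j)) = kcomp mu (kcomp mu (kpow mu K i) (kpow mu K j)) K"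
    by (simp add: kernel_assoc[OF kernel_kpow[OF K] kernel_kpow[OF K] K])
  then show ?case using Suc by simp
qed simp

lemma diag_integrable:
  assumes K: "kernel C K"
  shows "integrable mu (%x. K x x)"
proof (rule L1_bound)
  show "integrable mu (%z. C*(g z*k z))" by (intro integrable_mult_right gk_integrable)
  show "(%z. K z z) \<in> bmeas mu" by (intro dominated_by_measurable[OF K]) auto
  show "AE z in mu. norm (K z z) <= norm (C*(g z*k z))"
    using dominated_byD(4)[OF K] by (auto intro!: AE_I2 order_trans[OF _ abs_ge_self] simp: mult.assoc)
qed

lemma ktrace_bound:
  assumes K: "kernel C K"
  shows "abs (ktrace mu K) <= C*mass"
proof -
  have "abs (ktrace mu K) <= (\<integral>z. abs (K z z) \<partial>mu)" unfolding ktrace_def by (rule integral_abs_bound)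
  also have "... <= (\<integral>z. C*(g z*k z) \<partial>mu)" using dominated_byD(4)[OF K]
    by (intro integral_mono integrable_abs diag_integrable[OF K] integrable_mult_right gk_integrable) (simp add: mult.assoc)
  finally show ?thesis unfolding mass_def by simp
qed

lemma trpow_bound: "kernel C K ==> abs (trpow mu K n) <= (C*mass) ^ Suc n"
  unfolding trpow_def using ktrace_bound[OF kernel_kpow, of C K n] by (simp add: mult_ac)

lemma ktrace_add: "kernel C X ==> kernel D Y ==> ktrace mu (%x y. X x y + Y x y) = ktrace mu X + ktrace mu Y"
  unfolding ktrace_def by (simp add: diag_integrable)

lemma ktrace_diff: "kernel C X ==> kernel D Y ==> ktrace mu (%x y. X x y - Y x y) = ktrace mu X - ktrace mu Y"
  unfolding ktrace_def by (simp add: diag_integrable)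

end

subsection \<open>The Fredholm series as an exponential of traces\<close>

definition det_on :: "'i set => ('i => 'i => real) => real" where
  "det_on I M = (\<Sum>p | p permutes I. of_int (sign p)*(\<Prod>i\<in>I. M i (p i)))"

lemma detn_eq_det_on: "detn n M = det_on {..<n} M" unfolding detn_def det_on_def ..

lemma det_on_cong:
  assumes "!!i j. i \<in> I ==> j \<in> I ==> M i j = M' i j"
  shows "det_on I M = det_on I M'" unfolding det_on_def
  by (intro sum.cong refl arg_cong2[of _ _ _ _ "(*)"] prod.cong assms) (auto simp: permutes_in_image)

lemma det_on_insert:
  assumes S: "finite S" "j \<notin> S"
  shows "det_on (insert j S) M = M j j*det_on S M
  - (\<Sum>l\<in>S. M j l*det_on S (%i i'. if i' = l then M i j else M i i'))"
proof -
  let ?f = "%p. of_int (sign p)*(\<Prod>i\<in>insert j S. M i (p i)) :: real"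
  have fixed: "?f (Transposition.transpose j j \<circ> q) = M j j*(of_int (sign q)*(\<Prod>i\<in>S. M i (q i)))"
    if q: "q permutes S" for q using S permutes_not_in[OF q S(2)] by (simp add: comp_def)
  have moved: "?f (Transposition.transpose j l \<circ> q)
    = - (M j l*(of_int (sign q)*(\<Prod>i\<in>S. if q i = l then M i j else M i (q i))))"
    if q: "q permutes S" and l: "l \<in> S" for q l
  proof -
    have "j ~= l" using S l by auto
    moreover have "permutation q" using q S(1) by (auto simp: permutation_permutes)
    ultimately have "sign (Transposition.transpose j l \<circ> q) = - sign q"
      by (simp add: sign_compose[OF permutation_swap_id] sign_swap_id)
    moreover have "(\<Prod>i\<in>S. M i ((Transposition.transpose j l \<circ> q) i)) = (\<Prod>i\<in>S. if q i = l then M i j else M i (q i))"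
    proof (intro prod.cong refl)
      fix i assume "i \<in> S"
      then have "q i ~= j" using permutes_in_image[OF q] S by metis
      then show "M i ((Transposition.transpose j l \<circ> q) i) = (if q i = l then M i j else M i (q i))" by (auto simp: transpose_eq_iff)
    qed
    ultimately show ?thesis using S permutes_not_in[OF q S(2)] by simp
  qed
  have "det_on (insert j S) M = (\<Sum>b\<in>insert j S. \<Sum>q | q permutes S. ?f (Transposition.transpose j b \<circ> q))"
    unfolding det_on_def by (rule sum_over_permutations_insert[OF S])
  also have "... = (\<Sum>q | q permutes S. M j j*(of_int (sign q)*(\<Prod>i\<in>S. M i (q i))))
    + (\<Sum>l\<in>S. \<Sum>q | q permutes S. - (M j l*(of_int (sign q)*(\<Prod>i\<in>S. if q i = l then M i j else M i (q i)))))"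
    unfolding sum.insert[OF S] by (intro arg_cong2[of _ _ _ _ "(+)"] sum.cong refl fixed moved) auto
  also have "... = M j j*det_on S M - (\<Sum>l\<in>S. M j l*det_on S (%i i'. if i' = l then M i j else M i i'))"
    unfolding det_on_def by (simp add: sum_negf sum_distrib_left)
  finally show ?thesis .
qed

text \<open>The coefficients of the power series of \<open>exp (- (\<Sum>n. T n * u ^ (n + 1) / (n + 1)))\<close>;
  \<open>T n\<close> plays the role of the trace of the \<open>(n + 1)\<close>-st power.\<close>
fun fredcoef :: "(nat => real) => nat => real" where
  "fredcoef T 0 = 1"
  | "fredcoef T (Suc n) = - (\<Sum>i\<le>n. T i*fredcoef T (n - i))/(real n + 1)"

declare fredcoef.simps(2)[simp del]

lemma fredcoef_Suc: "(\<Sum>i\<le>n. T i*fredcoef T (n - i)) = - (real n + 1)*fredcoef T (Suc n)"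
  by (simp add: fredcoef.simps(2) field_simps)

definition newton_sum :: "(nat => real) => nat => nat => real" where
  "newton_sum T n k = (\<Sum>i\<le>n. T (k + i)*fredcoef T (n - i))"

lemma newton_sum_Suc: "newton_sum T (Suc n) k = T k*fredcoef T (Suc n) + newton_sum T n (Suc k)"
  unfolding newton_sum_def by (subst sum.atMost_Suc_shift) simp

context weighted_measure begin

lemma prod_permutation_bound:
  assumes I: "finite I" and p: "p permutes I"
  and M: "!!i j. i \<in> I ==> j \<in> I ==> abs (M i j) <= C*g (z i)*k (z j)"
  shows "abs (\<Prod>i\<in>I. M i (p i)) <= C ^ card I*(\<Prod>i\<in>I. g (z i)*k (z i))"
proof -
  have "abs (\<Prod>i\<in>I. M i (p i)) <= (\<Prod>i\<in>I. C*g (z i)*k (z (p i)))"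
    unfolding abs_prod using M permutes_in_image[OF p] by (intro prod_mono) auto
  also have "... = C ^ card I*(\<Prod>i\<in>I. g (z i))*(\<Prod>i\<in>I. k (z (p i)))" by (simp add: prod.distrib)
  also have "(\<Prod>i\<in>I. k (z (p i))) = (\<Prod>i\<in>I. k (z i))" using prod.permute[OF p, of "%i. k (z i)"] by (simp add: comp_def)
  finally show ?thesis by (simp add: prod.distrib)
qed

sublocale prod: product_sigma_finite "%_::nat. mu" by standard

lemma det_on_integrable:
  fixes I :: "nat set"
  assumes I: "finite I" and K: "!!i j. kernel C (K i j)"
  shows "integrable (Pi\<^sub>M I (%_. mu)) (%z. det_on I (%i j. K i j (z i) (z j)))" unfolding det_on_def
proof (intro L1_sum integrable_mult_right)
  fix p assume "p \<in> {p. p permutes I}"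
  then have p: "p permutes I" by simp
  show "integrable (Pi\<^sub>M I (%_. mu)) (%z. \<Prod>i\<in>I. K i (p i) (z i) (z (p i)))"
  proof (rule L1_bound)
    show "integrable (Pi\<^sub>M I (%_. mu)) (%z. C ^ card I*(\<Prod>i\<in>I. g (z i)*k (z i)))"
      by (intro integrable_mult_right prod.product_integrable_prod I gk_integrable)
    show "(%z. \<Prod>i\<in>I. K i (p i) (z i) (z (p i))) \<in> bmeas (Pi\<^sub>M I (%_. mu))" using permutes_in_image[OF p]
      by (intro borel_measurable_prod dominated_by_measurable[OF K] measurable_component_singleton) auto
    show "AE z in Pi\<^sub>M I (%_. mu). norm (\<Prod>i\<in>I. K i (p i) (z i) (z (p i))) <= norm (C ^ card I*(\<Prod>i\<in>I. g (z i)*k (z i)))"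
      using prod_permutation_bound[OF I p dominated_byD(4)[OF K]] by (auto intro!: AE_I2 order_trans[OF _ abs_ge_self])
  qed
qed

definition repl_col :: "('a => 'a => real) => ('a => 'a => real) => nat => (nat => 'a) => nat => nat => real" where
  "repl_col K R l z = (%i j. (if j = l then R else K) (z i) (z j))"

lemma repl_col_integrable:
  assumes I: "finite I" and K: "kernel C K" and R: "kernel D R"
  shows "integrable (Pi\<^sub>M I (%_. mu)) (%z. det_on I (repl_col K R l z))"
proof -
  have "kernel (max C D) (if b then R else K)" for b using kernel_mono[OF K, of "max C D"] kernel_mono[OF R, of "max C D"] by auto
  then show ?thesis unfolding repl_col_def by (rule det_on_integrable[OF I])
qed

lemma integral_column:
  assumes S: "finite S" "l \<in> S" and K: "kernel C K" and R: "kernel D R"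
  shows "integrable mu (%y. K y (z l)*det_on S (%i i'. if i' = l then R (z i) y else K (z i) (z i')))"
  and "(\<integral>y. K y (z l)*det_on S (%i i'. if i' = l then R (z i) y else K (z i) (z i')) \<partial>mu)
  = det_on S (repl_col K (kcomp mu R K) l z)"
proof -
  define P where "P = (%q. \<Prod>i\<in>S - {inv_into UNIV q l}. K (z i) (z (q i)))"
  have split_row: "(\<Prod>i\<in>S. if q i = l then r i else K (z i) (z (q i))) = r (inv_into UNIV q l)*P q"
    if q: "q permutes S" for q and r :: "nat => real"
  proof -
    have "inv_into UNIV q l \<in> S" using S(2) permutes_in_image[OF permutes_inv[OF q]] by simp
    from prod.remove[OF S(1) this, of "%i. if q i = l then r i else K (z i) (z (q i))"]
    have "(\<Prod>i\<in>S. if q i = l then r i else K (z i) (z (q i)))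
      = r (inv_into UNIV q l)*(\<Prod>i\<in>S - {inv_into UNIV q l}. if q i = l then r i else K (z i) (z (q i)))"
      using permutes_inverses(1)[OF q] by simp
    also have "(\<Prod>i\<in>S - {inv_into UNIV q l}. if q i = l then r i else K (z i) (z (q i))) = P q"
      unfolding P_def using permutes_inverses(2)[OF q] by (intro prod.cong) auto
    finally show ?thesis .
  qed
  have expand: "K y (z l)*det_on S (%i i'. if i' = l then R (z i) y else K (z i) (z i'))
    = (\<Sum>q | q permutes S. of_int (sign q)*((R (z (inv_into UNIV q l)) y*K y (z l))*P q))" for y unfolding det_on_def sum_distrib_left
    by (intro sum.cong refl) (simp add: split_row mult_ac)
  show "integrable mu (%y. K y (z l)*det_on S (%i i'. if i' = l then R (z i) y else K (z i) (z i')))"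
    unfolding expand by (intro L1_sum integrable_mult_right integrable_mult_left kcomp_integrable[OF R K])
  have "det_on S (repl_col K (kcomp mu R K) l z)
    = (\<Sum>q | q permutes S. of_int (sign q)*(kcomp mu R K (z (inv_into UNIV q l)) (z l)*P q))" unfolding det_on_def repl_col_def
    by (intro sum.cong refl) (simp add: if_distrib[of "%f. f _ _"] split_row cong: if_cong)
  then show "(\<integral>y. K y (z l)*det_on S (%i i'. if i' = l then R (z i) y else K (z i) (z i')) \<partial>mu)
    = det_on S (repl_col K (kcomp mu R K) l z)"
    unfolding expand kcomp_def by (subst LINT_sum) (auto intro!: integrable_mult_right integrable_mult_left kcomp_integrable[OF R K])
qed

lemma integral_repl_col:
  assumes S: "finite S" "j \<notin> S" and K: "kernel C K" and R: "kernel D R"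
  shows "(\<integral>z. det_on (insert j S) (repl_col K R j z) \<partial>Pi\<^sub>M (insert j S) (%_. mu))
  = ktrace mu R*(\<integral>z. det_on S (%i i'. K (z i) (z i')) \<partial>Pi\<^sub>M S (%_. mu))
  - (\<Sum>l\<in>S. \<integral>z. det_on S (repl_col K (kcomp mu R K) l z) \<partial>Pi\<^sub>M S (%_. mu))"
proof -
  have not_j: "i ~= j" if "i \<in> S" for i using S that by auto
  have expand: "det_on (insert j S) (repl_col K R j (z(j := y))) = R y y*det_on S (%i i'. K (z i) (z i'))
    - (\<Sum>l\<in>S. K y (z l)*det_on S (%i i'. if i' = l then R (z i) y else K (z i) (z i')))" for z y unfolding det_on_insert[OF S]
    by (intro arg_cong2[of _ _ _ _ "(-)"] arg_cong2[of _ _ _ _ "(*)"] sum.cong refl det_on_cong)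
    (auto simp: repl_col_def dest: not_j)
  have "(\<integral>z. det_on (insert j S) (repl_col K R j z) \<partial>Pi\<^sub>M (insert j S) (%_. mu))
    = (\<integral>z. (\<integral>y. det_on (insert j S) (repl_col K R j (z(j := y))) \<partial>mu) \<partial>Pi\<^sub>M S (%_. mu))"
    by (rule prod.product_integral_insert[OF S repl_col_integrable[OF _ K R]]) (use S in auto)
  also have "... = (\<integral>z. ktrace mu R*det_on S (%i i'. K (z i) (z i'))
    - (\<Sum>l\<in>S. det_on S (repl_col K (kcomp mu R K) l z)) \<partial>Pi\<^sub>M S (%_. mu))" unfolding expand by (intro LINT_cong refl)
    (auto simp: LINT_diff LINT_sum ktrace_def integral_column[OF S(1) _ K R] diag_integrable[OF R] intro!: sum.cong)
  also have "... = ktrace mu R*(\<integral>z. det_on S (%i i'. K (z i) (z i')) \<partial>Pi\<^sub>M S (%_. mu))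
    - (\<Sum>l\<in>S. \<integral>z. det_on S (repl_col K (kcomp mu R K) l z) \<partial>Pi\<^sub>M S (%_. mu))"
    using det_on_integrable[OF S(1) K] repl_col_integrable[OF S(1) K dominated_by_kcomp[OF R K]] by (simp add: LINT_diff LINT_sum)
  finally show ?thesis .
qed

lemma integral_det_on_of_repl_col:
  assumes I: "finite I" and repl: "!!l. l \<in> I ==> (\<integral>z. det_on I (repl_col K K l z) \<partial>Pi\<^sub>M I (%_. mu))
  = (-1) ^ (card I - 1)*fact (card I - 1)*newton_sum (trpow mu K) (card I - 1) 0"
  shows "(\<integral>z. det_on I (%i j. K (z i) (z j)) \<partial>Pi\<^sub>M I (%_. mu)) = (-1) ^ card I*fact (card I)*fredcoef (trpow mu K) (card I)"
proof (cases "I = {}")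
  case True
  interpret prob_space "Pi\<^sub>M {} (%_::nat. mu)" by (rule prob_space_PiM) simp
  show ?thesis using True prob_space by (simp add: det_on_def)
next
  case False
  then obtain l where l: "l \<in> I" by auto
  from False I obtain n where n: "card I = Suc n" by (metis card_0_eq not0_implies_Suc)
  have newton: "newton_sum (trpow mu K) n 0 = - (real n + 1)*fredcoef (trpow mu K) (Suc n)"
    using fredcoef_Suc[of "trpow mu K" n] by (simp add: newton_sum_def)
  show ?thesis using repl[OF l] by (simp add: repl_col_def n newton algebra_simps)
qed

text \<open>Expanding along the replaced column lowers the size by one and composes that column with \<open>K\<close>.\<close>
lemma integral_repl_col_kpow:
  assumes K: "kernel C K" and "finite I" "l \<in> I"
  shows "(\<integral>z. det_on I (repl_col K (kpow mu K m) l z) \<partial>Pi\<^sub>M I (%_. mu))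
  = (-1) ^ (card I - 1)*fact (card I - 1)*newton_sum (trpow mu K) (card I - 1) m" using assms(2,3)
proof (induction "card I - 1" arbitrary: I l m rule: less_induct)
  case less
  define S where "S = I - {l}"
  have S: "finite S" "l \<notin> S" "I = insert l S" "card I - 1 = card S" using less.prems by (auto simp: S_def card_Diff_singleton)
  have IH: "(\<integral>z. det_on S (repl_col K (kpow mu K m) j z) \<partial>Pi\<^sub>M S (%_. mu))
    = (-1) ^ (card S - 1)*fact (card S - 1)*newton_sum (trpow mu K) (card S - 1) m" if "j \<in> S" for j m
  proof (rule less.hyps[OF _ S(1) that])
    have "0 < card S" using S(1) that by (auto simp: card_gt_0_iff)
    then show "card S - 1 < card I - 1" using S(4) by simp
  qed
  have "(\<integral>z. det_on I (repl_col K (kpow mu K m) l z) \<partial>Pi\<^sub>M I (%_. mu))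
    = trpow mu K m*(\<integral>z. det_on S (%i i'. K (z i) (z i')) \<partial>Pi\<^sub>M S (%_. mu))
    - (\<Sum>l\<in>S. \<integral>z. det_on S (repl_col K (kpow mu K (Suc m)) l z) \<partial>Pi\<^sub>M S (%_. mu))"
    unfolding S(3) trpow_def using integral_repl_col[OF S(1,2) K kernel_kpow[OF K]] by simp
  also have "... = trpow mu K m*((-1) ^ card S*fact (card S)*fredcoef (trpow mu K) (card S))
    - (\<Sum>l\<in>S. (-1) ^ (card S - 1)*fact (card S - 1)*newton_sum (trpow mu K) (card S - 1) (Suc m))"
    using integral_det_on_of_repl_col[OF S(1), of K] IH[of _ 0] by (simp add: IH del: kpow.simps(2))
  also have "... = (-1) ^ card S*fact (card S)*newton_sum (trpow mu K) (card S) m"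
    by (cases "card S") (simp_all add: newton_sum_def[of _ 0] newton_sum_Suc algebra_simps)
  finally show ?case unfolding S(4) .
qed

lemma fredcoef_eq_det_on:
  assumes K: "kernel C K"
  shows "fredcoef (trpow mu K) n = (-1) ^ n/fact n*(\<integral>z. det_on {..<n} (%i j. K (z i) (z j)) \<partial>Pi\<^sub>M {..<n} (%_. mu))"
proof -
  have "(-1) ^ n*((-1) ^ n*x) = (x::real)" for x by (simp flip: mult.assoc power_mult_distrib)
  then show ?thesis
    using integral_det_on_of_repl_col[of "{..<n}" K] integral_repl_col_kpow[OF K, of "{..<n}" _ 0] by (simp add: field_simps)
qed

lemma integral_det_on_bound:
  assumes K: "!!i j. kernel C (K i j)"
  shows "abs (\<integral>z. det_on {..<n} (%i j. K i j (z i) (z j)) \<partial>Pi\<^sub>M {..<n} (%_. mu)) <= (C*mass * sqrt n) ^ n"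
proof -
  have C: "0 <= C" using dominated_byD(1)[OF K] .
  have "abs (\<integral>z. det_on {..<n} (%i j. K i j (z i) (z j)) \<partial>Pi\<^sub>M {..<n} (%_. mu))
    <= (\<integral>z. abs (det_on {..<n} (%i j. K i j (z i) (z j))) \<partial>Pi\<^sub>M {..<n} (%_. mu))" by (rule integral_abs_bound)
  also have "... <= (\<integral>z. (C * sqrt n) ^ n*(\<Prod>i<n. g (z i)*k (z i)) \<partial>Pi\<^sub>M {..<n} (%_. mu))"
  proof (intro integral_mono integrable_abs det_on_integrable[OF _ K] integrable_mult_right prod.product_integrable_prod gk_integrable)
    show "abs (det_on {..<n} (%i j. K i j (z i) (z j))) <= (C * sqrt n) ^ n*(\<Prod>i<n. g (z i)*k (z i))" for z
      unfolding detn_eq_det_on[symmetric] using dominated_byD(4)[OF K] C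
      by (intro Hadamard_bound[of n _ C "%i. g (z i)" "%i. k (z i)"]) auto
  qed auto
  also have "... = (C * sqrt n) ^ n*mass ^ n"
    using prod.product_integral_prod[of "{..<n}" "%_ x. g x*k x"] gk_integrable by (simp add: mass_def)
  finally show ?thesis by (simp add: power_mult_distrib mult_ac)
qed

lemma fredcoef_bound:
  assumes K: "kernel C K"
  shows "abs (fredcoef (trpow mu K) n) <= (C*mass * sqrt n) ^ n/fact n"
  unfolding fredcoef_eq_det_on[OF K] using integral_det_on_bound[of C "%_ _. K" n, OF K] by (simp add: abs_mult power_abs divide_right_mono)

end

lemma summable_Hadamard_series:
  fixes x :: real
  assumes x: "0 <= x"
  shows "summable (%n. (x * sqrt n) ^ n/fact n)"
proof (rule summable_comparison_test_ev)
  show "summable (%n. (1/2::real) ^ n)" by (rule summable_geometric) simp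
  have "eventually (%n. sqrt (real n) >= 2*x*exp 1) sequentially" by real_asymp
  then show "\<forall>\<^sub>F n in sequentially. norm ((x * sqrt (real n)) ^ n/fact n) <= (1/2) ^ n"
  proof eventually_elim
    case (elim n)
    have "(\<Sum>i\<in>{n}. inverse (fact i)*real n ^ i) <= (\<Sum>i. inverse (fact i)*real n ^ i)"
      by (rule sum_le_suminf) (auto intro: summable_exp)
    then have "real n ^ n/fact n <= exp (real n)" unfolding exp_def by (simp add: field_simps scaleR_conv_of_real)
    then have Stirling: "real n ^ n <= exp 1 ^ n*fact n" by (simp add: field_simps flip: exp_of_nat_mult)
    have "(2*x*exp 1 * sqrt n) ^ n <= (sqrt n * sqrt n) ^ n" using elim x by (intro power_mono mult_right_mono) auto
    also have "... <= exp 1 ^ n*fact n" using Stirling by simp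
    finally have "(exp 1) ^ n*(2 ^ n*(x * sqrt n) ^ n) <= exp 1 ^ n*fact n" by (simp add: power_mult_distrib mult_ac)
    then have "2 ^ n*(x * sqrt n) ^ n <= fact n" by (subst (asm) mult_le_cancel_left_pos) auto
    then show ?case using x by (simp add: field_simps power_one_over abs_mult)
  qed
qed

lemma fredcoef_scale: "fredcoef (%n. u ^ Suc n*T n) n = u ^ n*fredcoef T n"
proof (induction n rule: less_induct)
  case (less n)
  show ?case
  proof (cases n)
    case (Suc m)
    have "(\<Sum>i\<le>m. u ^ Suc i*T i*fredcoef (%n. u ^ Suc n*T n) (m - i)) = (\<Sum>i\<le>m. u ^ Suc m*(T i*fredcoef T (m - i)))"
    proof (intro sum.cong refl)
      fix i assume "i \<in> {..m}"
      then have "u ^ Suc m = u ^ Suc i*u ^ (m - i)" by (simp flip: power_add)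
      moreover have "fredcoef (%n. u ^ Suc n*T n) (m - i) = u ^ (m - i)*fredcoef T (m - i)" by (rule less.IH) (simp add: Suc)
      ultimately show "u ^ Suc i*T i*fredcoef (%n. u ^ Suc n*T n) (m - i) = u ^ Suc m*(T i*fredcoef T (m - i))" by (simp only: mult_ac)
    qed
    then show ?thesis unfolding Suc fredcoef.simps(2) by (simp add: sum_distrib_left)
  qed simp
qed

lemma has_field_derivative_suminf_geometric:
  fixes f f' :: "nat => real => real"
  assumes deriv: "!!n x. abs x < r ==> (f n has_field_derivative f' n x) (at x)"
  and bound: "!!n x. abs x < r ==> abs (f' n x) <= c*q ^ n" and q: "0 <= q" "q < 1"
  and at_0: "summable (%n. f n 0)" and v: "abs v < r"
  shows "((%x. \<Sum>n. f n x) has_field_derivative (\<Sum>n. f' n v)) (at v)"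
proof (rule has_field_derivative_series'(2)[where S="{-r<..<r}"])
  show "uniformly_convergent_on {-r<..<r} (%n x. \<Sum>i<n. f' i x)"
    by (rule Weierstrass_m_test'[where M="%i. c*q ^ i"]) (use bound q in \<open>auto intro!: summable_mult summable_geometric\<close>)
qed (use deriv at_0 v in \<open>auto simp: interior_open intro: has_field_derivative_at_within\<close>)

lemma has_field_derivative_fredcoef_powser:
  assumes S: "!!x. summable (%n. fredcoef T n*x ^ n)" and T: "summable (%n. norm (T n*u ^ n))"
  shows "((%u. \<Sum>n. fredcoef T n*u ^ n) has_field_derivative -((\<Sum>n. T n*u ^ n)*(\<Sum>n. fredcoef T n*u ^ n))) (at u)"
proof -
  define r where "r = abs u + 1"
  have "summable (%n. norm (fredcoef T n*u ^ n))" by (intro powser_insidea[OF S[of r]]) (simp add: r_def)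
  then have "(%n. \<Sum>i\<le>n. (T i*u ^ i)*(fredcoef T (n - i)*u ^ (n - i))) sums ((\<Sum>n. T n*u ^ n)*(\<Sum>n. fredcoef T n*u ^ n))"
    by (rule Cauchy_product_sums[OF T])
  moreover have "(\<Sum>i\<le>n. (T i*u ^ i)*(fredcoef T (n - i)*u ^ (n - i))) = - (diffs (fredcoef T) n*u ^ n)" for n
  proof -
    have "(\<Sum>i\<le>n. (T i*u ^ i)*(fredcoef T (n - i)*u ^ (n - i))) = (\<Sum>i\<le>n. T i*fredcoef T (n - i))*u ^ n"
      unfolding sum_distrib_right
    proof (intro sum.cong refl)
      fix i assume "i \<in> {..n}"
      then have "u ^ n = u ^ i*u ^ (n - i)" by (simp flip: power_add)
      then show "(T i*u ^ i)*(fredcoef T (n - i)*u ^ (n - i)) = T i*fredcoef T (n - i)*u ^ n" by simp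
    qed
    then show ?thesis unfolding fredcoef_Suc diffs_def by (simp add: algebra_simps)
  qed
  ultimately have "(%n. - (diffs (fredcoef T) n*u ^ n)) sums ((\<Sum>n. T n*u ^ n)*(\<Sum>n. fredcoef T n*u ^ n))" by simp
  from sums_minus[OF this] have "(\<Sum>n. diffs (fredcoef T) n*u ^ n) = - ((\<Sum>n. T n*u ^ n)*(\<Sum>n. fredcoef T n*u ^ n))"
    by (simp add: sums_iff)
  with termdiffs_strong[OF S[of r], of u] show ?thesis by (simp add: r_def)
qed

lemma fredcoef_sums_exp:
  assumes S: "!!x. summable (%n. fredcoef T n*x ^ n)"
  and T: "!!n. abs (T n) <= M*q ^ n" and q: "0 <= q" "q < 1"
  shows "(\<Sum>n. fredcoef T n) = exp (-(\<Sum>n. T n/(real n + 1)))"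
proof -
  define r where "r = 2/(1 + q)"
  have r: "1 < r" "0 <= q*r" "q*r < 1" using q by (auto simp: r_def field_simps)
  have bound: "abs (T n*u ^ n) <= M*(q*r) ^ n" if "abs u < r" for u n
  proof -
    have "abs (T n*u ^ n) <= (M*q ^ n)*r ^ n"
      unfolding abs_mult power_abs using T that by (intro mult_mono power_mono order_trans[OF abs_ge_zero T]) auto
    then show ?thesis by (simp add: power_mult_distrib mult_ac)
  qed
  define D where "D = (%u::real. \<Sum>n. fredcoef T n*u ^ n)"
  define L where "L = (%u::real. \<Sum>n. T n*u ^ Suc n/(real n + 1))"
  have D': "(D has_field_derivative -((\<Sum>n. T n*u ^ n)*D u)) (at u)" if "abs u < r" for u unfolding D_def
  proof (rule has_field_derivative_fredcoef_powser[OF S])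
    show "summable (%n. norm (T n*u ^ n))" by (rule summable_comparison_test[of _ "%n. M*(q*r) ^ n"])
      (use bound[OF that] r in \<open>auto intro!: exI[of _ 0] summable_mult summable_geometric\<close>)
  qed
  have L': "(L has_field_derivative (\<Sum>n. T n*u ^ n)) (at u)" if "abs u < r" for u unfolding L_def
  proof (rule has_field_derivative_suminf_geometric[OF _ bound r(2,3) _ that])
    show "((%u. T n*u ^ Suc n/(real n + 1)) has_field_derivative T n*x ^ n) (at x)" for n x
      by (rule derivative_eq_intros refl | simp add: field_simps add_nonneg_eq_0_iff)+
  qed auto
  have "D 1*exp (L 1) = D 0*exp (L 0)"
  proof (rule DERIV_isconst2[of 0 1 "%u. D u*exp (L u)" 1])
    have deriv: "((%u. D u*exp (L u)) has_field_derivative 0) (at u)" if "abs u < r" for u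
      using that by (auto intro!: derivative_eq_intros D' L' simp: algebra_simps)
    show "!!x. 0 < x ==> x < 1 ==> DERIV (%u. D u*exp (L u)) x :> 0" using r by (intro deriv) auto
    show "continuous_on {0..1} (%u. D u*exp (L u))" using r by (intro continuous_at_imp_continuous_on ballI DERIV_isCont[OF deriv]) auto
  qed auto
  moreover have "D 0 = 1" "L 0 = 0" unfolding D_def L_def using powser_zero[of "fredcoef T"] by auto
  ultimately have "D 1 = exp (-L 1)" by (simp add: exp_minus field_simps)
  then show ?thesis by (simp add: D_def L_def)
qed

lemma fredcoef_tendsto:
  assumes "!!n. ((%j. T j n) \<longlongrightarrow> T' n) F"
  shows "((%j. fredcoef (T j) n) \<longlongrightarrow> fredcoef T' n) F"
proof (induction n rule: less_induct)
  case (less n)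
  show ?case
  proof (cases n)
    case (Suc m)
    then show ?thesis using less assms unfolding Suc fredcoef.simps(2) by (intro tendsto_intros) auto
  qed simp
qed

definition fredholm :: "'a measure => ('a => 'a => real) => real" where
  "fredholm mu K = (\<Sum>n. fredcoef (trpow mu K) n)"

context weighted_measure begin

lemma fredcoef_powser_summable:
  assumes K: "kernel C K"
  shows "summable (%n. fredcoef (trpow mu K) n*x ^ n)"
proof (rule summable_comparison_test)
  show "summable (%n. (C*mass*abs x * sqrt n) ^ n/fact n)" by (rule summable_Hadamard_series) (use dominated_byD(1)[OF K] in auto)
  have "abs (fredcoef (trpow mu K) n)*abs x ^ n <= (C*mass * sqrt n) ^ n/fact n*abs x ^ n" for n
    by (intro mult_right_mono fredcoef_bound[OF K]) auto
  then show "\<exists>N. \<forall>n\<ge>N. norm (fredcoef (trpow mu K) n*x ^ n) <= (C*mass*abs x * sqrt n) ^ n/fact n"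
    by (intro exI[of _ 0]) (simp add: abs_mult power_abs power_mult_distrib mult_ac)
qed

lemma fredholm_eq_exp:
  assumes K: "kernel C K" and T: "!!n. abs (trpow mu K n) <= M*q ^ n" and q: "0 <= q" "q < 1"
  shows "fredholm mu K = exp (-(\<Sum>n. trpow mu K n/(real n + 1)))"
  unfolding fredholm_def by (rule fredcoef_sums_exp[OF fredcoef_powser_summable[OF K] T q])

lemma fredholm_scale_sums:
  assumes K: "kernel C K"
  shows "(%n. fredcoef (trpow mu K) n*u ^ n) sums fredholm mu (%x y. u*K x y)"
proof -
  have scale: "trpow mu (%x y. u*K x y) = (%n. u ^ Suc n*trpow mu K n)" by (rule ext, rule trpow_scale)
  have "fredholm mu (%x y. u*K x y) = (\<Sum>n. fredcoef (trpow mu K) n*u ^ n)"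
    unfolding fredholm_def scale fredcoef_scale by (simp only: mult.commute)
  then show ?thesis using fredcoef_powser_summable[OF K] by (simp add: summable_sums)
qed

lemma kcomp_tendsto:
  assumes X: "!!j. kernel C (X j)" and Y: "!!j. kernel D (Y j)" and lim: "kernel C X'" "kernel D Y'"
  "!!x y. (%j. X j x y) ----> X' x y" "!!x y. (%j. Y j x y) ----> Y' x y"
  shows "(%j. kcomp mu (X j) (Y j) x y) ----> kcomp mu X' Y' x y" unfolding kcomp_def
proof (rule integral_dominated_convergence[where w="%z. (C*D*g x*k y)*(g z*k z)"])
  show "AE z in mu. (%j. X j x z*Y j z y) ----> X' x z*Y' z y" by (intro AE_I2 tendsto_mult lim)
  show "AE z in mu. norm (X j x z*Y j z y) <= (C*D*g x*k y)*(g z*k z)" for j using kcomp_integrand_bound[OF X Y] by simp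
qed (use kcomp_integrable[OF X Y] kcomp_integrable[OF lim(1,2)] in \<open>auto intro: gk_integrable borel_measurable_integrable\<close>)

lemma trpow_tendsto:
  assumes K: "!!j. kernel C (K j)" "kernel C K'" and lim: "!!x y. (%j. K j x y) ----> K' x y"
  shows "(%j. trpow mu (K j) n) ----> trpow mu K' n"
proof -
  have kpow: "(%j. kpow mu (K j) n x y) ----> kpow mu K' n x y" for x y
  proof (induction n arbitrary: x y)
    case (Suc n)
    then show ?case unfolding kpow.simps by (rule kcomp_tendsto[OF kernel_kpow[OF K(1)] K(1) kernel_kpow[OF K(2)] K(2) _ lim])
  qed (simp add: lim)
  show ?thesis unfolding trpow_def ktrace_def
  proof (rule integral_dominated_convergence[where w="%z. C*(C*mass) ^ n*(g z*k z)"])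
    show "AE x in mu. norm (kpow mu (K j) n x x) <= C*(C*mass) ^ n*(g x*k x)" for j
      using dominated_byD(4)[OF kernel_kpow[OF K(1)]] by (simp add: mult.assoc)
  qed (use kpow diag_integrable[OF kernel_kpow[OF K(1)]] diag_integrable[OF kernel_kpow[OF K(2)]] gk_integrable in auto)
qed

lemma fredholm_tendsto:
  assumes K: "!!j. kernel C (K j)" "kernel C K'" and lim: "!!x y. (%j. K j x y) ----> K' x y"
  shows "(%j. fredholm mu (K j)) ----> fredholm mu K'" unfolding fredholm_def
proof (rule tannerys_theorem[THEN conjunct2, THEN conjunct2])
  show "summable (%n. (C*mass * sqrt (real n)) ^ n/fact n)" by (rule summable_Hadamard_series) (use dominated_byD(1)[OF K(2)] in auto)
  show "(%j. fredcoef (trpow mu (K j)) n) ----> fredcoef (trpow mu K') n" for n by (intro fredcoef_tendsto trpow_tendsto[OF K lim])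
qed (use fredcoef_bound[OF K(1)] in \<open>auto simp: case_prod_beta always_eventually\<close>)

end

section \<open>Perturbation of Fredholm determinants\<close>

lemma DERIV_quadratic_remainder:
  fixes f :: "real => real"
  assumes remainder: "!!h. abs h <= 1 ==> abs (f (x + h) - f x - h*D) <= C*h^2"
  shows "(f has_field_derivative D) (at x)"
proof -
  have "(%h. (f (x + h) - f x)/h - D) \<midarrow>0\<rightarrow> 0"
  proof (rule Lim_null_comparison)
    show "\<forall>\<^sub>F h in at 0. norm ((f (x + h) - f x)/h - D) <= C*abs h" using eventually_at_ball'[of 1 0 UNIV, simplified]
    proof eventually_elim
      case h: (elim h)
      then have "abs ((f (x + h) - f x - h*D)/h) <= C*h^2/abs h"
        unfolding abs_divide using remainder[of h] by (intro divide_right_mono) (auto simp: dist_real_def)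
      also have "... = C*abs h" using h by (simp add: power2_eq_square abs_if)
      finally show ?case using h by (simp add: diff_divide_distrib)
    qed
    show "(%h. C*abs h) \<midarrow>0\<rightarrow> 0" by (rule tendsto_eq_intros | simp)+
  qed
  then show ?thesis unfolding DERIV_def by (rule LIM_zero_cancel)
qed

lemma powser_unique_real:
  fixes a b :: "nat => real"
  assumes r: "0 < r" and a: "!!x. abs x < r ==> (%n. a n*x ^ n) sums f x" and b: "!!x. abs x < r ==> (%n. b n*x ^ n) sums f x"
  shows "a = b"
proof (rule ccontr)
  assume "a ~= b"
  then obtain m where m: "a m - b m ~= 0" by (auto simp: fun_eq_iff)
  have diff: "(%n. (a n - b n)*(x - 0) ^ n) sums 0" if "norm (x - 0) < r" for x
    using sums_diff[OF a[of x] b[of x]] that by (simp add: algebra_simps)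
  have "a 0 = f 0" "b 0 = f 0" using a[of 0] b[of 0] r by (simp_all add: powser_sums_zero_iff)
  then have "0 < m" using m by (cases m) auto
  show False
  proof (rule powser_0_nonzero[where f="%_. 0::real" and a="%n. a n - b n" and \<xi>=0, OF r diff refl m \<open>0 < m\<close>])
    fix t :: real assume t: "0 < t" "!!z. z \<in> cball (0::real) t - {0} ==> (0::real) ~= 0"
    from t(2)[of t] t(1) show False by auto
  qed
qed

context weighted_measure begin

fun kpow_deriv :: "('a => 'a => real) => ('a => 'a => real) => nat => 'a => 'a => real" where
  "kpow_deriv K A 0 = A"
  | "kpow_deriv K A (Suc n) = (%x y. kcomp mu (kpow_deriv K A n) K x y + kcomp mu (kpow mu K n) A x y)"

lemma kernel_kpow_deriv:
  assumes "kernel C K" "kernel D A" shows "\<exists>E. kernel E (kpow_deriv K A n)"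
proof (induction n)
  case 0 then show ?case using assms by auto
next
  case (Suc n)
  then show ?case using kernel_add[OF dominated_by_kcomp[OF _ assms(1)] dominated_by_kcomp[OF kernel_kpow[OF assms(1)] assms(2)]] by auto
qed

lemma kpow_expansion:
  assumes K: "kernel C K" and A: "kernel D A"
  shows "\<exists>B\<ge>0. \<forall>h. abs h <= 1 -->
  kernel (B*h^2) (%x y. kpow mu (%x y. K x y + h*A x y) n x y - kpow mu K n x y - h*kpow_deriv K A n x y)"
proof (induction n)
  case 0
  show ?case using K by (intro exI[of _ 0]) (auto simp: dominated_by_def)
next
  case (Suc n)
  then obtain B where B: "0 <= B" "!!h. abs h <= 1 ==>
    kernel (B*h^2) (%x y. kpow mu (%x y. K x y + h*A x y) n x y - kpow mu K n x y - h*kpow_deriv K A n x y)" by auto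
  obtain E where E: "kernel E (kpow_deriv K A n)" using kernel_kpow_deriv[OF K A] by auto
  note P = kernel_kpow[OF K]
  have nonneg: "0 <= C" "0 <= D" "0 <= E" using K A E by (auto dest: dominated_byD)
  show ?case
  proof (intro exI[of _ "E*D*mass + B*(C + D)*mass"] conjI allI impI)
    fix h :: real assume h: "abs h <= 1"
    define K' where "K' = (%x y. K x y + h*A x y)"
    define R where "R = (%x y. kpow mu K' n x y - kpow mu K n x y - h*kpow_deriv K A n x y)"
    note hA = kernel_scale[OF A, of h] and hE = kernel_scale[OF E, of h]
    have K': "kernel (C + D) K'" unfolding K'_def
      by (rule kernel_mono[OF kernel_add[OF K hA]]) (use h nonneg in \<open>auto intro: mult_left_le_one_le\<close>)
    have R: "kernel (B*h^2) R" unfolding R_def K'_def by (rule B(2)[OF h])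
    have "kpow mu K' n = (%x y. kpow mu K n x y + h*kpow_deriv K A n x y + R x y)" by (simp add: R_def)
    then have "kpow mu K' (Suc n) = (%x y. kcomp mu (%x y. kpow mu K n x y + h*kpow_deriv K A n x y) K' x y + kcomp mu R K' x y)"
      by (simp add: kcomp_add_left[OF kernel_add[OF P hE] R K'])
    also have "kcomp mu (%x y. kpow mu K n x y + h*kpow_deriv K A n x y) K' =
      (%x y. kcomp mu (kpow mu K n) K x y + h*kcomp mu (kpow mu K n) A x y
      + (h*kcomp mu (kpow_deriv K A n) K x y + h*(h*kcomp mu (kpow_deriv K A n) A x y)))" unfolding K'_def
      by (simp add: kcomp_add_right[OF kernel_add[OF P hE] K hA] kcomp_add_left[OF P hE K] kcomp_add_left[OF P hE A]
      kcomp_scale_left kcomp_scale_right fun_eq_iff distrib_left)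
    finally have remainder: "(%x y. kpow mu K' (Suc n) x y - kpow mu K (Suc n) x y - h*kpow_deriv K A (Suc n) x y)
      = (%x y. h^2*kcomp mu (kpow_deriv K A n) A x y + kcomp mu R K' x y)" by (simp add: fun_eq_iff algebra_simps power2_eq_square)
    have "kernel (abs (h^2)*(E*D*mass) + B*h^2*(C + D)*mass) (%x y. h^2*kcomp mu (kpow_deriv K A n) A x y + kcomp mu R K' x y)"
      by (intro kernel_add kernel_scale dominated_by_kcomp[OF E A] dominated_by_kcomp[OF R K'])
    then show "kernel ((E*D*mass + B*(C + D)*mass)*h^2)
      (%x y. kpow mu (%x y. K x y + h*A x y) (Suc n) x y - kpow mu K (Suc n) x y - h*kpow_deriv K A (Suc n) x y)"
      unfolding K'_def[symmetric] remainder by (simp add: algebra_simps)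
  qed (use nonneg B in auto)
qed

definition kpow_mult :: "('a => 'a => real) => ('a => 'a => real) => nat => 'a => 'a => real" where
  "kpow_mult K A n = (case n of 0 => A | Suc m => kcomp mu (kpow mu K m) A)"

lemma kpow_mult_simps: "kpow_mult K A 0 = A" "kpow_mult K A (Suc n) = kcomp mu (kpow mu K n) A" by (simp_all add: kpow_mult_def)

lemma kernel_kpow_mult:
  assumes "kernel C K" "kernel D A"
  shows "kernel (D*(C*mass) ^ n) (kpow_mult K A n)" using assms dominated_by_kcomp[OF kernel_kpow[OF assms(1)] assms(2)]
  by (cases n) (auto simp: kpow_mult_simps mult_ac)

lemma kcomp_kpow_mult:
  assumes K: "kernel C K" and A: "kernel D A"
  shows "kcomp mu K (kpow_mult K A n) = kpow_mult K A (Suc n)" using kernel_assoc[OF K kernel_kpow[OF K] A] kcomp_kpow[OF K, of 0]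
  by (cases n) (simp_all add: kpow_mult_simps del: kpow.simps(2))

lemma ktrace_kpow_deriv_mult:
  assumes K: "kernel C K" and A: "kernel D A"
  shows "ktrace mu (kcomp mu (kpow_deriv K A n) (kpow mu K j)) = (real n + 1)*ktrace mu (kcomp mu A (kpow mu K (n + j)))"
proof (induction n arbitrary: j)
  case (Suc n)
  obtain E where E: "kernel E (kpow_deriv K A n)" using kernel_kpow_deriv[OF K A] by auto
  note P = kernel_kpow[OF K] and comp = dominated_by_kcomp
  have "ktrace mu (kcomp mu (kpow_deriv K A (Suc n)) (kpow mu K j))
    = ktrace mu (kcomp mu (kcomp mu (kpow_deriv K A n) K) (kpow mu K j))
    + ktrace mu (kcomp mu (kcomp mu (kpow mu K n) A) (kpow mu K j))"
    unfolding kpow_deriv.simps kcomp_add_left[OF comp[OF E K] comp[OF P A] P]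
    by (rule ktrace_add[OF comp[OF comp[OF E K] P] comp[OF comp[OF P A] P]])
  also have "kcomp mu (kcomp mu (kpow_deriv K A n) K) (kpow mu K j) = kcomp mu (kpow_deriv K A n) (kpow mu K (Suc j))"
    using kernel_assoc[OF E K P] kcomp_kpow[OF K, of 0 j] by simp
  also have "ktrace mu (kcomp mu (kcomp mu (kpow mu K n) A) (kpow mu K j))
    = ktrace mu (kcomp mu (kpow mu K j) (kcomp mu (kpow mu K n) A))" by (rule ktrace_kernel_commute[OF comp[OF P A] P])
  also have "kcomp mu (kpow mu K j) (kcomp mu (kpow mu K n) A) = kcomp mu (kpow mu K (Suc (n + j))) A"
    using kernel_assoc[OF P P A, of j n] kcomp_kpow[OF K, of j n] by (simp add: add.commute)
  also have "ktrace mu (kcomp mu (kpow mu K (Suc (n + j))) A) = ktrace mu (kcomp mu A (kpow mu K (Suc (n + j))))"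
    by (rule ktrace_kernel_commute[OF P A])
  finally show ?case unfolding Suc.IH by (simp add: algebra_simps)
qed simp

lemma ktrace_kpow_deriv:
  assumes K: "kernel C K" and A: "kernel D A"
  shows "ktrace mu (kpow_deriv K A n) = (real n + 1)*ktrace mu (kpow_mult K A n)"
proof (cases n)
  case (Suc m)
  obtain E where E: "kernel E (kpow_deriv K A m)" using kernel_kpow_deriv[OF K A] by auto
  note P = kernel_kpow[OF K]
  have "ktrace mu (kpow_deriv K A (Suc m)) = ktrace mu (kcomp mu (kpow_deriv K A m) (kpow mu K 0)) + ktrace mu (kcomp mu (kpow mu K m) A)"
    unfolding kpow_deriv.simps kpow.simps by (rule ktrace_add[OF dominated_by_kcomp[OF E K] dominated_by_kcomp[OF P A]])
  also have "... = (real m + 1)*ktrace mu (kcomp mu A (kpow mu K m)) + ktrace mu (kcomp mu A (kpow mu K m))"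
    using ktrace_kpow_deriv_mult[OF K A, of m 0] ktrace_kernel_commute[OF P A] by simp
  finally show ?thesis using ktrace_kernel_commute[OF P A] unfolding Suc kpow_mult_simps by (simp add: algebra_simps)
qed (simp add: kpow_mult_simps)

lemma trpow_affine_has_derivative:
  assumes V: "kernel CV V" and A: "kernel CA A"
  defines "K \<equiv> %u x y. u*A x y - V x y"
  shows "((%u. trpow mu (K u) n) has_field_derivative (real n + 1)*ktrace mu (kpow_mult (K v) A n)) (at v)"
proof -
  have K: "kernel (abs u*CA + CV) (K u)" for u unfolding K_def by (intro kernel_diff kernel_scale A V)
  obtain B where B: "!!h. abs h <= 1 ==>
    kernel (B*h^2) (%x y. kpow mu (%x y. K v x y + h*A x y) n x y - kpow mu (K v) n x y - h*kpow_deriv (K v) A n x y)"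
    using kpow_expansion[OF K A, of v n] by auto
  obtain E where E: "kernel E (kpow_deriv (K v) A n)" using kernel_kpow_deriv[OF K A] by auto
  note P = kernel_kpow[OF K]
  have "((%u. trpow mu (K u) n) has_field_derivative ktrace mu (kpow_deriv (K v) A n)) (at v)"
  proof (rule DERIV_quadratic_remainder)
    fix h :: real assume h: "abs h <= 1"
    have shift: "(%x y. K v x y + h*A x y) = K (v + h)" by (simp add: K_def fun_eq_iff algebra_simps)
    have "ktrace mu (%x y. kpow mu (K (v + h)) n x y - kpow mu (K v) n x y - h*kpow_deriv (K v) A n x y)
      = trpow mu (K (v + h)) n - trpow mu (K v) n - h*ktrace mu (kpow_deriv (K v) A n)"
      unfolding trpow_def by (simp add: ktrace_diff[OF kernel_diff[OF P P] kernel_scale[OF E]] ktrace_diff[OF P P] ktrace_scale)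
    with ktrace_bound[OF B[OF h]]
    show "abs (trpow mu (K (v + h)) n - trpow mu (K v) n - h*ktrace mu (kpow_deriv (K v) A n)) <= B*mass*h^2"
      unfolding shift by (simp add: mult_ac)
  qed
  then show ?thesis using ktrace_kpow_deriv[OF K A] by simp
qed

lemma kernel_suminf:
  assumes X: "!!n. kernel (c n) (X n)" and summable_c: "summable c"
  shows "summable (%n. abs (X n x y))" and "kernel (suminf c) (%x y. \<Sum>n. X n x y)"
proof -
  have c_scaled: "summable (%n. c n*g x*k y)" for x y using summable_c by (intro summable_mult2)
  then show summable: "summable (%n. abs (X n x y))" for x y
    by (rule summable_comparison_test'[of _ 0]) (use dominated_byD(4)[OF X] in auto)
  note [measurable] = dominated_by_measurable[OF X]
  show "kernel (suminf c) (%x y. \<Sum>n. X n x y)"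
  proof (rule kernelI)
    show "0 <= suminf c" using summable_c dominated_byD(1)[OF X] by (intro suminf_nonneg)
    show "(%p. \<Sum>n. X n (fst p) (snd p)) \<in> bmeas (mu \<Otimes>\<^sub>M mu)" by measurable
    fix x y
    have "abs (\<Sum>n. X n x y) <= (\<Sum>n. abs (X n x y))" by (rule summable_rabs[OF summable])
    also have "... <= (\<Sum>n. c n*g x*k y)" by (intro suminf_le summable c_scaled dominated_byD(4)[OF X])
    also have "... = suminf c*g x*k y" using summable_c by (simp add: suminf_mult2 summable_mult2)
    finally show "abs (\<Sum>n. X n x y) <= suminf c*g x*k y" .
  qed
qed

lemma integral_suminf_dominated:
  assumes f: "!!n. integrable mu (f n)" "!!n x. abs (f n x) <= c n*(g x*k x)" and summable_c: "summable c"
  shows "(%n. \<integral>x. f n x \<partial>mu) sums (\<integral>x. (\<Sum>n. f n x) \<partial>mu)"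
proof (rule sums_integral[OF f(1)])
  show "AE x in mu. summable (%n. norm (f n x))"
    by (intro AE_I2 summable_comparison_test'[OF summable_mult2[OF summable_c], of 0]) (use f(2) in auto)
  have "norm (\<integral>x. norm (f n x) \<partial>mu) <= c n*mass" for n
  proof -
    have "(\<integral>x. norm (f n x) \<partial>mu) <= (\<integral>x. c n*(g x*k x) \<partial>mu)"
      by (intro integral_mono integrable_norm f(1) integrable_mult_right gk_integrable) (use f(2) in auto)
    then show ?thesis by (simp add: mass_def)
  qed
  then show "summable (%n. \<integral>x. norm (f n x) \<partial>mu)"
    by (intro summable_comparison_test'[OF summable_mult2[OF summable_c], of 0])
qed

lemma ktrace_suminf:
  assumes X: "!!n. kernel (c n) (X n)" and summable_c: "summable c"
  shows "(%n. ktrace mu (X n)) sums ktrace mu (%x y. \<Sum>n. X n x y)" unfolding ktrace_def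
  by (rule integral_suminf_dominated[OF diag_integrable[OF X] _ summable_c]) (use dominated_byD(4)[OF X] in \<open>simp add: mult.assoc\<close>)

lemma kcomp_suminf:
  assumes Y: "kernel D Y" and X: "!!n. kernel (c n) (X n)" and summable_c: "summable c"
  shows "(%n. kcomp mu Y (X n) x y) sums kcomp mu Y (%x y. \<Sum>n. X n x y) x y"
proof -
  have "(\<integral>z. (\<Sum>n. Y x z*X n z y) \<partial>mu) = kcomp mu Y (%x y. \<Sum>n. X n x y) x y"
    unfolding kcomp_def by (simp add: suminf_mult summable_rabs_cancel[OF kernel_suminf(1)[OF X summable_c]])
  moreover have "(%n. kcomp mu Y (X n) x y) sums (\<integral>z. (\<Sum>n. Y x z*X n z y) \<partial>mu)" unfolding kcomp_def
  proof (rule integral_suminf_dominated[OF kcomp_integrable[OF Y X]])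
    show "abs (Y x z*X n z y) <= D*g x*k y*c n*(g z*k z)" for n z using kcomp_integrand_bound[OF Y X, of x z n y] by (simp add: mult_ac)
  qed (intro summable_mult summable_c)
  ultimately show ?thesis by simp
qed

lemma kcomp_fixed_point_zero:
  assumes K: "kernel C K" and small: "C*mass < 1" and D: "kernel W D" and fixed: "D = kcomp mu K D"
  shows "D x y = 0"
proof -
  have "kernel ((C*mass) ^ n*W) D" for n
  proof (induction n)
    case (Suc n)
    from dominated_by_kcomp[OF K this] show ?case by (simp add: fixed[symmetric] mult_ac)
  qed (simp add: D)
  then have "abs (D x y) <= (C*mass) ^ n*(W*g x*k y)" for n using dominated_byD(4) by (fastforce simp: mult_ac)
  moreover have "(%n. (C*mass) ^ n*(W*g x*k y)) ----> 0"
    using small dominated_byD(1)[OF K] by (intro tendsto_mult_left_zero LIMSEQ_power_zero) simp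
  ultimately have "abs (D x y) <= 0" by (intro LIMSEQ_le_const) auto
  then show ?thesis by simp
qed

definition resolvent :: "('a => 'a => real) => ('a => 'a => real) => 'a => 'a => real" where
  "resolvent K A x y = (\<Sum>n. kpow_mult K A n x y)"

context
  fixes C D :: real and K A :: "'a => 'a => real"
  assumes K: "kernel C K" and A: "kernel D A" and small: "C*mass < 1"
begin

lemma kpow_mult_bounds_summable: "summable (%n. D*(C*mass) ^ n)"
  using small dominated_byD(1)[OF K] by (intro summable_mult summable_geometric) simp

lemma kernel_resolvent: "kernel (\<Sum>n. D*(C*mass) ^ n) (resolvent K A)"
  unfolding resolvent_def[abs_def] by (rule kernel_suminf(2)[OF kernel_kpow_mult[OF K A] kpow_mult_bounds_summable])

lemma ktrace_resolvent: "(%n. ktrace mu (kpow_mult K A n)) sums ktrace mu (resolvent K A)"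
  unfolding resolvent_def[abs_def] by (rule ktrace_suminf[OF kernel_kpow_mult[OF K A] kpow_mult_bounds_summable])

lemma resolvent_eq: "resolvent K A x y = A x y + kcomp mu K (resolvent K A) x y"
proof -
  note series = kernel_kpow_mult[OF K A] kpow_mult_bounds_summable
  have "kcomp mu K (resolvent K A) x y = (\<Sum>n. kpow_mult K A (Suc n) x y)"
    using kcomp_suminf[OF K series, of x y] unfolding kcomp_kpow_mult[OF K A] resolvent_def[abs_def] by (simp add: sums_iff)
  then show ?thesis unfolding resolvent_def
    using suminf_split_head[OF summable_rabs_cancel[OF kernel_suminf(1)[OF series]], of x y] by (simp add: kpow_mult_simps)
qed

end

text \<open>Both series are \<open>(1 - K)\<inverse> A = (1 - u B)\<inverse> B\<close> for \<open>K = u A - V\<close>, because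
  \<open>1 - K = (1 + V) (1 - u B)\<close> and \<open>A = (1 + V) B\<close>.\<close>
lemma resolvent_triangular:
  assumes B: "kernel CB B" and A: "kernel CA A" and V: "kernel CV V" and B_eq: "!!x y. B x y = A x y - kcomp mu V B x y"
  and small: "(abs u*CA + CV)*mass < 1" "abs u*CB*mass < 1"
  defines "K \<equiv> %x y. u*A x y - V x y"
  shows "resolvent K A = resolvent (%x y. u*B x y) B"
proof (intro ext)
  fix x y
  have K: "kernel (abs u*CA + CV) K" unfolding K_def by (intro kernel_diff kernel_scale A V)
  note uB = kernel_scale[OF B, of u]
  define G H where "G = resolvent K A" and "H = resolvent (%x y. u*B x y) B"
  note G = kernel_resolvent[OF K A small(1), folded G_def] and H = kernel_resolvent[OF uB B small(2), folded H_def]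
  have G_eq: "G x y = A x y + kcomp mu K G x y" for x y using resolvent_eq[OF K A small(1)] by (simp add: G_def)
  have uBH: "u*kcomp mu B H x y = H x y - B x y" for x y using resolvent_eq[OF uB B small(2), of x y] by (simp add: H_def kcomp_scale_left)
  note VB = dominated_by_kcomp[OF V B]
  have A_eq: "A = (%x y. B x y + kcomp mu V B x y)" using B_eq by (simp add: fun_eq_iff)
  have "(%x y. u*kcomp mu A H x y) = (%x y. u*kcomp mu B H x y + kcomp mu V (%x y. u*kcomp mu B H x y) x y)"
    unfolding A_eq kcomp_add_left[OF B VB H] kernel_assoc[OF V B H] kcomp_scale_right by (simp add: distrib_left)
  also have "... = (%x y. H x y - B x y + (kcomp mu V H x y - kcomp mu V B x y))" unfolding uBH kcomp_diff_right[OF V H B] ..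
  finally have H_eq: "H x y = A x y + kcomp mu K H x y" for x y
    unfolding K_def kcomp_diff_left[OF kernel_scale[OF A] V H] kcomp_scale_left using B_eq[of x y] by (simp add: fun_eq_iff)
  have "G x y - H x y = 0"
  proof (rule kcomp_fixed_point_zero[OF K small(1) kernel_diff[OF G H]])
    show "(%x y. G x y - H x y) = kcomp mu K (%x y. G x y - H x y)"
      unfolding kcomp_diff_right[OF K G H] using G_eq H_eq by (simp add: fun_eq_iff)
  qed
  then show "resolvent K A x y = resolvent (%x y. u*B x y) B x y" by (simp add: G_def H_def)
qed

lemma ktrace_kpow_mult_bound:
  assumes K: "kernel C K" and A: "kernel D A" and q: "C*mass <= q"
  shows "abs (ktrace mu (kpow_mult K A n)) <= D*mass*q ^ n"
proof -
  have "abs (ktrace mu (kpow_mult K A n)) <= D*mass*(C*mass) ^ n"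
    using ktrace_bound[OF kernel_kpow_mult[OF K A], of n] by (simp add: mult_ac)
  also have "... <= D*mass*q ^ n" using q dominated_byD(1)[OF K] dominated_byD(1)[OF A] by (intro mult_left_mono power_mono) auto
  finally show ?thesis .
qed

lemma trpow_geometric_bound:
  assumes K: "kernel C K" and q: "C*mass <= q"
  shows "abs (trpow mu K n) <= q*q ^ n" using order_trans[OF trpow_bound[OF K] power_mono[OF q]] dominated_byD(1)[OF K] by simp

end

lemma summable_div_Suc:
  fixes T :: "nat => real"
  assumes T: "!!n. abs (T n) <= c*q ^ n" and q: "0 <= q" "q < 1"
  shows "summable (%n. T n/(real n + 1))"
proof (rule summable_comparison_test'[of "%n. c*q ^ n" 0])
  fix n
  have "abs (T n)/(real n + 1) <= abs (T n)" by (simp add: field_simps)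
  then show "norm (T n/(real n + 1)) <= c*q ^ n" using T[of n] by simp
qed (use q in \<open>auto intro!: summable_mult summable_geometric\<close>)

context weighted_measure begin

lemma trpow_gap_has_derivative:
  assumes A: "kernel CA A" and V: "kernel CV V" and B: "kernel CB B"
  shows "((%v. (trpow mu (%x y. v * A x y - V x y) n - trpow mu (%x y. v * B x y) n)/(real n + 1))
  has_field_derivative ktrace mu (kpow_mult (%x y. v * A x y - V x y) A n) - ktrace mu (kpow_mult (%x y. v * B x y) B n)) (at v)"
proof -
  have "kernel 0 (%_ _. 0)" by (intro kernelI) auto
  from trpow_affine_has_derivative[OF this B, of n v]
  have "((%v. trpow mu (%x y. v * B x y) n) has_field_derivative (real n + 1)*ktrace mu (kpow_mult (%x y. v * B x y) B n)) (at v)" by simp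
  from DERIV_cdivide[OF DERIV_diff[OF trpow_affine_has_derivative[OF V A, of n v] this], of "real n + 1"]
  show ?thesis by (simp add: add_nonneg_eq_0_iff flip: right_diff_distrib)
qed

lemma fredholm_triangular_small:
  assumes B: "kernel CB B" and A: "kernel CA A" and V: "kernel CV V" and B_eq: "!!x y. B x y = A x y - kcomp mu V B x y"
  and nilpotent: "!!n. trpow mu (%x y. - V x y) n = 0"
  and r: "0 < r" "(r*CA + CV)*mass < 1" "r*CB*mass < 1" and u: "abs u < r"
  shows "fredholm mu (%x y. u*A x y - V x y) = fredholm mu (%x y. u*B x y)"
proof -
  have nonneg: "0 <= CA" "0 <= CV" "0 <= CB" using A V B by (auto dest: dominated_byD)
  define K uB where "K = (%u x y. u*A x y - V x y)" and "uB = (%u x y. u*B x y)"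
  define q where "q = max ((r*CA + CV)*mass) (r*CB*mass)"
  have q: "0 <= q" "q < 1" using r nonneg by (auto simp: q_def le_max_iff_disj)
  have K: "kernel (abs v *CA + CV) (K v)" for v unfolding K_def by (intro kernel_diff kernel_scale A V)
  have uB: "kernel (abs v *CB) (uB v)" for v unfolding uB_def by (intro kernel_scale B)
  have small: "(abs v *CA + CV)*mass <= q" "abs v *CB*mass <= q" if "abs v < r" for v using that nonneg unfolding q_def
    by (intro max.coboundedI1 max.coboundedI2 mult_right_mono add_mono; simp)+
  define f where "f = (%n v. (trpow mu (K v) n - trpow mu (uB v) n)/(real n + 1))"
  define f' where "f' = (%n v. ktrace mu (kpow_mult (K v) A n) - ktrace mu (kpow_mult (uB v) B n))"
  have "abs (f' n v) <= (CA*mass + CB*mass)*q ^ n" if "abs v < r" for v n unfolding f'_def distrib_right using small[OF that]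
    by (intro order_trans[OF abs_triangle_ineq4] add_mono ktrace_kpow_mult_bound[OF K A] ktrace_kpow_mult_bound[OF uB B])
  moreover have "(f n has_field_derivative f' n v) (at v)" for n v
    unfolding f_def f'_def K_def uB_def by (rule trpow_gap_has_derivative[OF A V B])
  moreover have f_0: "f n 0 = 0" for n unfolding f_def uB_def trpow_scale by (simp add: K_def nilpotent)
  moreover have "(\<Sum>n. f' n v) = 0" if "abs v < r" for v
  proof -
    have v: "(abs v *CA + CV)*mass < 1" "abs v *CB*mass < 1" using small[OF that] q by auto
    have "resolvent (K v) A = resolvent (uB v) B" unfolding K_def uB_def by (rule resolvent_triangular[OF B A V B_eq v])
    with sums_diff[OF ktrace_resolvent[OF K A v(1)] ktrace_resolvent[OF uB B v(2)]]
    show ?thesis by (simp add: f'_def sums_iff)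
  qed
  ultimately have deriv_0: "((%v. \<Sum>n. f n v) has_field_derivative 0) (at v)" if "abs v < r" for v
    using has_field_derivative_suminf_geometric[of r f f' "CA*mass + CB*mass" q v] q that by simp
  have "\<exists>c. \<forall>v\<in>{-r<..<r}. (\<Sum>n. f n v) = c"
    by (rule has_field_derivative_zero_constant) (use deriv_0 in \<open>auto intro: has_field_derivative_at_within\<close>)
  then obtain c where "\<forall>v\<in>{-r<..<r}. (\<Sum>n. f n v) = c" by blast
  then have "(\<Sum>n. f n u) = (\<Sum>n. f n 0)" using u r(1) by (simp add: abs_less_iff)
  then have total: "(\<Sum>n. trpow mu (K u) n/(real n + 1) - trpow mu (uB u) n/(real n + 1)) = 0"
    unfolding f_0 by (simp add: f_def diff_divide_distrib)
  note bounds = trpow_geometric_bound[OF K small(1)[OF u]] trpow_geometric_bound[OF uB small(2)[OF u]]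
  from suminf_diff[OF summable_div_Suc[OF bounds(1) q] summable_div_Suc[OF bounds(2) q]] total
  have "fredholm mu (K u) = fredholm mu (uB u)" unfolding fredholm_eq_exp[OF K bounds(1) q] fredholm_eq_exp[OF uB bounds(2) q] by simp
  then show ?thesis by (simp add: K_def uB_def)
qed

end

lemma det_on_affine:
  assumes "finite I"
  shows "det_on I (%i j. u*A i j + B i j) = (\<Sum>J\<in>Pow I. u ^ card J*det_on I (%i j. if i \<in> J then A i j else B i j))"
proof -
  have "(\<Prod>i\<in>I. u*A i (p i) + B i (p i)) = (\<Sum>J\<in>Pow I. u ^ card J*(\<Prod>i\<in>I. if i \<in> J then A i (p i) else B i (p i)))" for p
    unfolding prod_add[OF assms]
  proof (intro sum.cong refl)
    fix J assume "J \<in> Pow I"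
    then have J: "J \<subseteq> I" by simp
    have "(\<Prod>i\<in>I. if i \<in> J then A i (p i) else B i (p i)) = (\<Prod>i\<in>J. A i (p i))*(\<Prod>i\<in>I - J. B i (p i))"
      using J assms by (subst prod.If_cases) (auto simp: Int_absorb1 Diff_eq)
    then show "(\<Prod>x\<in>J. u*A x (p x))*(\<Prod>x\<in>I - J. B x (p x)) = u ^ card J*(\<Prod>i\<in>I. if i \<in> J then A i (p i) else B i (p i))"
      by (simp add: prod.distrib)
  qed
  then show ?thesis unfolding det_on_def sum_distrib_left by (subst sum.swap) (simp add: sum_distrib_left mult_ac)
qed

lemma sum_Pow_by_card: "(\<Sum>J\<in>Pow {..<N}. f J) = (\<Sum>n\<le>N. \<Sum>J | J \<subseteq> {..<N} \<and> card J = n. f J)" for f :: "nat set => real"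
proof -
  have "card ` Pow {..<N} \<subseteq> {..N}" using card_mono[OF finite_lessThan, of _ N] by auto
  from sum.group[OF _ _ this, of f] show ?thesis by simp
qed

lemma polynomial_series_powser:
  fixes c :: "nat => nat => real"
  assumes abs_summable: "!!u. summable (%N. \<Sum>n\<le>N. abs (c N n*u ^ n))"
  shows "\<exists>d. \<forall>u. (%n. d n*u ^ n) sums (\<Sum>N. \<Sum>n\<le>N. c N n*u ^ n)"
proof (intro exI allI)
  fix u :: real
  define f where "f = (%u N n. if n \<le> N then c N n*u ^ n else 0)"
  have row: "((%n. h (f u N n)) has_sum (\<Sum>n\<le>N. h (c N n*u ^ n))) UNIV" if "h 0 = 0" for h :: "real => real" and u N
  proof -
    have "((%n. h (c N n*u ^ n)) has_sum (\<Sum>n\<le>N. h (c N n*u ^ n))) {..N}" by (rule has_sum_finite) simp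
    then show ?thesis by (rule has_sum_cong_neutral[THEN iffD1, rotated -1]) (auto simp: f_def that)
  qed
  have summable: "(%(N, n). f u N n) summable_on UNIV \<times> UNIV" for u
  proof -
    have "(%N. \<Sum>n\<le>N. abs (c N n*u ^ n)) summable_on UNIV"
      using abs_summable[of u] by (intro norm_summable_imp_summable_on) (simp add: sum_nonneg)
    then have "(%p. norm (f u (fst p) (snd p))) summable_on UNIV \<times> UNIV"
      using row[of abs u] by (intro summable_on_SigmaI[where g="%N. \<Sum>n\<le>N. abs (c N n*u ^ n)"]) auto
    from abs_summable_summable[OF this] show ?thesis by (simp add: case_prod_beta')
  qed
  have swapped: "(%(n, N). f u N n) summable_on UNIV \<times> UNIV" for u
    using summable_on_swap[of "%(N, n). f u N n" UNIV UNIV] summable[of u] by (simp add: case_prod_beta')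
  have "summable (%N. norm (\<Sum>n\<le>N. c N n*u ^ n))"
    by (rule summable_comparison_test'[OF abs_summable[of u], of 0]) (auto intro: sum_abs)
  from norm_summable_imp_has_sum[OF this summable_sums[OF summable_norm_cancel[OF this]]]
  have total: "((%N. \<Sum>n\<le>N. c N n*u ^ n) has_sum (\<Sum>N. \<Sum>n\<le>N. c N n*u ^ n)) UNIV" .
  have "(\<Sum>\<^sub>\<infinity>n. \<Sum>\<^sub>\<infinity>N. f u N n) = (\<Sum>\<^sub>\<infinity>N. \<Sum>\<^sub>\<infinity>n. f u N n)"
    by (rule infsum_swap_banach[symmetric, OF summable])
  also have "... = (\<Sum>N. \<Sum>n\<le>N. c N n*u ^ n)" using infsumI[OF row[of "%x. x" u]] infsumI[OF total] by simp
  finally have sum: "((%n. \<Sum>\<^sub>\<infinity>N. f u N n) has_sum (\<Sum>N. \<Sum>n\<le>N. c N n*u ^ n)) UNIV"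
    using has_sum_infsum[OF summable_on_Sigma_banach[OF swapped]] by metis
  have factor: "(\<Sum>\<^sub>\<infinity>N. f u N n) = (\<Sum>\<^sub>\<infinity>N. f 1 N n)*u ^ n" for n
  proof -
    have "(%N. f 1 N n) summable_on UNIV" using summable_on_SigmaD1[OF swapped[of 1], of n] by simp
    then show ?thesis unfolding f_def by (subst infsum_cmult_left[symmetric]) (auto intro!: infsum_cong)
  qed
  show "(%n. (\<Sum>\<^sub>\<infinity>N. f 1 N n)*u ^ n) sums (\<Sum>N. \<Sum>n\<le>N. c N n*u ^ n)"
    by (rule has_sum_imp_sums[OF sum[unfolded factor]])
qed

context weighted_measure begin

lemma fredcoef_affine:
  assumes A: "kernel C A" and V: "kernel C V"
  shows "\<exists>c. \<forall>N u. fredcoef (trpow mu (%x y. u*A x y - V x y)) N = (\<Sum>n\<le>N. c N n*u ^ n)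
  \<and> (\<Sum>n\<le>N. abs (c N n*u ^ n)) <= (2*max 1 (abs u)*C*mass * sqrt N) ^ N/fact N"
proof (intro exI allI conjI)
  fix N :: nat and u :: real
  define X where "X = (%(J::nat set) i (j::nat). if i \<in> J then A else (%x y. - V x y))"
  have X: "kernel C (X J i j)" for J i j using A kernel_uminus[OF V] by (simp add: X_def)
  define d where "d = (%N J. \<integral>z. det_on {..<N} (%i j. X J i j (z i) (z j)) \<partial>Pi\<^sub>M {..<N} (%_. mu))"
  have d: "abs (d N J) <= (C*mass * sqrt N) ^ N" for N J unfolding d_def by (rule integral_det_on_bound[OF X])
  define c where "c = (%N n. (-1) ^ N/fact N*(\<Sum>J | J \<subseteq> {..<N} \<and> card J = n. d N J))"
  have "det_on {..<N} (%i j. u*A (z i) (z j) - V (z i) (z j))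
    = (\<Sum>J\<in>Pow {..<N}. u ^ card J*det_on {..<N} (%i j. X J i j (z i) (z j)))" for z
    using det_on_affine[of "{..<N}" u "%i j. A (z i) (z j)" "%i j. - V (z i) (z j)"] by (simp add: X_def if_distrib[of "%f. f _ _"])
  then have "fredcoef (trpow mu (%x y. u*A x y - V x y)) N = (-1) ^ N/fact N*(\<Sum>J\<in>Pow {..<N}. u ^ card J*d N J)"
    unfolding fredcoef_eq_det_on[OF kernel_diff[OF kernel_scale[OF A] V]] d_def by (simp add: det_on_integrable[OF _ X])
  then show "fredcoef (trpow mu (%x y. u*A x y - V x y)) N = (\<Sum>n\<le>N. c N n*u ^ n)"
    unfolding sum_Pow_by_card c_def by (simp add: sum_distrib_left sum_distrib_right mult_ac)
  let ?b = "max 1 (abs u) ^ N*(C*mass * sqrt N) ^ N/fact N"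
  have coef_bound: "abs (c N n*u ^ n) <= (\<Sum>J | J \<subseteq> {..<N} \<and> card J = n. ?b)" if "n <= N" for n
  proof -
    have u: "abs u ^ n <= max 1 (abs u) ^ N"
      using power_mono[of "abs u" "max 1 (abs u)" n] power_increasing[of n N "max 1 (abs u)"] that by auto
    have "abs (c N n*u ^ n) = abs (\<Sum>J | J \<subseteq> {..<N} \<and> card J = n. d N J)*(abs u ^ n/fact N)"
      unfolding c_def by (simp add: abs_mult power_abs)
    also have "... <= (\<Sum>J | J \<subseteq> {..<N} \<and> card J = n. abs (d N J)*(abs u ^ n/fact N))"
      unfolding sum_distrib_right[symmetric] by (intro mult_right_mono sum_abs) auto
    also have "... <= (\<Sum>J | J \<subseteq> {..<N} \<and> card J = n. ?b)"
    proof (rule sum_mono)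
      fix J
      have "abs (d N J)*abs u ^ n <= (C*mass * sqrt N) ^ N*max 1 (abs u) ^ N" using d u dominated_byD(1)[OF A] by (intro mult_mono) auto
      then show "abs (d N J)*(abs u ^ n/fact N) <= ?b" by (simp add: divide_right_mono mult.commute)
    qed
    finally show ?thesis .
  qed
  have "(\<Sum>n\<le>N. abs (c N n*u ^ n)) <= (\<Sum>n\<le>N. \<Sum>J | J \<subseteq> {..<N} \<and> card J = n. ?b)"
    by (intro sum_mono coef_bound) simp
  also have "... = (\<Sum>J\<in>Pow {..<N}. ?b)" by (rule sum_Pow_by_card[symmetric])
  also have "... = (2*max 1 (abs u)*C*mass * sqrt N) ^ N/fact N" by (simp add: card_Pow power_mult_distrib mult_ac)
  finally show "(\<Sum>n\<le>N. abs (c N n*u ^ n)) <= (2*max 1 (abs u)*C*mass * sqrt N) ^ N/fact N" .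
qed

lemma fredholm_affine_powser:
  assumes A: "kernel CA A" and V: "kernel CV V"
  shows "\<exists>d. \<forall>u. (%n. d n*u ^ n) sums fredholm mu (%x y. u*A x y - V x y)"
proof -
  define C where "C = max CA CV"
  have C: "kernel C A" "kernel C V" using kernel_mono A V by (auto simp: C_def)
  from fredcoef_affine[OF C] obtain c where
    coef: "fredcoef (trpow mu (%x y. u*A x y - V x y)) N = (\<Sum>n\<le>N. c N n*u ^ n)"
    "(\<Sum>n\<le>N. abs (c N n*u ^ n)) <= (2*max 1 (abs u)*C*mass * sqrt N) ^ N/fact N" for u N by blast
  have "summable (%N. \<Sum>n\<le>N. abs (c N n*u ^ n))" for u
    by (rule summable_comparison_test'[OF summable_Hadamard_series, of "2*max 1 (abs u)*C*mass" 0])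
    (use coef(2) dominated_byD(1)[OF C(1)] in \<open>auto simp: sum_nonneg\<close>)
  from polynomial_series_powser[of c, OF this] show ?thesis unfolding fredholm_def coef(1) .
qed

text \<open>The identity \<open>det (1 + V - A) = det (1 + V) det (1 - (1 + V)\<inverse> A)\<close> for a volterra kernel \<open>V\<close>.
  Both sides are entire in \<open>u\<close> when \<open>A\<close> is replaced by \<open>u A\<close>, and for small \<open>u\<close> their logarithms are trace series.\<close>
lemma fredholm_triangular:
  assumes B: "kernel CB B" and A: "kernel CA A" and V: "kernel CV V" and B_eq: "!!x y. B x y = A x y - kcomp mu V B x y"
  and nilpotent: "!!n. trpow mu (%x y. - V x y) n = 0" and small: "CV*mass < 1"
  shows "fredholm mu (%x y. A x y - V x y) = fredholm mu B"
proof -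
  have "eventually (%r. (r*CA + CV)*mass < 1 \<and> r*CB*mass < 1) (at_right 0)"
  proof (intro eventually_conj)
    have "((%r. (r*CA + CV)*mass) \<longlongrightarrow> (0*CA + CV)*mass) (at_right 0)" by (intro tendsto_intros)
    then show "\<forall>\<^sub>F r in at_right 0. (r*CA + CV)*mass < 1" using small by (intro order_tendstoD) auto
    have "((%r. r*CB*mass) \<longlongrightarrow> 0*CB*mass) (at_right 0)" by (intro tendsto_intros)
    then show "\<forall>\<^sub>F r in at_right 0. r*CB*mass < 1" by (intro order_tendstoD) auto
  qed
  then obtain r where r: "0 < r" "(r*CA + CV)*mass < 1" "r*CB*mass < 1" unfolding eventually_at_right_field by (metis dense)
  obtain d where d: "!!u. (%n. d n*u ^ n) sums fredholm mu (%x y. u*A x y - V x y)" using fredholm_affine_powser[OF A V] by blast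
  have "d = fredcoef (trpow mu B)"
  proof (rule powser_unique_real[OF r(1)])
    show "(%n. fredcoef (trpow mu B) n*u ^ n) sums fredholm mu (%x y. u*A x y - V x y)" if "abs u < r" for u
      unfolding fredholm_triangular_small[OF B A V B_eq nilpotent r that] by (rule fredholm_scale_sums[OF B])
  qed (rule d)
  with d[of 1] fredholm_scale_sums[OF B, of 1] show ?thesis by (simp add: sums_iff)
qed

end

section \<open>Contour integrals for the Airy function\<close>

lemma gauss_integrable: "0 < c ==> Leb1 (%v::real. exp (-c * v^2))"
  and gauss_integral: "0 < c ==> (LBINT v. exp (-c * v^2)) = sqrt (pi/c)"
proof -
  assume c_pos: "0 < c"
  define s where "s = 1/sqrt (2*c)"
  have s: "0 < s" "s^2 = 1/(2*c)" using c_pos by (auto simp: s_def power_divide)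
  have normal_eq: "exp (-c * v^2) = sqrt (pi/c)*normal_density 0 s v" for v
    using c_pos unfolding normal_density_def s(2) by (simp add: real_sqrt_divide)
  show "Leb1 (%v::real. exp (-c * v^2))" unfolding normal_eq by (intro integrable_mult_right integrable_normal_density s)
  show "(LBINT v. exp (-c * v^2)) = sqrt (pi/c)" unfolding normal_eq using integral_normal_density[OF s(1)] by simp
qed

lemma has_bochner_integral_exp_right:
  fixes c :: real
  assumes c_pos: "0 < c"
  shows "Leb_has (%x. ind {a..} x*exp (-c*x)) (exp (-c*a)/c)"
proof (rule has_bochner_integral_nn_integral)
  have "(\<integral>\<^sup>+x. ennreal (exp (-c*x))*ind {a..} x \<partial>lborel) = ennreal (0 - (-exp (-c*a)/c))"
  proof (rule nn_integral_FTC_atLeast)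
    show "((%x. - exp (-c*x)/c) has_field_derivative exp (-c*x)) (at x)" for x using c_pos by (auto intro!: derivative_eq_intros)
    show "((%x. - exp (-c*x)/c) \<longlongrightarrow> 0) at_top" using c_pos by real_asymp
  qed auto
  then show "(\<integral>\<^sup>+x. ennreal (ind {a..} x*exp (-c*x)) \<partial>lborel) = ennreal (exp (-c*a)/c)"
    by (simp add: ennreal_mult' ennreal_indicator mult.commute)
qed (use c_pos in auto)

lemma has_bochner_integral_exp_left:
  fixes c :: real
  assumes c_pos: "0 < c"
  shows "Leb_has (%x. ind {..a} x*exp (c*x)) (exp (c*a)/c)"
proof -
  have "Leb_has (%x. ind {- a..} (0 + -1*x)*exp (-c*(0 + -1*x))) (exp (-c*(-a))/c /\<^sub>R abs (-1))"
    by (rule lborel_has_bochner_integral_real_affine_iff[THEN iffD1, OF _ has_bochner_integral_exp_right[OF c_pos]]) simp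
  moreover have "ind {- a..} (0 + -1*x)*exp (-c*(0 + -1*x)) = ind {..a} x*exp (c*x)" for x by (auto simp: indicator_def)
  ultimately show ?thesis by simp
qed

lemma has_bochner_integral_exp_abs:
  fixes c :: real
  assumes c_pos: "0 < c"
  shows "Leb_has (%x. exp (-c*abs x)) (2/c)"
proof -
  have "Leb_has (%x. ind {0..} x*exp (-c*x) + ind {..0} x*exp (c*x)) (exp (-c*0)/c + exp (c*0)/c)"
    by (intro has_bochner_integral_add has_bochner_integral_exp_right has_bochner_integral_exp_left c_pos)
  moreover have "AE x in lborel. ind {0..} x*exp (-c*x) + ind {..0} x*exp (c*x) = exp (-c*abs x)"
    using AE_lborel_singleton[of "0::real"] by eventually_elim (auto simp: indicator_def)
  ultimately have "Leb_has (%x. exp (-c*abs x)) (exp (-c*0)/c + exp (c*0)/c)" by (subst (asm) has_bochner_integral_cong_AE) auto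
  then show ?thesis by simp
qed

lemma primitive_line_limit:
  fixes f P :: "real => complex"
  assumes P: "!!v. (P has_vector_derivative f v) (at v)" and f: "continuous_on UNIV f" "Leb1 f"
  shows "((%V. P V - P (-V)) \<longlongrightarrow> (LBINT v. f v)) at_top"
proof -
  have "((%V. LBINT v. ind {-V..V} v *\<^sub>R f v) \<longlongrightarrow> (LBINT v. f v)) at_top"
  proof (rule integral_dominated_convergence_at_top[where w="%v. norm (f v)"])
    show "AE v in lborel. ((%V. ind {-V..V} v *\<^sub>R f v) \<longlongrightarrow> f v) at_top"
    proof (intro AE_I2 tendsto_eventually)
      fix v :: real
      show "\<forall>\<^sub>F V in at_top. ind {-V..V} v *\<^sub>R f v = f v"
        using eventually_ge_at_top[of "abs v"] by eventually_elim (auto simp: indicator_def)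
    qed
  qed (use f in \<open>auto simp: indicator_def\<close>)
  moreover have "\<forall>\<^sub>F V in at_top. (LBINT v. ind {-V..V} v *\<^sub>R f v) = P V - P (-V)"
    using eventually_ge_at_top[of "0::real"]
  proof eventually_elim
    case (elim V)
    have "Leb_has (%x. ind {-V..V} x *\<^sub>R f x) (P V - P (-V))" by (rule has_bochner_integral_FTC_Icc)
      (use elim f in \<open>auto intro: P[THEN has_vector_derivative_at_within] continuous_on_subset\<close>)
    then show ?case by (rule Leb_eq)
  qed
  ultimately show ?thesis by (rule Lim_transform_eventually)
qed

definition airy_integrand :: "real => real => complex => complex" where
  "airy_integrand ta X w = exp (w ^ 3/3 - of_real ta*w^2 - w * of_real X)"

lemma Re_cube: "Re (w ^ 3) = Re w ^ 3 - 3*Re w*(Im w)^2" by (simp_all add: power3_eq_cube power2_eq_square algebra_simps)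

lemma norm_airy_integrand: "norm (airy_integrand ta X (Complex r V)) = exp (r ^ 3/3 - ta*r^2 - r*X)*exp (-(r - ta)*V^2)"
proof -
  have "Re (Complex r V ^ 3/3 - of_real ta*(Complex r V)^2 - Complex r V * of_real X)
    = (r ^ 3 - 3*r*V^2)/3 - ta*(r^2 - V^2) - r*X" by (simp add: Re_cube power2_eq_square)
  also have "... = (r ^ 3/3 - ta*r^2 - r*X) + (-(r - ta)*V^2)" by (simp add: field_simps)
  finally have Re_exponent: "Re (Complex r V ^ 3/3 - of_real ta*(Complex r V)^2 - Complex r V * of_real X)
    = (r ^ 3/3 - ta*r^2 - r*X) + (-(r - ta)*V^2)" .
  show ?thesis unfolding airy_integrand_def norm_exp_eq_Re Re_exponent exp_add ..
qed

lemma continuous_on_Complex: "continuous_on A f ==> continuous_on A g ==> continuous_on A (%x. Complex (f x) (g x))"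
  unfolding Complex_eq by (intro continuous_intros)

lemma continuous_on_airy_integrand: "continuous_on A f ==> continuous_on A (%x. airy_integrand ta X (f x))"
  unfolding airy_integrand_def by (intro continuous_intros) auto

lemma airy_integrand_vertical_integrable: "ta < a ==> Leb1 (%v. airy_integrand ta X (Complex a v))"
proof (rule L1_bound)
  assume a: "ta < a"
  show "Leb1 (%v. exp (a ^ 3/3 - ta*a^2 - a*X)*exp (-(a - ta) * v^2))" using a by (intro integrable_mult_right gauss_integrable) auto
  show "(%v. airy_integrand ta X (Complex a v)) \<in> bmeas lborel"
    using borel_measurable_continuous_onI[OF continuous_on_airy_integrand[OF continuous_on_Complex[OF continuous_on_const continuous_on_id]]]
    by simp
qed (simp add: norm_airy_integrand)

lemma airy_integrand_primitive:
  obtains Ph where "!!w. (Ph has_field_derivative airy_integrand ta X w) (at w)"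
proof -
  have "airy_integrand ta X holomorphic_on UNIV" unfolding airy_integrand_def[abs_def] by (intro holomorphic_intros) auto
  from holomorphic_convex_primitive'[OF _ _ this] show ?thesis using that by auto
qed

lemma primitive_horizontal:
  assumes Ph: "!!w. (Ph has_field_derivative f w) (at w)" and B: "!!r. r \<in> {a..b} ==> norm (f (Complex r V)) <= B" and ab: "a <= b"
  shows "norm (Ph (Complex b V) - Ph (Complex a V)) <= B*(b - a)"
proof -
  let ?S = "closed_segment (Complex a V) (Complex b V)"
  have S: "z = Complex (Re z) V \<and> Re z \<in> {a..b}" if "z \<in> ?S" for z
  proof -
    obtain u where u: "0 <= u" "u <= 1" "z = (1 - u) *\<^sub>R Complex a V + u *\<^sub>R Complex b V"
      using \<open>z \<in> ?S\<close> by (auto simp: in_segment)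
    have "Re z = a + u*(b - a)" "Im z = V" unfolding u(3) by (simp_all add: algebra_simps)
    moreover have "u*(b - a) <= 1*(b - a)" using u ab by (intro mult_right_mono) auto
    ultimately show ?thesis using u ab by (auto simp: complex_eq_iff)
  qed
  have "norm (Ph (Complex b V) - Ph (Complex a V)) <= B*norm (Complex b V - Complex a V)"
  proof (rule field_differentiable_bound[of ?S])
    show "norm (f z) <= B" if "z \<in> ?S" for z using S[OF that] B by metis
  qed (auto intro: has_field_derivative_at_within Ph)
  also have "norm (Complex b V - Complex a V) = b - a" using ab by (simp add: cmod_def)
  finally show ?thesis .
qed

lemma vertical_deriv:
  assumes "!!w. (Ph has_field_derivative f w) (at w)"
  shows "((%v. Ph (Complex a v)/\<i>) has_vector_derivative f (Complex a v)) (at v)"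
proof -
  have "((%v. Complex a v) has_vector_derivative \<i>) (at v)" unfolding Complex_eq by (auto intro!: derivative_eq_intros)
  from field_vector_diff_chain_at[OF this assms]
  have "((%v. Ph (Complex a v)) has_vector_derivative \<i>*f (Complex a v)) (at v)" by (simp add: o_def)
  from has_vector_derivative_mult_right[OF this, of "- \<i>"] show ?thesis by (simp add: divide_inverse mult.commute)
qed

lemma primitive_vertical_limit:
  assumes Ph: "!!w. (Ph has_field_derivative airy_integrand ta X w) (at w)" and a: "ta < a"
  shows "((%V. Ph (Complex a V)/\<i> - Ph (Complex a (-V))/\<i>) \<longlongrightarrow> (LBINT v. airy_integrand ta X (Complex a v))) at_top"
  by (intro primitive_line_limit vertical_deriv Ph continuous_on_airy_integrand continuous_on_Complex airy_integrand_vertical_integrable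
  continuous_intros a)

lemma norm_primitive_gap: "norm ((p/\<i> - p'/\<i>) - (q/\<i> - q'/\<i>)) <= norm (p - q) + norm (p' - q')"
proof -
  have "(p/\<i> - p'/\<i>) - (q/\<i> - q'/\<i>) = ((p - q) - (p' - q'))/\<i>" by (simp add: field_simps)
  then show ?thesis by (simp only: norm_divide norm_ii div_by_1 norm_triangle_ineq4)
qed

lemma norm_airy_integrand_strip:
  assumes "0 <= r" "r <= a"
  shows "norm (airy_integrand 0 X (Complex r V)) <= exp (a ^ 3/3 + a*abs X)*exp (-r*V^2)"
proof -
  have "r ^ 3 <= a ^ 3" using assms by (intro power_mono) auto
  moreover have "- (r*X) <= a*abs X"
  proof -
    have "r*(-X) <= r*abs X" using assms by (intro mult_left_mono) auto
    also have "... <= a*abs X" using assms by (intro mult_right_mono) auto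
    finally show ?thesis by (simp only: mult_minus_right)
  qed
  ultimately have "r ^ 3/3 - 0*r^2 - r*X <= a ^ 3/3 + a*abs X" by linarith
  then show ?thesis unfolding norm_airy_integrand by (intro mult_mono) auto
qed

text \<open>The horizontal segment is cut at \<open>1 / \<bar>V\<bar>\<close>: the first piece is short, on the second the integrand is small.\<close>
lemma airy_primitive_horizontal_gap:
  assumes Ph: "!!w. (Ph has_field_derivative airy_integrand 0 X w) (at w)" and V: "1/a <= abs V" "0 < abs V" and a: "0 < a"
  defines "M \<equiv> exp (a ^ 3/3 + a*abs X)"
  shows "norm (Ph (Complex a V) - Ph (Complex 0 V)) <= M/abs V + M*exp (-abs V)*a"
proof -
  define e where "e = 1/abs V"
  have e: "0 < e" "e <= a" using V a by (auto simp: e_def field_simps)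
  have "norm (Ph (Complex e V) - Ph (Complex 0 V)) <= M*(e - 0)"
  proof (rule primitive_horizontal[OF Ph])
    fix r assume r: "r \<in> {0..e}"
    then have "norm (airy_integrand 0 X (Complex r V)) <= M*exp (-r*V^2)" unfolding M_def using e by (intro norm_airy_integrand_strip) auto
    also have "... <= M*1" using r by (intro mult_left_mono) (auto simp: M_def)
    finally show "norm (airy_integrand 0 X (Complex r V)) <= M" by simp
  qed (use e in auto)
  moreover have "norm (Ph (Complex a V) - Ph (Complex e V)) <= M*exp (-abs V)*(a - e)"
  proof (rule primitive_horizontal[OF Ph])
    fix r assume r: "r \<in> {e..a}"
    then have "norm (airy_integrand 0 X (Complex r V)) <= M*exp (-r*V^2)" unfolding M_def using e by (intro norm_airy_integrand_strip) auto
    also have "e*V^2 <= r*V^2" using r by (intro mult_right_mono) auto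
    then have "M*exp (-r*V^2) <= M*exp (-abs V)"
      using V by (intro mult_left_mono) (auto simp: M_def e_def power2_eq_square abs_if split: if_splits)
    finally show "norm (airy_integrand 0 X (Complex r V)) <= M*exp (-abs V)" .
  qed (use e in auto)
  moreover have "M*exp (-abs V)*(a - e) <= M*exp (-abs V)*a" using e by (intro mult_left_mono) (auto simp: M_def)
  ultimately show ?thesis using norm_triangle_ineq[of "Ph (Complex e V) - Ph (Complex 0 V)" "Ph (Complex a V) - Ph (Complex e V)"]
    by (simp add: e_def)
qed

lemma airy_integrand_imaginary:
  "airy_integrand 0 X (Complex 0 v) + airy_integrand 0 X (Complex 0 (-v)) = of_real (2*cos (v ^ 3/3 + X * v))"
proof -
  have axis: "airy_integrand 0 X (Complex 0 v) = cis (-(v ^ 3/3 + X * v))" for v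
  proof -
    have "Complex 0 v ^ 3/3 - of_real 0*(Complex 0 v)^2 - Complex 0 v * of_real X = \<i> * of_real (-(v ^ 3/3 + X * v))"
      by (simp add: complex_eq_iff power3_eq_cube)
    then show ?thesis unfolding airy_integrand_def cis_conv_exp by simp
  qed
  have "cis (-p) + cis p = of_real (2*cos p)" for p by (simp add: complex_eq_iff)
  from this[of "v ^ 3/3 + X * v"] show ?thesis unfolding axis by (simp add: add.commute)
qed

lemma airy_primitive_imaginary_axis:
  assumes Ph: "!!w. (Ph has_field_derivative airy_integrand 0 X w) (at w)" and V: "0 <= V"
  shows "Ph (Complex 0 V)/\<i> - Ph (Complex 0 (-V))/\<i> = of_real (2*integral {0..V} (%t. cos (t ^ 3/3 + X*t)))"
proof -
  define P where "P = (%v. Ph (Complex 0 v)/\<i>)"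
  have P': "(P has_vector_derivative airy_integrand 0 X (Complex 0 v)) (at v)" for v unfolding P_def by (rule vertical_deriv[OF Ph])
  have "((%v. P v - P (-v)) has_vector_derivative of_real (2*cos (v ^ 3/3 + X * v))) (at v)" for v
  proof -
    have "(uminus has_vector_derivative (-1::real)) (at v)" by (auto intro!: derivative_eq_intros)
    from has_vector_derivative_diff[OF P' vector_diff_chain_at[OF this P']]
    show ?thesis by (simp add: o_def airy_integrand_imaginary)
  qed
  from fundamental_theorem_of_calculus[OF V has_vector_derivative_at_within[OF this]]
  have "((%v. of_real (2*cos (v ^ 3/3 + X * v)) :: complex) has_integral P V - P (-V)) {0..V}" by simp
  moreover have "((%t. cos (t ^ 3/3 + X*t)) has_integral integral {0..V} (%t. cos (t ^ 3/3 + X*t))) {0..V}"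
    by (intro integrable_integral integrable_continuous_real continuous_intros) simp
  from has_integral_linear[OF has_integral_mult_right[OF this, of 2] bounded_linear_of_real]
  have "((%v. of_real (2*cos (v ^ 3/3 + X * v)) :: complex) has_integral of_real (2*integral {0..V} (%t. cos (t ^ 3/3 + X*t)))) {0..V}"
    by (simp add: o_def)
  ultimately show ?thesis unfolding P_def by (rule has_integral_unique)
qed

lemma airy_vertical_0:
  assumes a: "0 < a"
  shows "(LBINT v. airy_integrand 0 X (Complex a v)) = of_real (2*pi*Airy_Ai X)"
proof -
  let ?I = "LBINT v. airy_integrand 0 X (Complex a v)"
  obtain Ph where Ph: "!!w. (Ph has_field_derivative airy_integrand 0 X w) (at w)" using airy_integrand_primitive by blast
  define P where "P = (%r v. Ph (Complex r v)/\<i>)"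
  define M where "M = exp (a ^ 3/3 + a*abs X)"
  have "((%V. (P a V - P a (-V)) - (P 0 V - P 0 (-V))) \<longlongrightarrow> 0) at_top"
  proof (rule Lim_null_comparison)
    show "\<forall>\<^sub>F V in at_top. norm ((P a V - P a (-V)) - (P 0 V - P 0 (-V))) <= 2*(M/V + M*exp (-V)*a)"
      using eventually_ge_at_top[of "max (1/a) 1"]
    proof eventually_elim
      case (elim V)
      then show ?case unfolding P_def M_def
        using airy_primitive_horizontal_gap[OF Ph _ _ a, of V] airy_primitive_horizontal_gap[OF Ph _ _ a, of "-V"]
        by (intro order_trans[OF norm_primitive_gap]) auto
    qed
    show "((%V. 2*(M/V + M*exp (-V)*a)) \<longlongrightarrow> 0) at_top" using a by (real_asymp simp: M_def)
  qed
  from tendsto_diff[OF primitive_vertical_limit[OF Ph a] this[unfolded P_def]]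
  have "((%V. P 0 V - P 0 (-V)) \<longlongrightarrow> ?I) at_top" by (simp add: P_def)
  moreover have "\<forall>\<^sub>F V in at_top. P 0 V - P 0 (-V) = of_real (2*integral {0..V} (%t. cos (t ^ 3/3 + X*t)))"
    using eventually_ge_at_top[of 0] by eventually_elim (simp only: P_def airy_primitive_imaginary_axis[OF Ph])
  ultimately have lim: "((%V. of_real (2*integral {0..V} (%t. cos (t ^ 3/3 + X*t)))) \<longlongrightarrow> ?I) at_top"
    by (rule Lim_transform_eventually)
  have "((%V. integral {0..V} (%t. cos (t ^ 3/3 + X*t))) \<longlongrightarrow> Re ?I/2) at_top"
    using tendsto_divide[OF tendsto_Re[OF lim] tendsto_const, of 2] by simp
  then have "Re ?I = 2*pi*Airy_Ai X" unfolding Airy_Ai_def by (simp add: tendsto_Lim)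
  moreover have "Im ?I = 0" using tendsto_Im[OF lim] by (simp add: tendsto_const_iff)
  ultimately show ?thesis by (simp add: complex_eq_iff)
qed

definition airy_tilt :: "real => real => real" where
  "airy_tilt ta X = Airy_Ai (X + ta^2)*exp (-ta*X - 2/3*ta ^ 3)"

lemma airy_vertical:
  assumes a: "ta < a"
  shows "(LBINT v. airy_integrand ta X (Complex a v)) = of_real (2*pi*airy_tilt ta X)"
proof -
  have "airy_integrand ta X (Complex a v) = of_real (exp (-ta*X - 2/3*ta ^ 3))*airy_integrand 0 (X + ta^2) (Complex (a - ta) v)" for v
  proof -
    define w where "w = Complex (a - ta) v"
    have w: "Complex a v = w + of_real ta" by (simp add: w_def complex_eq_iff)
    show ?thesis unfolding w_def[symmetric] w airy_integrand_def exp_of_real[symmetric] exp_add[symmetric]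
      by (rule arg_cong[of _ _ exp]) (simp add: field_simps power2_eq_square power3_eq_cube)
  qed
  then show ?thesis using airy_vertical_0[of "a - ta" "X + ta^2"] a by (simp add: airy_tilt_def)
qed

definition hyperbola :: "real => real => complex" where "hyperbola bt xi = csqrt (Complex bt xi)"

lemma nonpos_Reals_Complex: "0 < bt ==> Complex bt xi \<notin> \<real>\<^sub>\<le>\<^sub>0" by (auto simp: complex_nonpos_Reals_iff)

context fixes bt :: real assumes bt: "0 < bt" begin

lemma hyperbola_sq: "(hyperbola bt xi)^2 = Complex bt xi" unfolding hyperbola_def by simp

lemma hyperbola_Re_Im: "(Re (hyperbola bt xi))^2 - (Im (hyperbola bt xi))^2 = bt" "2*Re (hyperbola bt xi)*Im (hyperbola bt xi) = xi"
proof -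
  have "Re ((hyperbola bt xi)^2) = bt" "Im ((hyperbola bt xi)^2) = xi" unfolding hyperbola_sq by simp_all
  then show "(Re (hyperbola bt xi))^2 - (Im (hyperbola bt xi))^2 = bt" "2*Re (hyperbola bt xi)*Im (hyperbola bt xi) = xi"
    by (simp_all add: power2_eq_square mult_ac)
qed

lemma hyperbola_Re_ge: "sqrt bt <= Re (hyperbola bt xi)"
proof (rule power2_le_imp_le)
  have "bt <= (Re (hyperbola bt xi))^2" using hyperbola_Re_Im(1)[of xi] zero_le_power2[of "Im (hyperbola bt xi)"] by linarith
  then show "(sqrt bt)^2 <= (Re (hyperbola bt xi))^2" using bt by simp
qed (unfold hyperbola_def, rule Re_csqrt)

lemma hyperbola_Re_pos: "0 < Re (hyperbola bt xi)" using hyperbola_Re_ge[of xi] bt by (meson less_le_trans real_sqrt_gt_zero)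

lemma hyperbola_nz: "hyperbola bt xi ~= 0" using hyperbola_Re_pos[of xi] by auto

lemma hyperbola_Im_le: "abs (Im (hyperbola bt xi)) <= Re (hyperbola bt xi)"
proof (rule power2_le_imp_le)
  show "(abs (Im (hyperbola bt xi)))^2 <= (Re (hyperbola bt xi))^2" using hyperbola_Re_Im(1)[of xi] bt by simp
qed (use hyperbola_Re_pos[of xi] in simp)

lemma hyperbola_xi_le: "abs xi <= 2*(Re (hyperbola bt xi))^2"
proof -
  have "abs xi = 2*Re (hyperbola bt xi)*abs (Im (hyperbola bt xi))"
    using hyperbola_Re_Im(2)[of xi] hyperbola_Re_pos[of xi] by (metis abs_mult abs_numeral abs_of_pos)
  also have "... <= 2*Re (hyperbola bt xi)*Re (hyperbola bt xi)"
    using hyperbola_Im_le[of xi] hyperbola_Re_pos[of xi] by (intro mult_left_mono) auto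
  finally show ?thesis by (simp add: power2_eq_square)
qed

lemma hyperbola_Im_ge: "(abs xi - bt)/2 <= (Im (hyperbola bt xi))^2"
proof -
  have "abs xi <= (Re (hyperbola bt xi))^2 + (Im (hyperbola bt xi))^2"
    using sum_squares_bound[of "Re (hyperbola bt xi)" "Im (hyperbola bt xi)"] sum_squares_bound[of "Re (hyperbola bt xi)" "- Im (hyperbola bt xi)"]
    hyperbola_Re_Im(2)[of xi] by (auto simp: abs_if)
  then show ?thesis using hyperbola_Re_Im(1)[of xi] by (simp add: field_simps)
qed

lemma hyperbola_minus: "hyperbola bt (-xi) = cnj (hyperbola bt xi)" unfolding hyperbola_def
proof (rule csqrt_unique)
  have "cnj (csqrt (Complex bt xi)) ^ 2 = cnj ((csqrt (Complex bt xi))^2)" by (simp only: complex_cnj_power)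
  then show "cnj (csqrt (Complex bt xi)) ^ 2 = Complex bt (-xi)" by (simp add: complex_eq_iff)
  show "0 < Re (cnj (csqrt (Complex bt xi))) \<or> Re (cnj (csqrt (Complex bt xi))) = 0 \<and> 0 <= Im (cnj (csqrt (Complex bt xi)))"
    using hyperbola_Re_pos[of xi] by (simp add: hyperbola_def)
qed

lemma continuous_on_hyperbola: "continuous_on A (hyperbola bt)" unfolding hyperbola_def[abs_def]
  by (rule continuous_on_compose2[OF continuous_on_csqrt])
  (auto intro!: continuous_on_Complex continuous_intros simp: nonpos_Reals_Complex[OF bt])

lemma hyperbola_deriv: "(hyperbola bt has_vector_derivative \<i>/(2*hyperbola bt xi)) (at xi)"
proof -
  have "((%v. Complex bt v) has_vector_derivative \<i>) (at xi)" unfolding Complex_eq by (auto intro!: derivative_eq_intros)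
  from field_vector_diff_chain_at[OF this has_field_derivative_csqrt[OF nonpos_Reals_Complex[OF bt]]]
  have "(csqrt \<circ> (%v. Complex bt v) has_vector_derivative \<i>*inverse (2*csqrt (Complex bt xi))) (at xi)" .
  moreover have "csqrt \<circ> (%v. Complex bt v) = hyperbola bt" by (rule ext) (simp only: o_def hyperbola_def)
  ultimately show ?thesis by (simp only: hyperbola_def divide_inverse)
qed

lemma norm_airy_integrand_hyperbola:
  "norm (airy_integrand ta X (hyperbola bt xi)) = exp (-ta*bt + Re (hyperbola bt xi)*(bt - X) - 2/3*Re (hyperbola bt xi) ^ 3)"
proof -
  define r V where "r = Re (hyperbola bt xi)" and "V = Im (hyperbola bt xi)"
  have V: "V^2 = r^2 - bt" using hyperbola_Re_Im(1)[of xi] by (simp add: r_def V_def)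
  have "norm (airy_integrand ta X (hyperbola bt xi)) = norm (airy_integrand ta X (Complex r V))" by (simp add: r_def V_def)
  also have "... = exp ((r ^ 3/3 - ta*r^2 - r*X) + (-(r - ta)*(r^2 - bt)))" unfolding norm_airy_integrand V exp_add ..
  also have "(r ^ 3/3 - ta*r^2 - r*X) + (-(r - ta)*(r^2 - bt)) = - ta*bt + r*(bt - X) - 2/3*r ^ 3"
    by (simp add: field_simps power2_eq_square power3_eq_cube)
  finally show ?thesis by (simp add: r_def)
qed

lemma cubic_bounded_above: "\<exists>B. \<forall>r\<ge>0. m*r + K*r^2 - 2/3*r ^ 3 <= (B::real)"
proof -
  define R where "R = max 1 (2*(abs m + abs K))"
  have R: "1 <= R" "2*(abs m + abs K) <= R" by (auto simp: R_def)
  show ?thesis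
  proof (intro exI[of _ "(abs m + abs K)*R^2"] allI impI)
    fix r :: real assume r: "0 <= r"
    show "m*r + K*r^2 - 2/3*r ^ 3 <= (abs m + abs K)*R^2"
    proof (cases "r <= R")
      case True
      have "r <= R^2" using True R(1) mult_mono[of r R 1 R] r by (simp add: power2_eq_square)
      moreover have "r^2 <= R^2" using True r by (intro power_mono)
      ultimately have "m*r <= abs m*R^2" "K*r^2 <= abs K*R^2" using r by (auto intro!: mult_mono)
      moreover have "0 <= r ^ 3" using r by simp
      ultimately show ?thesis unfolding distrib_right by linarith
    next
      case False
      then have rR: "R <= r" "1 <= r" using R by auto
      have "r <= r^2" using rR by (simp add: power2_eq_square)
      then have "m*r <= abs m*r^2" "K*r^2 <= abs K*r^2" using rR by (intro mult_mono; simp)+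
      then have "m*r + K*r^2 <= (abs m + abs K)*r^2" by (simp add: distrib_right)
      also have "... <= (r/2)*r^2" using rR R by (intro mult_right_mono) auto
      also have "... <= 2/3*r ^ 3" using rR by (simp add: power2_eq_square power3_eq_cube)
      finally have "m*r + K*r^2 - 2/3*r ^ 3 <= 0" by simp
      also have "0 <= (abs m + abs K)*R^2" by simp
      finally show ?thesis .
    qed
  qed
qed

lemma hyperbola_cubic_integrable:
  "Leb1 (%xi. exp (m*Re (hyperbola bt xi) + K*(Re (hyperbola bt xi))^2 - 2/3*Re (hyperbola bt xi) ^ 3))"
proof -
  obtain B where B: "!!r. 0 <= r ==> m*r + (K + 2)*r^2 - 2/3*r ^ 3 <= B" using cubic_bounded_above by blast
  show ?thesis
  proof (rule L1_bound)
    show "Leb1 (%xi. exp B*exp (-abs (xi::real)))" using has_bochner_integral_exp_abs[of 1] by (intro integrable_mult_right) (simp add: Leb_iff)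
    show "(%xi. exp (m*Re (hyperbola bt xi) + K*(Re (hyperbola bt xi))^2 - 2/3*Re (hyperbola bt xi) ^ 3)) \<in> bmeas lborel"
      using borel_measurable_continuous_onI[OF continuous_on_hyperbola[of UNIV]] by measurable
    show "AE xi in lborel. norm (exp (m*Re (hyperbola bt xi) + K*(Re (hyperbola bt xi))^2 - 2/3*Re (hyperbola bt xi) ^ 3)) <= norm (exp B*exp (-abs xi))"
    proof (intro AE_I2)
      fix xi
      have "m*Re (hyperbola bt xi) + K*(Re (hyperbola bt xi))^2 - 2/3*Re (hyperbola bt xi) ^ 3 <= B - abs xi"
        using B[of "Re (hyperbola bt xi)"] hyperbola_Re_pos[of xi] hyperbola_xi_le[of xi] by (simp add: algebra_simps)
      then show "norm (exp (m*Re (hyperbola bt xi) + K*(Re (hyperbola bt xi))^2 - 2/3*Re (hyperbola bt xi) ^ 3)) <= norm (exp B*exp (-abs xi))"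
        by (simp flip: exp_add)
    qed
  qed
qed

lemma airy_integrand_hyperbola_integrable: "Leb1 (%xi. airy_integrand ta X (hyperbola bt xi))"
proof (rule L1_bound)
  show "Leb1 (%xi. exp (-ta*bt)*exp ((bt - X)*Re (hyperbola bt xi) + 0*(Re (hyperbola bt xi))^2 - 2/3*Re (hyperbola bt xi) ^ 3))"
    by (intro integrable_mult_right hyperbola_cubic_integrable)
  show "(%xi. airy_integrand ta X (hyperbola bt xi)) \<in> bmeas lborel"
    using borel_measurable_continuous_onI[OF continuous_on_airy_integrand[OF continuous_on_hyperbola]] by simp
qed (simp add: norm_airy_integrand_hyperbola mult.commute flip: exp_add)

lemma airy_integrand_hyperbola_div_integrable: "Leb1 (%xi. airy_integrand ta X (hyperbola bt xi)/(2*hyperbola bt xi))"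
proof (rule L1_bound)
  show "Leb1 (%xi. airy_integrand ta X (hyperbola bt xi)/of_real (2 * sqrt bt))"
    by (intro integrable_divide airy_integrand_hyperbola_integrable)
  show "(%xi. airy_integrand ta X (hyperbola bt xi)/(2*hyperbola bt xi)) \<in> bmeas lborel"
    using borel_measurable_continuous_onI[OF continuous_on_airy_integrand[OF continuous_on_hyperbola]] borel_measurable_continuous_onI[OF continuous_on_hyperbola]
    by (intro borel_measurable_divide borel_measurable_times) auto
  show "AE xi in lborel. norm (airy_integrand ta X (hyperbola bt xi)/(2*hyperbola bt xi)) <= norm (airy_integrand ta X (hyperbola bt xi)/of_real (2 * sqrt bt))"
  proof (intro AE_I2)
    fix xi
    have "sqrt bt <= norm (hyperbola bt xi)" using hyperbola_Re_ge[of xi] complex_Re_le_cmod order_trans by blast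
    then show "norm (airy_integrand ta X (hyperbola bt xi)/(2*hyperbola bt xi)) <= norm (airy_integrand ta X (hyperbola bt xi)/of_real (2 * sqrt bt))"
      using bt unfolding norm_divide by (intro divide_left_mono) (auto simp: norm_mult hyperbola_nz)
  qed
qed

lemma primitive_hyperbola_limit:
  assumes Ph: "!!w. (Ph has_field_derivative airy_integrand ta X w) (at w)"
  shows "((%xi. Ph (hyperbola bt xi)/\<i> - Ph (hyperbola bt (-xi))/\<i>)
  \<longlongrightarrow> (LBINT xi. airy_integrand ta X (hyperbola bt xi)/(2*hyperbola bt xi))) at_top"
proof (rule primitive_line_limit)
  fix xi
  from field_vector_diff_chain_at[OF hyperbola_deriv Ph]
  have "((%xi. Ph (hyperbola bt xi)) has_vector_derivative \<i>/(2*hyperbola bt xi)*airy_integrand ta X (hyperbola bt xi)) (at xi)"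
    by (simp add: o_def)
  from has_vector_derivative_mult_right[OF this, of "- \<i>"]
  moreover have "- \<i>*(\<i>/(2*hyperbola bt xi)*z) = z/(2*hyperbola bt xi)" "z/\<i> = - \<i>*z" for z
    using hyperbola_nz[of xi] by (simp_all add: field_simps)
  ultimately show "((%xi. Ph (hyperbola bt xi)/\<i>) has_vector_derivative airy_integrand ta X (hyperbola bt xi)/(2*hyperbola bt xi)) (at xi)"
    by (simp only:)
qed (auto intro!: continuous_intros continuous_on_airy_integrand continuous_on_hyperbola airy_integrand_hyperbola_div_integrable
  simp: hyperbola_nz)

lemma hyperbola_Im_at_top: "filterlim (%xi. Im (hyperbola bt xi)) at_top at_top"
proof (rule filterlim_at_top_mono)
  show "filterlim (%xi. sqrt ((xi - bt)/2)) at_top at_top" by real_asymp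
  show "\<forall>\<^sub>F xi in at_top. sqrt ((xi - bt)/2) <= Im (hyperbola bt xi)" using eventually_gt_at_top[of 0]
  proof eventually_elim
    case (elim xi)
    have "0 < (2*Re (hyperbola bt xi))*Im (hyperbola bt xi)" using hyperbola_Re_Im(2)[of xi] elim by simp
    then have "0 < Im (hyperbola bt xi)" using hyperbola_Re_pos[of xi] by (simp only: zero_less_mult_iff) auto
    then show ?case using real_sqrt_le_mono[OF hyperbola_Im_ge[of xi]] elim by simp
  qed
qed

lemma norm_airy_integrand_inside_hyperbola:
  assumes t: "1 <= t" "3*abs ta <= t" "t^2 <= bt + V^2" and V: "6*(bt/3 - X) <= V^2"
  shows "norm (airy_integrand ta X (Complex t V)) <= exp (abs ta*bt - V\<^sup>2/6)"
proof -
  have "t ^ 3 = t*t^2" by (simp add: power3_eq_cube power2_eq_square)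
  also have "... <= t*(bt + V^2)" using t by (intro mult_left_mono) auto
  finally have cubic: "t ^ 3 <= t*bt + t*V^2" by (simp add: distrib_left)
  have quadratic: "ta*(V^2 - t^2) <= abs ta*bt + t*V^2/3"
  proof (cases "0 <= ta")
    case True
    have "ta*(V^2 - t^2) <= ta*V^2" using True by (intro mult_left_mono) auto
    also have "... <= (t/3)*V^2" using t by (intro mult_right_mono) auto
    finally show ?thesis using True bt by (simp add: add_increasing)
  next
    case False
    have "ta*(V^2 - t^2) = abs ta*(t^2 - V^2)" using False by (simp add: algebra_simps)
    also have "... <= abs ta*bt" using t by (intro mult_left_mono) auto
    finally show ?thesis using t by (simp add: add_increasing2)
  qed
  have combine: "x/3 - y - z + e <= (b + z)/3 - y - z + (h + z/3)" if "x <= b + z" "e <= h + z/3" for x y z e b h :: real using that by argo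
  have "(t ^ 3/3 - ta*t^2 - t*X) + (-(t - ta)*V^2) = t ^ 3/3 - t*X - t*V^2 + ta*(V^2 - t^2)" by (simp add: algebra_simps)
  also have "... <= (t*bt + t*V^2)/3 - t*X - t*V^2 + (abs ta*bt + t*V^2/3)" by (rule combine[OF cubic quadratic])
  also have "... = abs ta*bt + t*(bt/3 - X - V\<^sup>2/3)" by (simp add: field_simps)
  also have "t*(bt/3 - X - V\<^sup>2/3) <= t*(-V\<^sup>2/6)" using V t by (intro mult_left_mono) auto
  also have "t*(-V\<^sup>2/6) <= 1*(-V\<^sup>2/6)" using t by (intro mult_right_mono_neg) auto
  finally show ?thesis unfolding norm_airy_integrand exp_add[symmetric] by simp
qed

lemma airy_primitive_hyperbola_gap:
  assumes Ph: "!!w. (Ph has_field_derivative airy_integrand ta X w) (at w)"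
  and a: "1 <= a" "3*abs ta <= a" and V: "6*(bt/3 - X) <= V^2" "a <= abs V" and r: "0 <= r" "r^2 = bt + V^2"
  shows "norm (Ph (Complex r V) - Ph (Complex a V)) <= exp (abs ta*bt - V\<^sup>2/6)*(abs V + sqrt bt)"
proof -
  have V_le: "abs V <= r" by (rule power2_le_imp_le) (use r bt in auto)
  have r_le: "r <= abs V + sqrt bt" by (rule power2_le_imp_le) (use r bt in \<open>auto simp: power2_sum\<close>)
  have "norm (Ph (Complex r V) - Ph (Complex a V)) <= exp (abs ta*bt - V\<^sup>2/6)*(r - a)"
  proof (rule primitive_horizontal[OF Ph])
    fix t assume t: "t \<in> {a..r}"
    have "t^2 <= bt + V^2" using t r a by (metis atLeastAtMost_iff order_trans power_mono zero_le_one)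
    then show "norm (airy_integrand ta X (Complex t V)) <= exp (abs ta*bt - V\<^sup>2/6)"
      using t a V by (intro norm_airy_integrand_inside_hyperbola) auto
  qed (use V V_le in auto)
  also have "... <= exp (abs ta*bt - V\<^sup>2/6)*(abs V + sqrt bt)" using r_le a by (intro mult_left_mono) auto
  finally show ?thesis .
qed

lemma airy_hyperbola:
  "(LBINT xi. airy_integrand ta X (hyperbola bt xi)/(2*hyperbola bt xi)) = of_real (2*pi*airy_tilt ta X)"
proof -
  obtain Ph where Ph: "!!w. (Ph has_field_derivative airy_integrand ta X w) (at w)" using airy_integrand_primitive by blast
  define a where "a = 3*abs ta + 1"
  have a: "ta < a" "1 <= a" "3*abs ta <= a" by (auto simp: a_def)
  define P Q W where "P = (%v. Ph (Complex a v)/\<i>)" and "Q = (%xi. Ph (hyperbola bt xi)/\<i>)" and "W = (%xi. Im (hyperbola bt xi))"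
  note W = hyperbola_Im_at_top[folded W_def]
  have gap: "((%xi. (Q xi - Q (-xi)) - (P (W xi) - P (-W xi))) \<longlongrightarrow> 0) at_top"
  proof (rule Lim_null_comparison)
    have "\<forall>\<^sub>F V in at_top. 6*(bt/3 - X) <= V^2 \<and> a <= V" by (intro eventually_conj eventually_ge_at_top) real_asymp
    from eventually_compose_filterlim[OF this W]
    show "\<forall>\<^sub>F xi in at_top. norm ((Q xi - Q (-xi)) - (P (W xi) - P (-W xi))) <= 2*(exp (abs ta*bt - (W xi)\<^sup>2/6)*(abs (W xi) + sqrt bt))"
    proof eventually_elim
      case (elim xi)
      define r where "r = Re (hyperbola bt xi)"
      have upper: "hyperbola bt xi = Complex r (W xi)" unfolding r_def W_def by (rule complex_surj[symmetric])
      have lower: "hyperbola bt (-xi) = Complex r (-W xi)" unfolding hyperbola_minus upper by (rule complex_cnj)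
      have r: "0 <= r" "r^2 = bt + (W xi)^2" using hyperbola_Re_pos[of xi] hyperbola_Re_Im(1)[of xi] by (auto simp: r_def W_def)
      have "a <= abs (W xi)" using elim by linarith
      then show ?case
        using airy_primitive_hyperbola_gap[OF Ph a(2,3) _ _ r] airy_primitive_hyperbola_gap[OF Ph a(2,3), of "- W xi" r] r elim
        unfolding P_def Q_def upper lower by (intro order_trans[OF norm_primitive_gap]) simp
    qed
    have "((%V. 2*(exp (m - V\<^sup>2/6)*(abs V + s))) \<longlongrightarrow> 0) at_top" for m s :: real by real_asymp
    from filterlim_compose[OF this W]
    show "((%xi. 2*(exp (abs ta*bt - (W xi)\<^sup>2/6)*(abs (W xi) + sqrt bt))) \<longlongrightarrow> 0) at_top" .
  qed
  have "((%xi. P (W xi) - P (-W xi)) \<longlongrightarrow> of_real (2*pi*airy_tilt ta X)) at_top"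
    using filterlim_compose[OF primitive_vertical_limit[OF Ph a(1)] W] unfolding P_def airy_vertical[OF a(1)] .
  from tendsto_add[OF gap this]
  have "((%xi. Q xi - Q (-xi)) \<longlongrightarrow> of_real (2*pi*airy_tilt ta X)) at_top" by (simp only: diff_add_cancel add_0)
  with primitive_hyperbola_limit[OF Ph] show ?thesis unfolding Q_def using tendsto_unique[OF trivial_limit_at_top_linorder] by blast
qed

end

section \<open>Heat kernel and first-passage density\<close>

definition heat :: "real => real => real" where
  "heat t x = exp (-x\<^sup>2/(4*t))/sqrt (4*pi*t)"

lemma heat_eq_normal: "0 < t ==> heat t x = normal_density 0 (sqrt (2*t)) x" by (simp add: heat_def normal_density_def)

lemma heat_nonneg [simp]: "0 <= heat t x" if "0 <= t" using that by (simp add: heat_def)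

lemma heat_minus: "heat t (-x) = heat t x" by (simp add: heat_def)

lemma heat_minus_commute: "heat t (x - y) = heat t (y - x)" using heat_minus[of t "x - y"] by simp

lemma heat_measurable [measurable]:
  assumes "f \<in> bmeas N" "h \<in> bmeas N"
  shows "(%x. heat (f x) (h x)) \<in> bmeas N" unfolding heat_def using assms by measurable

lemma heat_le: "0 < t ==> heat t x <= 1/sqrt (4*pi*t)" unfolding heat_def by (intro divide_right_mono) auto

lemma heat_tilt: "0 < t ==> heat t v * exp (b * v) = exp (t*b^2)*heat t (v - 2*t*b)"
proof -
  assume t: "0 < t"
  have "- v\<^sup>2/(4*t) + b * v = t*b^2 + (-(v - 2*t*b)\<^sup>2/(4*t))" using t by (simp add: field_simps power2_eq_square)
  then show ?thesis unfolding heat_def by (simp flip: exp_add)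
qed

lemma heat_has_integral: "0 < t ==> Leb_has (heat t) 1"
proof -
  assume t: "0 < t"
  then have "heat t = normal_density 0 (sqrt (2*t))" by (simp add: fun_eq_iff heat_eq_normal)
  then show ?thesis using t by (simp add: Leb_iff)
qed

lemma heat_mgf:
  assumes t: "0 < t"
  shows "Leb_has (%v. heat t (v - z)*exp (b * v)) (exp (b*z + t*b^2))"
proof -
  have shift: "Leb_has (%v. heat t ((-z - 2*t*b) + 1 * v)) (1 /\<^sub>R abs 1)"
    by (rule lborel_has_bochner_integral_real_affine_iff[THEN iffD1, OF _ heat_has_integral[OF t]]) simp
  have "Leb_has (%v. exp (b*z + t*b^2)*heat t ((-z - 2*t*b) + 1 * v)) (exp (b*z + t*b^2)*1)"
    by (intro has_bochner_integral_mult_right) (use shift in simp)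
  moreover have "exp (b*z + t*b^2)*heat t ((-z - 2*t*b) + 1 * v) = heat t (v - z)*exp (b * v)" for v
  proof -
    have "heat t (v - z)*exp (b * v) = heat t (v - z)*exp (b*(v - z))*exp (b*z)" by (simp add: right_diff_distrib mult.assoc flip: exp_add)
    also have "... = exp (t*b^2)*heat t (v - z - 2*t*b)*exp (b*z)" unfolding heat_tilt[OF t] ..
    finally show ?thesis by (simp add: exp_add algebra_simps)
  qed
  ultimately show ?thesis by simp
qed

lemma heat_integral_shift: "0 < t ==> Leb_has (%v. heat t (v - z)) 1" using heat_mgf[of t z 0] by simp

lemma heat_semigroup:
  assumes "0 < s" "0 < t"
  shows "Leb_has (%y. heat s (x - y)*heat t (y - z)) (heat (s + t) (x - z))"
proof (rule has_bochner_integral_nn_integral)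
  have "(%x. \<integral>\<^sup>+y. ennreal (normal_density 0 (sqrt (2 * s)) (x - y)*normal_density 0 (sqrt (2*t)) y) \<partial>lborel)
    = normal_density 0 (sqrt ((sqrt (2 * s))^2 + (sqrt (2*t))^2))" using assms by (intro conv_normal_density_zero_mean) auto
  then have "(\<integral>\<^sup>+y. ennreal (heat s (x - z - y)*heat t y) \<partial>lborel) = ennreal (heat (s + t) (x - z))"
    using assms by (simp add: heat_eq_normal fun_eq_iff distrib_left)
  also have "(\<integral>\<^sup>+y. ennreal (heat s (x - z - y)*heat t y) \<partial>lborel) = (\<integral>\<^sup>+y. ennreal (heat s (x - z - (-z + 1*y))*heat t (-z + 1*y)) \<partial>lborel)"
    by (subst nn_integral_real_affine[where c=1 and t="-z"]) auto
  finally show "(\<integral>\<^sup>+y. ennreal (heat s (x - y)*heat t (y - z)) \<partial>lborel) = ennreal (heat (s + t) (x - z))" by simp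
qed (use assms in auto)

lemma heat_iexp_integral:
  assumes t: "0 < t"
  shows "(LBINT v. of_real (heat t v)*iexp (b * v)) = of_real (exp (-t*b^2))"
proof -
  define s where "s = sqrt (2*t)"
  have s: "0 < s" "s^2 = 2*t" using t by (auto simp: s_def)
  have "char std_normal_distribution (s*b) = (LBINT x. std_normal_density x *\<^sub>R iexp (s*b*x))"
    unfolding char_def by (subst integral_density) auto
  also have "... = (LBINT x. of_real (s*heat t (s*x))*iexp (b*(s*x)))"
  proof (intro LINT_cong refl)
    fix x
    have "std_normal_density x = s*heat t (s*x)" using t s unfolding heat_def normal_density_def
      by (simp add: power_mult_distrib field_simps s_def real_sqrt_mult)
    then show "std_normal_density x *\<^sub>R iexp (s*b*x) = of_real (s*heat t (s*x))*iexp (b*(s*x))"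
      by (simp add: scaleR_conv_of_real mult_ac)
  qed
  also have "... = (LBINT v. of_real (heat t v)*iexp (b * v))"
    using lborel_integral_real_affine[of s "%v. of_real (heat t v)*iexp (b * v)" 0] s by (simp add: scaleR_conv_of_real mult_ac)
  finally show ?thesis unfolding char_std_normal_distribution using s by (simp add: power_mult_distrib)
qed

lemma heat_char_integrable:
  fixes w :: complex
  assumes t: "0 < t"
  shows "Leb1 (%v. of_real (heat t v)*exp (w * of_real v))"
proof (rule L1_bound)
  show "Leb1 (%v. heat t v * exp (Re w * v))" using heat_mgf[OF t, of 0 "Re w"] by (simp add: Leb_iff)
qed (use t in \<open>auto simp: norm_mult\<close>)

lemma heat_char:
  fixes w :: complex
  assumes t: "0 < t"
  shows "(LBINT v. of_real (heat t v)*exp (w * of_real v)) = exp (of_real t*w^2)"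
proof -
  define a b where "a = Re w" and "b = Im w"
  have w: "w = of_real a + \<i> * of_real b" by (simp add: a_def b_def complex_eq_iff)
  have tilt: "of_real (heat t v)*exp (w * of_real v) = of_real (exp (t*a^2))*(of_real (heat t (v - 2*t*a))*iexp (b * v))" for v
  proof -
    have "w * of_real v = of_real (a * v) + \<i> * of_real (b * v)" unfolding w by (simp add: algebra_simps)
    then have "of_real (heat t v)*exp (w * of_real v) = of_real (heat t v * exp (a * v))*iexp (b * v)"
      by (simp add: exp_add flip: exp_of_real)
    then show ?thesis unfolding heat_tilt[OF t] by simp
  qed
  have "(LBINT v. of_real (heat t (v - 2*t*a))*iexp (b * v))
    = (LBINT v. iexp (2*t*a*b)*(of_real (heat t v)*iexp (b * v)))"
    by (subst lborel_integral_real_affine[where c=1 and t="2*t*a"]) (auto simp: distrib_left exp_add mult_ac)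
  also have "... = iexp (2*t*a*b) * of_real (exp (-t*b^2))" using heat_iexp_integral[OF t] by simp
  finally have "(LBINT v. of_real (heat t v)*exp (w * of_real v))
    = of_real (exp (t*a^2))*(iexp (2*t*a*b) * of_real (exp (-t*b^2)))" unfolding tilt by simp
  also have "... = exp (of_real t*w^2)" unfolding w exp_of_real[symmetric] exp_add[symmetric]
    by (rule arg_cong[of _ _ exp]) (simp add: power2_eq_square algebra_simps)
  finally show ?thesis .
qed

lemma mult_exp_neg_sq_le: "0 < t ==> abs v *exp (-v\<^sup>2/(8*t)) <= 2 * sqrt t" for v t :: real
proof -
  assume t: "0 < t"
  have "1 + v^2/(8*t) <= exp (v^2/(8*t))" by (rule exp_ge_add_one_self)
  moreover have "abs v/(2 * sqrt t) <= 1 + v^2/(8*t)"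
  proof -
    have "0 <= (abs v/(2 * sqrt t) - 1)^2" by simp
    then have "2*(abs v/(2 * sqrt t)) <= 1 + v^2/(4*t)" using t by (simp add: power2_diff power_divide power_mult_distrib)
    moreover have "v^2/(4*t) = 2*(v^2/(8*t))" by simp
    ultimately show ?thesis by linarith
  qed
  ultimately have "abs v/(2 * sqrt t) <= exp (v^2/(8*t))" by linarith
  then show ?thesis using t by (simp add: exp_minus field_simps)
qed

text \<open>The first-passage density at time \<open>t\<close> over distance \<open>v\<close>, odd in \<open>v\<close>.\<close>
definition passage :: "real => real => real" where "passage t v = v/t*heat t v"

lemma passage_measurable [measurable]:
  assumes "f \<in> bmeas N" "h \<in> bmeas N"
  shows "(%x. passage (f x) (h x)) \<in> bmeas N" unfolding passage_def using assms by measurable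

lemma passage_bound: "0 < t ==> abs (passage t v) <= exp (-v\<^sup>2/(8*t))/t"
proof -
  assume t: "0 < t"
  have "exp (-v\<^sup>2/(4*t)) = exp (-v\<^sup>2/(8*t))*exp (-v\<^sup>2/(8*t))" by (simp flip: exp_add)
  then have "abs (passage t v) = (abs v *exp (-v\<^sup>2/(8*t)))*exp (-v\<^sup>2/(8*t))/(t * sqrt (4*pi*t))"
    using t by (simp add: passage_def heat_def abs_mult)
  also have "... <= (2 * sqrt t)*exp (-v\<^sup>2/(8*t))/(t * sqrt (4*pi*t))"
    using t by (intro divide_right_mono mult_right_mono mult_exp_neg_sq_le) auto
  also have "... = exp (-v\<^sup>2/(8*t))/t/sqrt pi" using t by (simp add: real_sqrt_mult field_simps)
  also have "... <= exp (-v\<^sup>2/(8*t))/t/1" using t pi_gt3 by (intro divide_left_mono) auto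
  finally show ?thesis by simp
qed

lemma passage_nonneg: "0 < t ==> 0 <= v ==> 0 <= passage t v" by (simp add: passage_def)

lemma passage_minus: "passage t (-v) = - passage t v" by (simp add: passage_def heat_minus)

lemma heat_deriv: "0 < t ==> (heat t has_real_derivative (-passage t v/2)) (at v)"
  unfolding heat_def[abs_def] passage_def heat_def by (auto intro!: derivative_eq_intros simp: field_simps)

lemma passage_halfline_integral: "0 < t ==> Leb_has (%v. ind {0..} v * passage t v) (1/sqrt (pi*t))"
proof (rule has_bochner_integral_nn_integral)
  assume t: "0 < t"
  have "(\<integral>\<^sup>+v. ennreal (passage t v)*ind {0..} v \<partial>lborel) = ennreal (0 - (-2*heat t 0))"
  proof (rule nn_integral_FTC_atLeast)
    show "((%v. - 2*heat t v) has_field_derivative passage t v) (at v)" for v by (auto intro!: derivative_eq_intros heat_deriv[OF t])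
    show "((%v. - 2*heat t v) \<longlongrightarrow> 0) at_top" unfolding heat_def using t by real_asymp
  qed (use t in \<open>auto simp: passage_nonneg\<close>)
  moreover have "2*heat t 0 = 1/sqrt (pi*t)" using t by (simp add: heat_def real_sqrt_mult)
  moreover have "ennreal (ind {0..} v * passage t v) = ennreal (passage t v)*ind {0..} v" for v by (auto simp: indicator_def)
  ultimately show "(\<integral>\<^sup>+v. ennreal (ind {0..} v * passage t v) \<partial>lborel) = ennreal (1/sqrt (pi*t))" by simp
qed (auto simp: passage_nonneg indicator_def)

lemma passage_char_integrable:
  fixes w :: complex
  assumes t: "0 < t"
  shows "Leb1 (%v. of_real (passage t v)*exp (w * of_real v))"
proof (rule L1_bound)
  show "Leb1 (%v. sqrt (8*pi*t)/t*(heat (2*t) (v - 0)*exp (Re w * v)))"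
    using heat_mgf[of "2*t" 0 "Re w"] t by (intro integrable_mult_right) (auto simp: Leb_iff)
  show "AE v in lborel. norm (of_real (passage t v)*exp (w * of_real v)) <= norm (sqrt (8*pi*t)/t*(heat (2*t) (v - 0)*exp (Re w * v)))"
  proof (intro AE_I2)
    fix v
    have "sqrt (8*pi*t)/t*heat (2*t) v = exp (-v\<^sup>2/(8*t))/t" using t by (simp add: heat_def mult.assoc)
    then show "norm (of_real (passage t v)*exp (w * of_real v)) <= norm (sqrt (8*pi*t)/t*(heat (2*t) (v - 0)*exp (Re w * v)))"
      using mult_right_mono[OF passage_bound[OF t, of v], of "exp (Re w * v)"] t by (simp add: norm_mult mult.assoc[symmetric] abs_mult)
  qed
qed simp

lemma passage_char:
  fixes w :: complex
  assumes t: "0 < t"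
  shows "(LBINT v. of_real (passage t v)*exp (w * of_real v)) = 2*w*exp (of_real t*w^2)"
proof -
  define P where "P = (%v. of_real (heat t v)*exp (w * of_real v))"
  define f where "f = (%v. w*(of_real (heat t v)*exp (w * of_real v)) - of_real (passage t v)*exp (w * of_real v)/2)"
  have "((%V. P V - P (-V)) \<longlongrightarrow> (LBINT v. f v)) at_top"
  proof (rule primitive_line_limit)
    fix v
    have heat_deriv_complex: "((%v. of_real (heat t v) :: complex) has_vector_derivative of_real (-passage t v/2)) (at v)"
      using heat_deriv[OF t, of v] by (intro has_vector_derivative_of_real) (simp add: has_real_derivative_iff_has_vector_derivative)
    have "((%v. w * of_real v) has_vector_derivative w * of_real 1) (at v)"
      by (intro has_vector_derivative_mult_right has_vector_derivative_of_real DERIV_ident)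
    from field_vector_diff_chain_at[OF this DERIV_exp]
    have exp_deriv: "((%v. exp (w * of_real v)) has_vector_derivative w*exp (w * of_real v)) (at v)" by (simp add: o_def)
    show "(P has_vector_derivative f v) (at v)"
      unfolding P_def f_def using has_vector_derivative_mult[OF heat_deriv_complex exp_deriv] by (simp add: algebra_simps)
    show "continuous_on UNIV f" unfolding f_def passage_def heat_def using t by (intro continuous_intros) auto
    show "Leb1 f" unfolding f_def using heat_char_integrable[OF t] passage_char_integrable[OF t] by auto
  qed
  moreover have "((%V. P V - P (-V)) \<longlongrightarrow> 0) at_top"
  proof (rule Lim_null_comparison)
    show "\<forall>\<^sub>F V in at_top. norm (P V - P (-V)) <= heat t V*exp (Re w*V) + heat t V*exp (-Re w*V)"
      using t by (intro always_eventually allI order_trans[OF norm_triangle_ineq4]) (simp add: P_def norm_mult heat_minus)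
    have lim: "((%V. exp (-V\<^sup>2/(4*t))/sqrt (4*pi*t)*exp (b*V)) \<longlongrightarrow> 0) at_top" for b
    proof -
      have "((%V. exp (-V\<^sup>2/(4*t) + b*V)) \<longlongrightarrow> 0) at_top" using t by real_asymp
      from tendsto_mult_right_zero[OF this, of "1/sqrt (4*pi*t)"]
      have "((%V. 1/sqrt (4*pi*t)*exp (-V\<^sup>2/(4*t) + b*V)) \<longlongrightarrow> 0) at_top" .
      moreover have "(%V. 1/sqrt (4*pi*t)*exp (-V\<^sup>2/(4*t) + b*V)) = (%V. exp (-V\<^sup>2/(4*t))/sqrt (4*pi*t)*exp (b*V))"
        unfolding exp_add by simp
      ultimately show ?thesis by (simp only:)
    qed
    show "((%V. heat t V*exp (Re w*V) + heat t V*exp (-Re w*V)) \<longlongrightarrow> 0) at_top"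
      unfolding heat_def using tendsto_add[OF lim[of "Re w"] lim[of "- Re w"]] by simp
  qed
  ultimately have "(LBINT v. f v) = 0" using tendsto_unique trivial_limit_at_top_linorder by blast
  then show ?thesis unfolding f_def using heat_char[OF t, of w] heat_char_integrable[OF t, of w] passage_char_integrable[OF t, of w] by (simp add: mult_ac)
qed

section \<open>Semigroup identities and bounds\<close>

lemma airy_integrand_shift: "airy_integrand ta (X + y) w = airy_integrand ta X w*exp (-w * of_real y)"
  unfolding airy_integrand_def by (simp add: algebra_simps flip: exp_add)

lemma airy_tilt_vert_bound:
  assumes a: "ta < a"
  shows "abs (airy_tilt ta X) <= exp (a ^ 3/3 - ta*a^2 - a*X) * sqrt (pi/(a - ta))/(2*pi)"
proof -
  have "2*pi*abs (airy_tilt ta X) = norm (LBINT v. airy_integrand ta X (Complex a v))"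
    unfolding airy_vertical[OF a] norm_of_real by (simp add: abs_mult)
  also have "... <= (LBINT v. norm (airy_integrand ta X (Complex a v)))" by (rule integral_norm_bound)
  also have "... = exp (a ^ 3/3 - ta*a^2 - a*X) * sqrt (pi/(a - ta))"
  proof -
    have "(LBINT v. exp (-(a - ta) * v^2)) = sqrt (pi/(a - ta))" by (rule gauss_integral) (use a in simp)
    then show ?thesis unfolding norm_airy_integrand by (simp only: integral_mult_right_zero)
  qed
  finally show ?thesis by (simp add: field_simps)
qed

lemma heat_char_shift:
  fixes w :: complex
  assumes t: "0 < t"
  shows "(LBINT v. of_real (heat t (v - z))*exp (w * of_real v)) = exp (w * of_real z + of_real t*w^2)"
proof -
  have "(LBINT v. of_real (heat t (v - z))*exp (w * of_real v)) = (LBINT v. exp (w * of_real z)*(of_real (heat t v)*exp (w * of_real v)))"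
    by (subst lborel_integral_real_affine[where c=1 and t=z]) (auto simp: distrib_left exp_add mult_ac)
  then show ?thesis using heat_char[OF t, of w] by (simp add: exp_add)
qed

lemma airy_integrand_measurable [measurable]:
  assumes "f \<in> bmeas N" "h \<in> bmeas N" "w \<in> bmeas N"
  shows "(%x. airy_integrand (f x) (h x) (w x)) \<in> bmeas N" unfolding airy_integrand_def using assms by measurable

lemma Complex_measurable [measurable]:
  assumes "f \<in> bmeas N" "h \<in> bmeas N"
  shows "(%x. Complex (f x) (h x)) \<in> bmeas N" unfolding Complex_eq using assms by measurable

lemma hyperbola_measurable [measurable]:
  assumes bt: "0 < bt" and f: "f \<in> bmeas N"
  shows "(%x. hyperbola bt (f x)) \<in> bmeas N"
  using measurable_compose[OF f borel_measurable_continuous_onI[OF continuous_on_hyperbola[OF bt]]] .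

lemma airy_tilt_semigroup:
  assumes t: "0 < t"
  shows "(LBINT y. airy_tilt ta (x + y)*heat t (y - z)) = airy_tilt (ta - t) (x + z)"
  and "Leb1 (%y. airy_tilt ta (x + y)*heat t (y - z))"
proof -
  define a where "a = ta + 1"
  have a: "ta < a" "ta - t < a" using t by (auto simp: a_def)
  define f where "f = (%y v. of_real (heat t (y - z))*airy_integrand ta (x + y) (Complex a v))"
  have meas: "(%p. f (fst p) (snd p)) \<in> bmeas (lborel \<Otimes>\<^sub>M lborel)" unfolding f_def by measurable
  have bound: "norm (f y v) <= (heat t (y - z)*exp (-a*y))*norm (airy_integrand ta x (Complex a v))" for y v
    unfolding f_def airy_integrand_shift using t by (simp add: norm_mult)
  have int_y: "Leb1 (%y. heat t (y - z)*exp (-a*y))" using heat_mgf[OF t, of z "- a"] by (simp add: Leb_iff)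
  have int_v: "Leb1 (%v. norm (airy_integrand ta x (Complex a v)))" using airy_integrand_vertical_integrable[OF a(1)] by simp
  note Fubini = Fubini_dominated[OF sigma_finite_lborel sigma_finite_lborel meas bound int_y int_v]
  have inner_v: "(LBINT v. f y v) = of_real (2*pi*(airy_tilt ta (x + y)*heat t (y - z)))" for y
    unfolding f_def using airy_vertical[OF a(1), of "x + y"] by (simp add: mult_ac)
  have inner_y: "(LBINT y. f y v) = airy_integrand (ta - t) (x + z) (Complex a v)" for v
  proof -
    let ?w = "Complex a v"
    have "(LBINT y. f y v) = (LBINT y. airy_integrand ta x ?w*(of_real (heat t (y - z))*exp ((- ?w) * of_real y)))"
      unfolding f_def airy_integrand_shift by (simp add: mult_ac)
    also have "... = airy_integrand ta x ?w*exp ((- ?w) * of_real z + of_real t*(- ?w)^2)" using heat_char_shift[OF t, of z "- ?w"] by simp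
    also have "... = airy_integrand (ta - t) (x + z) ?w" unfolding airy_integrand_def by (simp add: algebra_simps flip: exp_add)
    finally show ?thesis .
  qed
  have "of_real (2*pi*(LBINT y. airy_tilt ta (x + y)*heat t (y - z))) = (LBINT y. (LBINT v. f y v))"
    unfolding inner_v by (simp del: of_real_mult)
  also have "... = of_real (2*pi*airy_tilt (ta - t) (x + z))" unfolding Fubini(2) inner_y using airy_vertical[OF a(2)] .
  finally show "(LBINT y. airy_tilt ta (x + y)*heat t (y - z)) = airy_tilt (ta - t) (x + z)"
    by (simp only: of_real_eq_iff mult_cancel_left) simp
  have "Leb1 (%y. Re (of_real (2*pi*(airy_tilt ta (x + y)*heat t (y - z)))))" using integrable_Re[OF Fubini(3)] unfolding inner_v .
  then show "Leb1 (%y. airy_tilt ta (x + y)*heat t (y - z))" by (simp add: mult.assoc)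
qed

lemma norm_passage_airy_integrand:
  assumes s: "0 < s" and bt: "0 < bt"
  defines "r xi \<equiv> Re (hyperbola bt xi)"
  shows "norm (of_real (passage s v)*(airy_integrand ta (x + (-v)) (hyperbola bt xi)/(2*hyperbola bt xi)))
  <= (exp (-(1/(16 * s)) * v^2)/s)*(exp (-ta*bt)/(2 * sqrt bt)*exp ((bt - x)*r xi + (4 * s)*(r xi)^2 - 2/3*(r xi) ^ 3))"
proof -
  define R where "R = r xi"
  have "sqrt bt <= R" using hyperbola_Re_ge[OF bt] by (simp add: R_def r_def)
  then have norm_ge: "sqrt bt <= norm (hyperbola bt xi)" using complex_Re_le_cmod[of "hyperbola bt xi"] unfolding R_def r_def by linarith
  have "0 <= (v - 8 * s*R)^2/(16 * s)" using s by simp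
  then have "v * R <= v^2/(16 * s) + 4 * s*R^2" using s by (simp add: power2_eq_square field_simps)
  moreover have "R*(bt - (x + - v)) = (bt - x)*R + v * R" by (simp add: algebra_simps)
  moreover have "- v\<^sup>2/(8 * s) = - 2*(v^2/(16 * s))" "- (1/(16 * s)) * v^2 = - (v^2/(16 * s))" by simp_all
  ultimately have exponent: "- v\<^sup>2/(8 * s) + (-ta*bt + R*(bt - (x + - v)) - 2/3*R ^ 3)
    <= - (1/(16 * s)) * v^2 + (-ta*bt + ((bt - x)*R + (4 * s)*R^2 - 2/3*R ^ 3))" by simp
  have "norm (of_real (passage s v)*(airy_integrand ta (x + (-v)) (hyperbola bt xi)/(2*hyperbola bt xi)))
    = abs (passage s v)*exp (-ta*bt + R*(bt - (x + - v)) - 2/3*R ^ 3)/(2*norm (hyperbola bt xi))"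
    unfolding norm_mult norm_divide norm_airy_integrand_hyperbola[OF bt] R_def r_def by simp
  also have "... <= (exp (-v\<^sup>2/(8 * s))/s)*exp (-ta*bt + R*(bt - (x + - v)) - 2/3*R ^ 3)/(2 * sqrt bt)"
    using norm_ge bt s passage_bound[OF s, of v] by (intro frac_le mult_right_mono mult_nonneg_nonneg) auto
  also have "... = exp (-v\<^sup>2/(8 * s) + (-ta*bt + R*(bt - (x + - v)) - 2/3*R ^ 3))/s/(2 * sqrt bt)"
    unfolding exp_add[of "- v\<^sup>2/(8 * s)"] by simp
  also have "... <= exp (-(1/(16 * s)) * v^2 + (-ta*bt + ((bt - x)*R + (4 * s)*R^2 - 2/3*R ^ 3)))/s/(2 * sqrt bt)"
    using exponent s bt by (intro divide_right_mono) auto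
  finally show ?thesis unfolding R_def[symmetric] exp_add by simp
qed

lemma passage_airy_tilt_hyperbola:
  assumes s: "0 < s" and bt: "0 < bt"
  shows "of_real (2*pi*(LBINT v. passage s v * airy_tilt ta (x - v))) = (LBINT xi. airy_integrand (ta - s) x (hyperbola bt xi))"
  and "Leb1 (%v. passage s v * airy_tilt ta (x - v))"
proof -
  define f where "f = (%v xi. of_real (passage s v)*(airy_integrand ta (x + (-v)) (hyperbola bt xi)/(2*hyperbola bt xi)))"
  have [measurable]: "(%p. hyperbola bt (snd p)) \<in> bmeas (lborel \<Otimes>\<^sub>M (lborel :: real measure))"
    by (rule hyperbola_measurable[OF bt]) simp
  define b where "b = (%xi. exp (-ta*bt)/(2 * sqrt bt)*exp ((bt - x)*Re (hyperbola bt xi) + (4 * s)*(Re (hyperbola bt xi))^2 - 2/3*Re (hyperbola bt xi) ^ 3))"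
  have meas: "(%p. f (fst p) (snd p)) \<in> bmeas (lborel \<Otimes>\<^sub>M lborel)" unfolding f_def by measurable
  have bound: "norm (f v xi) <= exp (-(1/(16 * s)) * v^2)/s*b xi" for v xi
    unfolding f_def b_def by (rule norm_passage_airy_integrand[OF s bt])
  have "Leb1 (%v. exp (-(1/(16 * s)) * v^2)/s)" "Leb1 b"
    unfolding b_def using s by (intro integrable_divide gauss_integrable integrable_mult_right hyperbola_cubic_integrable bt; simp)+
  note Fubini = Fubini_dominated[OF sigma_finite_lborel sigma_finite_lborel meas bound this]
  have inner_xi: "(LBINT xi. f v xi) = of_real (2*pi*(passage s v * airy_tilt ta (x - v)))" for v
    unfolding f_def integral_mult_right_zero airy_hyperbola[OF bt] by simp
  have inner_v: "(LBINT v. f v xi) = airy_integrand (ta - s) x (hyperbola bt xi)" for xi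
  proof -
    let ?w = "hyperbola bt xi"
    have "(LBINT v. f v xi) = (LBINT v. airy_integrand ta x ?w/(2 * ?w)*(of_real (passage s v)*exp (?w * of_real v)))"
      unfolding f_def airy_integrand_shift by (simp add: mult_ac)
    also have "... = airy_integrand ta x ?w/(2 * ?w)*(2 * ?w*exp (of_real s * ?w^2))" using passage_char[OF s, of ?w] by simp
    also have "... = airy_integrand ta x ?w*exp (of_real s * ?w^2)" using hyperbola_nz[OF bt, of xi] by simp
    also have "... = airy_integrand (ta - s) x ?w" unfolding airy_integrand_def by (simp add: algebra_simps flip: exp_add)
    finally show ?thesis .
  qed
  have "of_real (2*pi*(LBINT v. passage s v * airy_tilt ta (x - v))) = (LBINT v. (LBINT xi. f v xi))"
    unfolding inner_xi by (simp del: of_real_mult)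
  also have "... = (LBINT xi. airy_integrand (ta - s) x (hyperbola bt xi))" unfolding Fubini(2) inner_v ..
  finally show "of_real (2*pi*(LBINT v. passage s v * airy_tilt ta (x - v))) = (LBINT xi. airy_integrand (ta - s) x (hyperbola bt xi))" .
  have "Leb1 (%v. Re (of_real (2*pi*(passage s v * airy_tilt ta (x - v)))))" using integrable_Re[OF Fubini(3)] unfolding inner_xi .
  then show "Leb1 (%v. passage s v * airy_tilt ta (x - v))" by (simp add: mult.assoc)
qed

definition airy_passage :: "real => real => real" where
  "airy_passage x t = (LBINT v. passage 1 v * airy_tilt (1 - t) (x - v))"

lemma airy_passage_hyperbola: "0 < bt ==> of_real (2*pi*airy_passage x t) = (LBINT xi. airy_integrand (-t) x (hyperbola bt xi))"
  unfolding airy_passage_def using passage_airy_tilt_hyperbola(1)[of 1 bt "1 - t" x] by simp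

lemma passage_airy_tilt_integral: "0 < s ==> (LBINT v. passage s v * airy_tilt ta (x - v)) = airy_passage x (s - ta)"
proof -
  assume s: "0 < s"
  have "of_real (2*pi*(LBINT v. passage s v * airy_tilt ta (x - v))) = (of_real (2*pi*airy_passage x (s - ta)) :: complex)"
    using passage_airy_tilt_hyperbola(1)[OF s, of 1 ta x] airy_passage_hyperbola[of 1 x "s - ta"] by simp
  then show ?thesis by (simp only: of_real_eq_iff mult_cancel_left) simp
qed

lemma norm_airy_integrand_hyperbola_le:
  assumes bt: "0 < bt" "bt <= 4" and X: "3 <= X"
  shows "norm (airy_integrand ta X (hyperbola bt xi))
  <= exp (-ta*bt - sqrt bt*(X - 3) - sqrt bt*(21/8 - bt/3))*exp (-(1/2)*abs xi)"
proof -
  define r V where "r = Re (hyperbola bt xi)" and "V = Im (hyperbola bt xi)"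
  have r: "sqrt bt <= r" "0 < r" using hyperbola_Re_ge[OF bt(1)] hyperbola_Re_pos[OF bt(1)] by (auto simp: r_def)
  have "abs xi = abs (2*r*V)" using hyperbola_Re_Im(2)[OF bt(1), of xi] by (simp add: r_def V_def)
  then have V: "V^2 = r^2 - bt" "abs xi = 2*(r*abs V)" using hyperbola_Re_Im(1)[OF bt(1), of xi] r by (auto simp: r_def V_def abs_mult)
  have "0 <= 2/3*(abs V - 3/4)^2" by simp
  then have "abs V <= 2/3*V^2 + 3/8" by (simp add: power2_eq_square algebra_simps)
  then have "r*abs V <= r*(2/3*(r^2 - bt) + 3/8)" using r V by (intro mult_left_mono) auto
  also have "... = 2/3*r ^ 3 - 2/3*(r*bt) + 3/8*r" by (simp add: field_simps power2_eq_square power3_eq_cube)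
  finally have "r*(bt - 3) - 2/3*r ^ 3 + r*abs V <= r*(-(21/8 - bt/3))" by (simp add: algebra_simps)
  also have "... <= sqrt bt*(-(21/8 - bt/3))" using r bt by (intro mult_right_mono_neg) auto
  finally have "r*(bt - 3) - 2/3*r ^ 3 + r*abs V <= - (sqrt bt*(21/8 - bt/3))" by (simp only: mult_minus_right)
  moreover have "- (r*(X - 3)) <= - (sqrt bt*(X - 3))" using r X by (simp add: mult_right_mono)
  moreover have "- ta*bt + r*(bt - X) - 2/3*r ^ 3 = - ta*bt + - (r*(X - 3)) + (r*(bt - 3) - 2/3*r ^ 3)" by (simp add: algebra_simps)
  ultimately have "- ta*bt + r*(bt - X) - 2/3*r ^ 3 <= (-ta*bt - sqrt bt*(X - 3) - sqrt bt*(21/8 - bt/3)) + - (1/2)*abs xi"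
    unfolding V(2) by linarith
  then show ?thesis unfolding norm_airy_integrand_hyperbola[OF bt(1)] r_def[symmetric] exp_add[symmetric] by simp
qed

lemma hyperbola_norm_integral:
  assumes bt: "0 < bt" "bt <= 4" and X: "3 <= X"
  shows "(LBINT xi. norm (airy_integrand ta X (hyperbola bt xi))) <= 4*exp (-ta*bt - sqrt bt*(X - 3) - sqrt bt*(21/8 - bt/3))"
proof -
  define E where "E = - ta*bt - sqrt bt*(X - 3) - sqrt bt*(21/8 - bt/3)"
  have half: "Leb_has (%xi::real. exp (-(1/2)*abs xi)) 4" using has_bochner_integral_exp_abs[of "1/2"] by simp
  have "(LBINT xi. norm (airy_integrand ta X (hyperbola bt xi))) <= (LBINT xi. exp E*exp (-(1/2)*abs xi))"
    unfolding E_def using half by (intro integral_mono integrable_norm airy_integrand_hyperbola_integrable bt integrable_mult_right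
    norm_airy_integrand_hyperbola_le X) (auto simp: Leb_iff)
  also have "... = 4*exp E" using half by (simp add: Leb_iff)
  finally show ?thesis unfolding E_def .
qed

lemma hyperbola_norm_integral_14:
  assumes bt: "bt = 1 \<or> bt = 4" and X: "3 <= X"
  shows "(LBINT xi. norm (airy_integrand ta X (hyperbola bt xi)))/(2*pi) <= 1/8*exp (-ta*bt - sqrt bt*(X - 3))"
proof -
  have s: "sqrt 4 = (2::real)" by simp
  have bt': "0 < bt" "bt <= 4" "9/4 <= sqrt bt*(21/8 - bt/3)" using bt s by auto
  have "4*exp (-(sqrt bt*(21/8 - bt/3))) <= 4*exp (-(9/4))" using bt' by simp
  also have "... <= 1/8*6"
  proof -
    have "16/3 <= (1::real) + 9/4 + (9/4)^2/2" by (simp add: power2_eq_square)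
    also have "... <= exp (9/4)" by (rule exp_lower_Taylor_quadratic) simp
    finally show ?thesis by (simp add: exp_minus field_simps)
  qed
  also have "... <= 1/8*(2*pi)" using pi_gt3 by simp
  finally have numeric: "4*exp (-(sqrt bt*(21/8 - bt/3)))/(2*pi) <= 1/8" using pi_gt_zero by (simp add: field_simps)
  have "(LBINT xi. norm (airy_integrand ta X (hyperbola bt xi)))/(2*pi) <= 4*exp (-ta*bt - sqrt bt*(X - 3) - sqrt bt*(21/8 - bt/3))/(2*pi)"
    by (intro divide_right_mono hyperbola_norm_integral bt' X) auto
  also have "... = 4*exp (-(sqrt bt*(21/8 - bt/3)))/(2*pi)*exp (-ta*bt - sqrt bt*(X - 3))"
  proof -
    have "exp (p - B) = exp (-B)*exp p" for p B :: real by (simp flip: exp_add)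
    then show ?thesis by (simp only:) simp
  qed
  also have "... <= 1/8*exp (-ta*bt - sqrt bt*(X - 3))" by (rule mult_right_mono[OF numeric]) simp
  finally show ?thesis .
qed

lemma airy_passage_bound:
  assumes bt: "bt = 1 \<or> bt = 4" and X: "3 <= x"
  shows "abs (airy_passage x t) <= 1/8*exp (bt*t - sqrt bt*(x - 3))"
proof -
  have "2*pi*abs (airy_passage x t) = norm (LBINT xi. airy_integrand (-t) x (hyperbola bt xi))"
    using bt by (subst airy_passage_hyperbola[symmetric]) (auto simp: norm_mult abs_mult simp flip: of_real_mult)
  also have "... <= (LBINT xi. norm (airy_integrand (-t) x (hyperbola bt xi)))" by (rule integral_norm_bound)
  finally have "abs (airy_passage x t) <= (LBINT xi. norm (airy_integrand (-t) x (hyperbola bt xi)))/(2*pi)" by (simp add: field_simps)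
  also have "... <= 1/8*exp (-(-t)*bt - sqrt bt*(x - 3))" by (rule hyperbola_norm_integral_14[OF assms])
  finally show ?thesis by (simp add: mult.commute)
qed

lemma airy_tilt_bound:
  assumes X: "3 <= X"
  shows "abs (airy_tilt ta X) <= 1/32*exp (-4*ta - 2*(X - 3))"
proof -
  have p: "(0::real) < 4" by simp
  have "2*pi*abs (airy_tilt ta X) = norm (LBINT xi. airy_integrand ta X (hyperbola 4 xi)/(2*hyperbola 4 xi))"
    unfolding airy_hyperbola[OF p] norm_of_real by (simp add: abs_mult)
  also have "... <= (LBINT xi. norm (airy_integrand ta X (hyperbola 4 xi)/(2*hyperbola 4 xi)))" by (rule integral_norm_bound)
  also have "... <= (LBINT xi. norm (airy_integrand ta X (hyperbola 4 xi))/4)"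
  proof (intro integral_mono integrable_norm airy_integrand_hyperbola_div_integrable airy_integrand_hyperbola_integrable p integrable_divide)
    fix xi
    have "sqrt 4 <= norm (hyperbola 4 xi)" using hyperbola_Re_ge[OF p, of xi] complex_Re_le_cmod order_trans by blast
    then show "norm (airy_integrand ta X (hyperbola 4 xi)/(2*hyperbola 4 xi)) <= norm (airy_integrand ta X (hyperbola 4 xi))/4"
      unfolding norm_divide norm_mult by (intro divide_left_mono) auto
  qed
  finally have "abs (airy_tilt ta X) <= (LBINT xi. norm (airy_integrand ta X (hyperbola 4 xi)))/(2*pi)/4" by (simp add: field_simps)
  also have "... <= (1/8*exp (-ta*4 - sqrt 4*(X - 3)))/4" by (intro divide_right_mono hyperbola_norm_integral_14 X) auto
  finally show ?thesis by (simp add: algebra_simps)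
qed

lemma airy_tilt_0: "airy_tilt 0 x = Airy_Ai x" by (simp add: airy_tilt_def)

lemma norm_exp_quadratic_remainder:
  fixes h :: complex
  assumes d: "abs d <= 1" and h: "0 < Re h"
  shows "norm (exp (-h * of_real d) - (1 + (-h * of_real d))) <= exp (Re h)*(norm h ^ 2*d^2)"
proof -
  have "norm (exp (-h * of_real d) - (\<Sum>k\<le>1. (-h * of_real d) ^ k/fact k))
    <= exp (abs (Re (-h * of_real d)))*norm (-h * of_real d) ^ Suc 1/fact 1" by (rule Taylor_exp)
  also have "... <= exp (Re h)*norm (-h * of_real d) ^ Suc 1/fact 1"
    using d h mult_left_mono[of "abs d" 1 "Re h"] by (intro divide_right_mono mult_right_mono) (auto simp: abs_mult)
  finally show ?thesis by (simp add: norm_mult power_mult_distrib numeral_2_eq_2[symmetric])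
qed

lemma norm_airy_integrand_remainder:
  assumes d: "abs d <= 1"
  defines "h xi \<equiv> hyperbola 1 xi"
  shows "norm (airy_integrand 0 (x + d) (h xi)/(2*h xi) - airy_integrand 0 x (h xi)/(2*h xi) + of_real (d/2)*airy_integrand 0 x (h xi))
  <= d^2*exp ((3 - x)*Re (h xi) + 0*(Re (h xi))^2 - 2/3*Re (h xi) ^ 3)"
proof -
  define H r where "H = h xi" and "r = Re H"
  have r: "0 < r" "abs (Im H) <= r" using hyperbola_Re_pos[of 1 xi] hyperbola_Im_le[of 1 xi] by (auto simp: H_def h_def r_def)
  then have "H ~= 0" and "norm H <= 2*r" using cmod_le[of H] by (auto simp: r_def)
  then have H: "H ~= 0" "norm H/2 <= exp r" using exp_ge_add_one_self[of r] by linarith+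
  have "norm (airy_integrand 0 (x + d) H/(2*H) - airy_integrand 0 x H/(2*H) + of_real (d/2)*airy_integrand 0 x H)
    = norm (airy_integrand 0 x H/(2*H)*(exp (-H * of_real d) - (1 + (-H * of_real d))))"
    unfolding airy_integrand_shift using H by (intro arg_cong[of _ _ norm]) (simp add: field_simps)
  also have "... = norm (airy_integrand 0 x H)/(2*norm H)*norm (exp (-H * of_real d) - (1 + (-H * of_real d)))"
    unfolding norm_mult[of "airy_integrand 0 x H/(2*H)"] norm_divide norm_mult[of 2] by simp
  also have "... <= norm (airy_integrand 0 x H)/(2*norm H)*(exp r*(norm H ^ 2*d^2))"
    using norm_exp_quadratic_remainder[OF d, of H] r by (intro mult_left_mono) (auto simp: r_def)
  also have "... = d^2*(norm (airy_integrand 0 x H)*(norm H/2*exp r))" using H by (simp add: field_simps power2_eq_square)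
  also have "... <= d^2*(norm (airy_integrand 0 x H)*(exp r*exp r))" using H by (intro mult_left_mono mult_right_mono) auto
  also have "norm (airy_integrand 0 x H)*(exp r*exp r) = exp ((3 - x)*r + 0*r^2 - 2/3*r ^ 3)"
    using norm_airy_integrand_hyperbola[of 1 0 x xi] unfolding H_def h_def r_def by (simp add: algebra_simps flip: exp_add)
  finally show ?thesis unfolding r_def H_def .
qed

lemma Airy_Ai_has_derivative: "(Airy_Ai has_field_derivative (-airy_passage x 0/2)) (at x)"
proof (rule DERIV_quadratic_remainder)
  define b where "b = (%xi. exp ((3 - x)*Re (hyperbola 1 xi) + 0*(Re (hyperbola 1 xi))^2 - 2/3*Re (hyperbola 1 xi) ^ 3))"
  have b: "Leb1 b" unfolding b_def by (rule hyperbola_cubic_integrable) simp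
  fix d :: real assume d: "abs d <= 1"
  define f where "f = (%xi. airy_integrand 0 (x + d) (hyperbola 1 xi)/(2*hyperbola 1 xi)
    - airy_integrand 0 x (hyperbola 1 xi)/(2*hyperbola 1 xi) + of_real (d/2)*airy_integrand 0 x (hyperbola 1 xi))"
  have int: "Leb1 (%xi. airy_integrand 0 X (hyperbola 1 xi)/(2*hyperbola 1 xi))" "Leb1 (%xi. airy_integrand 0 X (hyperbola 1 xi))" for X
    by (simp_all add: airy_integrand_hyperbola_div_integrable airy_integrand_hyperbola_integrable)
  have "(LBINT xi. f xi) = of_real (2*pi*Airy_Ai (x + d)) - of_real (2*pi*Airy_Ai x) + of_real (d/2) * of_real (2*pi*airy_passage x 0)"
    unfolding f_def using airy_hyperbola[of 1 0] airy_passage_hyperbola[of 1 x 0] int by (simp add: airy_tilt_0)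
  also have "... = of_real (2*pi*(Airy_Ai (x + d) - Airy_Ai x - d*(-airy_passage x 0/2)))" by (simp add: algebra_simps)
  finally have "2*pi*abs (Airy_Ai (x + d) - Airy_Ai x - d*(-airy_passage x 0/2)) = norm (LBINT xi. f xi)"
    by (simp only: norm_of_real) (simp add: abs_mult)
  also have "... <= (LBINT xi. norm (f xi))" by (rule integral_norm_bound)
  also have "... <= (LBINT xi. d^2*b xi)"
  proof (intro integral_mono integrable_norm integrable_mult_right b)
    show "Leb1 f" unfolding f_def by (intro L1_add L1_diff integrable_mult_right int)
    show "norm (f xi) <= d^2*b xi" for xi unfolding f_def b_def by (rule norm_airy_integrand_remainder[OF d])
  qed
  also have "... = d^2*(LBINT xi. b xi)" by simp
  finally show "abs (Airy_Ai (x + d) - Airy_Ai x - d*(-airy_passage x 0/2)) <= ((LBINT xi. b xi)/(2*pi))*d^2" by (simp add: field_simps)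
qed

lemma continuous_on_Airy_Ai: "continuous_on A Airy_Ai" by (rule DERIV_continuous_on) (rule DERIV_subset[OF Airy_Ai_has_derivative], simp)

lemma airy_tilt_measurable [measurable]:
  assumes "f \<in> bmeas N" "h \<in> bmeas N"
  shows "(%x. airy_tilt (f x) (h x)) \<in> bmeas N"
proof -
  have [measurable]: "Airy_Ai \<in> bmeas borel" by (rule borel_measurable_continuous_onI[OF continuous_on_Airy_Ai])
  show ?thesis unfolding airy_tilt_def using assms by measurable
qed

lemma deriv_Airy_Ai: "deriv Airy_Ai x = - airy_passage x 0/2" by (rule DERIV_imp_deriv[OF Airy_Ai_has_derivative])

lemma airy1_kernel_eq:
  "airy1_kernel ti x tj y = airy_tilt (ti - tj) (x + y) - (if tj > ti then heat (tj - ti) (y - x) else 0)"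
proof -
  have "- (ti - tj)*(x + y) - 2/3*(ti - tj) ^ 3 = (tj - ti)*(x + y) + 2/3*(tj - ti) ^ 3" by (simp add: power3_eq_cube algebra_simps)
  moreover have "(ti - tj)^2 = (tj - ti)^2" by (simp add: power2_commute)
  ultimately show ?thesis unfolding airy1_kernel_def airy_tilt_def heat_def by (simp add: add.assoc)
qed

lemma weighted_measure_exp:
  assumes "p < a" "a < r"
  shows "weighted_measure lborel (%y. min (exp (p*y)) (exp (r*y))) (%y. exp (-a*y))"
proof unfold_locales
  show "Leb1 (%y. min (exp (p*y)) (exp (r*y))*exp (-a*y))"
  proof (rule L1_bound)
    show "Leb1 (%y. ind {0..} y*exp (-(a - p)*y) + ind {..0} y*exp ((r - a)*y))"
      using has_bochner_integral_exp_right[of "a - p" 0] has_bochner_integral_exp_left[of "r - a" 0] assms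
      by (intro L1_add) (auto simp: Leb_iff)
    show "AE y in lborel. norm (min (exp (p*y)) (exp (r*y))*exp (-a*y)) <= norm (ind {0..} y*exp (-(a - p)*y) + ind {..0} y*exp ((r - a)*y))"
    proof (intro AE_I2)
      fix y :: real
      define G where "G = min (exp (p*y)) (exp (r*y))*exp (-a*y)"
      have "G <= exp (p*y)*exp (-a*y)" "G <= exp (r*y)*exp (-a*y)" unfolding G_def by (intro mult_right_mono; simp)+
      then have "G <= exp (-(a - p)*y)" "G <= exp ((r - a)*y)" by (simp_all add: algebra_simps flip: exp_add)
      moreover have "0 <= G" by (simp add: G_def)
      ultimately show "norm (min (exp (p*y)) (exp (r*y))*exp (-a*y)) <= norm (ind {0..} y*exp (-(a - p)*y) + ind {..0} y*exp ((r - a)*y))"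
        unfolding G_def[symmetric] by (auto simp: indicator_def not_le)
    qed
  qed simp
qed auto

section \<open>The process on a finite grid\<close>

abbreviation grid_measure :: "(nat \<times> real) measure" where
  "grid_measure \<equiv> count_space UNIV \<Otimes>\<^sub>M lborel"

lemma pair_sigma_finite_grid: "pair_sigma_finite (count_space (UNIV :: nat set)) (lborel :: real measure)"
  by (simp add: pair_sigma_finite_def sigma_finite_lborel sigma_finite_measure_count_space_countable)

lemma sigma_finite_grid: "sigma_finite_measure grid_measure"
proof -
  interpret pair_sigma_finite "count_space (UNIV :: nat set)" "lborel :: real measure" by (rule pair_sigma_finite_grid)
  show ?thesis by unfold_locales
qed

lemma nn_integral_grid:
  assumes F: "F \<in> bmeas grid_measure" and vanish: "!!i x. m <= i ==> F (i, x) = 0"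
  shows "(\<integral>\<^sup>+p. F p \<partial>grid_measure) = (\<Sum>i<m. \<integral>\<^sup>+x. F (i, x) \<partial>lborel)"
proof -
  have "(\<integral>\<^sup>+p. F p \<partial>grid_measure) = (\<integral>\<^sup>+i. (\<integral>\<^sup>+x. F (i, x) \<partial>lborel) \<partial>count_space UNIV)"
    by (rule lborel.nn_integral_fst[OF F, symmetric])
  also have "... = (\<Sum>i<m. \<integral>\<^sup>+x. F (i, x) \<partial>lborel)"
    by (rule nn_integral_count_space') (use vanish in \<open>auto simp: not_less\<close>)
  finally show ?thesis .
qed

lemma integral_grid:
  fixes F :: "nat \<times> real => real"
  assumes F: "integrable grid_measure F" and vanish: "!!i x. m <= i ==> F (i, x) = 0"
  shows "(\<integral>p. F p \<partial>grid_measure) = (\<Sum>i<m. LBINT x. F (i, x))"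
proof -
  interpret pair_sigma_finite "count_space (UNIV :: nat set)" "lborel :: real measure" by (rule pair_sigma_finite_grid)
  have "(LBINT x. F (i, x)) = 0" if "m <= i" for i using vanish[OF that] by simp
  then have support: "{i \<in> UNIV. (LBINT x. F (i, x)) ~= 0} \<subseteq> {..<m}" using leI by blast
  have "(\<integral>p. F p \<partial>grid_measure) = (\<integral>i. (LBINT x. F (i, x)) \<partial>count_space UNIV)"
    by (rule integral_fst'[OF F, symmetric])
  also have "... = (\<Sum>i | i \<in> UNIV \<and> (LBINT x. F (i, x)) ~= 0. LBINT x. F (i, x))"
    by (rule lebesgue_integral_count_space_finite_support, rule finite_subset[OF support]) simp
  also have "... = (\<Sum>i<m. LBINT x. F (i, x))" by (rule sum.mono_neutral_left) (use support in auto)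
  finally show ?thesis .
qed

context
  fixes F :: "(nat => nat \<times> real) => ennreal" and I :: "nat set" and j :: nat
  assumes I: "finite I" "j \<notin> I" and F: "F \<in> bmeas (Pi\<^sub>M (insert j I) (%_. grid_measure))"
begin

lemma nn_integral_grid_coordinate_measurable:
  "(%z. \<integral>\<^sup>+x. F (z(j := (k, x))) \<partial>lborel) \<in> bmeas (Pi\<^sub>M I (%_. grid_measure))"
proof -
  have update: "(%(z, p). F (z(j := p))) \<in> bmeas (Pi\<^sub>M I (%_. grid_measure) \<Otimes>\<^sub>M grid_measure)"
    using measurable_compose[OF measurable_add_dim F] by (simp add: case_prod_beta' fun_upd_def)
  have "(%(z, x). (z, (k, x))) \<in> measurable (Pi\<^sub>M I (%_. grid_measure) \<Otimes>\<^sub>M lborel) (Pi\<^sub>M I (%_. grid_measure) \<Otimes>\<^sub>M grid_measure)"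
    by measurable
  from measurable_compose[OF this update]
  have "(%(z, x). F (z(j := (k, x)))) \<in> bmeas (Pi\<^sub>M I (%_. grid_measure) \<Otimes>\<^sub>M lborel)" by (simp add: case_prod_beta')
  from lborel.borel_measurable_nn_integral[OF this] show ?thesis by simp
qed

lemma nn_integral_PiM_insert_grid:
  assumes vanish: "!!z. m <= fst (z j) ==> F z = 0"
  shows "(\<integral>\<^sup>+z. F z \<partial>Pi\<^sub>M (insert j I) (%_. grid_measure))
  = (\<Sum>k<m. \<integral>\<^sup>+z. (\<integral>\<^sup>+x. F (z(j := (k, x))) \<partial>lborel) \<partial>Pi\<^sub>M I (%_. grid_measure))"
proof -
  interpret P: product_sigma_finite "%_::nat. grid_measure" by (rule product_sigma_finite.intro) (rule sigma_finite_grid)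
  have "(\<integral>\<^sup>+z. F z \<partial>Pi\<^sub>M (insert j I) (%_. grid_measure))
    = (\<integral>\<^sup>+z. (\<integral>\<^sup>+p. F (z(j := p)) \<partial>grid_measure) \<partial>Pi\<^sub>M I (%_. grid_measure))"
    by (rule P.product_nn_integral_insert[OF I F])
  also have "... = (\<integral>\<^sup>+z. (\<Sum>k<m. \<integral>\<^sup>+x. F (z(j := (k, x))) \<partial>lborel) \<partial>Pi\<^sub>M I (%_. grid_measure))"
  proof (intro nn_integral_cong nn_integral_grid)
    fix z assume "z \<in> space (Pi\<^sub>M I (%_. grid_measure))"
    then show "(%p. F (z(j := p))) \<in> bmeas grid_measure" by (intro measurable_compose[OF measurable_component_update F] I)
  qed (simp add: vanish)
  also have "... = (\<Sum>k<m. \<integral>\<^sup>+z. (\<integral>\<^sup>+x. F (z(j := (k, x))) \<partial>lborel) \<partial>Pi\<^sub>M I (%_. grid_measure))"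
    by (rule nn_integral_sum[OF nn_integral_grid_coordinate_measurable])
  finally show ?thesis .
qed

end

lemma nn_integral_PiM_grid:
  fixes F :: "(nat => nat \<times> real) => ennreal"
  assumes I: "finite I" and F: "F \<in> bmeas (Pi\<^sub>M I (%_. grid_measure))"
  and vanish: "!!z. \<exists>i\<in>I. m <= fst (z i) ==> F z = 0"
  shows "(\<integral>\<^sup>+z. F z \<partial>Pi\<^sub>M I (%_. grid_measure))
  = (\<Sum>kp\<in>PiE I (%_. {..<m}). \<integral>\<^sup>+x. F (\<lambda>i\<in>I. (kp i, x i)) \<partial>Pi\<^sub>M I (%_. lborel))"
  using assms
proof (induction I arbitrary: F rule: finite_induct)
  case empty
  interpret P: product_sigma_finite "%_::nat. grid_measure" by (rule product_sigma_finite.intro) (rule sigma_finite_grid)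
  have "prob_space (Pi\<^sub>M {} (%_::nat. lborel :: real measure))" by (rule prob_space_PiM) simp
  then show ?case by (simp add: P.nn_integral_empty restrict_def prob_space.emeasure_space_1)
next
  case (insert j I)
  interpret product_sigma_finite "%_::nat. lborel :: real measure" by standard
  note F = insert.prems(1)
  have "(\<integral>\<^sup>+z. F z \<partial>Pi\<^sub>M (insert j I) (%_. grid_measure))
    = (\<Sum>k<m. \<integral>\<^sup>+z. (\<integral>\<^sup>+x. F (z(j := (k, x))) \<partial>lborel) \<partial>Pi\<^sub>M I (%_. grid_measure))"
    by (rule nn_integral_PiM_insert_grid[OF insert.hyps F]) (auto intro: insert.prems(2))
  also have "... = (\<Sum>k<m. \<Sum>kp\<in>PiE I (%_. {..<m}).
    \<integral>\<^sup>+x'. (\<integral>\<^sup>+x. F ((\<lambda>i\<in>I. (kp i, x' i))(j := (k, x))) \<partial>lborel) \<partial>Pi\<^sub>M I (%_. lborel))"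
  proof (intro sum.cong refl insert.IH nn_integral_grid_coordinate_measurable[OF insert.hyps F])
    fix k and z :: "nat => nat \<times> real" assume "\<exists>i\<in>I. m <= fst (z i)"
    then have "F (z(j := (k, x))) = 0" for x :: real using insert.hyps by (intro insert.prems(2)) force
    then show "(\<integral>\<^sup>+x. F (z(j := (k, x))) \<partial>lborel) = 0" by simp
  qed
  also have "... = (\<Sum>k<m. \<Sum>kp\<in>PiE I (%_. {..<m}). \<integral>\<^sup>+x. F (\<lambda>i\<in>insert j I. ((kp(j := k)) i, x i)) \<partial>Pi\<^sub>M (insert j I) (%_. lborel))"
  proof (intro sum.cong refl)
    fix k kp
    have measurable: "(%x. F (\<lambda>i\<in>insert j I. ((kp(j := k)) i, x i))) \<in> bmeas (Pi\<^sub>M (insert j I) (%_. lborel))"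
      by (rule measurable_compose[OF _ F]) measurable
    have "(\<lambda>i\<in>insert j I. ((kp(j := k)) i, (x'(j := x)) i)) = (\<lambda>i\<in>I. (kp i, x' i))(j := (k, x))" for x' :: "nat => real" and x
      using insert.hyps by (auto simp: fun_eq_iff)
    then show "(\<integral>\<^sup>+x'. (\<integral>\<^sup>+x. F ((\<lambda>i\<in>I. (kp i, x' i))(j := (k, x))) \<partial>lborel) \<partial>Pi\<^sub>M I (%_. lborel))
      = (\<integral>\<^sup>+x. F (\<lambda>i\<in>insert j I. ((kp(j := k)) i, x i)) \<partial>Pi\<^sub>M (insert j I) (%_. lborel))"
      unfolding product_nn_integral_insert[OF insert.hyps measurable] by simp
  qed
  also have "... = (\<Sum>kp\<in>PiE (insert j I) (%_. {..<m}). \<integral>\<^sup>+x. F (\<lambda>i\<in>insert j I. (kp i, x i)) \<partial>Pi\<^sub>M (insert j I) (%_. lborel))"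
    unfolding PiE_insert_eq sum.cartesian_product
    by (subst sum.reindex) (auto simp: case_prod_beta' intro!: inj_combinator[of j I "%_. {..<m}", unfolded case_prod_beta'] insert.hyps)
  finally show ?case .
qed

lemma integral_PiM_grid:
  fixes F :: "(nat => nat \<times> real) => real"
  assumes I: "finite I" and F: "integrable (Pi\<^sub>M I (%_. grid_measure)) F"
  and vanish: "!!z. \<exists>i\<in>I. m <= fst (z i) ==> F z = 0"
  shows "(\<integral>z. F z \<partial>Pi\<^sub>M I (%_. grid_measure))
  = (\<Sum>kp\<in>PiE I (%_. {..<m}). \<integral>x. F (\<lambda>i\<in>I. (kp i, x i)) \<partial>Pi\<^sub>M I (%_. lborel))"
proof -
  let ?M = "Pi\<^sub>M I (%_. grid_measure)" and ?N = "Pi\<^sub>M I (%_. lborel)" and ?K = "PiE I (%_. {..<m})"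
  define f where "f = (%kp x. F (\<lambda>i\<in>I. (kp i, x i)))"
  have f_meas: "f kp \<in> bmeas ?N" for kp unfolding f_def by (rule measurable_compose[OF _ borel_measurable_integrable[OF F]]) measurable
  have split: "(\<integral>\<^sup>+z. ennreal (u*F z) \<partial>?M) = (\<Sum>kp\<in>?K. \<integral>\<^sup>+x. ennreal (u*f kp x) \<partial>?N)" for u
    unfolding f_def by (rule nn_integral_PiM_grid[OF I]) (use F vanish in auto)
  have finite: "(\<integral>\<^sup>+x. ennreal (u*f kp x) \<partial>?N) < \<infinity>" if "kp \<in> ?K" for u kp
  proof -
    have "(\<integral>\<^sup>+x. ennreal (u*f kp x) \<partial>?N) <= (\<integral>\<^sup>+z. ennreal (u*F z) \<partial>?M)"
      unfolding split using I that by (intro member_le_sum finite_PiE) auto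
    also have "... < \<infinity>" using integrable_mult_right[OF F, of u, unfolded real_integrable_def] by (simp add: less_top)
    finally show ?thesis .
  qed
  have int: "integrable ?N (f kp)" if "kp \<in> ?K" for kp
    using f_meas finite[OF that, of 1] finite[OF that, of "-1"] by (auto simp: real_integrable_def)
  have "(\<integral>z. F z \<partial>?M) = enn2real (\<integral>\<^sup>+z. ennreal (1*F z) \<partial>?M) - enn2real (\<integral>\<^sup>+z. ennreal (-1*F z) \<partial>?M)"
    by (simp add: real_lebesgue_integral_def[OF F])
  also have "... = (\<Sum>kp\<in>?K. enn2real (\<integral>\<^sup>+x. ennreal (1*f kp x) \<partial>?N) - enn2real (\<integral>\<^sup>+x. ennreal (-1*f kp x) \<partial>?N))"
    unfolding split by (simp only: enn2real_sum[OF finite[unfolded infinity_ennreal_def]] o_def sum_subtractf)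
  also have "... = (\<Sum>kp\<in>?K. \<integral>x. f kp x \<partial>?N)" by (simp add: real_lebesgue_integral_def[OF int])
  finally show ?thesis unfolding f_def .
qed

definition ext_kernel :: "nat => (nat => real) => real => nat \<times> real => nat \<times> real => real" where
  "ext_kernel m t c p q = ind {..<m} (fst p)*ind {..<m} (fst q)*ind {c<..} (snd p)*ind {c<..} (snd q)
  * airy1_kernel (t (fst p)) (snd p) (t (fst q)) (snd q)"

lemma airy1_fredholm_eq_fredholm:
  assumes "weighted_measure grid_measure g k" and K: "dominated_by C grid_measure g grid_measure k (ext_kernel m t c)"
  shows "airy1_fredholm m t (%_. c) = fredholm grid_measure (ext_kernel m t c)"
proof -
  interpret weighted_measure grid_measure g k by fact
  have "(-1) ^ n/fact n*(\<Sum>kp \<in> PiE {..<n} (%_. {..<m}). integral\<^sup>L (PiM {..<n} (%_. lborel))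
    (%x. detn n (%i j. ind {c<..} (x i)*airy1_kernel (t (kp i)) (x i) (t (kp j)) (x j)*ind {c<..} (x j))))
    = fredcoef (trpow grid_measure (ext_kernel m t c)) n" for n
  proof -
    have "(\<integral>z. det_on {..<n} (%i j. ext_kernel m t c (z i) (z j)) \<partial>Pi\<^sub>M {..<n} (%_. grid_measure))
      = (\<Sum>kp\<in>PiE {..<n} (%_. {..<m}). \<integral>x. det_on {..<n} (%i j.
      ext_kernel m t c ((\<lambda>i\<in>{..<n}. (kp i, x i)) i) ((\<lambda>i\<in>{..<n}. (kp i, x i)) j)) \<partial>Pi\<^sub>M {..<n} (%_. lborel))"
    proof (rule integral_PiM_grid)
      show "integrable (Pi\<^sub>M {..<n} (%_. grid_measure)) (%z. det_on {..<n} (%i j. ext_kernel m t c (z i) (z j)))"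
        by (rule det_on_integrable[OF _ K]) simp
      fix z :: "nat => nat \<times> real" assume "\<exists>i\<in>{..<n}. m <= fst (z i)"
      then obtain i where i: "i \<in> {..<n}" "m <= fst (z i)" by blast
      have "(\<Prod>i\<in>{..<n}. ext_kernel m t c (z i) (z (p i))) = 0" for p
        by (rule prod_zero) (use i in \<open>auto intro!: bexI[of _ i] simp: ext_kernel_def\<close>)
      then show "det_on {..<n} (%i j. ext_kernel m t c (z i) (z j)) = 0" by (simp only: det_on_def mult_zero_right sum.neutral_const)
    qed simp
    also have "... = (\<Sum>kp \<in> PiE {..<n} (%_. {..<m}). integral\<^sup>L (PiM {..<n} (%_. lborel))
      (%x. detn n (%i j. ind {c<..} (x i)*airy1_kernel (t (kp i)) (x i) (t (kp j)) (x j)*ind {c<..} (x j))))" unfolding detn_eq_det_on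
    proof (rule sum.cong[OF refl], rule LINT_cong[OF refl], rule det_on_cong)
      fix kp and x :: "nat => real" and i j assume kp: "kp \<in> PiE {..<n} (%_. {..<m})" and ij: "i \<in> {..<n}" "j \<in> {..<n}"
      have "kp i < m" "kp j < m" using PiE_mem[OF kp ij(1)] PiE_mem[OF kp ij(2)] by auto
      then show "ext_kernel m t c ((\<lambda>i\<in>{..<n}. (kp i, x i)) i) ((\<lambda>i\<in>{..<n}. (kp i, x i)) j)
        = ind {c<..} (x i)*airy1_kernel (t (kp i)) (x i) (t (kp j)) (x j)*ind {c<..} (x j)" using ij by (simp add: ext_kernel_def)
    qed
    finally show ?thesis unfolding fredcoef_eq_det_on[OF K] by simp
  qed
  then show ?thesis unfolding airy1_fredholm_def fredholm_def by simp
qed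

section \<open>Heat flow killed above a level\<close>

definition exp_bounded :: "real => real => (real => real) => bool" where
  "exp_bounded a C f \<longleftrightarrow> f \<in> bmeas borel \<and> (\<forall>x. abs (f x) <= C*exp (-a*x))"

lemma exp_boundedD:
  assumes "exp_bounded a C f"
  shows "f \<in> bmeas borel" "abs (f x) <= C*exp (-a*x)" "0 <= C"
  using assms order_trans[OF abs_ge_zero, of "f 0" C] by (auto simp: exp_bounded_def elim!: allE[of _ 0])

lemma exp_bounded_cut: "exp_bounded a C f ==> A \<in> sets borel ==> exp_bounded a C (%x. ind A x*f x)"
  using exp_boundedD(3)[of a C f] by (auto simp: exp_bounded_def indicator_def)

lemma exp_bounded_exp: "exp_bounded a 1 (%x. exp (-a*x))" by (simp add: exp_bounded_def)

lemma heat_exp_bound: "0 < t ==> heat t d <= exp (t*et^2)/sqrt (4*pi*t)*exp (-et*d)"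
proof -
  assume t: "0 < t"
  have "heat t d = (heat t d*exp (et*d))*exp (-et*d)" by (simp add: mult.assoc flip: exp_add)
  also have "... = exp (t*et^2)*heat t (d - 2*t*et)*exp (-et*d)" unfolding heat_tilt[OF t] ..
  also have "... <= exp (t*et^2)*(1/sqrt (4*pi*t))*exp (-et*d)" using heat_le[OF t] by (intro mult_right_mono mult_left_mono) auto
  finally show ?thesis by simp
qed

lemma heat_exp_bounded:
  assumes t: "0 < t" and f: "exp_bounded a C f"
  shows "Leb1 (%x'. heat t (x - x')*f x')"
  and "abs (LBINT x'. heat t (x - x')*f x') <= C*exp (t*a^2)*exp (-a*x)"
proof -
  note [measurable] = exp_boundedD(1)[OF f]
  have mgf: "Leb_has (%x'. heat t (x' - x)*exp (-a*x')) (exp (-a*x + t*(-a)^2))" by (rule heat_mgf[OF t])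
  have bound: "abs (heat t (x - x')*f x') <= C*(heat t (x' - x)*exp (-a*x'))" for x'
    using mult_left_mono[OF exp_boundedD(2)[OF f], of "heat t (x - x')" x'] t by (simp add: abs_mult heat_minus_commute[of t x] mult_ac)
  have dominating: "Leb1 (%x'. C*(heat t (x' - x)*exp (-a*x')))" using mgf by (intro integrable_mult_right) (auto simp: Leb_iff)
  show int: "Leb1 (%x'. heat t (x - x')*f x')" by (rule integrable_dominated[OF dominating]) (use bound in auto)
  have "abs (LBINT x'. heat t (x - x')*f x') <= (LBINT x'. abs (heat t (x - x')*f x'))" by (rule integral_abs_bound)
  also have "... <= (LBINT x'. C*(heat t (x' - x)*exp (-a*x')))" by (intro integral_mono integrable_abs int dominating bound)
  also have "... = C*exp (-a*x + t*(-a)^2)" using mgf by (simp add: Leb_iff)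
  also have "... = C*exp (t*a^2)*exp (-a*x)" by (simp only: exp_add mult_ac power2_minus)
  finally show "abs (LBINT x'. heat t (x - x')*f x') <= C*exp (t*a^2)*exp (-a*x)" .
qed

lemma heat_compose:
  assumes s: "0 < s" and t: "0 < t" and f: "Leb1 f"
  shows "Leb1 (%x'. heat s (x - x')*(LBINT z. heat t (x' - z)*f z))"
  and "(LBINT x'. heat s (x - x')*(LBINT z. heat t (x' - z)*f z)) = (LBINT z. heat (s + t) (x - z)*f z)"
proof -
  have [measurable]: "f \<in> bmeas lborel" using f by simp
  define F where "F x' z = heat s (x - x')*(heat t (x' - z)*f z)" for x' z
  have meas: "(%p. F (fst p) (snd p)) \<in> bmeas (lborel \<Otimes>\<^sub>M lborel)" unfolding F_def by measurable
  have bound: "norm (F x' z) <= heat s (x' - x)*(1/sqrt (4*pi*t)*abs (f z))" for x' z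
  proof -
    have "heat t (x' - z)*abs (f z) <= 1/sqrt (4*pi*t)*abs (f z)" using heat_le[OF t] by (intro mult_right_mono) auto
    from mult_left_mono[OF this, of "heat s (x' - x)"] show ?thesis
      unfolding F_def using s t by (simp add: abs_mult heat_minus_commute[of s x])
  qed
  have "Leb1 (%x'. heat s (x' - x))" "Leb1 (%z. 1/sqrt (4*pi*t)*abs (f z))" using f heat_integral_shift[OF s, of x] by (auto simp: Leb_iff)
  note Fubini = Fubini_dominated[OF sigma_finite_lborel sigma_finite_lborel meas bound this]
  show "Leb1 (%x'. heat s (x - x')*(LBINT z. heat t (x' - z)*f z))" using Fubini(3) by (simp add: F_def)
  have "(LBINT x'. heat s (x - x')*(LBINT z. heat t (x' - z)*f z)) = (LBINT z. (LBINT x'. F x' z))" using Fubini(2) by (simp add: F_def)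
  also have "... = (LBINT z. heat (s + t) (x - z)*f z)"
    unfolding F_def using heat_semigroup[OF s t] by (intro LINT_cong refl) (simp add: mult.assoc[symmetric] Leb_iff)
  finally show "(LBINT x'. heat s (x - x')*(LBINT z. heat t (x' - z)*f z)) = (LBINT z. heat (s + t) (x - z)*f z)" .
qed

fun killed :: "real => real => (real => real) => nat => real => real" where
  "killed dt c f 0 x = f x"
  | "killed dt c f (Suc n) x = (LBINT x'. heat dt (x - x')*(ind {..c} x'*killed dt c f n x'))"

lemma killed_measurable_pair:
  assumes f: "(%(x, y). f y x) \<in> bmeas (borel \<Otimes>\<^sub>M N)"
  shows "(%(x, y). killed dt c (f y) n x) \<in> bmeas (borel \<Otimes>\<^sub>M N)"
proof (induction n)
  case (Suc n)
  have "(%p. (snd p, snd (fst p))) \<in> measurable ((borel \<Otimes>\<^sub>M N) \<Otimes>\<^sub>M borel) (borel \<Otimes>\<^sub>M N)" by measurable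
  from measurable_compose[OF this Suc]
  have [measurable]: "(%p. killed dt c (f (snd (fst p))) n (snd p)) \<in> bmeas ((borel \<Otimes>\<^sub>M N) \<Otimes>\<^sub>M borel)" by simp
  have "(%p. LBINT x'. heat dt (fst p - x')*(ind {..c} x'*killed dt c (f (snd p)) n x')) \<in> bmeas (borel \<Otimes>\<^sub>M N)"
    by measurable
  then show ?case by (simp add: case_prod_beta')
qed (simp add: f)

lemma killed_measurable [measurable (raw)]:
  assumes [measurable]: "f \<in> bmeas borel" and h: "h \<in> bmeas M"
  shows "(%p. killed dt c f n (h p)) \<in> bmeas M"
proof -
  have "(%(x, y::real). f x) \<in> bmeas (borel \<Otimes>\<^sub>M borel)" by measurable
  from measurable_compose[OF measurable_Pair[OF h measurable_const[of 0]] killed_measurable_pair[OF this]] show ?thesis by simp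
qed

lemma killed_scale: "killed dt c (%x. u*f x) n x = u*killed dt c f n x"
  by (induction n arbitrary: x) (simp_all add: mult.left_commute[of _ u])

context
  fixes dt a c :: real
  assumes dt: "0 < dt"
begin

lemma killed_exp_bounded:
  assumes "exp_bounded a C f"
  shows "exp_bounded a (C*exp (real n*dt*a^2)) (killed dt c f n)"
proof (induction n)
  case 0
  then show ?case using assms by (simp add: exp_bounded_def)
next
  case (Suc n)
  have "killed dt c f (Suc n) \<in> bmeas borel" using killed_measurable[OF exp_boundedD(1)[OF assms], of "%x. x" borel] by simp
  moreover have "abs (killed dt c f (Suc n) x) <= C*exp (real (Suc n)*dt*a^2)*exp (-a*x)" for x
    using heat_exp_bounded(2)[OF dt exp_bounded_cut[OF Suc, of "{..c}"], of x] by (simp add: algebra_simps exp_add)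
  ultimately show ?case unfolding exp_bounded_def by blast
qed

lemma killed_integrable:
  "exp_bounded a C f ==> Leb1 (%x'. heat dt (x - x')*(ind {..c} x'*killed dt c f n x'))"
  by (rule heat_exp_bounded(1)[OF dt exp_bounded_cut[OF killed_exp_bounded]]) auto

lemma killed_add:
  assumes f: "exp_bounded a C f" and h: "exp_bounded a D h"
  shows "killed dt c (%x. f x + h x) n x = killed dt c f n x + killed dt c h n x"
proof (induction n arbitrary: x)
  case (Suc n)
  have "killed dt c (%x. f x + h x) (Suc n) x
    = (LBINT x'. heat dt (x - x')*(ind {..c} x'*killed dt c f n x') + heat dt (x - x')*(ind {..c} x'*killed dt c h n x'))"
    by (simp add: Suc algebra_simps)
  also have "... = killed dt c f (Suc n) x + killed dt c h (Suc n) x"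
    using killed_integrable[OF f, of x n] killed_integrable[OF h, of x n] by simp
  finally show ?case .
qed simp

lemma killed_nonneg: "(!!x. 0 <= f x) ==> 0 <= killed dt c f n x"
  using dt by (induction n arbitrary: x) (auto intro!: integral_nonneg_AE AE_I2 mult_nonneg_nonneg)

end

text \<open>The transition density of the killed flow after \<open>n + 1\<close> steps.\<close>
fun killed_density :: "real => real => nat => real => real => ennreal" where
  "killed_density dt c 0 x z = ennreal (heat dt (x - z)*ind {..c} z)"
  | "killed_density dt c (Suc n) x z = (\<integral>\<^sup>+x'. ennreal (heat dt (x - x')*ind {..c} x')*killed_density dt c n x' z \<partial>lborel)"

lemma killed_density_measurable [measurable (raw)]:
  assumes "f \<in> bmeas M" "h \<in> bmeas M"
  shows "(%p. killed_density dt c n (f p) (h p)) \<in> bmeas M"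
proof -
  have "(%p. killed_density dt c n (fst p) (snd p)) \<in> bmeas (borel \<Otimes>\<^sub>M borel)"
  proof (induction n)
    case (Suc n)
    have [measurable]: "(%p. killed_density dt c n (f p) (h p)) \<in> bmeas M" if "f \<in> bmeas M" "h \<in> bmeas M" for f h and M :: "((real \<times> real) \<times> real) measure"
      using measurable_compose[OF measurable_Pair[OF that] Suc] by simp
    show ?case by simp measurable
  qed simp
  from measurable_compose[OF measurable_Pair[OF assms] this] show ?thesis by simp
qed

lemma killed_eq_density:
  assumes dt: "0 < dt" and f: "exp_bounded a C f" "!!x. 0 <= f x"
  shows "ennreal (killed dt c f (Suc n) x) = (\<integral>\<^sup>+z. killed_density dt c n x z*ennreal (f z) \<partial>lborel)"
proof (induction n arbitrary: x)
  case 0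
  have "ennreal (killed dt c f (Suc 0) x) = (\<integral>\<^sup>+x'. ennreal (heat dt (x - x')*(ind {..c} x'*f x')) \<partial>lborel)"
    using killed_integrable[OF dt f(1), of x c 0] dt f(2) by (simp add: nn_integral_eq_integral)
  then show ?case using dt f(2) by (simp add: ennreal_mult'[symmetric] mult.assoc)
next
  case (Suc n)
  have [measurable]: "f \<in> bmeas borel" by (rule exp_boundedD(1)[OF f(1)])
  have "ennreal (killed dt c f (Suc (Suc n)) x)
    = (\<integral>\<^sup>+x'. ennreal (heat dt (x - x')*(ind {..c} x'*killed dt c f (Suc n) x')) \<partial>lborel)"
    unfolding killed.simps(2)[of _ _ _ "Suc n"] using killed_nonneg[OF dt f(2)] dt
    by (intro nn_integral_eq_integral[symmetric] killed_integrable[OF dt f(1)] AE_I2 mult_nonneg_nonneg) auto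
  also have "... = (\<integral>\<^sup>+x'. ennreal (heat dt (x - x')*ind {..c} x')*ennreal (killed dt c f (Suc n) x') \<partial>lborel)"
    using killed_nonneg[OF dt f(2)] dt by (intro nn_integral_cong) (simp add: ennreal_mult'[symmetric] mult.assoc del: killed.simps)
  also have "... = (\<integral>\<^sup>+x'. (\<integral>\<^sup>+z. ennreal (heat dt (x - x')*ind {..c} x')*killed_density dt c n x' z*ennreal (f z) \<partial>lborel) \<partial>lborel)"
    unfolding Suc by (simp add: nn_integral_cmult mult.assoc)
  also have "... = (\<integral>\<^sup>+z. (\<integral>\<^sup>+x'. ennreal (heat dt (x - x')*ind {..c} x')*killed_density dt c n x' z*ennreal (f z) \<partial>lborel) \<partial>lborel)"
    by (rule lborel_pair.Fubini') measurable
  also have "... = (\<integral>\<^sup>+z. killed_density dt c (Suc n) x z*ennreal (f z) \<partial>lborel)" by (simp add: nn_integral_multc)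
  finally show ?case .
qed

lemma killed_density_le:
  assumes dt: "0 < dt" and r: "0 <= r"
  and [measurable]: "!!t x. P t x \<in> bmeas borel" "!!t z. (%x. P t x z) \<in> bmeas borel"
  and nonneg: "!!t x z. 0 < t ==> x <= c ==> z <= c ==> 0 <= P t x z"
  and step: "!!x z. x <= c ==> z <= c ==> heat dt (x - z) <= r*P dt x z"
  and semigroup: "!!s t x z. 0 < s ==> 0 < t ==> x <= c ==> z <= c ==>
  (\<integral>\<^sup>+x'. ennreal (ind {..c} x'*(P s x x'*P t x' z)) \<partial>lborel) <= ennreal (P (s + t) x z)"
  and x: "x <= c"
  shows "killed_density dt c n x z <= ennreal (r ^ Suc n*(ind {..c} z*P (real (Suc n)*dt) x z))" using x
proof (induction n arbitrary: x)
  case 0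
  then show ?case using step[of x z] by (auto simp: indicator_def intro: ennreal_leI)
next
  case (Suc n)
  define t where "t = real (Suc n)*dt"
  have t: "0 < t" using dt by (simp add: t_def)
  have t_Suc: "dt + t = real (Suc (Suc n))*dt" by (simp add: t_def algebra_simps)
  let ?r = "ennreal (r ^ Suc (Suc n)*ind {..c} z)" and ?p = "%x'. ennreal (ind {..c} x'*(P dt x x'*P t x' z))"
  have row: "ennreal (heat dt (x - x')*ind {..c} x')*killed_density dt c n x' z <= ?r*?p x'" for x'
  proof (cases "x' <= c")
    case True
    have "ennreal (heat dt (x - x')*ind {..c} x')*killed_density dt c n x' z
      <= ennreal (r*P dt x x')*ennreal (r ^ Suc n*(ind {..c} z*P t x' z))"
      using True step[OF Suc.prems True] unfolding t_def by (intro mult_mono[OF ennreal_leI Suc.IH]) auto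
    also have "... = ?r*?p x'" using True r nonneg[OF dt Suc.prems True] nonneg[OF t True, of z]
      by (cases "z <= c") (simp_all add: ennreal_mult'[symmetric] mult_ac)
    finally show ?thesis .
  qed simp
  have "killed_density dt c (Suc n) x z <= (\<integral>\<^sup>+x'. ?r*?p x' \<partial>lborel)"
    unfolding killed_density.simps by (intro nn_integral_mono row)
  also have "... = ?r*(\<integral>\<^sup>+x'. ?p x' \<partial>lborel)" by (rule nn_integral_cmult) measurable
  also have "... <= ennreal (r ^ Suc (Suc n)*(ind {..c} z*P (dt + t) x z))"
  proof (cases "z <= c")
    case True
    have "ennreal (r ^ Suc (Suc n))*(\<integral>\<^sup>+x'. ?p x' \<partial>lborel) <= ennreal (r ^ Suc (Suc n))*ennreal (P (dt + t) x z)"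
      by (intro mult_left_mono semigroup dt t Suc.prems True) auto
    then show ?thesis using True r by (simp add: ennreal_mult'[symmetric] del: power_Suc)
  qed simp
  finally show ?case unfolding t_Suc .
qed

lemma has_bochner_integral_nn:
  fixes f :: "'b => real"
  assumes "has_bochner_integral M f v" "!!x. 0 <= f x"
  shows "(\<integral>\<^sup>+x. ennreal (f x) \<partial>M) = ennreal v" using assms by (auto simp: Leb_iff nn_integral_eq_integral)

text \<open>The heat kernel on the half line below \<open>b\<close> with absorbing boundary, by the reflection principle.\<close>
definition absorbed :: "real => real => real => real => real" where
  "absorbed b t x z = heat t (x - z) - heat t (2*b - x - z)"

lemma absorbed_measurable [measurable]:
  assumes "f \<in> bmeas M" "h \<in> bmeas M"
  shows "(%p. absorbed b t (f p) (h p)) \<in> bmeas M" using assms unfolding absorbed_def by measurable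

lemma heat_reflect_le:
  assumes t: "0 < t" and ep: "0 <= ep" and "x <= b - ep" "z <= b - ep"
  shows "heat t (2*b - x - z) <= exp (-ep\<^sup>2/t)*heat t (x - z)"
proof -
  have "ep*ep <= (b - x)*(b - z)" using assms by (intro mult_mono) auto
  then have "(x - z)^2 + 4*ep^2 <= (2*b - x - z)^2" by (simp add: power2_eq_square algebra_simps)
  then have "- (2*b - x - z)\<^sup>2/(4*t) <= (-(4*ep^2) + - (x - z)\<^sup>2)/(4*t)" using t by (intro divide_right_mono) auto
  also have "... = - ep\<^sup>2/t + - (x - z)\<^sup>2/(4*t)" by (simp add: add_divide_distrib diff_divide_distrib)
  finally have "exp (-(2*b - x - z)\<^sup>2/(4*t)) <= exp (-ep\<^sup>2/t)*exp (-(x - z)\<^sup>2/(4*t))" by (simp only: exp_add[symmetric] exp_le_cancel_iff)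
  from divide_right_mono[OF this, of "sqrt (4*pi*t)"] t show ?thesis unfolding heat_def by simp
qed

lemma absorbed_nonneg: "0 < t ==> x <= b ==> z <= b ==> 0 <= absorbed b t x z"
  using heat_reflect_le[of t 0 x b z] by (simp add: absorbed_def)

lemma absorbed_le_heat: "0 < t ==> absorbed b t x z <= heat t (x - z)" by (simp add: absorbed_def)

lemma absorbed_semigroup:
  assumes s: "0 < s" and t: "0 < t"
  shows "Leb_has (%x'. ind {..b} x'*(absorbed b s x x'*absorbed b t x' z)) (absorbed b (s + t) x z)"
proof -
  define F where "F x' = absorbed b s x x'*absorbed b t x' z" for x'
  have reflect: "heat t (2*b - x' - z) = heat t (x' - (2*b - z))" for x' using heat_minus[of t "2*b - x' - z"] by (simp add: algebra_simps)
  have "Leb_has (%x'. (heat s (x - x')*heat t (x' - z) - heat s (x - x')*heat t (x' - (2*b - z)))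
    - (heat s ((2*b - x) - x')*heat t (x' - z) - heat s ((2*b - x) - x')*heat t (x' - (2*b - z))))
    ((heat (s + t) (x - z) - heat (s + t) (x - (2*b - z))) - (heat (s + t) ((2*b - x) - z) - heat (s + t) ((2*b - x) - (2*b - z))))"
    by (intro has_bochner_integral_diff heat_semigroup s t)
  moreover have "((heat (s + t) (x - z) - heat (s + t) (x - (2*b - z)))
    - (heat (s + t) ((2*b - x) - z) - heat (s + t) ((2*b - x) - (2*b - z)))) = 2*absorbed b (s + t) x z"
    using heat_minus[of "s + t" "x - (2*b - z)"] heat_minus[of "s + t" "x - z"] by (simp add: absorbed_def algebra_simps)
  moreover have "(%x'. (heat s (x - x')*heat t (x' - z) - heat s (x - x')*heat t (x' - (2*b - z)))
    - (heat s ((2*b - x) - x')*heat t (x' - z) - heat s ((2*b - x) - x')*heat t (x' - (2*b - z)))) = F"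
    unfolding F_def absorbed_def reflect by (intro ext) (simp only: left_diff_distrib right_diff_distrib)
  ultimately have F: "Leb_has F (2*absorbed b (s + t) x z)" by simp
  have [measurable]: "F \<in> bmeas lborel" unfolding F_def[abs_def] by measurable
  have below: "Leb1 (%x'. ind {..b} x'*F x')" and above: "Leb1 (%x'. ind {b..} x'*F x')"
    using F by (auto intro!: L1_bound[of lborel F] simp: Leb_iff indicator_def)
  have symmetric: "F (2*b + -1*x') = F x'" for x'
    using heat_minus[of t "x' - z"] heat_minus[of s "x - x'"] heat_minus[of s "2*b - x - x'"] by (simp add: F_def absorbed_def algebra_simps)
  have "(LBINT x'. ind {..b} x'*F x') = abs (-1) *\<^sub>R (LBINT x'. ind {..b} (2*b + -1*x')*F (2*b + -1*x'))"
    by (rule lborel_integral_real_affine) simp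
  also have "... = (LBINT x'. ind {b..} x'*F x')" unfolding symmetric by (auto intro!: LINT_cong simp: indicator_def)
  finally have halves: "(LBINT x'. ind {..b} x'*F x') = (LBINT x'. ind {b..} x'*F x')" .
  have "F b = 0" by (simp add: F_def absorbed_def)
  then have "F x' = ind {..b} x'*F x' + ind {b..} x'*F x'" for x' by (cases x' b rule: linorder_cases) (auto simp: indicator_def)
  then have "2*absorbed b (s + t) x z = (LBINT x'. ind {..b} x'*F x' + ind {b..} x'*F x')" using F by (simp add: Leb_iff)
  also have "... = 2*(LBINT x'. ind {..b} x'*F x')" using below above halves by simp
  finally show ?thesis using below unfolding F_def by (simp add: Leb_iff)
qed

lemma absorbed_semigroup_nn:
  assumes s: "0 < s" and t: "0 < t" and x: "x <= b" "z <= b"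
  shows "(\<integral>\<^sup>+x'. ennreal (ind {..b} x'*(absorbed b s x x'*absorbed b t x' z)) \<partial>lborel) = ennreal (absorbed b (s + t) x z)"
  by (rule has_bochner_integral_nn[OF absorbed_semigroup[OF s t]])
  (use x absorbed_nonneg[OF s, of x b] absorbed_nonneg[OF t, of _ b z] in \<open>auto simp: indicator_def\<close>)

lemma killed_density_ge_absorbed:
  assumes dt: "0 < dt" and x: "x <= c"
  shows "ennreal (ind {..c} z*absorbed c (real (Suc n)*dt) x z) <= killed_density dt c n x z" using x
proof (induction n arbitrary: x)
  case 0
  then show ?case using absorbed_le_heat[OF dt] by (auto simp: indicator_def intro: ennreal_leI)
next
  case (Suc n)
  define t where "t = real (Suc n)*dt"
  have t: "0 < t" using dt by (simp add: t_def)
  have t_Suc: "dt + t = real (Suc (Suc n))*dt" by (simp add: t_def algebra_simps)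
  have "ennreal (ind {..c} z*absorbed c (dt + t) x z)
    <= (\<integral>\<^sup>+x'. ennreal (ind {..c} x'*(absorbed c dt x x'*(ind {..c} z*absorbed c t x' z))) \<partial>lborel)"
    using absorbed_semigroup_nn[OF dt t Suc.prems, of z] by (cases "z <= c") simp_all
  also have "... <= (\<integral>\<^sup>+x'. ennreal (heat dt (x - x')*ind {..c} x')*killed_density dt c n x' z \<partial>lborel)"
  proof (rule nn_integral_mono)
    fix x'
    show "ennreal (ind {..c} x'*(absorbed c dt x x'*(ind {..c} z*absorbed c t x' z)))
      <= ennreal (heat dt (x - x')*ind {..c} x')*killed_density dt c n x' z"
    proof (cases "x' <= c")
      case True
      have "ennreal (absorbed c dt x x')*ennreal (ind {..c} z*absorbed c t x' z) <= ennreal (heat dt (x - x'))*killed_density dt c n x' z"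
        unfolding t_def by (intro mult_mono ennreal_leI absorbed_le_heat dt Suc.IH True) auto
      then show ?thesis using True absorbed_nonneg[OF dt Suc.prems True] by (simp add: ennreal_mult')
    qed simp
  qed
  finally show ?case unfolding t_Suc by simp
qed

lemma absorbed_integrable:
  assumes t: "0 < t" and f: "exp_bounded a C f" and "x <= b" "c <= b"
  shows "Leb1 (%z. ind {..c} z*absorbed b t x z*f z)"
proof (rule L1_bound[OF heat_exp_bounded(1)[OF t f, of x]])
  have [measurable]: "f \<in> bmeas borel" by (rule exp_boundedD(1)[OF f])
  show "(%z. ind {..c} z*absorbed b t x z*f z) \<in> bmeas lborel" by measurable
  have "abs (ind {..c} z*absorbed b t x z*f z) <= abs (heat t (x - z)*f z)" for z
    unfolding abs_mult using absorbed_nonneg[OF t, of x b z] absorbed_le_heat[OF t, of b x z] assms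
    by (intro mult_right_mono) (auto simp: indicator_def)
  then show "AE z in lborel. norm (ind {..c} z*absorbed b t x z*f z) <= norm (heat t (x - z)*f z)" by simp
qed

context
  fixes dt a c C x :: real and f :: "real => real" and n :: nat
  assumes dt: "0 < dt" and f: "exp_bounded a C f" and nonneg: "!!x. 0 <= f x" and x: "x <= c" and n: "0 < n"
begin

lemma killed_le_density:
  assumes density: "!!z. killed_density dt c (n - 1) x z <= ennreal (p z)"
  and p: "Leb1 (%z. p z*f z)" "!!z. 0 <= p z"
  shows "killed dt c f n x <= (LBINT z. p z*f z)"
proof -
  have "ennreal (killed dt c f n x) = (\<integral>\<^sup>+z. killed_density dt c (n - 1) x z*ennreal (f z) \<partial>lborel)"
    using killed_eq_density[OF dt f nonneg, of c "n - 1" x] n by simp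
  also have "... <= (\<integral>\<^sup>+z. ennreal (p z*f z) \<partial>lborel)"
    using mult_right_mono[OF density zero_le] by (intro nn_integral_mono) (simp add: ennreal_mult nonneg p)
  finally show ?thesis using p nonneg by (simp add: nn_integral_eq_integral)
qed

lemma killed_le_heat: "killed dt c f n x <= (LBINT z. heat (real n*dt) (x - z)*f z)"
proof (rule killed_le_density)
  have t: "0 < real n*dt" using n dt by simp
  show "Leb1 (%z. heat (real n*dt) (x - z)*f z)" by (rule heat_exp_bounded(1)[OF t f])
  show "0 <= heat (real n*dt) (x - z)" for z using t by simp
  have "killed_density dt c (n - 1) x z <= ennreal (1 ^ Suc (n - 1)*(ind {..c} z*heat (real (Suc (n - 1))*dt) (x - z)))" for z
  proof (rule killed_density_le[where P="%t x z. heat t (x - z)", OF dt _ _ _ _ _ _ x])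
    fix s t x z :: real assume st: "0 < s" "0 < t"
    have "(\<integral>\<^sup>+x'. ennreal (ind {..c} x'*(heat s (x - x')*heat t (x' - z))) \<partial>lborel) <= (\<integral>\<^sup>+x'. ennreal (heat s (x - x')*heat t (x' - z)) \<partial>lborel)"
      using st by (intro nn_integral_mono ennreal_leI) (auto simp: indicator_def)
    also have "... = ennreal (heat (s + t) (x - z))" by (rule has_bochner_integral_nn[OF heat_semigroup[OF st]]) (use st in auto)
    finally show "(\<integral>\<^sup>+x'. ennreal (ind {..c} x'*(heat s (x - x')*heat t (x' - z))) \<partial>lborel) <= ennreal (heat (s + t) (x - z))" .
  qed (use dt in auto)
  from order_trans[OF this ennreal_leI] show "killed_density dt c (n - 1) x z <= ennreal (heat (real n*dt) (x - z))" for z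
    using n t by (simp add: indicator_def)
qed

lemma killed_ge_absorbed: "(LBINT z. ind {..c} z*absorbed c (real n*dt) x z*f z) <= killed dt c f n x"
proof -
  have t: "0 < real n*dt" using n dt by simp
  have pos: "0 <= ind {..c} z*absorbed c (real n*dt) x z" for z using absorbed_nonneg[OF t x, of z] by (simp add: indicator_def)
  have "ennreal (LBINT z. ind {..c} z*absorbed c (real n*dt) x z*f z)
    = (\<integral>\<^sup>+z. ennreal (ind {..c} z*absorbed c (real n*dt) x z*f z) \<partial>lborel)"
    by (intro nn_integral_eq_integral[symmetric] absorbed_integrable[OF t f x] AE_I2 mult_nonneg_nonneg[OF pos nonneg]) simp
  also have "... <= (\<integral>\<^sup>+z. killed_density dt c (n - 1) x z*ennreal (f z) \<partial>lborel)"
    using killed_density_ge_absorbed[OF dt x, of _ "n - 1"] n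
    by (intro nn_integral_mono) (simp add: ennreal_mult pos nonneg mult_right_mono)
  also have "... = ennreal (killed dt c f n x)" using killed_eq_density[OF dt f nonneg, of c "n - 1" x] n by simp
  finally show ?thesis by (simp only: ennreal_le_iff killed_nonneg[OF dt nonneg])
qed

text \<open>A barrier at distance \<open>ep\<close> above \<open>c\<close> costs a free step between points below \<open>c\<close> only the factor
  \<open>1 - exp (- ep\<^sup>2 / dt)\<close>, which stays harmless over all \<open>n\<close> steps.\<close>
lemma killed_le_absorbed:
  assumes ep: "0 < ep"
  shows "killed dt c f n x <= inverse ((1 - exp (-ep\<^sup>2/dt)) ^ n)*(LBINT z. ind {..c} z*absorbed (c + ep) (real n*dt) x z*f z)"
proof -
  define r where "r = inverse (1 - exp (-ep\<^sup>2/dt))"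
  have less: "exp (-ep\<^sup>2/dt) < 1" using ep dt by simp
  have r: "0 < r" using less by (simp add: r_def)
  have t: "0 < real n*dt" using n dt by simp
  have int: "Leb1 (%z. ind {..c} z*absorbed (c + ep) (real n*dt) x z*f z)" by (rule absorbed_integrable[OF t f]) (use x ep in auto)
  have "killed_density dt c (n - 1) x z <= ennreal (r ^ Suc (n - 1)*(ind {..c} z*absorbed (c + ep) (real (Suc (n - 1))*dt) x z))" for z
  proof (rule killed_density_le[where P="absorbed (c + ep)", OF dt _ _ _ _ _ _ x])
    fix x z :: real assume xz: "x <= c" "z <= c"
    have "heat dt (2*(c + ep) - x - z) <= exp (-ep\<^sup>2/dt)*heat dt (x - z)" by (rule heat_reflect_le) (use xz dt ep in auto)
    then have "(1 - exp (-ep\<^sup>2/dt))*heat dt (x - z) <= absorbed (c + ep) dt x z" by (simp add: absorbed_def algebra_simps)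
    then show "heat dt (x - z) <= r*absorbed (c + ep) dt x z" unfolding r_def using less by (simp add: field_simps)
  next
    fix s t x z :: real assume st: "0 < s" "0 < t" and xz: "x <= c" "z <= c"
    have "(\<integral>\<^sup>+x'. ennreal (ind {..c} x'*(absorbed (c + ep) s x x'*absorbed (c + ep) t x' z)) \<partial>lborel)
      <= (\<integral>\<^sup>+x'. ennreal (ind {..c + ep} x'*(absorbed (c + ep) s x x'*absorbed (c + ep) t x' z)) \<partial>lborel)"
      using st ep by (intro nn_integral_mono ennreal_leI) (auto simp: indicator_def intro!: mult_nonneg_nonneg absorbed_nonneg xz[THEN order_trans])
    also have "... = ennreal (absorbed (c + ep) (s + t) x z)" by (rule absorbed_semigroup_nn) (use st xz ep in auto)
    finally show "(\<integral>\<^sup>+x'. ennreal (ind {..c} x'*(absorbed (c + ep) s x x'*absorbed (c + ep) t x' z)) \<partial>lborel) <= ennreal (absorbed (c + ep) (s + t) x z)" .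
  qed (use r ep in \<open>auto intro: absorbed_nonneg\<close>)
  then have "killed dt c f n x <= (LBINT z. r ^ n*(ind {..c} z*absorbed (c + ep) (real n*dt) x z)*f z)"
    using n r ep x int absorbed_nonneg[OF t, of x "c + ep"]
    by (intro killed_le_density) (auto simp: mult.assoc indicator_def intro!: integrable_mult_right)
  then show ?thesis by (simp add: r_def power_inverse mult.assoc)
qed

end

lemma barrier_factor_tendsto:
  assumes L: "0 < L"
  shows "(%n. (1 - exp (-(real n powr (-1/4))\<^sup>2/(L/real n))) ^ n) ----> 1"
proof (rule tendsto_sandwich)
  let ?e = "%n. exp (-(real n powr (-1/4))\<^sup>2/(L/real n))"
  show "(%n. 1 + real n*(- ?e n)) ----> 1" using L by real_asymp
  have factor_le_1: "?e n <= 1" for n using L by simp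
  show "\<forall>\<^sub>F n in sequentially. 1 + real n*(- ?e n) <= (1 - ?e n) ^ n"
    using Bernoulli_inequality[of "- ?e n" n for n] factor_le_1 by simp
  show "\<forall>\<^sub>F n in sequentially. (1 - ?e n) ^ n <= 1" using factor_le_1 by (auto intro!: always_eventually power_le_one)
qed simp

lemma absorbed_barrier_tendsto:
  assumes L: "0 < L" and f: "exp_bounded a C f" and x: "x <= c" and ep: "ep ----> 0" "!!n. 0 <= ep n"
  shows "(%n. LBINT z. ind {..c} z*absorbed (c + ep n) L x z*f z) ----> (LBINT z. ind {..c} z*absorbed c L x z*f z)"
proof (rule integral_dominated_convergence[where w="%z. abs (heat L (x - z)*f z)"])
  show "Leb1 (%z. abs (heat L (x - z)*f z))" by (intro integrable_abs heat_exp_bounded(1)[OF L f])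
  have "abs (ind {..c} z*absorbed (c + ep n) L x z*f z) <= abs (heat L (x - z)*f z)" for n z
    unfolding abs_mult using absorbed_nonneg[OF L, of x "c + ep n" z] absorbed_le_heat[OF L, of "c + ep n" x z] x ep(2)[of n] L
    by (intro mult_right_mono) (auto simp: indicator_def)
  then show "AE z in lborel. norm (ind {..c} z*absorbed (c + ep n) L x z*f z) <= abs (heat L (x - z)*f z)" for n by simp
  have "(%n. heat L (2*(c + ep n) - x - z)) ----> heat L (2*(c + 0) - x - z)" for z
    unfolding heat_def using L by (intro tendsto_intros ep) auto
  then show "AE z in lborel. (%n. ind {..c} z*absorbed (c + ep n) L x z*f z) ----> ind {..c} z*absorbed c L x z*f z"
    unfolding absorbed_def by (auto intro!: tendsto_intros)
  have [measurable]: "f \<in> bmeas borel" by (rule exp_boundedD(1)[OF f])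
  show "(%z. ind {..c} z*absorbed c L x z*f z) \<in> bmeas lborel" "!!n. (%z. ind {..c} z*absorbed (c + ep n) L x z*f z) \<in> bmeas lborel"
    by measurable
qed

lemma killed_tendsto_nonneg:
  assumes L: "0 < L" and f: "exp_bounded a C f" and nonneg: "!!x. 0 <= f x" and x: "x <= c"
  shows "(%n. killed (L/real n) c f n x) ----> (LBINT z. ind {..c} z*absorbed c L x z*f z)"
proof (rule tendsto_sandwich)
  define ep where "ep n = real n powr (-1/4)" for n
  let ?upper = "%n. inverse ((1 - exp (-(ep n)\<^sup>2/(L/real n))) ^ n)*(LBINT z. ind {..c} z*absorbed (c + ep n) L x z*f z)"
  have step: "0 < L/real n" "real n*(L/real n) = L" if "0 < n" for n using that L by auto
  show "\<forall>\<^sub>F n in sequentially. (LBINT z. ind {..c} z*absorbed c L x z*f z) <= killed (L/real n) c f n x"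
    using eventually_gt_at_top[of 0]
  proof eventually_elim
    case (elim n)
    show ?case using killed_ge_absorbed[OF step(1)[OF elim] f nonneg x elim] unfolding step(2)[OF elim] .
  qed
  show "\<forall>\<^sub>F n in sequentially. killed (L/real n) c f n x <= ?upper n" using eventually_gt_at_top[of 0]
  proof eventually_elim
    case (elim n)
    have "0 < ep n" using elim by (simp add: ep_def)
    from killed_le_absorbed[OF step(1)[OF elim] f nonneg x elim this] show ?case unfolding step(2)[OF elim] .
  qed
  have "ep ----> 0" "!!n. 0 <= ep n" unfolding ep_def by (real_asymp, simp)
  from tendsto_mult[OF tendsto_inverse[OF barrier_factor_tendsto[OF L]] absorbed_barrier_tendsto[OF L f x this]]
  show "?upper ----> (LBINT z. ind {..c} z*absorbed c L x z*f z)" by (simp add: ep_def)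
qed simp

lemma killed_tendsto:
  assumes L: "0 < L" and f: "exp_bounded a C f" and x: "x <= c"
  shows "(%n. killed (L/real n) c f n x) ----> (LBINT z. ind {..c} z*absorbed c L x z*f z)"
proof -
  define p m where "p x = max 0 (f x)" and "m x = max 0 (-f x)" for x
  have [measurable]: "f \<in> bmeas borel" by (rule exp_boundedD(1)[OF f])
  have "abs (p x) <= C*exp (-a*x)" "abs (m x) <= C*exp (-a*x)" for x using exp_boundedD(2)[OF f, of x] by (auto simp: p_def m_def)
  moreover have "p \<in> bmeas borel" "m \<in> bmeas borel" unfolding p_def[abs_def] m_def[abs_def] by measurable
  ultimately have p: "exp_bounded a C p" and m: "exp_bounded a C m" by (auto simp: exp_bounded_def)
  then have neg_m: "exp_bounded a C (%x. -1*m x)" by (simp add: exp_bounded_def)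
  have split: "f = (%x. p x + -1*m x)" by (auto simp: p_def m_def max_def)
  have "(%n. killed (L/real n) c p n x + -1*killed (L/real n) c m n x)
    ----> (LBINT z. ind {..c} z*absorbed c L x z*p z) + -1*(LBINT z. ind {..c} z*absorbed c L x z*m z)"
    by (intro tendsto_add tendsto_mult tendsto_const killed_tendsto_nonneg[OF L p _ x] killed_tendsto_nonneg[OF L m _ x]) (auto simp: p_def m_def)
  also have "(LBINT z. ind {..c} z*absorbed c L x z*p z) + -1*(LBINT z. ind {..c} z*absorbed c L x z*m z)
    = (LBINT z. ind {..c} z*absorbed c L x z*f z)"
    unfolding split using absorbed_integrable[OF L p x order_refl] absorbed_integrable[OF L m x order_refl] by (simp add: right_diff_distrib)
  finally show ?thesis
  proof (rule Lim_transform_eventually)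
    show "\<forall>\<^sub>F n in sequentially. killed (L/real n) c p n x + -1*killed (L/real n) c m n x = killed (L/real n) c f n x"
      using eventually_gt_at_top[of 0]
    proof eventually_elim
      case (elim n)
      then have "0 < L/real n" using L by simp
      from killed_add[OF this p neg_m, of c n x] show ?case unfolding killed_scale split[symmetric] by simp
    qed
  qed
qed

section \<open>The grid determinant on the line\<close>

lemma airy_tilt_exp_bounded:
  assumes "- L <= ta" "ta <= a - 1"
  shows "exp_bounded a (exp (a ^ 3/3 + L*a^2)*exp (-a*y)) (%x. airy_tilt ta (x + y))"
proof -
  have "abs (airy_tilt ta X) <= exp (a ^ 3/3 + L*a^2)*exp (-a*X)" for X
  proof -
    have "abs (airy_tilt ta X) <= exp (a ^ 3/3 - ta*a^2 - a*X) * sqrt (pi/(a - ta))/(2*pi)" using assms by (intro airy_tilt_vert_bound) auto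
    also have "... = exp (a ^ 3/3 - ta*a^2 - a*X)*(sqrt (pi/(a - ta))/(2*pi))" by simp
    also have "... <= exp (a ^ 3/3 + L*a^2 + (-a*X))*1"
    proof (intro mult_mono)
      have "pi/(a - ta) <= pi/1" using assms by (intro divide_left_mono) auto
      also have "... <= pi^2" using pi_gt3 by (simp add: power2_eq_square)
      finally have "sqrt (pi/(a - ta)) <= pi" by (intro real_le_lsqrt) auto
      then have "sqrt (pi/(a - ta)) <= 1*(2*pi)" using pi_gt_zero by linarith
      then show "sqrt (pi/(a - ta))/(2*pi) <= 1" using pi_gt_zero by (simp add: divide_le_eq)
      have "- ta*a^2 <= L*a^2" using assms by (intro mult_right_mono) auto
      then show "exp (a ^ 3/3 - ta*a^2 - a*X) <= exp (a ^ 3/3 + L*a^2 + (-a*X))" by simp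
    qed (use assms in auto)
    finally show ?thesis unfolding exp_add by simp
  qed
  from this[of "_ + y"] show ?thesis unfolding exp_bounded_def distrib_left exp_add by (simp add: mult_ac)
qed

locale airy_grid =
  fixes N :: nat and L c :: real
  assumes N: "0 < N" and L: "0 < L" and c_pos: "0 < c"
begin

definition dt :: real where "dt = L/N"

lemma dt_pos: "0 < dt" and N_dt: "real N*dt = L" using N L by (auto simp: dt_def)

definition killed_airy :: "nat => real => real => real" where
  "killed_airy n x y = killed dt c (%x. airy_tilt (L + 1) (x + y)) n x"

lemma killed_airy_simps:
  "killed_airy 0 x y = airy_tilt (L + 1) (x + y)"
  "killed_airy (Suc n) x y = (LBINT x'. heat dt (x - x')*(ind {..c} x'*killed_airy n x' y))" by (simp_all add: killed_airy_def)

lemma killed_airy_measurable [measurable]: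
  assumes "f \<in> bmeas M" "h \<in> bmeas M"
  shows "(%x. killed_airy n (f x) (h x)) \<in> bmeas M"
proof -
  have "(%(x, y). airy_tilt (L + 1) (x + y)) \<in> bmeas (borel \<Otimes>\<^sub>M borel)" by measurable
  from measurable_compose[OF measurable_Pair[OF assms] killed_measurable_pair[OF this]]
  show ?thesis by (simp add: killed_airy_def)
qed

lemma killed_airy_exp_bounded:
  assumes a: "L + 2 <= a" and n: "n <= N"
  shows "exp_bounded a (exp (a ^ 3/3 + 2*L*a^2)*exp (-a*y)) (%x. killed_airy n x y)"
proof -
  have "exp_bounded a (exp (a ^ 3/3 + L*a^2)*exp (-a*y)*exp (real n*dt*a^2)) (%x. killed_airy n x y)"
    unfolding killed_airy_def by (intro killed_exp_bounded[OF dt_pos] airy_tilt_exp_bounded) (use a L in auto)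
  moreover have "exp (a ^ 3/3 + L*a^2)*exp (-a*y)*exp (real n*dt*a^2) <= exp (a ^ 3/3 + 2*L*a^2)*exp (-a*y)"
  proof -
    have "real n*dt <= real N*dt" using n dt_pos by simp
    then have "real n*dt*a^2 <= L*a^2" unfolding N_dt by (intro mult_right_mono) auto
    then show ?thesis by (simp flip: exp_add)
  qed
  ultimately show ?thesis by (auto simp: exp_bounded_def intro: order_trans mult_right_mono)
qed

lemma killed_airy_above_integrable: "n <= N ==> Leb1 (%z. ind {c<..} z*killed_airy n z y)"
proof (rule L1_bound)
  assume n: "n <= N"
  define a where "a = L + 2"
  define C where "C = exp (a ^ 3/3 + 2*L*a^2)*exp (-a*y)"
  have a: "0 < a" using L by (simp add: a_def)
  show "Leb1 (%z. C*(ind {c..} z*exp (-a*z)))"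
    using has_bochner_integral_exp_right[OF a, of c] by (intro integrable_mult_right) (auto simp: Leb_iff)
  show "AE z in lborel. norm (ind {c<..} z*killed_airy n z y) <= norm (C*(ind {c..} z*exp (-a*z)))"
    using exp_boundedD(2)[OF killed_airy_exp_bounded[of a n y]] n by (auto simp: indicator_def C_def a_def)
qed simp

text \<open>The flow killed at the \<open>m\<close>-th step because it is above \<open>c\<close>, run freely for time \<open>t\<close> afterwards.\<close>
definition overshoot :: "nat => real => real => real => real" where
  "overshoot m t x y = (LBINT z. heat t (x - z)*(ind {c<..} z*killed_airy m z y))"

lemma heat_overshoots:
  fixes s x y :: real and f :: "real => real"
  assumes n: "n <= N" and s: "0 < s"
  defines "f \<equiv> %x. ind {c<..} x*killed_airy n x y + (\<Sum>m<n. overshoot m ((real n - real m)*dt) x y)"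
  shows "Leb1 (%x'. heat s (x - x')*f x')"
  and "(LBINT x'. heat s (x - x')*f x') = (\<Sum>m<Suc n. overshoot m ((real n - real m)*dt + s) x y)"
proof -
  have pos: "0 < (real n - real m)*dt" if "m < n" for m using that dt_pos by simp
  have int_n: "Leb1 (%x'. heat s (x - x')*(ind {c<..} x'*killed_airy n x' y))"
    by (rule heat_exp_bounded(1)[OF s exp_bounded_cut[OF killed_airy_exp_bounded[OF order_refl n]]]) auto
  have int: "Leb1 (%x'. heat s (x - x') * overshoot m ((real n - real m)*dt) x' y)"
    and compose: "(LBINT x'. heat s (x - x') * overshoot m ((real n - real m)*dt) x' y) = overshoot m ((real n - real m)*dt + s) x y"
    if "m < n" for m using heat_compose[OF s pos[OF that] killed_airy_above_integrable[of m y], of x] that n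
    by (simp_all add: overshoot_def add.commute)
  have sum: "(%x'. heat s (x - x')*f x') = (%x'. heat s (x - x')*(ind {c<..} x'*killed_airy n x' y)
    + (\<Sum>m<n. heat s (x - x') * overshoot m ((real n - real m)*dt) x' y))" unfolding f_def by (simp add: distrib_left sum_distrib_left)
  have int_sum: "Leb1 (%x'. \<Sum>m<n. heat s (x - x') * overshoot m ((real n - real m)*dt) x' y)" by (intro L1_sum int) simp
  show "Leb1 (%x'. heat s (x - x')*f x')" unfolding sum by (intro L1_add int_n int_sum)
  have "(LBINT x'. heat s (x - x')*f x') = overshoot n s x y + (\<Sum>m<n. LBINT x'. heat s (x - x') * overshoot m ((real n - real m)*dt) x' y)"
    unfolding sum LINT_add[OF int_n int_sum] overshoot_def[of n] by (subst LINT_sum) (use int in simp_all)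
  also have "... = (\<Sum>m<Suc n. overshoot m ((real n - real m)*dt + s) x y)" using compose by simp
  finally show "(LBINT x'. heat s (x - x')*f x') = (\<Sum>m<Suc n. overshoot m ((real n - real m)*dt + s) x y)" .
qed

lemma airy_tilt_eq_killed_plus_overshoots:
  assumes n: "n <= N"
  shows "airy_tilt ((real N - real n)*dt + 1) (x + y) = killed_airy n x y + (\<Sum>m<n. overshoot m ((real n - real m)*dt) x y)" using n
proof (induction n arbitrary: x)
  case 0
  then show ?case by (simp add: N_dt killed_airy_simps)
next
  case (Suc n)
  then have n: "n <= N" by auto
  define ta where "ta = (real N - real n)*dt + 1"
  define f where "f = (%x. ind {c<..} x*killed_airy n x y + (\<Sum>m<n. overshoot m ((real n - real m)*dt) x y))"
  note above = heat_overshoots[OF n dt_pos, of x y]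
  have below: "Leb1 (%x'. heat dt (x - x')*(ind {..c} x'*killed_airy n x' y))"
    by (rule heat_exp_bounded(1)[OF dt_pos exp_bounded_cut[OF killed_airy_exp_bounded[OF order_refl n]]]) auto
  have "airy_tilt ((real N - real (Suc n))*dt + 1) (x + y) = airy_tilt (ta - dt) (y + x)"
    by (rule arg_cong2[of _ _ _ _ airy_tilt]) (simp_all add: ta_def algebra_simps)
  also have "... = (LBINT x'. airy_tilt ta (y + x')*heat dt (x' - x))" by (rule airy_tilt_semigroup(1)[OF dt_pos, symmetric])
  also have "... = (LBINT x'. heat dt (x - x')*(ind {..c} x'*killed_airy n x' y) + heat dt (x - x')*f x')"
  proof (intro LINT_cong refl)
    fix x'
    have "airy_tilt ta (y + x') = ind {..c} x'*killed_airy n x' y + f x'"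
      using Suc.IH[OF n, of x'] by (simp add: ta_def f_def add.commute indicator_def)
    then show "airy_tilt ta (y + x')*heat dt (x' - x) = heat dt (x - x')*(ind {..c} x'*killed_airy n x' y) + heat dt (x - x')*f x'"
      unfolding heat_minus_commute[of dt x x'] by (simp add: algebra_simps)
  qed
  also have "... = killed_airy (Suc n) x y + (\<Sum>m<Suc n. overshoot m ((real n - real m)*dt + dt) x y)"
    using LINT_add[OF below above(1)] unfolding killed_airy_simps f_def above(2) .
  also have "(\<Sum>m<Suc n. overshoot m ((real n - real m)*dt + dt) x y) = (\<Sum>m<Suc n. overshoot m ((real (Suc n) - real m)*dt) x y)"
    by (intro sum.cong refl arg_cong[of _ _ "%t. overshoot _ t x y"]) (simp add: algebra_simps)
  finally show ?case .
qed

text \<open>What remains of the Airy function after removing the paths that stay below \<open>c\<close> on the grid.\<close>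
definition excess :: "real => real => real" where
  "excess x y = airy_tilt 1 (x + y) - ind {..c} x*killed_airy N x y"

lemma heat_excess:
  "(LBINT x. heat 1 (y - x)*excess x y') = (\<Sum>m<Suc N. overshoot m ((real N - real m)*dt + 1) y y')"
proof -
  have "excess x y' = ind {c<..} x*killed_airy N x y' + (\<Sum>m<N. overshoot m ((real N - real m)*dt) x y')" for x
    unfolding excess_def using airy_tilt_eq_killed_plus_overshoots[of N x y'] by (simp add: indicator_def)
  then show ?thesis using heat_overshoots(2)[of N 1 y y'] by (simp del: sum.lessThan_Suc)
qed

end

lemma real_index_measurable [measurable]:
  "f \<in> measurable M (count_space UNIV) ==> (%x. real (f x)) \<in> bmeas M"
  by (rule measurable_compose[OF _ borel_measurable_count_space])

context airy_grid begin

definition above :: "nat \<times> real => real" where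
  "above p = ind {..real N} (real (fst p))*ind {c<..} (snd p)"

lemma above_idem [simp]: "above p*above p = above p" "above p*(above p*x) = above p*x" by (auto simp: above_def indicator_def)

lemma above_nonneg [simp]: "0 <= above p" by (simp add: above_def)

lemma above_cases: "above p = 0 \<or> (above p = 1 \<and> fst p <= N \<and> c < snd p \<and> 0 < snd p)"
  using c_pos by (auto simp: above_def indicator_def)

lemma above_measurable [measurable]: "above \<in> bmeas grid_measure" unfolding above_def[abs_def] by measurable

lemma time_le: "above p ~= 0 ==> real (fst p)*dt <= L"
  using above_cases[of p] dt_pos N_dt by (metis mult_right_mono less_imp_le of_nat_mono)

definition heat_const :: real where "heat_const = exp (4*(real N)^2*L)/sqrt (4*pi*dt)"

definition rate :: real where "rate = ln ((real N + 1)*heat_const + 1)"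

lemma heat_const_pos: "0 < heat_const" using dt_pos by (simp add: heat_const_def)

lemma rate: "0 <= rate" "exp rate = (real N + 1)*heat_const + 1"
proof -
  have "0 < (real N + 1)*heat_const" using heat_const_pos by simp
  then show "0 <= rate" "exp rate = (real N + 1)*heat_const + 1" unfolding rate_def by auto
qed

text \<open>Weights growing with the time index: they turn the (non-integrable) heat kernel part into a bounded, arbitrarily small kernel.\<close>
definition grid_g :: "nat \<times> real => real" where
  "grid_g p = above p*exp (-rate*real (fst p) - 2*real (fst p) * snd p)"
definition grid_k :: "nat \<times> real => real" where
  "grid_k p = above p*exp (rate*real (fst p) + (2*real (fst p) - 1) * snd p)"

lemma grid_g_mult_k: "grid_g p*grid_k p = above p*exp (-snd p)"
  unfolding grid_g_def grid_k_def by (simp add: mult_ac flip: exp_add) (simp add: algebra_simps)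

lemma above_exp_row: "Leb1 (%x. above (i, x)*exp (-x))" "(LBINT x. above (i, x)*exp (-x)) <= 1"
proof -
  have tail: "Leb_has (%x. ind {c..} x*exp (-1*x)) (exp (-1*c)/1)" by (rule has_bochner_integral_exp_right) simp
  show int: "Leb1 (%x. above (i, x)*exp (-x))"
    by (rule L1_bound[of lborel "%x. ind {c..} x*exp (-1*x)"]) (use tail in \<open>auto simp: Leb_iff above_def indicator_def\<close>)
  have "(LBINT x. above (i, x)*exp (-x)) <= (LBINT x. ind {c..} x*exp (-1*x))"
    using tail int by (intro integral_mono) (auto simp: Leb_iff above_def indicator_def)
  also have "... <= 1" using tail c_pos by (simp add: Leb_iff)
  finally show "(LBINT x. above (i, x)*exp (-x)) <= 1" .
qed

lemma above_exp_integrable: "integrable grid_measure (%p. above p*exp (-snd p))"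
proof (rule integrableI_nonneg)
  have "(\<integral>\<^sup>+p. ennreal (above p*exp (-snd p)) \<partial>grid_measure) = (\<Sum>i<Suc N. \<integral>\<^sup>+x. ennreal (above (i, x)*exp (-x)) \<partial>lborel)"
    by (subst nn_integral_grid[where m="Suc N"]) (auto simp: above_def indicator_def)
  also have "... < \<infinity>" using above_exp_row(1) by (simp add: nn_integral_eq_integral)
  finally show "(\<integral>\<^sup>+p. ennreal (above p*exp (-snd p)) \<partial>grid_measure) < \<infinity>" .
qed auto

sublocale G: weighted_measure grid_measure grid_g grid_k
proof -
  interpret sigma_finite_measure grid_measure by (rule sigma_finite_grid)
  show "weighted_measure grid_measure grid_g grid_k"
  proof unfold_locales
    show "grid_g \<in> bmeas grid_measure" unfolding grid_g_def[abs_def] by measurable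
    show "grid_k \<in> bmeas grid_measure" unfolding grid_k_def[abs_def] by measurable
    show "integrable grid_measure (%x. grid_g x*grid_k x)" unfolding grid_g_mult_k by (rule above_exp_integrable)
  qed (auto simp: grid_g_def grid_k_def space_pair_measure)
qed

lemma grid_mass_le: "G.mass <= real N + 1"
proof -
  have "G.mass = (\<Sum>i<Suc N. LBINT x. above (i, x)*exp (-x))"
    unfolding G.mass_def grid_g_mult_k using integral_grid[OF above_exp_integrable, of "Suc N"] by (auto simp: above_def indicator_def)
  also have "... <= (\<Sum>i<Suc N. 1)" by (intro sum_mono above_exp_row)
  finally show ?thesis by simp
qed

definition heat_part :: "nat \<times> real => nat \<times> real => real" where
  "heat_part p q = above p*above q*(if real (fst p) < real (fst q) then heat ((real (fst q) - real (fst p))*dt) (snd q - snd p) else 0)"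
definition airy_part :: "nat \<times> real => nat \<times> real => real" where
  "airy_part p q = above p*above q*airy_tilt ((real (fst p) - real (fst q))*dt) (snd p + snd q)"

lemma ext_kernel_eq: "ext_kernel (Suc N) (%j. real j*dt) c = (%p q. airy_part p q - heat_part p q)"
proof (intro ext)
  fix p q
  have "ind {..<Suc N} (fst p)*ind {..<Suc N} (fst q)*ind {c<..} (snd p)*ind {c<..} (snd q) = above p*above q"
    by (auto simp: above_def indicator_def)
  moreover have "(real (fst p)*dt < real (fst q)*dt) = (real (fst p) < real (fst q))" using dt_pos by simp
  ultimately show "ext_kernel (Suc N) (%j. real j*dt) c p q = airy_part p q - heat_part p q"
    unfolding ext_kernel_def airy1_kernel_eq airy_part_def heat_part_def by (simp add: algebra_simps)
qed

lemma heat_grid_bound: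
  fixes i j x z :: real
  assumes i: "0 <= i" "i + 1 <= j" "j <= N" and pos: "0 < x" "0 < z"
  shows "heat ((j - i)*dt) (z - x) <= heat_const*exp (-rate)*exp (-rate*i - 2*i*x)*exp (rate*j + (2*j - 1)*z)"
proof -
  define t where "t = (j - i)*dt"
  have "dt*1 <= dt*(j - i)" "dt*(j - i) <= dt*N" using i dt_pos by (intro mult_left_mono; simp)+
  then have t: "0 < t" "dt <= t" "t <= L" using dt_pos N_dt by (auto simp: t_def mult.commute)
  have "heat t (z - x) <= exp (t*(-2*i)^2)/sqrt (4*pi*t)*exp (-(-2*i)*(z - x))" by (rule heat_exp_bound[OF t(1)])
  also have "... <= heat_const*exp ((2*j - 1)*z - 2*i*x)"
  proof (intro mult_mono)
    have "t*(-2*i)^2 = 4*(i^2*t)" by (simp add: power2_eq_square)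
    also have "... <= 4*((real N)^2*L)" using i t by (intro mult_left_mono mult_mono power_mono) auto
    finally have "exp (t*(-2*i)^2) <= exp (4*(real N)^2*L)" by simp
    moreover have "sqrt (4*pi*dt) <= sqrt (4*pi*t)" using t by simp
    ultimately show "exp (t*(-2*i)^2)/sqrt (4*pi*t) <= heat_const" unfolding heat_const_def using dt_pos by (intro frac_le) auto
    have "2*i*z <= (2*j - 1)*z" using i pos by (intro mult_right_mono) auto
    then show "exp (-(-2*i)*(z - x)) <= exp ((2*j - 1)*z - 2*i*x)" by (simp add: right_diff_distrib)
  qed (use heat_const_pos in auto)
  also have "... <= heat_const*exp ((-rate + (-rate*i - 2*i*x)) + (rate*j + (2*j - 1)*z))"
  proof -
    have "rate*(i + 1) <= rate*j" using i rate by (intro mult_left_mono) auto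
    then have "(2*j - 1)*z - 2*i*x <= (-rate + (-rate*i - 2*i*x)) + (rate*j + (2*j - 1)*z)" by (simp add: distrib_left)
    then show ?thesis using heat_const_pos by (intro mult_left_mono) auto
  qed
  finally show ?thesis unfolding t_def exp_add[of "- rate + (-rate*i - 2*i*x)"] exp_add[of "- rate"] by (simp only: mult.assoc)
qed

lemma heat_part_kernel: "G.kernel (heat_const*exp (-rate)) heat_part"
proof (rule G.kernelI)
  show "(%p. heat_part (fst p) (snd p)) \<in> bmeas (grid_measure \<Otimes>\<^sub>M grid_measure)" unfolding heat_part_def by measurable
  fix p q :: "nat \<times> real"
  show "abs (heat_part p q) <= heat_const*exp (-rate)*grid_g p*grid_k q"
  proof (cases "above p = 1 \<and> above q = 1 \<and> fst p < fst q")
    case False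
    then have "heat_part p q = 0" using above_cases[of p] above_cases[of q] by (auto simp: heat_part_def)
    then show ?thesis using heat_const_pos by simp
  next
    case True
    have "heat ((real (fst q) - real (fst p))*dt) (snd q - snd p) <= heat_const*exp (-rate)*
      exp (-rate*real (fst p) - 2*real (fst p) * snd p)*exp (rate*real (fst q) + (2*real (fst q) - 1) * snd q)"
      by (rule heat_grid_bound) (use True above_cases[of p] above_cases[of q] in auto)
    then show ?thesis using True dt_pos unfolding heat_part_def grid_g_def grid_k_def by (simp add: mult.assoc)
  qed
qed (use heat_const_pos in simp)

lemma heat_part_small: "heat_const*exp (-rate)*G.mass < 1"
proof -
  have "heat_const*G.mass <= heat_const*(real N + 1)" using grid_mass_le heat_const_pos by simp
  also have "... < exp rate" using rate by (simp add: mult.commute)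
  finally show ?thesis by (simp add: exp_minus field_simps)
qed

lemma trpow_heat_part: "trpow grid_measure (%p q. - heat_part p q) n = 0"
proof -
  let ?K = "kpow grid_measure (%p q. - heat_part p q)"
  have "?K n p q = 0" if "\<not> fst p < fst q" for p q using that
  proof (induction n arbitrary: q)
    case (Suc n)
    have "?K n p r*(-heat_part r q) = 0" for r
    proof (cases "fst p < fst r")
      case True
      then have "\<not> fst r < fst q" using Suc.prems by auto
      then show ?thesis by (simp add: heat_part_def)
    qed (simp add: Suc.IH)
    then have "(%r. ?K n p r*(-heat_part r q)) = (%r. 0)" by (intro ext)
    then show ?case by (simp only: kpow.simps kcomp_def) simp
  qed (simp add: heat_part_def)
  then show ?thesis by (simp add: trpow_def ktrace_def)
qed

definition decay :: real where "decay = 2*real N + L + 2"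

definition line_g :: "real => real" where "line_g y = min (exp y) (exp ((decay + 2)*y))"
definition line_k :: "real => real" where "line_k y = exp (-decay*y)"

lemma decay: "2 < decay" "L + 2 <= decay" "2*real N + 1 <= decay" using L by (auto simp: decay_def)

sublocale H: weighted_measure lborel line_g line_k
  using weighted_measure_exp[of 1 decay "decay + 2"] decay unfolding line_g_def[abs_def] line_k_def[abs_def] by simp

text \<open>With \<open>V\<close> the heat part, \<open>airy_factor heat_factor\<close> is the Airy part and \<open>killed_factor = (1 + V)\<inverse> airy_factor\<close>.\<close>
definition killed_factor :: "nat \<times> real => real => real" where
  "killed_factor p y = above p*killed_airy (N - fst p) (snd p) y"
definition heat_factor :: "real => nat \<times> real => real" where
  "heat_factor y p = above p*heat (real (fst p)*dt + 1) (y - snd p)"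
definition airy_factor :: "nat \<times> real => real => real" where
  "airy_factor p y = above p*airy_tilt (real (fst p)*dt + 1) (snd p + y)"

lemma above_exp_le_grid_g: "above p*exp (-decay * snd p) <= exp (rate*N)*grid_g p"
proof (cases "above p = 0")
  case True then show ?thesis by (simp add: grid_g_def)
next
  case False
  then have p: "above p = 1" "fst p <= N" "0 < snd p" using above_cases[of p] by auto
  have "- decay * snd p <= - (2*real (fst p)) * snd p" using p decay by (intro mult_right_mono) auto
  moreover have "rate*real (fst p) <= rate*real N" using p rate by (intro mult_left_mono) auto
  ultimately have "- decay * snd p <= rate*N + (-rate*real (fst p) - 2*real (fst p) * snd p)" by simp
  then show ?thesis unfolding grid_g_def using p by (simp flip: exp_add)
qed

lemma above_exp_le_grid_k: "above p*exp (-snd p) <= grid_k p"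
proof (cases "above p = 0")
  case False
  then have p: "above p = 1" "0 < snd p" using above_cases[of p] by auto
  have "0 <= rate*real (fst p) + 2*real (fst p) * snd p" using p rate by simp
  then show ?thesis unfolding grid_k_def using p by (simp add: algebra_simps)
qed (simp add: grid_k_def)

lemma dominated_factorI:
  assumes meas: "(%p. X (fst p) (snd p)) \<in> bmeas (grid_measure \<Otimes>\<^sub>M lborel)"
  and bound: "!!p y. above p = 1 ==> abs (X p y) <= C*exp (-decay*y)*exp (-decay * snd p)"
  and vanish: "!!p y. above p = 0 ==> X p y = 0" and C: "0 <= C"
  shows "dominated grid_measure grid_g lborel line_k X" unfolding dominated_def dominated_by_def
proof (intro exI conjI allI)
  show "0 <= C*exp (rate*N)" using C by simp
  fix p y
  have "abs (X p y) <= C*(above p*exp (-decay * snd p))*exp (-decay*y)"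
    using above_cases[of p] bound[of p y] vanish[of p y] by (auto simp: mult_ac)
  also have "... <= C*(exp (rate*N)*grid_g p)*exp (-decay*y)" by (intro mult_right_mono mult_left_mono above_exp_le_grid_g C) auto
  finally show "abs (X p y) <= C*exp (rate*N)*grid_g p*line_k y" by (simp add: line_k_def mult_ac)
qed (simp_all add: space_pair_measure meas)

lemma dominated_killed_factor: "dominated grid_measure grid_g lborel line_k killed_factor"
proof (rule dominated_factorI)
  show "(%p. killed_factor (fst p) (snd p)) \<in> bmeas (grid_measure \<Otimes>\<^sub>M lborel)"
    unfolding killed_factor_def by (rule measurable_compose_countable'[where g="%p. fst (fst p)" and I=UNIV
    and f="%i p. above (fst p)*killed_airy (N - i) (snd (fst p)) (snd p)"]) auto
  show "abs (killed_factor p y) <= exp (decay ^ 3/3 + 2*L*decay^2)*exp (-decay*y)*exp (-decay * snd p)" if "above p = 1" for p y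
    using exp_boundedD(2)[OF killed_airy_exp_bounded[OF decay(2)], of "N - fst p" "snd p" y] that by (simp add: killed_factor_def)
qed (simp_all add: killed_factor_def)

lemma dominated_airy_factor: "dominated grid_measure grid_g lborel line_k airy_factor"
proof (rule dominated_factorI)
  show "(%p. airy_factor (fst p) (snd p)) \<in> bmeas (grid_measure \<Otimes>\<^sub>M lborel)" unfolding airy_factor_def by measurable
  show "abs (airy_factor p y) <= exp (decay ^ 3/3 + L*decay^2)*exp (-decay*y)*exp (-decay * snd p)" if "above p = 1" for p y
  proof -
    have "0 <= real (fst p)*dt" "real (fst p)*dt <= L" using dt_pos time_le[of p] that by auto
    then have "exp_bounded decay (exp (decay ^ 3/3 + L*decay^2)*exp (-decay*y)) (%x. airy_tilt (real (fst p)*dt + 1) (x + y))"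
      using decay L by (intro airy_tilt_exp_bounded) auto
    from exp_boundedD(2)[OF this, of "snd p"] show ?thesis using that by (simp add: airy_factor_def)
  qed
qed (simp_all add: airy_factor_def)

lemma heat_factor_bound:
  assumes t: "1 <= t" "t <= L + 1" and z: "0 < z"
  shows "heat t (y - z) <= exp ((L + 1)*(decay + 2)^2)*line_g y*exp (-z)"
proof -
  define C where "C = exp ((L + 1)*(decay + 2)^2)"
  have tilted: "heat t (y - z) <= C*exp (et*(y - z))" if et: "0 <= et" "et <= decay + 2" for et
  proof -
    have "heat t (y - z) <= exp (t*(-et)^2)/sqrt (4*pi*t)*exp (-(-et)*(y - z))" by (rule heat_exp_bound) (use t in auto)
    also have "... <= C/1*exp (et*(y - z))"
    proof -
      have "t*et^2 <= (L + 1)*(decay + 2)^2" using t et by (intro mult_mono power_mono) auto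
      moreover have "1 <= 4*pi*t" using pi_gt3 t mult_mono[of 1 "4*pi" 1 t] by auto
      ultimately show ?thesis unfolding C_def by (intro mult_mono frac_le) auto
    qed
    finally show ?thesis by simp
  qed
  have "heat t (y - z) <= C*exp (1*(y - z))" by (rule tilted) (use decay in auto)
  then have slow: "heat t (y - z) <= C*exp y*exp (-z)" by (simp add: exp_diff exp_minus field_simps)
  have "1*z <= (decay + 2)*z" using z decay by (intro mult_right_mono) auto
  then have "C*exp ((decay + 2)*(y - z)) <= C*exp ((decay + 2)*y + - z)" by (simp add: C_def right_diff_distrib)
  with tilted[of "decay + 2"] decay have "heat t (y - z) <= C*exp ((decay + 2)*y)*exp (-z)" unfolding exp_add by simp
  with slow show ?thesis unfolding line_g_def min_def C_def by auto
qed

lemma dominated_heat_factor: "dominated lborel line_g grid_measure grid_k heat_factor" unfolding dominated_def dominated_by_def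
proof (intro conjI exI allI)
  define C where "C = exp ((L + 1)*(decay + 2)^2)"
  show "0 <= C" by (simp add: C_def)
  show "(%p. heat_factor (fst p) (snd p)) \<in> bmeas (lborel \<Otimes>\<^sub>M grid_measure)" unfolding heat_factor_def by measurable
  fix y p
  show "abs (heat_factor y p) <= C*line_g y*grid_k p"
  proof (cases "above p = 0")
    case True
    then show ?thesis by (simp add: heat_factor_def grid_k_def)
  next
    case False
    then have p: "above p = 1" "0 < snd p" using above_cases[of p] by auto
    have t: "1 <= real (fst p)*dt + 1" "real (fst p)*dt + 1 <= L + 1" using time_le[OF False] dt_pos by auto
    have "heat (real (fst p)*dt + 1) (y - snd p) <= C*line_g y*exp (-snd p)" unfolding C_def by (rule heat_factor_bound[OF t p(2)])
    also have "... <= C*line_g y*grid_k p" using above_exp_le_grid_k[of p] p by (intro mult_left_mono) (auto simp: C_def line_g_def)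
    finally show ?thesis using p t by (simp add: heat_factor_def)
  qed
qed (simp_all add: space_pair_measure)

lemma airy_part_eq: "airy_part = kcomp lborel airy_factor heat_factor"
proof (intro ext)
  fix p q :: "nat \<times> real"
  have pos: "0 < real (fst q)*dt + 1" using dt_pos by (simp add: add_nonneg_pos)
  have "kcomp lborel airy_factor heat_factor p q
    = (LBINT y. above p*above q*(airy_tilt (real (fst p)*dt + 1) (snd p + y)*heat (real (fst q)*dt + 1) (y - snd q)))"
    unfolding kcomp_def airy_factor_def heat_factor_def by (simp add: mult_ac)
  also have "... = above p*above q*airy_tilt ((real (fst p)*dt + 1) - (real (fst q)*dt + 1)) (snd p + snd q)"
    using airy_tilt_semigroup(1)[OF pos] by simp
  also have "... = airy_part p q" unfolding airy_part_def by (simp add: left_diff_distrib)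
  finally show "airy_part p q = kcomp lborel airy_factor heat_factor p q" by simp
qed

lemma kcomp_grid:
  assumes "integrable grid_measure (%q. X p q*Y q y)" "!!j z. N < j ==> X p (j, z)*Y (j, z) y = 0"
  shows "kcomp grid_measure X Y p y = (\<Sum>j<Suc N. LBINT z. X p (j, z)*Y (j, z) y)"
  unfolding kcomp_def by (rule integral_grid) (use assms in auto)

lemma kcomp_heat_part_killed_factor:
  assumes p: "above p = 1"
  defines "n \<equiv> N - fst p"
  shows "kcomp grid_measure heat_part killed_factor p y = (\<Sum>m<n. overshoot m ((real n - real m)*dt) (snd p) y)"
proof -
  define i where "i = fst p"
  have i: "i <= N" "real n = real N - real i" using p above_cases[of p] by (auto simp: i_def n_def)
  obtain C where "dominated_by C grid_measure grid_g lborel line_k killed_factor" using dominated_killed_factor by (auto simp: dominated_def)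
  from G.kcomp_integrable[OF heat_part_kernel this]
  have "kcomp grid_measure heat_part killed_factor p y = (\<Sum>j<Suc N. LBINT z. heat_part p (j, z)*killed_factor (j, z) y)"
    by (rule kcomp_grid) (simp add: killed_factor_def above_def)
  also have "... = (\<Sum>j\<in>{i<..N}. overshoot (N - j) ((real n - real (N - j))*dt) (snd p) y)" unfolding overshoot_def
  proof (rule sum.mono_neutral_cong_right)
    show "\<forall>j\<in>{..<Suc N} - {i<..N}. (LBINT z. heat_part p (j, z)*killed_factor (j, z) y) = 0"
      by (auto simp: heat_part_def i_def not_less)
    fix j assume j: "j \<in> {i<..N}"
    then have "real n - real (N - j) = real j - real i" using i by simp
    moreover have "heat_part p (j, z)*killed_factor (j, z) y = heat ((real j - real i)*dt) (snd p - z)*(ind {c<..} z*killed_airy (N - j) z y)" for z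
      unfolding heat_part_def killed_factor_def using p j heat_minus_commute[of _ z "snd p"] by (auto simp: above_def indicator_def i_def)
    ultimately show "(LBINT z. heat_part p (j, z)*killed_factor (j, z) y)
      = (LBINT z. heat ((real n - real (N - j))*dt) (snd p - z)*(ind {c<..} z*killed_airy (N - j) z y))" by simp
  qed auto
  also have "... = (\<Sum>m<n. overshoot m ((real n - real m)*dt) (snd p) y)"
    by (rule sum.reindex_bij_witness[of _ "%m. N - m" "%j. N - j"]) (use i(1) in \<open>auto simp: n_def i_def[symmetric]\<close>)
  finally show ?thesis .
qed

lemma killed_factor_eq: "killed_factor p y = airy_factor p y - kcomp grid_measure heat_part killed_factor p y"
proof (cases "above p = 0")
  case True
  then show ?thesis by (simp add: killed_factor_def airy_factor_def kcomp_def heat_part_def)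
next
  case False
  then have p: "above p = 1" "fst p <= N" using above_cases[of p] by auto
  then have "real N - real (N - fst p) = real (fst p)" by simp
  then show ?thesis using airy_tilt_eq_killed_plus_overshoots[of "N - fst p" "snd p" y] p
    unfolding kcomp_heat_part_killed_factor[OF p(1)] by (simp add: killed_factor_def airy_factor_def)
qed

definition grid_kernel :: "real => real => real" where
  "grid_kernel y y' = (LBINT x. heat 1 (y - x)*excess x y')"

lemma kcomp_heat_factor_killed_factor: "kcomp grid_measure heat_factor killed_factor = grid_kernel"
proof (intro ext)
  fix y y'
  obtain C D where "dominated_by C lborel line_g grid_measure grid_k heat_factor" "dominated_by D grid_measure grid_g lborel line_k killed_factor"
    using dominated_heat_factor dominated_killed_factor by (auto simp: dominated_def)
  from G.kcomp_integrable[OF this]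
  have "kcomp grid_measure heat_factor killed_factor y y' = (\<Sum>j<Suc N. LBINT z. heat_factor y (j, z)*killed_factor (j, z) y')"
    by (rule kcomp_grid) (simp add: killed_factor_def above_def)
  also have "... = (\<Sum>m<Suc N. overshoot m ((real N - real m)*dt + 1) y y')"
  proof (rule sum.reindex_bij_witness[of _ "%m. N - m" "%j. N - j"])
    fix j assume j: "j \<in> {..<Suc N}"
    then have "real N - real (N - j) = real j" by simp
    moreover have "heat_factor y (j, z)*killed_factor (j, z) y' = heat (real j*dt + 1) (y - z)*(ind {c<..} z*killed_airy (N - j) z y')" for z
      unfolding heat_factor_def killed_factor_def using j by (auto simp: above_def indicator_def)
    ultimately show "overshoot (N - j) ((real N - real (N - j))*dt + 1) y y' = (LBINT z. heat_factor y (j, z)*killed_factor (j, z) y')"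
      by (simp add: overshoot_def)
  qed auto
  also have "... = grid_kernel y y'" unfolding grid_kernel_def heat_excess ..
  finally show "kcomp grid_measure heat_factor killed_factor y y' = grid_kernel y y'" .
qed

theorem airy1_fredholm_grid: "airy1_fredholm (Suc N) (%j. real j*(L/real N)) (%_. c) = fredholm lborel grid_kernel"
proof -
  define B where "B = kcomp lborel killed_factor heat_factor"
  obtain CX CA CY where X: "dominated_by CX grid_measure grid_g lborel line_k killed_factor"
    and airy: "dominated_by CA grid_measure grid_g lborel line_k airy_factor" and Y: "dominated_by CY lborel line_g grid_measure grid_k heat_factor"
    using dominated_killed_factor dominated_airy_factor dominated_heat_factor by (auto simp: dominated_def)
  note A = H.dominated_by_kcomp[OF airy Y, folded airy_part_eq] and B = H.dominated_by_kcomp[OF X Y, folded B_def]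
  note VX = G.dominated_by_kcomp[OF heat_part_kernel X]
  have B_eq: "B p q = airy_part p q - kcomp grid_measure heat_part B p q" for p q
  proof -
    have "B p q = (LBINT y. airy_factor p y*heat_factor y q - kcomp grid_measure heat_part killed_factor p y*heat_factor y q)"
      unfolding B_def kcomp_def[of lborel] by (subst killed_factor_eq) (simp add: left_diff_distrib)
    also have "... = airy_part p q - kcomp lborel (kcomp grid_measure heat_part killed_factor) heat_factor p q"
      unfolding airy_part_eq kcomp_def[of lborel] by (intro LINT_diff H.kcomp_integrable[OF airy Y] H.kcomp_integrable[OF VX Y])
    also have "kcomp lborel (kcomp grid_measure heat_part killed_factor) heat_factor = kcomp grid_measure heat_part B"
      unfolding B_def by (rule G.kcomp_assoc_dominated_by[OF H.weighted_measure_axioms heat_part_kernel X Y])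
    finally show ?thesis .
  qed
  have "airy1_fredholm (Suc N) (%j. real j*dt) (%_. c) = fredholm grid_measure (%p q. airy_part p q - heat_part p q)"
    using airy1_fredholm_eq_fredholm[OF G.weighted_measure_axioms, of _ "Suc N" "%j. real j*dt" c] G.kernel_diff[OF A heat_part_kernel]
    unfolding ext_kernel_eq by blast
  also have "... = fredholm grid_measure B" by (rule G.fredholm_triangular[OF B A heat_part_kernel B_eq trpow_heat_part heat_part_small])
  also have "... = fredholm lborel grid_kernel" unfolding fredholm_def B_def kcomp_heat_factor_killed_factor[symmetric]
    using trpow_kcomp_commute[OF G.weighted_measure_axioms H.weighted_measure_axioms dominated_killed_factor dominated_heat_factor] by presburger
  finally show ?thesis unfolding dt_def .
qed

end

section \<open>The continuum limit\<close>

definition absorbed_excess :: "real => real => real => real => real" where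
  "absorbed_excess L c x y
  = airy_tilt 1 (x + y) - ind {..c} x*(LBINT z. ind {..c} z*absorbed c L x z*airy_tilt (L + 1) (z + y))"

definition limit_kernel :: "real => real => real => real => real" where
  "limit_kernel L c y y' = (LBINT x. heat 1 (y - x)*absorbed_excess L c x y')"

definition lost :: "real => real => (real => real) => nat => real => real" where
  "lost dt c f n x = (LBINT z. heat (real n*dt) (x - z)*f z) - killed dt c f n x"

lemma lost_scale: "lost dt c (%x. u*f x) n x = u*lost dt c f n x"
  by (simp add: lost_def killed_scale right_diff_distrib mult.left_commute[of _ u])

lemma abs_lost_le:
  assumes dt: "0 < dt" and f: "exp_bounded a B f" and x: "x <= c" and n: "0 < n"
  shows "abs (lost dt c f n x) <= B*lost dt c (%z. exp (-a*z)) n x"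
proof -
  have t: "0 < real n*dt" using dt n by simp
  have "0 <= B*lost dt c (%z. exp (-a*z)) n x + u*lost dt c f n x" if u: "abs u = 1" for u
  proof -
    let ?e = "%z. B*exp (-a*z)" and ?f = "%z. u*f z"
    have f_le: "abs (?f z) <= ?e z" for z using exp_boundedD(2)[OF f, of z] u by (simp add: abs_mult)
    have meas: "?f \<in> bmeas borel" using exp_boundedD(1)[OF f] by measurable
    have exp_e: "exp_bounded a B ?e" using exp_boundedD(3)[OF f] by (simp add: exp_bounded_def)
    have uf: "exp_bounded a B ?f" using meas f_le by (simp add: exp_bounded_def)
    have nonneg: "0 <= ?e z + ?f z" and sum_le: "abs (?e z + ?f z) <= 2*B*exp (-a*z)" for z using f_le[of z] by auto
    have sum: "exp_bounded a (2*B) (%z. ?e z + ?f z)" unfolding exp_bounded_def using sum_le meas by simp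
    have "0 <= (LBINT z. heat (real n*dt) (x - z)*(?e z + ?f z)) - killed dt c (%z. ?e z + ?f z) n x"
      using killed_le_heat[OF dt sum nonneg x n] by simp
    also have "... = lost dt c ?e n x + lost dt c ?f n x" unfolding lost_def killed_add[OF dt exp_e uf] distrib_left
      LINT_add[OF heat_exp_bounded(1)[OF t exp_e] heat_exp_bounded(1)[OF t uf]] by simp
    finally show ?thesis by (simp only: lost_scale)
  qed
  from this[of 1] this[of "-1"] show ?thesis by simp
qed

lemma heat_minus_absorbed_le:
  fixes a :: real
  assumes L: "0 < L" and x: "x <= c"
  defines "E \<equiv> exp (L*(2*a)^2)/sqrt (4*pi*L)"
  shows "heat L (x - z)*exp (-a*z) - ind {..c} z*absorbed c L x z*exp (-a*z)
  <= E*exp (2*a*x)*(ind {c..} z*exp (-(3*a)*z) + exp (-4*a*c)*(ind {..c} z*exp (a*z)))"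
proof -
  have E: "0 <= E" using L by (simp add: E_def)
  show ?thesis
  proof (cases "z <= c")
    case True
    have "heat L (2*c - x - z)*exp (-a*z) <= E*exp (-(2*a)*(2*c - x - z))*exp (-a*z)"
      unfolding E_def by (intro mult_right_mono heat_exp_bound L) auto
    also have "... = E*exp (2*a*x)*(exp (-4*a*c)*exp (a*z))" by (simp only: mult.assoc exp_add[symmetric]) (simp add: algebra_simps)
    also have "... <= E*exp (2*a*x)*(ind {c..} z*exp (-(3*a)*z) + exp (-4*a*c)*(ind {..c} z*exp (a*z)))"
      using True E by (intro mult_left_mono) auto
    finally show ?thesis using True by (simp add: absorbed_def left_diff_distrib)
  next
    case False
    have "heat L (z - x)*exp (-a*z) <= E*exp (-(2*a)*(z - x))*exp (-a*z)" unfolding E_def by (intro mult_right_mono heat_exp_bound L) auto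
    also have "... = E*exp (2*a*x)*exp (-(3*a)*z)" by (simp only: mult.assoc exp_add[symmetric]) (simp add: algebra_simps)
    finally show ?thesis using False heat_minus_commute[of L x z] by simp
  qed
qed

lemma lost_exp_bound:
  assumes L: "0 < L" and a: "0 < a"
  obtains D where "0 <= D"
  and "!!n x. 0 < n ==> x <= c ==> lost (L/real n) c (%z. exp (-a*z)) n x <= D*exp (2*a*x)"
proof
  define E where "E = exp (L*(2*a)^2)/sqrt (4*pi*L)"
  define I where "I z = ind {c..} z*exp (-(3*a)*z) + exp (-4*a*c)*(ind {..c} z*exp (a*z))" for z
  have I: "Leb1 I" using has_bochner_integral_exp_right[of "3*a" c] has_bochner_integral_exp_left[of a c] a unfolding I_def[abs_def]
    by (intro L1_add integrable_mult_right) (auto simp: Leb_iff)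
  show "0 <= E*integral\<^sup>L lborel I" using L by (intro mult_nonneg_nonneg integral_nonneg_AE) (auto simp: E_def I_def)
  fix n :: nat and x assume n: "0 < n" and x: "x <= c"
  have dt: "0 < L/real n" and time: "real n*(L/real n) = L" using L n by auto
  note heat = heat_exp_bounded(1)[OF L exp_bounded_exp, of x a] and absorbed = absorbed_integrable[OF L exp_bounded_exp x order_refl, of a]
  have "(LBINT z. ind {..c} z*absorbed c L x z*exp (-a*z)) <= killed (L/real n) c (%z. exp (-a*z)) n x"
    using killed_ge_absorbed[OF dt exp_bounded_exp _ x n, of a] unfolding time by simp
  then have "lost (L/real n) c (%z. exp (-a*z)) n x
    <= (LBINT z. heat L (x - z)*exp (-a*z)) - (LBINT z. ind {..c} z*absorbed c L x z*exp (-a*z))" unfolding lost_def time by simp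
  also have "... = (LBINT z. heat L (x - z)*exp (-a*z) - ind {..c} z*absorbed c L x z*exp (-a*z))" using heat absorbed by simp
  also have "... <= (LBINT z. E*exp (2*a*x)*I z)"
    unfolding E_def I_def by (intro integral_mono integrable_mult_right I[unfolded I_def[abs_def]] L1_diff heat absorbed heat_minus_absorbed_le L x)
  also have "... = E*integral\<^sup>L lborel I*exp (2*a*x)" by simp
  finally show "lost (L/real n) c (%z. exp (-a*z)) n x <= E*integral\<^sup>L lborel I*exp (2*a*x)" .
qed

definition tail_g :: "real => real => real" where "tail_g L y = min (exp (-(L + 2)*y)) (exp (2*(L + 2)*y))"
definition tail_k :: "real => real => real" where "tail_k L y = exp (-(L + 2)*y)"

lemma weighted_measure_tail: "0 < L ==> weighted_measure lborel (tail_g L) (tail_k L)"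
  unfolding tail_g_def[abs_def] tail_k_def[abs_def] by (rule weighted_measure_exp) auto

lemma mult_tail_g: "0 <= D ==> D*tail_g L x*k = min (D*exp (-(L + 2)*x)*k) (D*exp (2*(L + 2)*x)*k)" if "0 <= k"
  using that by (simp add: tail_g_def min_mult_distrib_left min_mult_distrib_right)

lemma dominated_by_smoothed:
  assumes "dominated_by D lborel (tail_g L) lborel (tail_k L) u"
  shows "dominated_by (D*exp (4*(L + 2)^2)) lborel (tail_g L) lborel (tail_k L) (%y y'. LBINT x. heat 1 (y - x)*u x y')"
proof -
  note D = dominated_byD[OF assms]
  have [measurable]: "(%p. u (f p) (h p)) \<in> bmeas N" if "f \<in> borel_measurable N" "h \<in> borel_measurable N" for f h and N :: "'a measure"
    using dominated_by_measurable[OF assms] that by simp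
  have "abs (LBINT x. heat 1 (y - x)*u x y') <= D*exp (4*(L + 2)^2)*tail_g L y*tail_k L y'" for y y'
  proof -
    define a where "a = L + 2"
    have k: "0 <= tail_k L y'" by (simp add: tail_k_def)
    have "abs (u x y') <= min (D*tail_k L y'*exp (-a*x)) (D*tail_k L y'*exp (-(-2*a)*x))" for x
      using D(4)[of x y'] unfolding mult_tail_g[OF k D(1), where L=L, folded a_def] by (simp add: mult_ac)
    then have "exp_bounded a (D*tail_k L y') (%x. u x y')" "exp_bounded (-2*a) (D*tail_k L y') (%x. u x y')"
      by (simp_all add: exp_bounded_def)
    from this[THEN heat_exp_bounded(2)[of 1, rotated], of y]
    have slow: "abs (LBINT x. heat 1 (y - x)*u x y') <= D*tail_k L y'*exp (1*a^2)*exp (-a*y)"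
      and fast: "abs (LBINT x. heat 1 (y - x)*u x y') <= D*tail_k L y'*exp (4*a^2)*exp (2*a*y)" by (simp_all add: power_mult_distrib)
    note slow
    also have "D*tail_k L y'*exp (1*a^2)*exp (-a*y) <= D*tail_k L y'*exp (4*a^2)*exp (-a*y)"
      using D(1) k by (intro mult_right_mono mult_left_mono) auto
    finally show ?thesis unfolding a_def[symmetric] using fast mult_tail_g[OF k, of "D*exp (4*a^2)" L, folded a_def] D(1) by (simp add: mult_ac)
  qed
  then show ?thesis using D(1) unfolding dominated_by_def by (auto simp: space_pair_measure)
qed

context airy_grid begin

lemma excess_eq_lost: "x <= c ==> excess x y = lost dt c (%z. airy_tilt (L + 1) (z + y)) N x"
  using airy_tilt_semigroup(1)[OF L, of "L + 1" y x] N_dt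
  by (simp add: excess_def lost_def killed_airy_def heat_minus_commute[of L x] add.commute mult.commute)

lemma dominated_by_excess:
  assumes D: "!!x. x <= c ==> lost dt c (%z. exp (-(L + 2)*z)) N x <= D*exp (2*(L + 2)*x)" "0 <= D"
  shows "dominated_by (exp ((L + 2) ^ 3/3 + 2*L*(L + 2)^2)*(D + 2)) lborel (tail_g L) lborel (tail_k L) excess"
proof -
  define a where "a = L + 2"
  define C where "C = exp (a ^ 3/3 + 2*L*a^2)"
  have C: "0 < C" and a: "0 < a" using L by (simp_all add: C_def a_def)
  have airy: "exp_bounded a (C*exp (-a*y)) (%x. airy_tilt t (x + y))" if "t = 1 \<or> t = L + 1" for t y
    unfolding C_def by (rule airy_tilt_exp_bounded) (use L that in \<open>auto simp: a_def\<close>)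
  have decay: "abs (excess x y) <= C*(D + 2)*exp (-a*x)*exp (-a*y)" for x y
  proof -
    have "abs (excess x y) <= abs (airy_tilt 1 (x + y)) + abs (killed_airy N x y)" by (auto simp: excess_def indicator_def)
    also have "... <= C*exp (-a*y)*exp (-a*x) + C*exp (-a*y)*exp (-a*x)"
      using exp_boundedD(2)[OF airy] exp_boundedD(2)[OF killed_airy_exp_bounded[of a N y]] by (intro add_mono) (simp_all add: C_def a_def)
    also have "... <= C*(D + 2)*exp (-a*x)*exp (-a*y)" using C D(2) by (simp add: algebra_simps)
    finally show ?thesis .
  qed
  have growth: "abs (excess x y) <= C*(D + 2)*exp (2*a*x)*exp (-a*y)" for x y
  proof (cases "x <= c")
    case True
    have "abs (excess x y) <= C*exp (-a*y)*lost dt c (%z. exp (-a*z)) N x"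
      unfolding excess_eq_lost[OF True] by (rule abs_lost_le[OF dt_pos airy True N]) simp
    also have "... <= C*exp (-a*y)*(D*exp (2*a*x))" using C D(1)[OF True] by (simp add: a_def)
    also have "... <= C*(D + 2)*exp (2*a*x)*exp (-a*y)" using C by (simp add: algebra_simps)
    finally show ?thesis .
  next
    case False
    have "abs (excess x y) <= C*exp (-a*y)*exp (-a*x)" using exp_boundedD(2)[OF airy, of 1 x] False by (simp add: excess_def)
    also have "... <= C*exp (-a*y)*((D + 2)*exp (2*a*x))"
    proof -
      have "exp (-a*x) <= 1*exp (2*a*x)" using False c_pos a by simp
      also have "... <= (D + 2)*exp (2*a*x)" using D(2) by (intro mult_right_mono) auto
      finally show ?thesis using C by (intro mult_left_mono) auto
    qed
    finally show ?thesis by (simp add: mult_ac)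
  qed
  have "abs (excess x y) <= C*(D + 2)*tail_g L x*tail_k L y" for x y
    using decay[of x y] growth[of x y] C D(2) by (subst mult_tail_g) (simp_all add: tail_k_def a_def)
  moreover have "(%p. excess (fst p) (snd p)) \<in> bmeas (lborel \<Otimes>\<^sub>M lborel)" unfolding excess_def by measurable
  ultimately show ?thesis using C D(2) unfolding dominated_by_def C_def a_def by simp
qed

end

lemma excess_tendsto:
  assumes L: "0 < L" and c_pos: "0 < c"
  shows "(%N. airy_grid.excess N L c x y) ----> absorbed_excess L c x y"
proof -
  let ?f = "%z. airy_tilt (L + 1) (z + y)"
  have f: "exp_bounded (L + 2) (exp ((L + 2) ^ 3/3 + L*(L + 2)^2)*exp (-(L + 2)*y)) ?f" by (rule airy_tilt_exp_bounded) (use L in auto)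
  have "(%N. ind {..c} x*killed (L/real N) c ?f N x) ----> ind {..c} x*(LBINT z. ind {..c} z*absorbed c L x z*?f z)"
    using killed_tendsto[OF L f, of x c] by (cases "x <= c") simp_all
  then have "(%N. airy_tilt 1 (x + y) - ind {..c} x*killed (L/real N) c ?f N x) ----> absorbed_excess L c x y"
    unfolding absorbed_excess_def by (intro tendsto_diff tendsto_const)
  then show ?thesis
  proof (rule Lim_transform_eventually)
    show "\<forall>\<^sub>F N in sequentially. airy_tilt 1 (x + y) - ind {..c} x*killed (L/real N) c ?f N x = airy_grid.excess N L c x y"
      using eventually_gt_at_top[of 0]
    proof eventually_elim
      case (elim N)
      interpret airy_grid N L c by unfold_locales (use elim L c_pos in auto)
      show ?case by (simp add: excess_def killed_airy_def dt_def)
    qed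
  qed
qed

lemma absorbed_excess_measurable [measurable]:
  assumes [measurable]: "f \<in> bmeas M" "h \<in> bmeas M"
  shows "(%p. absorbed_excess L c (f p) (h p)) \<in> bmeas M" unfolding absorbed_excess_def by measurable

lemma dominated_by_excesses:
  assumes L: "0 < L" and c_pos: "0 < c"
  obtains D where "!!N. 0 < N ==> dominated_by D lborel (tail_g L) lborel (tail_k L) (airy_grid.excess N L c)"
  and "dominated_by D lborel (tail_g L) lborel (tail_k L) (absorbed_excess L c)"
proof -
  obtain D0 where D0: "0 <= D0"
    "!!n x. 0 < n ==> x <= c ==> lost (L/real n) c (%z. exp (-(L + 2)*z)) n x <= D0*exp (2*(L + 2)*x)"
    by (rule lost_exp_bound[OF L, of "L + 2" c]) (use L in auto)
  define D where "D = exp ((L + 2) ^ 3/3 + 2*L*(L + 2)^2)*(D0 + 2)"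
  have grid: "dominated_by D lborel (tail_g L) lborel (tail_k L) (airy_grid.excess N L c)" if N: "0 < N" for N
  proof -
    interpret airy_grid N L c by unfold_locales (use N L c_pos in auto)
    show ?thesis unfolding D_def by (rule dominated_by_excess) (use D0 N in \<open>auto simp: dt_def\<close>)
  qed
  have "abs (absorbed_excess L c x y) <= D*tail_g L x*tail_k L y" for x y
    by (rule tendsto_upperbound[OF tendsto_rabs[OF excess_tendsto[OF L c_pos]] eventually_mono[OF eventually_gt_at_top[of 0] dominated_byD(4)[OF grid]]]) auto
  then have "dominated_by D lborel (tail_g L) lborel (tail_k L) (absorbed_excess L c)" using D0(1) by (simp add: dominated_by_def D_def)
  with grid show ?thesis by (rule that)
qed

lemma grid_kernel_tendsto:
  assumes L: "0 < L" and c_pos: "0 < c"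
  shows "(%N. airy_grid.grid_kernel (Suc N) L c y y') ----> limit_kernel L c y y'"
proof -
  have grid: "airy_grid (Suc N) L c" for N by unfold_locales (use L c_pos in auto)
  obtain D where D: "!!N. 0 < N ==> dominated_by D lborel (tail_g L) lborel (tail_k L) (airy_grid.excess N L c)"
    using dominated_by_excesses[OF L c_pos] by blast
  let ?w = "%x. D*exp (-(L + 2)*y')*(heat 1 (y - x)*exp (-(L + 2)*x))"
  have "(%N. LBINT x. heat 1 (y - x)*airy_grid.excess (Suc N) L c x y') ----> limit_kernel L c y y'" unfolding limit_kernel_def
  proof (rule integral_dominated_convergence[where w="?w"])
    show "Leb1 ?w" by (rule integrable_mult_right[OF heat_exp_bounded(1)[OF _ exp_bounded_exp]]) simp
    show "AE x in lborel. (%N. heat 1 (y - x)*airy_grid.excess (Suc N) L c x y') ----> heat 1 (y - x)*absorbed_excess L c x y'"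
      using LIMSEQ_Suc[OF excess_tendsto[OF L c_pos]] by (auto intro!: AE_I2 tendsto_intros)
    fix N
    note bound = D[of "Suc N", simplified]
    have "abs (airy_grid.excess (Suc N) L c x y') <= D*exp (-(L + 2)*x)*exp (-(L + 2)*y')" for x
      using dominated_byD(4)[OF bound, of x y'] dominated_byD(1)[OF bound] by (simp add: mult_tail_g tail_k_def)
    then have "heat 1 (y - x)*abs (airy_grid.excess (Suc N) L c x y') <= heat 1 (y - x)*(D*exp (-(L + 2)*x)*exp (-(L + 2)*y'))" for x
      by (intro mult_left_mono) auto
    then show "AE x in lborel. norm (heat 1 (y - x)*airy_grid.excess (Suc N) L c x y') <= ?w x" by (simp add: abs_mult mult_ac)
    show "(%x. heat 1 (y - x)*airy_grid.excess (Suc N) L c x y') \<in> bmeas lborel"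
      using dominated_by_measurable[OF bound, of "%x. x" lborel "%x. y'"] by measurable
  qed measurable
  then show ?thesis unfolding airy_grid.grid_kernel_def[OF grid] .
qed

lemma airy1_fredholm_tendsto:
  assumes L: "0 < L" and c_pos: "0 < c"
  shows "(%N. airy1_fredholm (Suc (Suc N)) (%j. real j*(L/real (Suc N))) (%_. c)) ----> fredholm lborel (limit_kernel L c)"
proof -
  interpret weighted_measure lborel "tail_g L" "tail_k L" by (rule weighted_measure_tail[OF L])
  have grid: "airy_grid (Suc N) L c" for N by unfold_locales (use L c_pos in auto)
  obtain D where D: "!!N. 0 < N ==> dominated_by D lborel (tail_g L) lborel (tail_k L) (airy_grid.excess N L c)"
    "dominated_by D lborel (tail_g L) lborel (tail_k L) (absorbed_excess L c)" using dominated_by_excesses[OF L c_pos] by blast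
  have "kernel (D*exp (4*(L + 2)^2)) (airy_grid.grid_kernel (Suc N) L c)" for N
    using dominated_by_smoothed[OF D(1)[of "Suc N"]] by (simp add: airy_grid.grid_kernel_def[OF grid, abs_def])
  moreover have "kernel (D*exp (4*(L + 2)^2)) (limit_kernel L c)"
    using dominated_by_smoothed[OF D(2)] by (simp add: limit_kernel_def[abs_def])
  ultimately show ?thesis unfolding airy_grid.airy1_fredholm_grid[OF grid] by (intro fredholm_tendsto grid_kernel_tendsto L c_pos)
qed

lemma dyadic_floor_tendsto: "(%n. of_int \<lfloor>x*2 ^ n\<rfloor>/2 ^ n) ----> (x::real)"
proof (rule tendsto_sandwich[OF _ _ _ tendsto_const])
  have "x - 1/2 ^ n <= of_int \<lfloor>x*2 ^ n\<rfloor>/2 ^ n" for n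
  proof -
    have "x*2 ^ n - 1 <= of_int \<lfloor>x*2 ^ n\<rfloor>" by linarith
    from divide_right_mono[OF this, of "2 ^ n"] show ?thesis by (simp add: diff_divide_distrib)
  qed
  then show "\<forall>\<^sub>F n in sequentially. x - 1/2 ^ n <= of_int \<lfloor>x*2 ^ n\<rfloor>/2 ^ n" by simp
  show "\<forall>\<^sub>F n in sequentially. of_int \<lfloor>x*2 ^ n\<rfloor>/2 ^ n <= x" by (simp add: divide_le_eq)
  show "(%n. x - 1/2 ^ n) ----> x" by real_asymp
qed

lemma dyadic_grid_le_iff:
  fixes f :: "real => real"
  assumes f: "continuous_on UNIV f" and L: "0 < L"
  shows "(\<forall>n. \<forall>k<Suc (2 ^ n). f (real k*(L/2 ^ n)) <= c) \<longleftrightarrow> (\<forall>s\<in>{0..L}. f s <= c)"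
proof (intro iffI ballI allI impI)
  fix s assume grid: "\<forall>n. \<forall>k<Suc (2 ^ n). f (real k*(L/2 ^ n)) <= c" and s: "s \<in> {0..L}"
  define k where "k n = nat \<lfloor>s/L*2 ^ n\<rfloor>" for n :: nat
  have k: "real (k n) = of_int \<lfloor>s/L*2 ^ n\<rfloor>" "k n < Suc (2 ^ n)" for n
  proof -
    have "0 <= s/L*2 ^ n" "s/L*2 ^ n <= 1*2 ^ n" using s L by (simp, intro mult_right_mono) auto
    then show "real (k n) = of_int \<lfloor>s/L*2 ^ n\<rfloor>" "k n < Suc (2 ^ n)"
      unfolding k_def less_Suc_eq_le by (auto simp: floor_le_iff nat_le_iff)
  qed
  have "(%n. of_int \<lfloor>s/L*2 ^ n\<rfloor>/2 ^ n*L) ----> s/L*L" by (intro tendsto_intros dyadic_floor_tendsto)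
  then have "(%n. real (k n)*(L/2 ^ n)) ----> s" using L by (simp add: k)
  then have "(%n. f (real (k n)*(L/2 ^ n))) ----> f s" using f by (intro continuous_on_tendsto_compose[where s=UNIV and f=f]) auto
  then show "f s <= c" using grid k(2) by (intro LIMSEQ_le_const2) auto
next
  fix n k :: nat assume below: "\<forall>s\<in>{0..L}. f s <= c" and "k < Suc (2 ^ n)"
  then have "real k <= 2 ^ n" using of_nat_mono[of k "2 ^ n", where ?'a=real] by simp
  from mult_right_mono[OF this, of "L/2 ^ n"] have "real k*(L/2 ^ n) \<in> {0..L}" using L by simp
  with below show "f (real k*(L/2 ^ n)) <= c" by blast
qed

theorem airy1_process_fredholm:
  fixes X :: "real => 'a => real"
  assumes X: "is_airy1_process M X" and L: "0 < L" and c_pos: "0 < c"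
  shows "measure M {om \<in> space M. \<forall>s\<in>{0..L}. X s om <= c} = fredholm lborel (limit_kernel L c)"
proof -
  interpret prob_space M using X by (simp add: is_airy1_process_def)
  have [measurable]: "X t \<in> bmeas M" for t using X by (simp add: is_airy1_process_def)
  define A where "A n = {om \<in> space M. \<forall>k<Suc (2 ^ n). X (real k*(L/2 ^ n)) om <= c}" for n
  have "decseq A"
  proof (rule decseq_SucI, rule subsetI)
    fix n om assume om: "om \<in> A (Suc n)"
    have "X (real k*(L/2 ^ n)) om <= c" if "k < Suc (2 ^ n)" for k
    proof -
      have "2*k < Suc (2 ^ Suc n)" using that by simp
      then have "X (real (2*k)*(L/2 ^ Suc n)) om <= c" using om unfolding A_def by blast
      then show ?thesis by simp
    qed
    then show "om \<in> A n" using om by (auto simp: A_def)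
  qed
  moreover have "A n \<in> sets M" for n unfolding A_def by measurable
  ultimately have "(%n. measure M (A n)) ----> measure M (\<Inter>n. A n)" by (intro finite_Lim_measure_decseq) auto
  moreover have "(\<Inter>n. A n) = {om \<in> space M. \<forall>s\<in>{0..L}. X s om <= c}"
  proof -
    have "continuous_on UNIV (%t. X t om)" if "om \<in> space M" for om using X that by (simp add: is_airy1_process_def)
    from dyadic_grid_le_iff[OF this L, of _ c] show ?thesis by (auto simp: A_def)
  qed
  moreover have "measure M (A n) = airy1_fredholm (Suc (2 ^ n)) (%j. real j*(L/real (2 ^ n))) (%_. c)" for n
  proof -
    have "\<forall>i j. i < j --> j < Suc (2 ^ n) --> real i*(L/2 ^ n) < real j*(L/2 ^ n)" using L by (intro allI impI mult_strict_right_mono) auto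
    then show ?thesis using X unfolding is_airy1_process_def A_def by auto
  qed
  moreover have "(%n. airy1_fredholm (Suc (2 ^ n)) (%j. real j*(L/real (2 ^ n))) (%_. c)) ----> fredholm lborel (limit_kernel L c)"
  proof -
    have "filterlim (%n. 2 ^ n - 1 :: nat) sequentially sequentially"
      by (intro filterlim_subseq strict_monoI_Suc) (simp add: diff_less_mono)
    from filterlim_compose[OF airy1_fredholm_tendsto[OF L c_pos] this] show ?thesis by simp
  qed
  ultimately show ?thesis by (auto intro: LIMSEQ_unique)
qed

section \<open>First-passage decomposition\<close>

lemma Fubini_rows:
  fixes f :: "real => real => real"
  assumes f: "(%p. f (fst p) (snd p)) \<in> bmeas (lborel \<Otimes>\<^sub>M lborel)" and rows: "!!x. Leb1 (f x)"
  and bound: "!!x. (LBINT y. abs (f x y)) <= h x" and h: "Leb1 h"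
  shows "(LBINT x. (LBINT y. f x y)) = (LBINT y. (LBINT x. f x y))"
proof -
  have [measurable]: "(%x. f (a x) (b x)) \<in> bmeas M" if "a \<in> bmeas M" "b \<in> bmeas M" for a b and M :: "'c measure"
    using measurable_compose[OF measurable_Pair[of a M lborel b lborel] f] that by simp
  have "integrable (lborel \<Otimes>\<^sub>M lborel) (%p. f (fst p) (snd p))"
  proof (rule lborel_pair.Fubini_integrable)
    show "Leb1 (%x. LBINT y. norm (f (fst (x, y)) (snd (x, y))))"
      by (rule L1_bound[OF h]) (use bound in \<open>auto intro!: AE_I2 order_trans[OF bound] simp: abs_of_nonneg\<close>)
  qed (use rows in auto)
  then have "integrable (lborel \<Otimes>\<^sub>M lborel) (case_prod f)" by (simp add: case_prod_beta')
  from lborel_pair.Fubini_integral[OF this] show ?thesis by simp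
qed

lemma inv_sqrt_integral:
  assumes L: "0 <= L"
  shows "Leb_has (%s. ind {0<..L} s*(1/sqrt s)) (2 * sqrt L)"
proof (cases "0 < L")
  case True
  have lim: "(((%s. 2 * sqrt s) \<circ> real_of_ereal) \<longlongrightarrow> 2 * sqrt 0) (at_right (ereal 0))" "(((%s. 2 * sqrt s) \<circ> real_of_ereal) \<longlongrightarrow> 2 * sqrt L) (at_left (ereal L))"
    unfolding ereal_tendsto_simps1 by (intro tendsto_intros)+
  have FTC: "set_integrable lborel (einterval (ereal 0) (ereal L)) (%s. 1/sqrt s)" "(LBINT s = ereal 0..ereal L. 1/sqrt s) = 2 * sqrt L - 2 * sqrt 0"
    by (rule interval_integral_FTC_nonneg[OF _ _ _ _ lim]; use True in \<open>auto intro!: derivative_eq_intros continuous_intros simp: field_simps\<close>)+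
  have ae: "AE s in lborel. ind {0<..<L} s*(1/sqrt s) = ind {0<..L} s*(1/sqrt s)"
    using AE_lborel_singleton[of L] by eventually_elim (auto simp: indicator_def)
  have "Leb_has (%s. ind {0<..<L} s*(1/sqrt s)) (2 * sqrt L)"
    using FTC True by (simp add: Leb_iff set_integrable_def interval_lebesgue_integral_def set_lebesgue_integral_def einterval_eq)
  then show ?thesis by (subst (asm) has_bochner_integral_cong_AE[OF _ _ ae]) auto
qed (use L in \<open>auto simp: Leb_iff\<close>)

lemma inv_sqrt_integrable: "Leb1 (%s. ind {0<..L} s*(1/sqrt s))" using inv_sqrt_integral[of L] by (cases "0 <= L") (auto simp: Leb_iff)

lemma Gauss_primitive:
  obtains Ph where "!!z. (Ph has_real_derivative exp (-z\<^sup>2)) (at z)"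
  "(Ph \<longlongrightarrow> Ph 0 + sqrt pi/2) at_top" "(Ph \<longlongrightarrow> Ph 0 - sqrt pi/2) at_bot"
proof -
  obtain Ph where Ph: "!!z. (Ph has_real_derivative exp (-z\<^sup>2)) (at z)"
    using einterval_antiderivative[of "-\<infinity>" "\<infinity>" "%z::real. exp (-z\<^sup>2)"]
    by (auto simp: has_real_derivative_iff_has_vector_derivative)
  have "((%y. LBINT x. ind {..y} x *\<^sub>R (ind {0..} x *\<^sub>R exp (-x\<^sup>2))) \<longlongrightarrow> (LBINT x. ind {0..} x *\<^sub>R exp (-x\<^sup>2 :: real))) at_top"
    by (rule tendsto_integral_at_top[where M=lborel and f="%x. ind {0..} x *\<^sub>R exp (-x\<^sup>2) :: real"])
    (use gaussian_moment_0 in \<open>auto simp: Leb_iff\<close>)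
  then have l: "((%y. LBINT x. ind {..y} x *\<^sub>R (ind {0..} x *\<^sub>R exp (-x\<^sup>2))) \<longlongrightarrow> sqrt pi/2) at_top"
    unfolding Leb_eq[OF gaussian_moment_0] .
  have "\<forall>\<^sub>F y in at_top. Ph 0 + (LBINT x. ind {..y} x *\<^sub>R (ind {0..} x *\<^sub>R exp (-x\<^sup>2))) = Ph y"
    using eventually_ge_at_top[of 0]
  proof eventually_elim
    case (elim y)
    have "(LBINT x. exp (-x\<^sup>2)*ind {0..y} x) = Ph y - Ph 0"
      by (rule integral_FTC_Icc_real[OF elim]) (auto intro: Ph continuous_intros)
    moreover have "(%x. ind {..y} x *\<^sub>R (ind {0..} x *\<^sub>R exp (-x\<^sup>2))) = (%x. exp (-x\<^sup>2)*ind {0..y} x)"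
      by (auto simp: indicator_def)
    ultimately show ?case by simp
  qed
  then have top: "(Ph \<longlongrightarrow> Ph 0 + sqrt pi/2) at_top" by (rule Lim_transform_eventually[OF tendsto_add[OF tendsto_const l]])
  have "((%y. Ph y + Ph (-y)) has_real_derivative 0) (at y)" for y
    using DERIV_add[OF Ph[of y] DERIV_mirror[THEN iffD1, OF Ph[of "- y"]]] by (simp)
  then have "Ph y + Ph (-y) = Ph 0 + Ph (-0)" for y using DERIV_isconst_all[of "%y. Ph y + Ph (-y)" y 0] by simp
  then have odd: "Ph y = 2*Ph 0 - Ph (-y)" for y by (simp add: algebra_simps)
  have "((%y. 2*Ph 0 - Ph (-y)) \<longlongrightarrow> 2*Ph 0 - (Ph 0 + sqrt pi/2)) at_bot"
    by (intro tendsto_intros filterlim_compose[OF top] filterlim_uminus_at_top_at_bot)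
  then have "(Ph \<longlongrightarrow> Ph 0 - sqrt pi/2) at_bot" unfolding odd[symmetric] by simp
  with Ph top show ?thesis using that by blast
qed

context
  fixes L :: real
  assumes L: "0 < L"
begin

definition time_odds :: "real => real" where "time_odds t = sqrt ((L - t)/t)"

definition phase :: "real => real => real => real" where
  "phase u v t = (u*time_odds t + v/time_odds t)/(2 * sqrt L)"

lemma time_odds: "0 < t ==> t < L ==> 0 < time_odds t" "0 < t ==> t < L ==> (time_odds t)^2 = (L - t)/t" by (auto simp: time_odds_def)

lemma DERIV_time_odds:
  assumes t: "0 < t" "t < L"
  shows "(time_odds has_real_derivative - L/(2*t^2*time_odds t)) (at t)"
proof -
  have "((%t. (L - t)/t) has_real_derivative - L/t^2) (at t)"
    using t by (auto intro!: derivative_eq_intros simp: power2_eq_square field_simps)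
  from DERIV_chain2[OF DERIV_real_sqrt this] t show ?thesis unfolding time_odds_def[abs_def] by (simp add: field_simps)
qed

lemma DERIV_phase:
  assumes t: "0 < t" "t < L"
  shows "(phase u v has_real_derivative (u - v/(time_odds t)^2)*(- L/(2*t^2*time_odds t))/(2 * sqrt L)) (at t)"
proof -
  have "((%P. u*P + v/P) has_real_derivative u - v/(time_odds t)^2) (at (time_odds t))"
    using time_odds(1)[OF t] by (auto intro!: derivative_eq_intros simp: power2_eq_square)
  from DERIV_cdivide[OF DERIV_chain2[OF this DERIV_time_odds[OF t]], of "2 * sqrt L"] show ?thesis unfolding phase_def[abs_def] .
qed

lemma exp_phase:
  assumes t: "0 < t" "t < L"
  shows "exp (-(u - v)\<^sup>2/(4*L))*exp (-(phase u v t)\<^sup>2) = exp (-u\<^sup>2/(4*t))*exp (-v\<^sup>2/(4*(L - t)))"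
proof -
  have "(phase u v t)^2 = (u*time_odds t + v/time_odds t)^2/(4*L)" using L by (simp add: phase_def power_divide power_mult_distrib)
  also have "(u*time_odds t + v/time_odds t)^2 = u^2*(time_odds t)^2 + 2*u * v + v^2/(time_odds t)^2"
    unfolding power2_sum using time_odds(1)[OF t] by (simp add: power_mult_distrib power_divide)
  also have "... = u^2*((L - t)/t) + 2*u * v + v^2*(t/(L - t))" unfolding time_odds(2)[OF t] by simp
  finally have "- (u - v)\<^sup>2/(4*L) + - (phase u v t)\<^sup>2 = - (u^2*((L - t)/t + 1) + v^2*(t/(L - t) + 1))/(4*L)"
    using L by (simp add: power2_eq_square field_simps)
  also have "(L - t)/t + 1 = L/t" using t by (simp add: field_simps)
  also have "t/(L - t) + 1 = L/(L - t)" using t by (simp add: field_simps)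
  also have "- (u^2*(L/t) + v^2*(L/(L - t)))/(4*L) = - u\<^sup>2/(4*t) + - v\<^sup>2/(4*(L - t))" using L t by (simp add: field_simps)
  finally show ?thesis unfolding exp_add[symmetric] by (rule arg_cong)
qed

lemma passage_heat_eq:
  assumes t: "0 < t" "t < L"
  shows "passage t u*heat (L - t) v = exp (-u\<^sup>2/(4*t))*exp (-v\<^sup>2/(4*(L - t)))*u/(4*pi*(t^2*time_odds t))"
proof -
  have "4*pi*t*(4*pi*(L - t)) = (4*pi)^2*(t*(L - t))" by (simp add: power2_eq_square)
  then have roots: "sqrt (4*pi*t) * sqrt (4*pi*(L - t)) = 4*pi*(sqrt t * sqrt (L - t))"
    using t by (simp add: real_sqrt_mult[symmetric]) (simp add: real_sqrt_mult)
  have "t^2*time_odds t = t*(sqrt t * sqrt (L - t))"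
    using t by (simp add: time_odds_def real_sqrt_divide power2_eq_square real_div_sqrt field_simps)
  moreover have "passage t u*heat (L - t) v
    = exp (-u\<^sup>2/(4*t))*exp (-v\<^sup>2/(4*(L - t)))*u/(t*(sqrt (4*pi*t) * sqrt (4*pi*(L - t))))"
    by (simp add: passage_def heat_def mult_ac)
  ultimately show ?thesis unfolding roots by (simp add: mult_ac)
qed

text \<open>An explicit primitive of the density of the passage time is a combination of two Gaussian distribution functions.\<close>
definition passage_primitive :: "(real => real) => real => real => real => real" where
  "passage_primitive Ph u v t
  = - (1/(2*pi * sqrt L))*(exp (-(u + v)\<^sup>2/(4*L))*Ph (phase u (-v) t) + exp (-(u - v)\<^sup>2/(4*L))*Ph (phase u v t))"

lemma DERIV_passage_primitive:
  assumes Ph: "!!z. (Ph has_real_derivative exp (-z\<^sup>2)) (at z)" and t: "0 < t" "t < L"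
  shows "(passage_primitive Ph u v has_real_derivative passage t u*heat (L - t) v) (at t)"
proof -
  define q where "q = exp (-u\<^sup>2/(4*t))*exp (-v\<^sup>2/(4*(L - t)))"
  define d where "d = - L/(2*t^2*time_odds t)"
  let ?d = "%v. (u - v/(time_odds t)^2)*d/(2 * sqrt L)"
  have "(passage_primitive Ph u v has_real_derivative - (1/(2*pi * sqrt L))*(exp (-(u + v)\<^sup>2/(4*L))*(exp (-(phase u (-v) t)\<^sup>2)*?d (-v))
    + exp (-(u - v)\<^sup>2/(4*L))*(exp (-(phase u v t)\<^sup>2)*?d v))) (at t)"
    unfolding passage_primitive_def[abs_def] d_def by (intro DERIV_cmult DERIV_add DERIV_chain2[OF Ph] DERIV_phase[OF t])
  also have "- (1/(2*pi * sqrt L))*(exp (-(u + v)\<^sup>2/(4*L))*(exp (-(phase u (-v) t)\<^sup>2)*?d (-v))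
    + exp (-(u - v)\<^sup>2/(4*L))*(exp (-(phase u v t)\<^sup>2)*?d v)) = - (1/(2*pi * sqrt L))*(q*?d (-v) + q*?d v)"
    unfolding q_def using exp_phase[OF t, of u v] exp_phase[OF t, of u "-v"] by (simp only: mult.assoc[symmetric]) simp
  also have "... = - (1/(2*pi * sqrt L))*q*(u*d/sqrt L)" using L by (simp add: field_simps)
  also have "... = q*u*L/(4*pi*(sqrt L)^2*t^2*time_odds t)" using L t time_odds[OF t] by (simp add: d_def power2_eq_square field_simps)
  also have "... = passage t u*heat (L - t) v" unfolding passage_heat_eq[OF t] q_def using L by (simp add: mult_ac)
  finally show ?thesis .
qed

lemma phase_at_0: "LIM t at_right 0. phase u v t :> at_top" if u: "0 < u"
proof -
  have "LIM P at_top. (u*P + v/P)/(2 * sqrt L) :> at_top"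
  proof (cases "v = 0")
    case True then show ?thesis using u L by simp real_asymp
  next
    case False then show ?thesis using u L by real_asymp
  qed
  moreover have "LIM t at_right 0. time_odds t :> at_top" unfolding time_odds_def using L by real_asymp
  ultimately show ?thesis unfolding phase_def by (rule filterlim_compose)
qed

lemma time_odds_at_L: "filterlim time_odds (at_right 0) (at_left L)" unfolding time_odds_def[abs_def] filterlim_at
proof (intro conjI)
  show "((%t. sqrt ((L - t)/t)) \<longlongrightarrow> 0) (at_left L)" using L by (auto intro!: tendsto_eq_intros)
  have "\<forall>\<^sub>F t in at_left L. t \<in> {0<..<L}" by (rule eventually_at_left_real[OF L])
  then show "\<forall>\<^sub>F t in at_left L. sqrt ((L - t)/t) \<in> {0<..} \<and> sqrt ((L - t)/t) ~= 0" by eventually_elim auto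
qed

lemma phase_at_L:
  assumes v: "0 < v"
  shows "LIM t at_left L. phase u v t :> at_top" "LIM t at_left L. phase u (-v) t :> at_bot"
proof -
  have "LIM P at_right 0. (u*P + v/P)/(2 * sqrt L) :> at_top" "LIM P at_right 0. (u*P + -v/P)/(2 * sqrt L) :> at_bot"
    using v L by real_asymp+
  from this[THEN filterlim_compose[OF _ time_odds_at_L]]
  show "LIM t at_left L. phase u v t :> at_top" "LIM t at_left L. phase u (-v) t :> at_bot" unfolding phase_def .
qed

lemma passage_heat_convolution:
  assumes u: "0 < u" and v: "0 < v"
  shows "(LBINT t. ind {0<..<L} t*(passage t u*heat (L - t) v)) = heat L (u + v)"
proof -
  obtain Ph where Ph: "!!z. (Ph has_real_derivative exp (-z\<^sup>2)) (at z)"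
    and top: "(Ph \<longlongrightarrow> Ph 0 + sqrt pi/2) at_top" and bot: "(Ph \<longlongrightarrow> Ph 0 - sqrt pi/2) at_bot"
    using Gauss_primitive by blast
  define K where "K = 1/(2*pi * sqrt L)"
  define eP eM where "eP = exp (-(u + v)\<^sup>2/(4*L))" and "eM = exp (-(u - v)\<^sup>2/(4*L))"
  note F_def = passage_primitive_def[of Ph u v, folded K_def eP_def eM_def]
  have "(LBINT t = ereal 0..ereal L. passage t u*heat (L - t) v)
    = - K*(eP*(Ph 0 - sqrt pi/2) + eM*(Ph 0 + sqrt pi/2)) - (- K*(eP*(Ph 0 + sqrt pi/2) + eM*(Ph 0 + sqrt pi/2)))"
  proof (rule interval_integral_FTC_nonneg(2)[where F="passage_primitive Ph u v"])
    show "((passage_primitive Ph u v \<circ> real_of_ereal) \<longlongrightarrow> - K*(eP*(Ph 0 + sqrt pi/2) + eM*(Ph 0 + sqrt pi/2))) (at_right (ereal 0))"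
      unfolding ereal_tendsto_simps1 F_def[abs_def] by (intro tendsto_intros filterlim_compose[OF top] phase_at_0 u)
    show "((passage_primitive Ph u v \<circ> real_of_ereal) \<longlongrightarrow> - K*(eP*(Ph 0 - sqrt pi/2) + eM*(Ph 0 + sqrt pi/2))) (at_left (ereal L))"
      unfolding ereal_tendsto_simps1 F_def[abs_def]
      by (intro tendsto_intros filterlim_compose[OF top] filterlim_compose[OF bot] phase_at_L v)
    show "(passage_primitive Ph u v has_real_derivative passage t u*heat (L - t) v) (at t)" if "ereal 0 < ereal t" "ereal t < ereal L" for t
      by (rule DERIV_passage_primitive[OF Ph]) (use that in auto)
    show "isCont (%t. passage t u*heat (L - t) v) t" if "ereal 0 < ereal t" "ereal t < ereal L" for t
      using that unfolding passage_def heat_def by (auto intro!: continuous_intros)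
    show "AE t in lborel. ereal 0 < ereal t --> ereal t < ereal L --> 0 <= passage t u*heat (L - t) v"
      using u by (auto intro!: AE_I2 mult_nonneg_nonneg passage_nonneg)
  qed (use L in auto)
  also have "... = K * sqrt pi*eP" by (simp add: algebra_simps)
  also have "K * sqrt pi = sqrt pi/(2*(sqrt pi * sqrt pi) * sqrt L)" by (simp add: K_def)
  also have "... = 1/sqrt (4*pi*L)" using L by (simp add: real_sqrt_mult field_simps)
  also have "1/sqrt (4*pi*L)*eP = heat L (u + v)" by (simp add: eP_def heat_def)
  finally show ?thesis using L by (simp add: interval_lebesgue_integral_def set_lebesgue_integral_def einterval_eq)
qed

lemma heat_minus_absorbed_eq:
  assumes x: "x < c" and z: "z ~= c"
  shows "heat L (x - z) - ind {..c} z*absorbed c L x z = (LBINT t. ind {0<..<L} t*(passage t (c - x)*heat (L - t) (c - z)))"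
proof -
  have "heat t (c - z) = heat t (abs (c - z))" for t using heat_minus[of t "c - z"] by (simp add: abs_if)
  then have "(LBINT t. ind {0<..<L} t*(passage t (c - x)*heat (L - t) (c - z))) = heat L (c - x + abs (c - z))"
    using passage_heat_convolution[of "c - x" "abs (c - z)"] x z by simp
  also have "... = heat L (x - z) - ind {..c} z*absorbed c L x z"
    using x heat_minus[of L "x - z"] by (cases "z <= c") (auto simp: absorbed_def algebra_simps)
  finally show ?thesis by simp
qed

end

lemma exp_inv_bound: "0 < k ==> 0 < t ==> exp (-k/t)/t <= 1/k" for k t :: real
proof -
  assume k: "0 < k" and t: "0 < t"
  have "k/t <= exp (k/t)" using exp_ge_add_one_self[of "k/t"] by linarith
  then show ?thesis using k t by (simp add: exp_minus field_simps)
qed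

lemma passage_le: "0 < t ==> 0 < u ==> passage t u <= 8/u^2" using passage_bound[of t u] exp_inv_bound[of "u^2/8" t] by simp

lemma passage_heat_row_le:
  assumes f: "exp_bounded a B f" and u: "0 < u" and t: "0 < t" "t < L"
  shows "(LBINT z. abs (passage t u*heat (L - t) (c - z)*f z)) <= 8/u^2*(B*exp (L*a^2)*exp (-a*c))"
proof -
  have "exp_bounded a B (%z. abs (f z))" using f by (auto simp: exp_bounded_def)
  from heat_exp_bounded(2)[OF _ this, of "L - t" c]
  have "(LBINT z. heat (L - t) (c - z)*abs (f z)) <= B*exp ((L - t)*a^2)*exp (-a*c)" using t by simp
  also have "... <= B*exp (L*a^2)*exp (-a*c)"
    using t exp_boundedD(3)[OF f] by (intro mult_right_mono mult_left_mono exp_le_cancel_iff[THEN iffD2]) auto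
  finally have row: "(LBINT z. heat (L - t) (c - z)*abs (f z)) <= B*exp (L*a^2)*exp (-a*c)" .
  have "(LBINT z. abs (passage t u*heat (L - t) (c - z)*f z)) = passage t u*(LBINT z. heat (L - t) (c - z)*abs (f z))"
    using passage_nonneg[of t u] u t by (simp add: abs_mult mult.assoc)
  also have "... <= 8/u^2*(B*exp (L*a^2)*exp (-a*c))" using t u by (intro mult_mono passage_le row) (auto intro!: integral_nonneg_AE AE_I2)
  finally show ?thesis .
qed

lemma passage_decomposition:
  assumes L: "0 < L" and x: "x < c" and f: "exp_bounded a B f"
  shows "(LBINT z. heat L (x - z)*f z - ind {..c} z*absorbed c L x z*f z)
  = (LBINT t. ind {0<..<L} t*(passage t (c - x)*(LBINT z. heat (L - t) (c - z)*f z)))"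
proof -
  note [measurable] = exp_boundedD(1)[OF f]
  let ?F = "%t z. ind {0<..<L} t*(passage t (c - x)*heat (L - t) (c - z)*f z)"
  have u: "0 < c - x" using x by simp
  have "(LBINT z. heat L (x - z)*f z - ind {..c} z*absorbed c L x z*f z) = (LBINT z. (LBINT t. ?F t z))"
  proof (rule integral_cong_AE)
    show "AE z in lborel. heat L (x - z)*f z - ind {..c} z*absorbed c L x z*f z = (LBINT t. ?F t z)" using AE_lborel_singleton[of c]
    proof eventually_elim
      case (elim z)
      have "(LBINT t. ?F t z) = (LBINT t. ind {0<..<L} t*(passage t (c - x)*heat (L - t) (c - z)))*f z"
        unfolding integral_mult_left_zero[symmetric] by (simp add: mult.assoc)
      then show ?case unfolding heat_minus_absorbed_eq[OF L x elim, symmetric] by (simp add: left_diff_distrib)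
    qed
  qed measurable
  also have "... = (LBINT t. (LBINT z. ?F t z))"
  proof (rule Fubini_rows[symmetric])
    show "(%p. ?F (fst p) (snd p)) \<in> bmeas (lborel \<Otimes>\<^sub>M lborel)" by measurable
    show "Leb1 (?F t)" for t using heat_exp_bounded(1)[OF _ f, of "L - t" c] by (cases "t \<in> {0<..<L}") (auto simp: mult.assoc)
    define D where "D = 8/(c - x)^2*(B*exp (L*a^2)*exp (-a*c))"
    show "Leb1 (%t. ind {0<..<L} t*D)" by (intro integrable_mult_left integrable_real_indicator) (use L in auto)
    show "(LBINT z. abs (?F t z)) <= ind {0<..<L} t*D" for t
      using passage_heat_row_le[OF f u, of t L c] by (cases "t \<in> {0<..<L}") (auto simp: D_def)
  qed
  also have "... = (LBINT t. ind {0<..<L} t*(passage t (c - x)*(LBINT z. heat (L - t) (c - z)*f z)))" by (simp add: mult.assoc)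
  finally show ?thesis .
qed

lemma absorbed_excess_passage:
  assumes L: "0 < L" and x: "x < c"
  shows "absorbed_excess L c x y = (LBINT t. ind {0<..<L} t*(passage t (c - x)*airy_tilt (t + 1) (c + y)))"
proof -
  let ?f = "%z. airy_tilt (L + 1) (z + y)"
  have f: "exp_bounded (L + 2) (exp ((L + 2) ^ 3/3 + L*(L + 2)^2)*exp (-(L + 2)*y)) ?f" by (rule airy_tilt_exp_bounded) (use L in auto)
  have flow: "(LBINT z. heat t (w - z)*?f z) = airy_tilt (L + 1 - t) (w + y)" if "0 < t" for t w
    using airy_tilt_semigroup(1)[OF that, of "L + 1" y w] by (simp add: heat_minus_commute[of t w] add.commute mult.commute)
  have "absorbed_excess L c x y = (LBINT z. heat L (x - z)*?f z - ind {..c} z*absorbed c L x z*?f z)" unfolding absorbed_excess_def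
    using x heat_exp_bounded(1)[OF L f, of x] absorbed_integrable[OF L f, of x c c] flow[OF L, of x] by simp
  also have "... = (LBINT t. ind {0<..<L} t*(passage t (c - x)*(LBINT z. heat (L - t) (c - z)*?f z)))"
    by (rule passage_decomposition[OF L x f])
  also have "... = (LBINT t. ind {0<..<L} t*(passage t (c - x)*airy_tilt (t + 1) (c + y)))"
    using flow[of "L - t" c for t] by (intro LINT_cong refl) (simp add: indicator_def add.commute)
  finally show ?thesis .
qed

section \<open>Kernels on the line with small rows\<close>

definition tilted :: "real => (real => real => real) => real => real => real" where
  "tilted b K s r = abs (K s r)*exp (-b*(r - s))"

lemma tilted_nonneg [simp]: "0 <= tilted b K s r" by (simp add: tilted_def)

lemma tilted_majorized:
  assumes [measurable]: "K s \<in> bmeas borel" and g: "Leb1 g" and bound: "!!r. tilted b K s r <= g r"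
  shows "Leb1 (tilted b K s)" and "integral\<^sup>L lborel (tilted b K s) <= integral\<^sup>L lborel g"
proof -
  show int: "Leb1 (tilted b K s)"
  proof (rule integrable_dominated[OF g])
    show "tilted b K s \<in> bmeas lborel" unfolding tilted_def by measurable
  qed (use bound in \<open>simp add: abs_of_nonneg\<close>)
  show "integral\<^sup>L lborel (tilted b K s) <= integral\<^sup>L lborel g" by (intro integral_mono int g bound)
qed

lemma abs_mult_exp_eq_tilted: "abs (K s r)*exp (b*(s' - r)) = exp (b*(s' - s))*tilted b K s r"
  unfolding tilted_def mult.left_commute[of "exp _"] exp_add[symmetric] by (simp add: algebra_simps)

lemma tilted_dominated:
  assumes [measurable]: "K s \<in> bmeas borel" "f \<in> bmeas borel" and row: "Leb1 (tilted b K s)"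
  and f: "!!r. abs (f r) <= C*exp (b*(s' - r))"
  shows "Leb1 (%r. K s r*f r)"
  and "(LBINT r. abs (K s r*f r)) <= C*exp (b*(s' - s))*integral\<^sup>L lborel (tilted b K s)"
  and "abs (LBINT r. K s r*f r) <= C*exp (b*(s' - s))*integral\<^sup>L lborel (tilted b K s)"
proof -
  have bound: "abs (K s r*f r) <= C*exp (b*(s' - s))*tilted b K s r" for r
    using mult_left_mono[OF f[of r], of "abs (K s r)"] abs_mult_exp_eq_tilted[of K s r b s'] by (simp add: abs_mult mult_ac)
  have majorant: "Leb1 (%r. C*exp (b*(s' - s))*tilted b K s r)" by (intro integrable_mult_right row)
  show int: "Leb1 (%r. K s r*f r)" by (rule integrable_dominated[OF majorant]) (use bound in auto)
  show abs_le: "(LBINT r. abs (K s r*f r)) <= C*exp (b*(s' - s))*integral\<^sup>L lborel (tilted b K s)"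
    unfolding integral_mult_right_zero[symmetric] by (intro integral_mono integrable_abs int majorant bound)
  show "abs (LBINT r. K s r*f r) <= C*exp (b*(s' - s))*integral\<^sup>L lborel (tilted b K s)"
    by (rule order_trans[OF integral_abs_bound abs_le])
qed

lemma nn_integral_tilted_kcomp:
  assumes [measurable]: "K s \<in> bmeas borel" and G: "(%p. G (fst p) (snd p)) \<in> bmeas (borel \<Otimes>\<^sub>M borel)"
  shows "(\<integral>\<^sup>+r. ennreal (tilted b (kcomp lborel K G) s r) \<partial>lborel)
  <= (\<integral>\<^sup>+u. ennreal (tilted b K s u)*(\<integral>\<^sup>+r. ennreal (tilted b G u r) \<partial>lborel) \<partial>lborel)"
proof -
  have [measurable]: "(%x. G (f x) (h x)) \<in> bmeas M" if "f \<in> bmeas M" "h \<in> bmeas M" for f h and M :: "'c measure"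
    using measurable_compose[OF measurable_Pair[OF that] G] by simp
  have "ennreal (tilted b (kcomp lborel K G) s r) <= (\<integral>\<^sup>+u. ennreal (tilted b K s u)*ennreal (tilted b G u r) \<partial>lborel)" for r
  proof -
    have "ennreal (abs (kcomp lborel K G s r)) <= (\<integral>\<^sup>+u. ennreal (abs (K s u*G u r)) \<partial>lborel)"
      unfolding kcomp_def using integral_norm_bound_ennreal[of lborel "%u. K s u*G u r"]
      by (cases "Leb1 (%u. K s u*G u r)") (simp_all add: not_integrable_integral_eq)
    then have "ennreal (tilted b (kcomp lborel K G) s r) <= (\<integral>\<^sup>+u. ennreal (abs (K s u*G u r)) \<partial>lborel)*ennreal (exp (-b*(r - s)))"
      by (simp add: tilted_def ennreal_mult mult_right_mono)
    also have "... = (\<integral>\<^sup>+u. ennreal (tilted b K s u)*ennreal (tilted b G u r) \<partial>lborel)"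
      unfolding nn_integral_multc[symmetric, OF measurable_compose[OF _ measurable_ennreal]]
      by (subst nn_integral_multc[symmetric]) (auto intro!: nn_integral_cong simp: tilted_def abs_mult algebra_simps simp flip: ennreal_mult exp_add)
    finally show ?thesis .
  qed
  then have "(\<integral>\<^sup>+r. ennreal (tilted b (kcomp lborel K G) s r) \<partial>lborel)
    <= (\<integral>\<^sup>+r. (\<integral>\<^sup>+u. ennreal (tilted b K s u)*ennreal (tilted b G u r) \<partial>lborel) \<partial>lborel)"
    by (intro nn_integral_mono)
  also have "... = (\<integral>\<^sup>+u. (\<integral>\<^sup>+r. ennreal (tilted b K s u)*ennreal (tilted b G u r) \<partial>lborel) \<partial>lborel)"
    by (rule lborel_pair.Fubini') (simp add: tilted_def case_prod_beta')
  also have "... = (\<integral>\<^sup>+u. ennreal (tilted b K s u)*(\<integral>\<^sup>+r. ennreal (tilted b G u r) \<partial>lborel) \<partial>lborel)"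
    by (intro nn_integral_cong nn_integral_cmult) (simp add: tilted_def)
  finally show ?thesis .
qed

lemma integral_below_peak:
  fixes p :: "real => real => real"
  assumes p: "(%p'. p (fst p') (snd p')) \<in> bmeas (lborel \<Otimes>\<^sub>M lborel)"
  and bound: "!!r l. r < l ==> l1 < l ==> l <= l2 ==> abs (p r l) <= h r*k l"
  and h: "Leb1 h" "!!r. 0 <= h r" and k: "Leb1 (%l. ind {l1<..l2} l*k l)" "!!l. 0 <= k l"
  shows "Leb1 (%r. LBINT l. ind {max l1 r<..l2} l*p r l)"
  and "(LBINT r. (LBINT l. ind {max l1 r<..l2} l*p r l)) = (LBINT l. ind {l1<..l2} l*(LBINT r. ind {..l} r*p r l))"
proof -
  let ?P = "%r l. ind {max l1 r<..l2} l*p r l"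
  have [measurable]: "(%x. p (f x) (g x)) \<in> bmeas M" if "f \<in> bmeas M" "g \<in> bmeas M" for f g and M :: "'c measure"
    using measurable_compose[OF measurable_Pair[of f M lborel g lborel] p] that by simp
  have ind_eq: "ind {max l1 r<..l2} l = (if max l1 r < l \<and> l <= l2 then 1 else (0::real))" for r l by (simp add: indicator_def)
  have meas: "(%p'. ?P (fst p') (snd p')) \<in> bmeas (lborel \<Otimes>\<^sub>M lborel)" unfolding ind_eq by measurable
  have dominated: "norm (?P r l) <= h r*(ind {l1<..l2} l*k l)" for r l using bound[of r l] h(2)[of r] k(2)[of l] by (auto simp: indicator_def)
  note Fubini = Fubini_dominated[OF sigma_finite_lborel sigma_finite_lborel meas dominated h(1) k(1)]
  show "Leb1 (%r. LBINT l. ?P r l)" by (rule Fubini(3))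
  have "(LBINT r. ?P r l) = ind {l1<..l2} l*(LBINT r. ind {..l} r*p r l)" for l
  proof -
    have "(LBINT r. ?P r l) = (LBINT r. ind {l1<..l2} l*(ind {..l} r*p r l))"
    proof (rule integral_cong_AE)
      show "AE r in lborel. ?P r l = ind {l1<..l2} l*(ind {..l} r*p r l)"
        using AE_lborel_singleton[of l] by eventually_elim (auto simp: indicator_def)
      show "(%r. ?P r l) \<in> bmeas lborel" unfolding ind_eq by measurable
    qed measurable
    then show ?thesis by simp
  qed
  with Fubini(2) show "(LBINT r. (LBINT l. ?P r l)) = (LBINT l. ind {l1<..l2} l*(LBINT r. ind {..l} r*p r l))" by simp
qed

text \<open>Kernels on the line whose rows have small total mass after tilting by \<open>exp (b s)\<close>. Such kernels need not be
  trace class on the whole line, so translation-invariant kernels are included.\<close>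
locale row_kernel =
  fixes K :: "real => real => real" and b q :: real and m :: "real => real"
  assumes K_pair: "(%p. K (fst p) (snd p)) \<in> bmeas (borel \<Otimes>\<^sub>M borel)"
  and m_measurable [measurable]: "m \<in> bmeas borel" and m_nonneg: "!!s. 0 <= m s"
  and K_le: "!!s s'. abs (K s s') <= m s'*exp (b*(s' - s))"
  and row_integrable: "!!s. Leb1 (tilted b K s)"
  and row_le: "!!s. integral\<^sup>L lborel (tilted b K s) <= q"
  and m_integrable: "!!x y. Leb1 (%s. ind {x<..y} s*m s)"
begin

lemma K_measurable [measurable]: "f \<in> bmeas M ==> h \<in> bmeas M ==> (%x. K (f x) (h x)) \<in> bmeas M"
  using measurable_compose[OF measurable_Pair K_pair, of f M h] by simp

lemma q_nonneg: "0 <= q" by (rule order_trans[OF _ row_le[of 0]]) (auto intro!: integral_nonneg_AE)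

fun capped :: "nat => real => real => real => real" where
  "capped 0 l s s' = K s s'"
  | "capped (Suc n) l s s' = (LBINT r. K s r*(ind {..l} r*capped n l r s'))"

lemma capped_measurable [measurable]:
  assumes "a \<in> bmeas M" "f \<in> bmeas M" "h \<in> bmeas M"
  shows "(%x. capped n (a x) (f x) (h x)) \<in> bmeas M"
proof -
  have "(%p. capped n (fst p) (fst (snd p)) (snd (snd p))) \<in> bmeas (borel \<Otimes>\<^sub>M (borel \<Otimes>\<^sub>M borel))"
  proof (induction n)
    case (Suc n)
    have [measurable]: "(%x. capped n (a x) (f x) (h x)) \<in> bmeas M" if "a \<in> bmeas M" "f \<in> bmeas M" "h \<in> bmeas M"
      for a f h and M :: "((real \<times> real \<times> real) \<times> real) measure"
      using measurable_compose[OF measurable_Pair[OF that(1) measurable_Pair[OF that(2,3)]] Suc] by simp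
    have [measurable]: "(%x. ind {..a x} (f x) :: real) \<in> bmeas M" if [measurable]: "a \<in> bmeas M" "f \<in> bmeas M"
      for a f :: "(real \<times> real \<times> real) \<times> real => real" and M
    proof -
      have "(%x. ind {..a x} (f x) :: real) = (%x. if f x <= a x then 1 else 0)" by (auto simp: indicator_def)
      then show ?thesis by simp
    qed
    have "(%p. LBINT r. K (fst (snd p)) r*(ind {..fst p} r*capped n (fst p) r (snd (snd p)))) \<in> bmeas (borel \<Otimes>\<^sub>M (borel \<Otimes>\<^sub>M borel))"
      by measurable
    then show ?case by simp
  qed simp
  from measurable_compose[OF measurable_Pair[OF assms(1) measurable_Pair[OF assms(2,3)]] this] show ?thesis by simp
qed

lemma row_dominated:
  assumes "f \<in> bmeas borel" and f: "!!r. abs (f r) <= C*exp (b*(s' - r))"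
  shows "Leb1 (%r. K s r*f r)" and "abs (LBINT r. K s r*f r) <= q*C*exp (b*(s' - s))"
proof -
  have "0 <= C*exp (b*(s' - s))" using order_trans[OF abs_ge_zero f[of s']] by simp
  from mult_left_mono[OF row_le[of s] this] tilted_dominated(3)[OF _ assms(1) row_integrable f, of s]
  show "abs (LBINT r. K s r*f r) <= q*C*exp (b*(s' - s))" by (simp add: mult_ac)
  show "Leb1 (%r. K s r*f r)" by (rule tilted_dominated(1)[OF _ assms(1) row_integrable f]) simp
qed

lemma capped_le: "abs (capped n l s s') <= q ^ n*m s'*exp (b*(s' - s))"
proof (induction n arbitrary: s)
  case (Suc n)
  have "abs (ind {..l} r*capped n l r s') <= q ^ n*m s'*exp (b*(s' - r))" for r
    using Suc[of r] q_nonneg m_nonneg by (auto simp: indicator_def)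
  from row_dominated(2)[OF _ this] show ?case by (simp add: mult.assoc)
qed (simp add: K_le)

lemma capped_cut_le: "abs (ind {..l} r*capped n l r s') <= q ^ n*m s'*exp (b*(s' - r))"
  using capped_le[of n l r s'] q_nonneg m_nonneg by (auto simp: indicator_def)

lemma capped_integrable: "Leb1 (%r. K s r*(ind {..l} r*capped n l r s'))" by (rule row_dominated(1)[OF _ capped_cut_le]) measurable

lemma nn_integral_row: "(\<integral>\<^sup>+r. ennreal (tilted b K s r) \<partial>lborel) <= ennreal q"
  using row_le by (simp add: nn_integral_eq_integral row_integrable ennreal_leI)

lemma nn_integral_capped_row: "(\<integral>\<^sup>+r. ennreal (tilted b (capped n l) s r) \<partial>lborel) <= ennreal (q ^ Suc n)"
proof (induction n arbitrary: s)
  case 0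
  then show ?case using nn_integral_row[of s] by (simp add: tilted_def)
next
  case (Suc n)
  let ?cut = "%u r. ind {..l} u*capped n l u r"
  have cut_row: "(\<integral>\<^sup>+r. ennreal (tilted b ?cut u r) \<partial>lborel) <= ennreal (q ^ Suc n)" for u
    by (rule order_trans[OF nn_integral_mono Suc[of u]]) (auto intro!: ennreal_leI simp: tilted_def indicator_def)
  have "capped (Suc n) l = kcomp lborel K ?cut" by (simp add: fun_eq_iff kcomp_def)
  then have "(\<integral>\<^sup>+r. ennreal (tilted b (capped (Suc n) l) s r) \<partial>lborel)
    <= (\<integral>\<^sup>+u. ennreal (tilted b K s u)*(\<integral>\<^sup>+r. ennreal (tilted b ?cut u r) \<partial>lborel) \<partial>lborel)"
    using nn_integral_tilted_kcomp[of K s ?cut b] by simp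
  also have "... <= (\<integral>\<^sup>+u. ennreal (tilted b K s u)*ennreal (q ^ Suc n) \<partial>lborel)"
    by (intro nn_integral_mono mult_left_mono cut_row) auto
  also have "... = (\<integral>\<^sup>+u. ennreal (tilted b K s u) \<partial>lborel)*ennreal (q ^ Suc n)"
    using borel_measurable_integrable[OF row_integrable] by (intro nn_integral_multc) simp
  also have "... <= ennreal q*ennreal (q ^ Suc n)" by (intro mult_right_mono nn_integral_row) simp
  also have "... = ennreal (q ^ Suc (Suc n))" using q_nonneg by (simp add: ennreal_mult)
  finally show ?case .
qed

lemma capped_row: "Leb1 (tilted b (capped n l) s)" "integral\<^sup>L lborel (tilted b (capped n l) s) <= q ^ Suc n"
proof -
  show int: "Leb1 (tilted b (capped n l) s)" using nn_integral_capped_row[of n l s] unfolding tilted_def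
    by (intro integrableI_nonneg) (auto simp: top_unique less_top[symmetric] intro: le_less_trans)
  show "integral\<^sup>L lborel (tilted b (capped n l) s) <= q ^ Suc n"
    using nn_integral_capped_row[of n l s] q_nonneg by (simp add: nn_integral_eq_integral[OF int] ennreal_le_iff del: power_Suc)
qed

lemma capped_capped_integrable: "Leb1 (%r. capped i l s r*(ind {..l} r*capped j l r s'))"
  by (rule tilted_dominated(1)[OF _ _ capped_row(1) capped_cut_le]) measurable

lemma capped_semigroup: "(LBINT r. capped i l s r*(ind {..l} r*capped j l r s')) = capped (Suc (i + j)) l s s'"
proof (induction i arbitrary: s)
  case (Suc i)
  let ?F = "%u r. K s u*ind {..l} u*(capped i l u r*(ind {..l} r*capped j l r s'))"
  let ?D = "%u. q ^ j*m s'*exp (b*(s' - u))"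
  have "capped (Suc i) l s r*(ind {..l} r*capped j l r s') = (LBINT u. ?F u r)" for r
    unfolding capped.simps by (subst integral_mult_left_zero[symmetric]) (simp only: mult_ac)
  then have "(LBINT r. capped (Suc i) l s r*(ind {..l} r*capped j l r s')) = (LBINT r. (LBINT u. ?F u r))" by simp
  also have "... = (LBINT u. (LBINT r. ?F u r))"
  proof (rule Fubini_rows[symmetric])
    show "(%p. ?F (fst p) (snd p)) \<in> bmeas (lborel \<Otimes>\<^sub>M lborel)" by measurable
    show "Leb1 (?F u)" for u by (intro integrable_mult_right capped_capped_integrable)
    show "Leb1 (%u. q ^ Suc i*abs (K s u*?D u))"
      by (intro integrable_mult_right integrable_abs row_dominated(1)[of _ "q ^ j*m s'" s']) (use q_nonneg m_nonneg in auto)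
    fix u
    have "(LBINT r. abs (capped i l u r*(ind {..l} r*capped j l r s'))) <= ?D u*integral\<^sup>L lborel (tilted b (capped i l) u)"
      by (rule tilted_dominated(2)[OF _ _ capped_row(1) capped_cut_le]) measurable
    also have "... <= ?D u*q ^ Suc i" using q_nonneg m_nonneg by (intro mult_left_mono capped_row) auto
    finally have "abs (K s u*ind {..l} u)*(LBINT r. abs (capped i l u r*(ind {..l} r*capped j l r s'))) <= abs (K s u)*(?D u*q ^ Suc i)"
      by (intro mult_mono) (auto simp: indicator_def)
    then show "(LBINT r. abs (?F u r)) <= q ^ Suc i*abs (K s u*?D u)" using q_nonneg m_nonneg
      unfolding abs_mult[of "K s u*ind {..l} u"] abs_mult[of "K s u" "?D u"] integral_mult_right_zero by (simp add: mult_ac)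
  qed
  also have "... = capped (Suc (Suc i + j)) l s s'" by (simp add: Suc mult.assoc)
  finally show ?case .
qed simp

lemma abs_capped_capped_le: "abs (capped i l r l*capped j l l s') <= q ^ (i + j)*m l*m s'*exp (b*(s' - r))"
proof -
  have "abs (capped i l r l*capped j l l s') <= (q ^ i*m l*exp (b*(l - r)))*(q ^ j*m s'*exp (b*(s' - l)))"
    unfolding abs_mult using q_nonneg m_nonneg by (intro mult_mono capped_le) auto
  also have "... = q ^ i*q ^ j*m l*m s'*(exp (b*(l - r))*exp (b*(s' - l)))" by (simp only: mult_ac)
  also have "exp (b*(l - r))*exp (b*(s' - l)) = exp (b*(s' - r))" unfolding exp_add[symmetric] by (simp add: algebra_simps)
  finally show ?thesis by (simp add: power_add)
qed

text \<open>The \<open>n\<close>-step paths whose highest intermediate point lies in \<open>{l1<..l2}\<close>; the summation index says which of the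
  intermediate points it is.\<close>
definition peaked :: "nat => real => real => real => real => real" where
  "peaked n l1 l2 s s' = (\<Sum>i<n. LBINT l. ind {l1<..l2} l*(capped i l s l*capped (n - 1 - i) l l s'))"

lemma peak_integrable: "Leb1 (%l. ind {x<..y} l*(capped i l s l*capped j l l s'))"
  by (rule integrable_dominated[OF integrable_mult_right[OF m_integrable[of x y], of "q ^ (i + j)*m s'*exp (b*(s' - s))"]])
  (use abs_capped_capped_le[of i _ s j s'] in \<open>auto simp: indicator_def mult_ac\<close>)

lemma integral_peaked:
  assumes [measurable]: "w \<in> bmeas borel" "t \<in> bmeas borel" and h: "Leb1 h"
  and bound: "!!r. abs (w r)*(m (t r)*exp (b*(t r - r))) <= h r"
  shows "Leb1 (%r. w r*peaked n (max l1 r) l2 r (t r))"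
  and "(LBINT r. w r*peaked n (max l1 r) l2 r (t r))
  = (\<Sum>i<n. LBINT l. ind {l1<..l2} l*(LBINT r. ind {..l} r*(w r*(capped i l r l*capped (n - 1 - i) l l (t r)))))"
proof -
  let ?p = "%i r l. w r*(capped i l r l*capped (n - 1 - i) l l (t r))"
  have p: "(%p'. ?p i (fst p') (snd p')) \<in> bmeas (lborel \<Otimes>\<^sub>M lborel)" for i by measurable
  have dominated: "abs (?p i r l) <= h r*(q ^ (i + (n - 1 - i))*m l)" for i r l
  proof -
    have "abs (?p i r l) <= abs (w r)*(q ^ (i + (n - 1 - i))*m l*m (t r)*exp (b*(t r - r)))"
      unfolding abs_mult[of "w r"] by (intro mult_left_mono abs_capped_capped_le) simp
    also have "... = abs (w r)*(m (t r)*exp (b*(t r - r)))*(q ^ (i + (n - 1 - i))*m l)" by (simp only: mult_ac)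
    also have "... <= h r*(q ^ (i + (n - 1 - i))*m l)" using q_nonneg m_nonneg by (intro mult_right_mono bound) auto
    finally show ?thesis .
  qed
  have h_nonneg: "0 <= h r" for r using m_nonneg by (intro order_trans[OF _ bound]) auto
  have k: "Leb1 (%l. ind {l1<..l2} l*(q ^ (i + (n - 1 - i))*m l))" for i
    using integrable_mult_right[OF m_integrable[of l1 l2], of "q ^ (i + (n - 1 - i))"] by (simp only: mult_ac)
  have "0 <= q ^ (i + (n - 1 - i))*m l" for i l using q_nonneg m_nonneg by simp
  note swap = integral_below_peak[OF p dominated h h_nonneg k this]
  have peaked_eq: "w r*peaked n (max l1 r) l2 r (t r) = (\<Sum>i<n. LBINT l. ind {max l1 r<..l2} l*?p i r l)" for r
    unfolding peaked_def sum_distrib_left integral_mult_right_zero[symmetric] by (simp only: mult.left_commute[of "w r"])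
  show "Leb1 (%r. w r*peaked n (max l1 r) l2 r (t r))" unfolding peaked_eq by (intro L1_sum swap(1))
  show "(LBINT r. w r*peaked n (max l1 r) l2 r (t r)) = (\<Sum>i<n. LBINT l. ind {l1<..l2} l*(LBINT r. ind {..l} r*?p i r l))"
    unfolding peaked_eq LINT_sum[OF swap(1)] swap(2) ..
qed

lemma cut_capped_diff:
  assumes "!!l1. l1 <= l2 ==> capped n l2 r s' - capped n l1 r s' = peaked n l1 l2 r s'" and "l1 <= l2"
  shows "ind {..l2} r*capped n l2 r s' - ind {..l1} r*capped n l1 r s' = ind {l1<..l2} r*capped n r r s' + peaked n (max l1 r) l2 r s'"
proof (cases "r <= l2")
  case True
  then show ?thesis using assms(1)[of "max l1 r"] assms(2) by (cases "r <= l1") (auto simp: max_def)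
qed (use assms(2) in \<open>simp add: peaked_def\<close>)

lemma capped_raise: "l1 <= l2 ==> capped n l2 s s' - capped n l1 s s' = peaked n l1 l2 s s'"
proof (induction n arbitrary: l1 s)
  case (Suc n)
  have meas: "K s \<in> bmeas borel" by measurable
  have majorant: "Leb1 (%r. m s'*exp (b*(s' - s))*tilted b K s r)" by (intro integrable_mult_right row_integrable)
  have bound: "abs (K s r)*(m s'*exp (b*(s' - r))) <= m s'*exp (b*(s' - s))*tilted b K s r" for r
    using abs_mult_exp_eq_tilted[of K s r b s'] by (simp only: mult_ac)
  note peaked = integral_peaked[where t="%_. s'" and n=n and ?l1.0=l1 and ?l2.0=l2, OF meas borel_measurable_const majorant bound]
  have below: "(LBINT r. ind {..l} r*(K s r*(capped i l r l*capped j l l s'))) = capped (Suc i) l s l*capped j l l s'" for i j l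
    unfolding capped.simps by (subst integral_mult_left_zero[symmetric]) (simp only: mult_ac)
  have first: "Leb1 (%r. ind {l1<..l2} r*(capped 0 r s r*capped n r r s'))" by (rule peak_integrable)
  have "capped (Suc n) l2 s s' - capped (Suc n) l1 s s' = (LBINT r. K s r*(ind {..l2} r*capped n l2 r s' - ind {..l1} r*capped n l1 r s'))"
    using capped_integrable[of s l2 n s'] capped_integrable[of s l1 n s'] by (simp add: right_diff_distrib)
  also have "... = (LBINT r. ind {l1<..l2} r*(capped 0 r s r*capped n r r s') + K s r*peaked n (max l1 r) l2 r s')"
    by (intro LINT_cong refl) (simp add: cut_capped_diff[OF Suc.IH Suc.prems] algebra_simps)
  also have "... = (LBINT l. ind {l1<..l2} l*(capped 0 l s l*capped n l l s'))
    + (\<Sum>i<n. LBINT l. ind {l1<..l2} l*(capped (Suc i) l s l*capped (n - 1 - i) l l s'))"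
    unfolding LINT_add[OF first peaked(1)] peaked(2) below ..
  also have "... = peaked (Suc n) l1 l2 s s'" unfolding peaked_def sum.lessThan_Suc_shift by simp
  finally show ?case .
qed (simp add: peaked_def)

definition capped_trace :: "nat => real => real" where "capped_trace n l = (LBINT r. ind {..l} r*capped n l r r)"

lemma capped_diag_le: "abs (capped n l r r) <= q ^ n*m r" using capped_le[of n l r r] by simp

lemma cut_diag_integrable:
  assumes "Leb1 (%s. ind {..l} s*m s)"
  shows "Leb1 (%r. ind {..l} r*capped n l r r)"
  by (rule integrable_dominated[OF integrable_mult_right[OF assms, of "q ^ n"]]) (use capped_diag_le in \<open>auto simp: indicator_def\<close>)

lemma diag_integrable: "Leb1 (%l. ind {x<..y} l*capped n l l l)"
  by (rule integrable_dominated[OF integrable_mult_right[OF m_integrable[of x y], of "q ^ n"]])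
  (use capped_diag_le in \<open>auto simp: indicator_def\<close>)

lemma abs_capped_trace_le:
  assumes "Leb1 (%s. ind {..l} s*m s)"
  shows "abs (capped_trace n l) <= (LBINT s. ind {..l} s*m s)*q ^ n"
proof -
  have "abs (capped_trace n l) <= (LBINT r. abs (ind {..l} r*capped n l r r))" unfolding capped_trace_def by (rule integral_abs_bound)
  also have "... <= (LBINT r. q ^ n*(ind {..l} r*m r))"
    by (intro integral_mono integrable_abs cut_diag_integrable[OF assms] integrable_mult_right assms) (use capped_diag_le in \<open>auto simp: indicator_def\<close>)
  finally show ?thesis by (simp add: mult.commute)
qed

lemma capped_trace_diff:
  assumes l: "l1 <= l2" and m: "Leb1 (%s. ind {..l2} s*m s)"
  shows "capped_trace n l2 - capped_trace n l1 = real (Suc n)*(LBINT l. ind {l1<..l2} l*capped n l l l)"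
proof -
  have below_l1: "Leb1 (%s. ind {..l1} s*m s)" by (rule L1_bound[OF m]) (use l m_nonneg in \<open>auto simp: indicator_def\<close>)
  have bound: "abs (ind {..l2} r)*(m r*exp (b*(r - r))) <= ind {..l2} r*m r" for r by (simp add: indicator_def)
  have cut: "ind {..l2} r*peaked n (max l1 r) l2 r r = peaked n (max l1 r) l2 r r" for r by (cases "r <= l2") (simp_all add: peaked_def)
  have meas: "(%r. ind {..l2} r :: real) \<in> bmeas borel" "(%r. r) \<in> bmeas borel" by measurable
  note peaked = integral_peaked[where ?l1.0=l1 and ?l2.0=l2 and n=n, OF meas m bound, unfolded cut]
  have rotate: "ind {l1<..l2} l*(LBINT r. ind {..l} r*(ind {..l2} r*(capped i l r l*capped (n - 1 - i) l l r))) = ind {l1<..l2} l*capped n l l l"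
    if "i < n" for i l
  proof (cases "l <= l2")
    case True
    then have "ind {..l} r*(ind {..l2} r*(capped i l r l*capped (n - 1 - i) l l r)) = capped (n - 1 - i) l l r*(ind {..l} r*capped i l r l)" for r
      by (simp add: indicator_def)
    moreover have "Suc (n - 1 - i + i) = n" using that by simp
    ultimately show ?thesis by (simp only: capped_semigroup)
  qed simp
  have "capped_trace n l2 - capped_trace n l1 = (LBINT r. ind {..l2} r*capped n l2 r r - ind {..l1} r*capped n l1 r r)"
    unfolding capped_trace_def using cut_diag_integrable[OF m] cut_diag_integrable[OF below_l1] by simp
  also have "... = (LBINT r. ind {l1<..l2} r*capped n r r r + peaked n (max l1 r) l2 r r)"
    by (simp only: cut_capped_diff[OF capped_raise l])
  also have "... = (LBINT l. ind {l1<..l2} l*capped n l l l) + (\<Sum>i<n. LBINT l. ind {l1<..l2} l*capped n l l l)"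
    unfolding LINT_add[OF diag_integrable peaked(1)] peaked(2) by (intro arg_cong2[of _ _ _ _ "(+)"] sum.cong LINT_cong refl rotate) simp
  finally show ?thesis by (simp add: distrib_right)
qed

fun power :: "nat => real => real => real" where
  "power 0 s s' = K s s'"
  | "power (Suc n) s s' = (LBINT r. K s r*power n r s')"

lemma capped_tendsto_power: "(%j. capped n (real j) s s') ----> power n s s'"
proof (induction n arbitrary: s)
  case (Suc n)
  let ?w = "%r. q ^ n*m s'*exp (b*(s' - r))"
  have "(%j. LBINT r. K s r*(ind {..real j} r*capped n (real j) r s')) ----> (LBINT r. K s r*power n r s')"
  proof (rule integral_dominated_convergence[where w="%r. abs (K s r*?w r)"])
    show "Leb1 (%r. abs (K s r*?w r))"
      by (intro integrable_abs row_dominated(1)[where C="q ^ n*m s'" and s'=s']) (use q_nonneg m_nonneg in auto)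
    show "AE r in lborel. norm (K s r*(ind {..real j} r*capped n (real j) r s')) <= abs (K s r*?w r)" for j
      unfolding real_norm_def abs_mult[of "K s _"] by (intro AE_I2 mult_left_mono order_trans[OF capped_cut_le abs_ge_self]) auto
    show "AE r in lborel. (%j. K s r*(ind {..real j} r*capped n (real j) r s')) ----> K s r*power n r s'"
    proof (intro AE_I2 tendsto_mult tendsto_const)
      fix r
      have "\<forall>\<^sub>F j in sequentially. capped n (real j) r s' = ind {..real j} r*capped n (real j) r s'"
        using eventually_ge_at_top[of "nat \<lceil>r\<rceil>"] by eventually_elim (auto simp: indicator_def nat_le_iff ceiling_le_iff)
      from Lim_transform_eventually[OF Suc this] show "(%j. ind {..real j} r*capped n (real j) r s') ----> power n r s'" .
    qed
    have "(%r. power n r s') \<in> bmeas borel" by (rule borel_measurable_LIMSEQ_real[OF Suc]) simp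
    then show "(%r. K s r*power n r s') \<in> bmeas lborel" by simp
  qed measurable
  then show ?case by simp
qed simp

context
  assumes invariant: "!!s s' h. K (s + h) (s' + h) = K s s'"
begin

lemma capped_shift: "capped n (l + h) (s + h) (s' + h) = capped n l s s'"
proof (induction n arbitrary: s)
  case (Suc n)
  have "capped (Suc n) (l + h) (s + h) (s' + h)
    = abs 1 *\<^sub>R (LBINT r. K (s + h) (h + 1*r)*(ind {..l + h} (h + 1*r)*capped n (l + h) (h + 1*r) (s' + h)))"
    unfolding capped.simps by (rule lborel_integral_real_affine) simp
  also have "... = capped (Suc n) l s s'" using Suc invariant[of s h] by (auto intro!: LINT_cong simp: add.commute[of h] indicator_def)
  finally show ?case .
qed (simp add: invariant)

lemma peak_mass:
  assumes i: "i < n"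
  shows "Leb_has (%l. ind {0<..} l*(capped i l 0 l*capped (n - 1 - i) l l 0)) (capped n 0 0 0)"
proof -
  define F where "F r = capped (n - 1 - i) 0 0 r*(ind {..0} r*capped i 0 r 0)" for r
  have "Leb_has F (capped n 0 0 0)"
    unfolding F_def Leb_iff using capped_capped_integrable[of "n - 1 - i" 0 0 i 0] capped_semigroup[of "n - 1 - i" 0 0 i 0] i by simp
  from lborel_has_bochner_integral_real_affine_iff[of "-1" F "capped n 0 0 0" 0, THEN iffD1, OF _ this]
  have reflected: "Leb_has (%l. F (-l)) (capped n 0 0 0)" by simp
  have "AE l in lborel. F (-l) = ind {0<..} l*(capped i l 0 l*capped (n - 1 - i) l l 0)" using AE_lborel_singleton[of 0]
  proof eventually_elim
    case (elim l)
    then show ?case using capped_shift[of i 0 l "-l" 0] capped_shift[of "n - 1 - i" 0 l 0 "-l"] by (auto simp: F_def indicator_def)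
  qed
  from has_bochner_integral_cong_AE[OF _ _ this, THEN iffD1, OF _ _ reflected] show ?thesis using reflected by (simp add: Leb_iff)
qed

text \<open>The continuous cycle lemma: among the cyclic rotations of a closed path exactly one starts at its highest point.\<close>
lemma power_cycle: "power n 0 0 = real (Suc n)*capped n 0 0 0"
proof -
  have "(%j. peaked n 0 (real j) 0 0) ----> (\<Sum>i<n. capped n 0 0 0)" unfolding peaked_def
  proof (rule tendsto_sum)
    fix i assume "i \<in> {..<n}"
    then have "i < n" by simp
    note mass = peak_mass[OF this]
    let ?f = "%l. ind {0<..} l*(capped i l 0 l*capped (n - 1 - i) l l 0)"
    have "((%y. LBINT l. ind {..y} l *\<^sub>R ?f l) \<longlongrightarrow> integral\<^sup>L lborel ?f) at_top"
      by (rule tendsto_integral_at_top) (use mass in \<open>auto simp: Leb_iff\<close>)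
    from filterlim_compose[OF this filterlim_real_sequentially]
    have "(%j. LBINT l. ind {..real j} l *\<^sub>R ?f l) ----> capped n 0 0 0" unfolding Leb_eq[OF mass] .
    moreover have "ind {..y} l *\<^sub>R ?f l = ind {0<..y} l*(capped i l 0 l*capped (n - 1 - i) l l 0)" for y l
      by (auto simp: indicator_def)
    ultimately show "(%j. LBINT l. ind {0<..real j} l*(capped i l 0 l*capped (n - 1 - i) l l 0)) ----> capped n 0 0 0" by (simp only:)
  qed
  moreover have "(%j. capped n (real j) 0 0 - capped n 0 0 0) ----> power n 0 0 - capped n 0 0 0"
    by (intro tendsto_diff capped_tendsto_power tendsto_const)
  moreover have "capped n (real j) 0 0 - capped n 0 0 0 = peaked n 0 (real j) 0 0" for j by (rule capped_raise) simp
  ultimately have "power n 0 0 - capped n 0 0 0 = (\<Sum>i<n. capped n 0 0 0)" by (simp only:) (rule LIMSEQ_unique)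
  then show ?thesis by (simp add: distrib_right)
qed

end

end

lemma tilted_diff_integrable:
  assumes "K s \<in> bmeas borel" "G s \<in> bmeas borel" and "Leb1 (tilted b K s)" "Leb1 (tilted b G s)"
  shows "Leb1 (tilted b (%s r. K s r - G s r) s)"
proof (rule tilted_majorized(1)[OF _ L1_add[OF assms(3,4)]])
  show "tilted b (%s r. K s r - G s r) s r <= tilted b K s r + tilted b G s r" for r
    unfolding tilted_def distrib_right[symmetric] by (intro mult_right_mono abs_triangle_ineq4) simp
qed (use assms(1,2) in measurable)

lemma abs_capped_diff_le:
  assumes K: "row_kernel K b q m" and G: "row_kernel G b q m"
  and fast: "!!s. Leb1 (tilted (b + 1) K s)" "!!s. integral\<^sup>L lborel (tilted (b + 1) K s) <= q"
  and diff: "!!s s'. abs (K s s' - G s s') <= C*exp (-s)*m s'*exp (b*(s' - s))"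
  and diff_row: "!!s. integral\<^sup>L lborel (tilted b (%s r. K s r - G s r) s) <= C*exp (-s)"
  shows "abs (row_kernel.capped K n l s s' - row_kernel.capped G n l s s') <= C*(q ^ n + real n*q ^ (n - 1))*m s'*exp (-s)*exp (b*(s' - s))"
proof -
  interpret K: row_kernel K b q m by fact
  interpret G: row_kernel G b q m by fact
  have "0 <= C*exp (-0)" by (rule order_trans[OF _ diff_row[of 0]]) (auto intro!: integral_nonneg_AE)
  then have C: "0 <= C" by simp
  show ?thesis
  proof (induction n arbitrary: s)
    case 0
    then show ?case using diff[of s s'] by (simp add: mult_ac)
  next
    case (Suc n)
    let ?D = "%r. ind {..l} r*(K.capped n l r s' - G.capped n l r s')" and ?G = "%r. ind {..l} r*G.capped n l r s'"
    define M where "M = C*(q ^ n + real n*q ^ (n - 1))*m s'"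
    have M: "0 <= M" using C K.q_nonneg K.m_nonneg by (simp add: M_def)
    have tilt: "exp (-r)*exp (b*(s' - r)) = exp (-s')*exp ((b + 1)*(s' - r))" for r unfolding exp_add[symmetric] by (simp add: algebra_simps)
    have "abs (?D r) <= M*exp (-r)*exp (b*(s' - r))" for r using Suc[of r] M by (auto simp: M_def indicator_def)
    then have D: "abs (?D r) <= M*exp (-s')*exp ((b + 1)*(s' - r))" for r unfolding mult.assoc[of M] tilt .
    note K_D = tilted_dominated[of K s ?D, OF _ _ fast(1) D]
    note E_G = tilted_dominated[of "%s r. K s r - G s r" s ?G, OF _ _ tilted_diff_integrable[OF _ _ K.row_integrable G.row_integrable] G.capped_cut_le]
    have "K.capped (Suc n) l s s' - G.capped (Suc n) l s s' = (LBINT r. K s r*(ind {..l} r*K.capped n l r s') - G s r*?G r)"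
      using K.capped_integrable[of s l n s'] G.capped_integrable[of s l n s'] by simp
    also have "... = (LBINT r. K s r*?D r + (K s r - G s r)*?G r)" by (intro LINT_cong refl) (simp add: algebra_simps)
    also have "... = (LBINT r. K s r*?D r) + (LBINT r. (K s r - G s r)*?G r)" using K_D(1) E_G(1) by simp
    finally have "abs (K.capped (Suc n) l s s' - G.capped (Suc n) l s s') <= abs (LBINT r. K s r*?D r) + abs (LBINT r. (K s r - G s r)*?G r)"
      by (simp only: abs_triangle_ineq)
    also have "... <= M*exp (-s')*exp ((b + 1)*(s' - s))*q + q ^ n*m s'*exp (b*(s' - s))*(C*exp (-s))" using M K.q_nonneg K.m_nonneg
      by (intro add_mono order_trans[OF K_D(3) mult_left_mono[OF fast(2)]] order_trans[OF E_G(3) mult_left_mono[OF diff_row]]) auto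
    also have "... = C*((q ^ n + real n*q ^ (n - 1))*q + q ^ n)*m s'*exp (-s)*exp (b*(s' - s))"
      unfolding mult.assoc[of M] tilt[symmetric] unfolding M_def by (simp add: algebra_simps)
    also have "(q ^ n + real n*q ^ (n - 1))*q + q ^ n = q ^ Suc n + real (Suc n)*q ^ (Suc n - 1)" by (cases n) (simp_all add: algebra_simps)
    finally show ?case .
  qed
qed

section \<open>Reduction to a kernel on the boundary curve\<close>

lemma passage_exp_le:
  assumes s: "0 < s" "s <= L" and v: "0 < v"
  shows "passage s v * exp (et * v) <= exp (4*L*et^2)/s*exp (-(1/(16 * s)) * v^2)"
proof -
  have "0 <= (v/(4 * sqrt s) - 2 * sqrt s*et)^2" by simp
  also have "... = v^2/(16 * s) + 4 * s*et^2 - et * v" using s unfolding power2_diff by (simp add: power_divide power_mult_distrib)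
  finally have "et * v <= v^2/(16 * s) + 4 * s*et^2" by simp
  also have "4 * s*et^2 <= 4*L*et^2" using s by (intro mult_right_mono) auto
  finally have "- v\<^sup>2/(8 * s) + et * v <= 4*L*et^2 + - (1/(16 * s)) * v^2" by simp
  then have "exp (-v\<^sup>2/(8 * s))*exp (et * v) <= exp (4*L*et^2)*exp (-(1/(16 * s)) * v^2)"
    by (simp only: exp_add[symmetric] exp_le_cancel_iff)
  from divide_right_mono[OF this, of s] s
  have "exp (-v\<^sup>2/(8 * s))/s*exp (et * v) <= exp (4*L*et^2)/s*exp (-(1/(16 * s)) * v^2)" by simp
  moreover have "passage s v * exp (et * v) <= exp (-v\<^sup>2/(8 * s))/s*exp (et * v)"
    using passage_bound[OF s(1), of v] by (intro mult_right_mono) auto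
  ultimately show ?thesis by linarith
qed

lemma passage_exp_integral:
  assumes s: "0 < s" "s <= L"
  shows "Leb1 (%v. ind {0<..} v * (passage s v * exp (et * v)))"
  and "(LBINT v. ind {0<..} v * (passage s v * exp (et * v))) <= 8*exp (4*L*et^2)*(1/sqrt s)"
proof -
  define D where "D = exp (4*L*et^2)/s"
  have D: "0 <= D" and pos: "0 < 1/(16 * s)" using s by (simp_all add: D_def)
  have gauss_le: "ind {0<..} v * (passage s v * exp (et * v)) <= D*exp (-(1/(16 * s)) * v^2)" for v
    using passage_exp_le[OF s, of v et] s by (cases "0 < v") (simp_all add: D_def)
  have nonneg: "0 <= ind {0<..} v * (passage s v * exp (et * v))" for v using passage_nonneg[OF s(1), of v] by (auto simp: indicator_def)
  have gauss: "Leb1 (%v. D*exp (-(1/(16 * s)) * v^2))" by (intro integrable_mult_right gauss_integrable pos)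
  show int: "Leb1 (%v. ind {0<..} v * (passage s v * exp (et * v)))"
    by (rule integrable_dominated[OF gauss]) (use gauss_le nonneg in \<open>auto simp: abs_of_nonneg\<close>)
  have "(LBINT v. ind {0<..} v * (passage s v * exp (et * v))) <= (LBINT v. D*exp (-(1/(16 * s)) * v^2))" by (intro integral_mono int gauss gauss_le)
  also have "... = D * sqrt (pi/(1/(16 * s)))" using gauss_integral[OF pos] by simp
  also have "... <= D * sqrt (64 * s)" using s D pi_less_4 by (intro mult_left_mono real_sqrt_le_mono) auto
  also have "sqrt (64 * s) = 8 * sqrt s" by (simp add: real_sqrt_mult)
  also have "D*(8 * sqrt s) = 8*exp (4*L*et^2)*(sqrt s/s)" by (simp add: D_def)
  also have "sqrt s/s = 1/sqrt s" using s by (simp add: sqrt_divide_self_eq inverse_eq_divide)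
  finally show "(LBINT v. ind {0<..} v * (passage s v * exp (et * v))) <= 8*exp (4*L*et^2)*(1/sqrt s)" .
qed

text \<open>The boundary of the region above \<open>c\<close> after time \<open>0\<close>, seen as one curve: parameters \<open>s <= 0\<close> run down the half line
  \<open>{c..}\<close> at time \<open>0\<close> (with speed 3), parameters \<open>s > 0\<close> run along the level \<open>c\<close>.\<close>
definition curve_time :: "real => real" where "curve_time s = max 0 s"
definition curve_level :: "real => real => real" where "curve_level c s = c + 3*max 0 (-s)"

lemma curve_measurable [measurable]:
  assumes "f \<in> bmeas M"
  shows "(%x. curve_time (f x)) \<in> bmeas M" "(%x. curve_level c (f x)) \<in> bmeas M"
  using assms unfolding curve_time_def curve_level_def by measurable

lemma curve_level_ge: "c <= curve_level c s" by (simp add: curve_level_def)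

text \<open>The integral of \<open>f\<close> against the starting position of a path from time \<open>0\<close>, by its first point \<open>s\<close> on the curve.\<close>
definition entry :: "real => real => (real => real) => real" where
  "entry c s f = (if s <= 0 then 3*f (curve_level c s) else (LBINT v. ind {0<..} v * (passage s v * f (c - v))))"

lemma passage_times_bounded:
  assumes s: "0 < s" "s <= L" and [measurable]: "f \<in> bmeas borel" and f: "!!x. abs (f x) <= C*exp (-et*x)"
  shows "Leb1 (%v. ind {0<..} v * (passage s v * f (c - v)))"
  and "(LBINT v. abs (ind {0<..} v * (passage s v * f (c - v)))) <= 8*exp (4*L*et^2)*(C*exp (-et*c))*(1/sqrt s)"
proof -
  have exp_le: "abs (ind {0<..} v * (passage s v * f (c - v))) <= C*exp (-et*c)*(ind {0<..} v * (passage s v * exp (et * v)))" for v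
  proof (cases "0 < v")
    case True
    have "passage s v * abs (f (c - v)) <= passage s v * (C*exp (-et*(c - v)))"
      using passage_nonneg[OF s(1), of v] True by (intro mult_left_mono f) auto
    also have "exp (-et*(c - v)) = exp (-et*c)*exp (et * v)" unfolding exp_add[symmetric] by (simp add: algebra_simps)
    finally show ?thesis using True passage_nonneg[OF s(1), of v] by (simp add: abs_mult mult_ac)
  qed simp
  have majorant: "Leb1 (%v. C*exp (-et*c)*(ind {0<..} v * (passage s v * exp (et * v))))"
    by (intro integrable_mult_right passage_exp_integral(1)[OF s])
  show int: "Leb1 (%v. ind {0<..} v * (passage s v * f (c - v)))" by (rule integrable_dominated[OF majorant]) (use exp_le in auto)
  have C: "0 <= C*exp (-et*c)" by (rule order_trans[OF abs_ge_zero f])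
  have "(LBINT v. abs (ind {0<..} v * (passage s v * f (c - v)))) <= (LBINT v. C*exp (-et*c)*(ind {0<..} v * (passage s v * exp (et * v))))"
    by (intro integral_mono integrable_abs int majorant exp_le)
  also have "... = C*exp (-et*c)*(LBINT v. ind {0<..} v * (passage s v * exp (et * v)))" by (rule integral_mult_right_zero)
  also have "... <= C*exp (-et*c)*(8*exp (4*L*et^2)*(1/sqrt s))" by (intro mult_left_mono passage_exp_integral(2)[OF s] C)
  finally show "(LBINT v. abs (ind {0<..} v * (passage s v * f (c - v)))) <= 8*exp (4*L*et^2)*(C*exp (-et*c))*(1/sqrt s)"
    by (simp only: mult_ac)
qed

definition curve_g :: "real => real => real => real" where "curve_g L c s = ind {..L} s*exp (-(L + 2)*curve_level c s)"
definition curve_k :: "real => real => real" where "curve_k L s = ind {..L} s*(if s <= 0 then 1 else 1/sqrt s)"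
definition start_g :: "real => real => real" where "start_g L y = min (exp y) (exp (2*(L + 2)*y))"

lemma abs_entry_le:
  assumes s: "s <= L" and L: "0 < L" and et: "0 <= et" and [measurable]: "f \<in> bmeas borel" and f: "!!x. abs (f x) <= C*exp (-et*x)"
  shows "abs (entry c s f) <= 8*exp (4*L*et^2)*(C*exp (-et*c))*curve_k L s"
proof -
  have C: "0 <= C" using order_trans[OF abs_ge_zero f[of 0]] by simp
  show ?thesis
  proof (cases "s <= 0")
    case True
    have "abs (f (curve_level c s)) <= C*exp (-et*curve_level c s)" by (rule f)
    also have "... <= C*exp (-et*c)" using C et curve_level_ge[of c s] by (intro mult_left_mono) (auto intro: mult_left_mono)
    finally have level_le: "abs (f (curve_level c s)) <= C*exp (-et*c)" .
    have "1 <= exp (4*L*et^2)" using L by simp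
    then have "3 <= 8*exp (4*L*et^2)" by linarith
    from mult_mono[OF this level_le] have "3*abs (f (curve_level c s)) <= 8*exp (4*L*et^2)*(C*exp (-et*c))" by simp
    then show ?thesis using True L by (simp add: entry_def curve_k_def abs_mult)
  next
    case False
    then have pos: "0 < s" by simp
    have "abs (entry c s f) <= (LBINT v. abs (ind {0<..} v * (passage s v * f (c - v))))" unfolding entry_def using False integral_abs_bound by simp
    also have "... <= 8*exp (4*L*et^2)*(C*exp (-et*c))*(1/sqrt s)" by (rule passage_times_bounded(2)[OF pos s _ f]) simp
    finally show ?thesis using False s by (simp add: curve_k_def)
  qed
qed

lemma weighted_measure_curve:
  assumes L: "0 < L" and c_pos: "0 < c"
  shows "weighted_measure lborel (curve_g L c) (curve_k L)"
proof unfold_locales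
  define a where "a = L + 2"
  have a: "0 < 3*a" using L by (simp add: a_def)
  show [measurable]: "curve_g L c \<in> bmeas lborel" "curve_k L \<in> bmeas lborel"
    unfolding curve_g_def[abs_def] curve_k_def[abs_def] by measurable
  show "Leb1 (%s. curve_g L c s*curve_k L s)"
  proof (rule L1_bound)
    show "Leb1 (%s. ind {..0} s*exp (3*a * s) + ind {0<..L} s*(1/sqrt s))"
      using has_bochner_integral_exp_left[OF a, of 0] by (intro L1_add inv_sqrt_integrable) (auto simp: Leb_iff)
    have ac: "0 <= a*c" using L c_pos by (simp add: a_def)
    have "norm (curve_g L c s*curve_k L s) <= norm (ind {..0} s*exp (3*a * s) + ind {0<..L} s*(1/sqrt s))" for s
    proof (cases "s <= 0")
      case True
      have "- a*curve_level c s <= 3*a * s" using True ac by (simp add: curve_level_def algebra_simps)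
      then show ?thesis using True L unfolding curve_g_def curve_k_def a_def[symmetric] by simp
    next
      case False
      have "exp (-a*curve_level c s) <= 1" using False ac by (simp add: curve_level_def)
      from mult_right_mono[OF this, of "1/sqrt s"] show ?thesis
        using False unfolding curve_g_def curve_k_def a_def[symmetric] by (auto simp: indicator_def)
    qed
    then show "AE s in lborel. norm (curve_g L c s*curve_k L s) <= norm (ind {..0} s*exp (3*a * s) + ind {0<..L} s*(1/sqrt s))" by simp
  qed measurable
qed (auto simp: curve_g_def curve_k_def)

lemma weighted_measure_start: "0 < L ==> weighted_measure lborel (start_g L) (tail_k L)"
  using weighted_measure_exp[of 1 "L + 2" "2*(L + 2)"] unfolding start_g_def[abs_def] tail_k_def[abs_def] by simp

definition curve_airy :: "real => real => real => real => real" where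
  "curve_airy L c s y = ind {..L} s*airy_tilt (curve_time s + 1) (curve_level c s + y)"

definition curve_heat :: "real => real => real => real => real" where
  "curve_heat L c y s = ind {..L} s*entry c s (%x. heat 1 (y - x))"

definition boundary_kernel :: "real => real => real => real" where
  "boundary_kernel c s s' = entry c s' (%x. airy_tilt (curve_time s) (curve_level c s + x))"

definition cut_boundary_kernel :: "real => real => real => real => real" where
  "cut_boundary_kernel L c s s' = ind {..L} s*ind {..L} s'*boundary_kernel c s s'"

lemma boundary_kernel_measurable: "(%p. boundary_kernel c (fst p) (snd p)) \<in> bmeas (borel \<Otimes>\<^sub>M borel)"
  unfolding boundary_kernel_def entry_def by measurable

lemma dominated_by_curve_airy:
  assumes L: "0 < L"
  shows "dominated_by (exp ((L + 2) ^ 3/3 + L*(L + 2)^2)) lborel (curve_g L c) lborel (tail_k L) (curve_airy L c)"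
  unfolding dominated_by_def
proof (intro conjI allI)
  show "(%p. curve_airy L c (fst p) (snd p)) \<in> bmeas (lborel \<Otimes>\<^sub>M lborel)" unfolding curve_airy_def by measurable
  fix s y
  show "abs (curve_airy L c s y) <= exp ((L + 2) ^ 3/3 + L*(L + 2)^2)*curve_g L c s*tail_k L y"
  proof (cases "s <= L")
    case True
    have "exp_bounded (L + 2) (exp ((L + 2) ^ 3/3 + L*(L + 2)^2)*exp (-(L + 2)*y)) (%x. airy_tilt (curve_time s + 1) (x + y))"
      by (rule airy_tilt_exp_bounded) (use True L in \<open>auto simp: curve_time_def\<close>)
    from exp_boundedD(2)[OF this, of "curve_level c s"] show ?thesis using True by (simp add: curve_airy_def curve_g_def tail_k_def mult_ac)
  qed (simp add: curve_airy_def curve_g_def)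
qed simp_all

lemma heat_1_le: "heat 1 d <= exp (et^2)*exp (et*d)"
proof -
  have "heat 1 d <= exp (1*(-et)^2)/sqrt (4*pi*1)*exp (-(-et)*d)" by (rule heat_exp_bound) simp
  also have "... <= exp (et^2)/1*exp (et*d)" using pi_gt3 by (intro mult_mono frac_le) auto
  finally show ?thesis by simp
qed

lemma dominated_by_curve_heat:
  assumes L: "0 < L" and c_pos: "0 < c"
  shows "dominated_by (8*exp ((1 + 4*L)*(2*(L + 2))^2)) lborel (start_g L) lborel (curve_k L) (curve_heat L c)" unfolding dominated_by_def
proof (intro conjI allI)
  show "(%p. curve_heat L c (fst p) (snd p)) \<in> bmeas (lborel \<Otimes>\<^sub>M lborel)" unfolding curve_heat_def entry_def by measurable
  define C where "C = 8*exp ((1 + 4*L)*(2*(L + 2))^2)"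
  fix y s
  have k: "0 <= curve_k L s" by (simp add: curve_k_def)
  have bound: "abs (curve_heat L c y s) <= C*exp (et*y)*curve_k L s" if et: "0 <= et" "et <= 2*(L + 2)" for et
  proof (cases "s <= L")
    case True
    have "abs (heat 1 (y - x)) <= exp (et^2)*exp (et*y)*exp (-et*x)" for x
      using heat_1_le[of "y - x" et] by (simp add: right_diff_distrib exp_diff exp_minus field_simps)
    then have "abs (entry c s (%x. heat 1 (y - x))) <= 8*exp (4*L*et^2)*(exp (et^2)*exp (et*y)*exp (-et*c))*curve_k L s"
      by (intro abs_entry_le[OF True L et(1)]) auto
    also have "... = 8*exp ((1 + 4*L)*et^2)*(exp (et*y)*exp (-et*c))*curve_k L s" by (simp add: distrib_right exp_add)
    also have "... <= C*(exp (et*y)*1)*curve_k L s"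
    proof (intro mult_right_mono mult_mono mult_left_mono)
      have "(1 + 4*L)*et^2 <= (1 + 4*L)*(2*(L + 2))^2" using et L by (intro mult_left_mono power_mono) auto
      then show "8*exp ((1 + 4*L)*et^2) <= C" by (simp add: C_def)
    qed (use et c_pos k in \<open>auto simp: C_def\<close>)
    finally show ?thesis using True by (simp add: curve_heat_def)
  qed (simp add: curve_heat_def curve_k_def)
  from bound[of 1] bound[of "2*(L + 2)"] L
  show "abs (curve_heat L c y s) <= 8*exp ((1 + 4*L)*(2*(L + 2))^2) * start_g L y*curve_k L s" unfolding start_g_def C_def min_def by auto
qed simp_all

lemma entry_heat_integral:
  assumes s: "s <= L" and a: "0 <= a" and g: "exp_bounded a B g"
  shows "(LBINT y. g y*entry c s (%x. heat 1 (y - x))) = entry c s (%x. LBINT y. g y*heat 1 (y - x))"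
proof (cases "s <= 0")
  case True
  then show ?thesis by (simp add: entry_def mult.left_commute[of _ 3])
next
  case False
  then have pos: "0 < s" by simp
  note [measurable] = exp_boundedD(1)[OF g]
  let ?F = "%v y. ind {0<..} v * passage s v * (g y*heat 1 (y - (c - v)))"
  have flow: "Leb1 (%y. g y*heat 1 (y - x))" for x
    using heat_exp_bounded(1)[OF _ g, of 1 x] by (simp add: heat_minus_commute[of 1 x] mult.commute)
  have row: "(LBINT y. abs (g y*heat 1 (y - x))) <= B*exp (a^2)*exp (-a*x)" for x
  proof -
    have "exp_bounded a B (%y. abs (g y))" using g by (simp add: exp_bounded_def)
    from heat_exp_bounded(2)[OF _ this, of 1 x] show ?thesis by (simp add: abs_mult heat_minus_commute[of 1 x] mult.commute)
  qed
  have "g y*entry c s (%x. heat 1 (y - x)) = (LBINT v. ?F v y)" for y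
    using False unfolding entry_def by (simp add: mult_ac flip: integral_mult_right_zero)
  then have "(LBINT y. g y*entry c s (%x. heat 1 (y - x))) = (LBINT y. (LBINT v. ?F v y))" by simp
  also have "... = (LBINT v. (LBINT y. ?F v y))"
  proof (rule Fubini_rows[symmetric])
    show "(%p. ?F (fst p) (snd p)) \<in> bmeas (lborel \<Otimes>\<^sub>M lborel)" by measurable
    show "Leb1 (?F v)" for v by (intro integrable_mult_right flow)
    show "Leb1 (%v. abs (ind {0<..} v * (passage s v * (B*exp (a^2)*exp (-a*(c - v))))))"
      by (intro integrable_abs passage_times_bounded(1)[OF pos s, where C="B*exp (a^2)" and et=a]) (use exp_boundedD(3)[OF g] in auto)
    fix v
    have "(LBINT y. abs (?F v y)) = abs (ind {0<..} v * passage s v) * (LBINT y. abs (g y*heat 1 (y - (c - v))))"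
      unfolding abs_mult[of "ind {0<..} v * passage s v"] by (rule integral_mult_right_zero)
    also have "... <= abs (ind {0<..} v * passage s v) * (B*exp (a^2)*exp (-a*(c - v)))" by (intro mult_left_mono row) simp
    also have "... = abs (ind {0<..} v * (passage s v * (B*exp (a^2)*exp (-a*(c - v)))))"
      using exp_boundedD(3)[OF g] by (simp add: abs_mult mult.assoc)
    finally show "(LBINT y. abs (?F v y)) <= abs (ind {0<..} v * (passage s v * (B*exp (a^2)*exp (-a*(c - v)))))" .
  qed
  also have "... = entry c s (%x. LBINT y. g y*heat 1 (y - x))" using False by (simp add: entry_def mult.assoc)
  finally show ?thesis .
qed

lemma kcomp_curve_airy_curve_heat:
  assumes L: "0 < L"
  shows "kcomp lborel (curve_airy L c) (curve_heat L c) = cut_boundary_kernel L c"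
proof (intro ext)
  fix s s'
  show "kcomp lborel (curve_airy L c) (curve_heat L c) s s' = cut_boundary_kernel L c s s'"
  proof (cases "s <= L \<and> s' <= L")
    case True
    let ?g = "%y. airy_tilt (curve_time s + 1) (y + curve_level c s)"
    have g: "exp_bounded (L + 2) (exp ((L + 2) ^ 3/3 + L*(L + 2)^2)*exp (-(L + 2)*curve_level c s)) ?g"
      by (rule airy_tilt_exp_bounded) (use True L in \<open>auto simp: curve_time_def\<close>)
    have "(LBINT y. ?g y*entry c s' (%x. heat 1 (y - x))) = entry c s' (%x. LBINT y. ?g y*heat 1 (y - x))"
      by (rule entry_heat_integral[OF _ _ g]) (use True L in auto)
    also have "(%x. LBINT y. ?g y*heat 1 (y - x)) = (%x. airy_tilt (curve_time s) (curve_level c s + x))"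
      using airy_tilt_semigroup(1)[of 1 "curve_time s + 1" "curve_level c s"] by (simp add: add.commute fun_eq_iff)
    finally show ?thesis using True
      by (simp add: kcomp_def curve_airy_def curve_heat_def cut_boundary_kernel_def boundary_kernel_def add.commute)
  qed (auto simp: kcomp_def curve_airy_def curve_heat_def cut_boundary_kernel_def)
qed

lemma integral_excess_above:
  assumes L: "0 < L" and [measurable]: "h \<in> bmeas borel"
  shows "(LBINT x. ind {c<..} x*(h x*absorbed_excess L c x y)) = (LBINT s. ind {..0} s*(entry c s h*curve_airy L c s y))"
proof -
  let ?F = "%x. ind {c<..} x*(h x*absorbed_excess L c x y)"
  have "integral\<^sup>L lborel ?F = abs (-3) *\<^sub>R (LBINT s. ?F (c + -3 * s))" by (rule lborel_integral_real_affine) simp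
  also have "... = (LBINT s. 3*?F (c + -3 * s))" by simp
  also have "... = (LBINT s. ind {..0} s*(entry c s h*curve_airy L c s y))"
  proof (rule integral_cong_AE)
    show "AE s in lborel. 3*?F (c + -3 * s) = ind {..0} s*(entry c s h*curve_airy L c s y)" using AE_lborel_singleton[of 0]
    proof eventually_elim
      case (elim s)
      then show ?case using L by (cases "s <= 0") (auto simp: absorbed_excess_def entry_def curve_airy_def curve_level_def curve_time_def)
    qed
    show "(%s. ind {..0} s*(entry c s h*curve_airy L c s y)) \<in> bmeas lborel" unfolding entry_def curve_airy_def by measurable
  qed measurable
  finally show ?thesis .
qed

lemma passage_integral_swap:
  fixes g h :: "real => real" and c L :: real
  assumes [measurable]: "g \<in> bmeas borel" "h \<in> bmeas borel"
  and g: "!!t. 0 < t ==> t < L ==> abs (g t) <= A" and h: "!!x. abs (h x) <= B" and A: "0 <= A"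
  shows "(LBINT v. (LBINT t. ind {0<..<L} t*g t*(ind {0<..} v * (passage t v * h (c - v))))) =
  (LBINT t. (LBINT v. ind {0<..<L} t*g t*(ind {0<..} v * (passage t v * h (c - v)))))"
proof (rule Fubini_rows[symmetric])
  let ?f = "%t v. ind {0<..<L} t*g t*(ind {0<..} v * (passage t v * h (c - v)))"
  have h': "abs (h x) <= B*exp (-0*x)" for x using h by simp
  have B: "0 <= B" by (rule order_trans[OF abs_ge_zero h])
  show "(%p. ?f (fst p) (snd p)) \<in> bmeas (lborel \<Otimes>\<^sub>M lborel)" by measurable
  show "Leb1 (?f t)" for t
    using passage_times_bounded(1)[OF _ _ _ h', of t L c] by (cases "t \<in> {0<..<L}") (auto intro!: integrable_mult_right)
  show "Leb1 (%t. A*(8*B)*(ind {0<..L} t*(1/sqrt t)))" by (intro integrable_mult_right inv_sqrt_integrable)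
  show "(LBINT v. abs (?f t v)) <= A*(8*B)*(ind {0<..L} t*(1/sqrt t))" for t
  proof (cases "t \<in> {0<..<L}")
    case True
    then have t: "0 < t" "t <= L" by auto
    have "(LBINT v. abs (?f t v)) = abs (g t)*(LBINT v. abs (ind {0<..} v * (passage t v * h (c - v))))" using True by (simp add: abs_mult)
    also have "... <= A*(8*exp (4*L*0^2)*(B*exp (-0*c))*(1/sqrt t))"
      using True A by (intro mult_mono g passage_times_bounded(2)[OF t _ h']) (auto intro!: integral_nonneg_AE)
    finally show ?thesis using t by (simp add: mult.assoc)
  qed (use A B in \<open>auto simp: indicator_def\<close>)
qed

lemma integral_excess_below:
  assumes L: "0 < L" and [measurable]: "h \<in> bmeas borel" and h: "!!x. abs (h x) <= B"
  shows "(LBINT x. ind {..<c} x*(h x*absorbed_excess L c x y)) = (LBINT s. ind {0<..} s*(entry c s h*curve_airy L c s y))"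
proof -
  let ?F = "%x. ind {..<c} x*(h x*absorbed_excess L c x y)"
  let ?f = "%t v. ind {0<..<L} t*airy_tilt (t + 1) (c + y)*(ind {0<..} v * (passage t v * h (c - v)))"
  define A where "A = exp ((L + 2) ^ 3/3 + L*(L + 2)^2)*exp (-(L + 2)*y)*exp (-(L + 2)*c)"
  have bound: "abs (airy_tilt (t + 1) (c + y)) <= A" if "0 < t" "t < L" for t
  proof -
    have "exp_bounded (L + 2) (exp ((L + 2) ^ 3/3 + L*(L + 2)^2)*exp (-(L + 2)*y)) (%x. airy_tilt (t + 1) (x + y))"
      by (rule airy_tilt_exp_bounded) (use that L in auto)
    from exp_boundedD(2)[OF this, of c] show ?thesis by (simp add: A_def)
  qed
  have "integral\<^sup>L lborel ?F = abs (-1) *\<^sub>R (LBINT v. ?F (c + -1 * v))" by (rule lborel_integral_real_affine) simp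
  also have "... = (LBINT v. (LBINT t. ?f t v))"
  proof -
    have "?F (c + -1 * v) = (LBINT t. ?f t v)" for v
    proof (cases "0 < v")
      case True
      then have "absorbed_excess L c (c - v) y = (LBINT t. ind {0<..<L} t*(passage t v * airy_tilt (t + 1) (c + y)))"
        using absorbed_excess_passage[OF L, of "c - v" c y] by simp
      then have "h (c - v)*absorbed_excess L c (c - v) y = (LBINT t. ?f t v)"
        using True by (simp add: mult_ac flip: integral_mult_right_zero)
      then show ?thesis using True by simp
    qed simp
    then show ?thesis by simp
  qed
  also have "... = (LBINT t. (LBINT v. ?f t v))" by (rule passage_integral_swap[OF _ _ bound h]) (simp_all add: A_def)
  also have "... = (LBINT s. ind {0<..} s*(entry c s h*curve_airy L c s y))"
  proof (rule integral_cong_AE)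
    show "AE t in lborel. (LBINT v. ?f t v) = ind {0<..} t*(entry c t h*curve_airy L c t y)" using AE_lborel_singleton[of L]
    proof eventually_elim
      case (elim t)
      then show ?case by (auto simp: entry_def curve_airy_def curve_time_def curve_level_def indicator_def)
    qed
    show "(%s. ind {0<..} s*(entry c s h*curve_airy L c s y)) \<in> bmeas lborel" unfolding entry_def curve_airy_def by measurable
    show "(%t. LBINT v. ?f t v) \<in> bmeas lborel" by measurable
  qed
  finally show ?thesis .
qed

lemma heat_excess_integrable:
  assumes L: "0 < L" and c_pos: "0 < c"
  shows "Leb1 (%x. heat 1 (y - x)*absorbed_excess L c x y')"
proof -
  obtain D where D: "dominated_by D lborel (tail_g L) lborel (tail_k L) (absorbed_excess L c)" using dominated_by_excesses[OF L c_pos] by blast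
  have "0 <= tail_k L y'" by (simp add: tail_k_def)
  from mult_tail_g[OF this dominated_byD(1)[OF D]]
  have "abs (absorbed_excess L c x y') <= D*exp (-(L + 2)*x)*tail_k L y'" for x using dominated_byD(4)[OF D, of x y'] by simp
  then have "abs (absorbed_excess L c x y') <= D*tail_k L y'*exp (-(L + 2)*x)" for x by (simp only: mult_ac)
  then have "exp_bounded (L + 2) (D*tail_k L y') (%x. absorbed_excess L c x y')" by (simp add: exp_bounded_def)
  from heat_exp_bounded(1)[OF _ this] show ?thesis by simp
qed

lemma kcomp_curve_heat_curve_airy:
  assumes L: "0 < L" and c_pos: "0 < c"
  shows "kcomp lborel (curve_heat L c) (curve_airy L c) = limit_kernel L c"
proof (intro ext)
  fix y y'
  let ?h = "%x. heat 1 (y - x)"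
  let ?F = "%x. ?h x*absorbed_excess L c x y'" and ?G = "%s. entry c s ?h*curve_airy L c s y'"
  have G_eq: "?G s = curve_heat L c y s*curve_airy L c s y'" for s by (simp add: curve_heat_def curve_airy_def indicator_def)
  interpret weighted_measure lborel "curve_g L c" "curve_k L" by (rule weighted_measure_curve[OF L c_pos])
  have G: "Leb1 ?G" unfolding G_eq by (rule kcomp_integrable[OF dominated_by_curve_heat[OF L c_pos] dominated_by_curve_airy[OF L]])
  have F: "Leb1 (%x. ind A x*?F x)" if "A \<in> sets borel" for A
    using that heat_excess_integrable[OF L c_pos] by (intro L1_bound[OF heat_excess_integrable[OF L c_pos]]) (auto simp: indicator_def)
  have "abs (?h x) <= 1" for x
  proof -
    have "heat 1 (y - x) <= 1/sqrt (4*pi*1)" by (rule heat_le) simp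
    also have "... <= 1" using pi_gt3 by (simp add: divide_le_eq)
    finally show ?thesis by simp
  qed
  note below = integral_excess_below[OF L _ this]
  have "limit_kernel L c y y' = (LBINT x. ind {c<..} x*?F x + ind {..<c} x*?F x)" unfolding limit_kernel_def
  proof (rule integral_cong_AE)
    show "AE x in lborel. ?F x = ind {c<..} x*?F x + ind {..<c} x*?F x"
      using AE_lborel_singleton[of c] by eventually_elim (auto simp: indicator_def)
  qed measurable
  also have "... = (LBINT s. ind {..0} s*?G s) + (LBINT s. ind {0<..} s*?G s)" using F integral_excess_above[OF L, of ?h] below by simp
  also have "... = (LBINT s. ind {..0} s*?G s + ind {0<..} s*?G s)"
    using G by (intro LINT_add[symmetric]) (auto intro!: L1_bound[OF G] simp: indicator_def)
  also have "... = kcomp lborel (curve_heat L c) (curve_airy L c) y y'"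
    unfolding kcomp_def by (intro LINT_cong refl) (simp add: G_eq indicator_def)
  finally show "kcomp lborel (curve_heat L c) (curve_airy L c) y y' = limit_kernel L c y y'" by simp
qed

lemma dominated_cut_boundary_kernel:
  assumes L: "0 < L" and c_pos: "0 < c"
  shows "dominated lborel (curve_g L c) lborel (curve_k L) (cut_boundary_kernel L c)"
proof -
  interpret weighted_measure lborel "start_g L" "tail_k L" by (rule weighted_measure_start[OF L])
  show ?thesis unfolding kcomp_curve_airy_curve_heat[OF L, symmetric] dominated_def
    using dominated_by_kcomp[OF dominated_by_curve_airy[OF L] dominated_by_curve_heat[OF L c_pos]] by blast
qed

lemma fredholm_limit_kernel:
  assumes L: "0 < L" and c_pos: "0 < c"
  shows "fredholm lborel (limit_kernel L c) = fredholm lborel (cut_boundary_kernel L c)"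
proof -
  have "dominated lborel (curve_g L c) lborel (tail_k L) (curve_airy L c)" "dominated lborel (start_g L) lborel (curve_k L) (curve_heat L c)"
    using dominated_by_curve_airy[OF L] dominated_by_curve_heat[OF L c_pos] by (auto simp: dominated_def)
  from trpow_kcomp_commute[OF weighted_measure_curve[OF L c_pos] weighted_measure_start[OF L] this]
  have "trpow lborel (cut_boundary_kernel L c) = trpow lborel (limit_kernel L c)"
    unfolding kcomp_curve_airy_curve_heat[OF L] kcomp_curve_heat_curve_airy[OF L c_pos] by (intro ext)
  then show ?thesis by (simp add: fredholm_def)
qed

section \<open>Estimates for the boundary kernel\<close>

lemma exp_div_sqrt_le:
  assumes b: "1 <= b"
  shows "ind {0<..} r*(exp (-b*r)/sqrt r) <= ind {0<..1} r*(1/sqrt r) + ind {0..} r*exp (-1*r)"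
proof (cases "0 < r")
  case True
  have exp_le: "exp (-b*r) <= exp (-1*r)" "exp (-b*r) <= 1" using True b by auto
  show ?thesis
  proof (cases "r <= 1")
    case True
    then show ?thesis using exp_le \<open>0 < r\<close> divide_right_mono[of "exp (-b*r)" 1 "sqrt r"] by (simp add: add_increasing2)
  next
    case False
    then have "1 <= sqrt r" by simp
    then have "exp (-b*r)/sqrt r <= exp (-1*r)/1" using exp_le by (intro frac_le) auto
    then show ?thesis using False by simp
  qed
qed simp

lemma exp_div_sqrt_integral:
  assumes b: "1 <= b"
  shows "Leb1 (%r. ind {0<..} r*(exp (-b*r)/sqrt r))" and "(LBINT r. ind {0<..} r*(exp (-b*r)/sqrt r)) <= 3"
proof -
  have tail: "Leb_has (%r::real. ind {0..} r*exp (-1*r)) (exp (-1*0)/1)" by (rule has_bochner_integral_exp_right) simp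
  have majorant: "Leb1 (%r. ind {0<..1} r*(1/sqrt r) + ind {0..} r*exp (-1*r))"
    using tail by (intro L1_add inv_sqrt_integrable) (simp add: Leb_iff)
  have nonneg: "0 <= ind {0<..} r*(exp (-b*r)/sqrt r)" for r :: real by (auto simp: indicator_def)
  show int: "Leb1 (%r. ind {0<..} r*(exp (-b*r)/sqrt r))"
    by (rule integrable_dominated[OF majorant]) (use exp_div_sqrt_le[OF b] in \<open>simp_all only: real_norm_def abs_of_nonneg[OF nonneg], measurable\<close>)
  have "(LBINT r. ind {0<..} r*(exp (-b*r)/sqrt r)) <= (LBINT r. ind {0<..1} r*(1/sqrt r) + ind {0..} r*exp (-1*r))"
    by (intro integral_mono int majorant exp_div_sqrt_le b)
  also have "... = (LBINT r. ind {0<..1} r*(1/sqrt r)) + (LBINT r. ind {0..} r*exp (-1*r))"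
    using tail by (intro LINT_add inv_sqrt_integrable) (simp add: Leb_iff)
  also have "... <= 3" using Leb_eq[OF inv_sqrt_integral[of 1]] unfolding Leb_eq[OF tail] by simp
  finally show "(LBINT r. ind {0<..} r*(exp (-b*r)/sqrt r)) <= 3" .
qed

definition tent :: "real => real" where "tent t = min (exp t) (exp (4*t))"

lemma tent_measurable [measurable]: "f \<in> bmeas M ==> (%x. tent (f x)) \<in> bmeas M" unfolding tent_def by simp

lemma tent_nonneg: "0 <= tent t" by (simp add: tent_def)

lemma tent_le:
  assumes "1 <= b" "b <= 4"
  shows "tent t <= exp (b*t)" using mult_right_mono[of 1 b t] mult_right_mono_neg[of b 4 t] assms
  by (cases "0 <= t") (auto simp: tent_def min_le_iff_disj)

abbreviation (input) tent_kernel :: "real => real => real" where "tent_kernel s r == tent (r - s)"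

lemma tent_row:
  assumes b: "b = 2 \<or> b = 3"
  shows "Leb1 (tilted b tent_kernel s)" and "integral\<^sup>L lborel (tilted b tent_kernel s) <= 3/2"
proof -
  define B where "B t = ind {0..} t*exp (-(b - 1)*t) + ind {..0} t*exp ((4 - b)*t)" for t
  have "Leb_has B (exp (-(b - 1)*0)/(b - 1) + exp ((4 - b)*0)/(4 - b))"
    unfolding B_def[abs_def] using b by (intro has_bochner_integral_add has_bochner_integral_exp_right has_bochner_integral_exp_left) auto
  moreover have "exp (-(b - 1)*0)/(b - 1) + exp ((4 - b)*0)/(4 - b) = 3/2" using b by auto
  ultimately have "Leb_has B (3/2)" by (simp only:)
  from lborel_has_bochner_integral_real_affine_iff[of 1 B "3/2" "-s", THEN iffD1, OF _ this]
  have B: "Leb_has (%r. B (-s + 1*r)) (3/2)" by simp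
  have majorant_le: "tilted b tent_kernel s r <= B (-s + 1*r)" for r
  proof -
    have "exp (-(b - 1)*t) = exp t*exp (-b*t)" "exp ((4 - b)*t) = exp (4*t)*exp (-b*t)" for t
      unfolding exp_add[symmetric] by (simp_all add: algebra_simps)
    then have "tent t*exp (-b*t) <= exp (-(b - 1)*t)" "tent t*exp (-b*t) <= exp ((4 - b)*t)" for t
      by (simp_all only: tent_def) (intro mult_right_mono; simp)+
    from this[of "r - s"] show ?thesis by (auto simp: B_def tilted_def indicator_def abs_of_nonneg[OF tent_nonneg] not_le)
  qed
  have meas: "tent_kernel s \<in> bmeas borel" by measurable
  have "Leb1 (%r. B (-s + 1*r))" using B by (simp add: Leb_iff)
  from tilted_majorized[of tent_kernel, OF meas this majorant_le] Leb_eq[OF B]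
  show "Leb1 (tilted b tent_kernel s)" "integral\<^sup>L lborel (tilted b tent_kernel s) <= 3/2" by simp_all
qed

lemma airy_passage_le_tent:
  assumes x: "3 <= x" and t: "t - (x - 3) <= u" "4*t - 2*(x - 3) <= 4*u"
  shows "abs (airy_passage x t) <= 1/8*tent u"
proof -
  have "abs (airy_passage x t) <= 1/8*exp (1*t - sqrt 1*(x - 3))" "abs (airy_passage x t) <= 1/8*exp (4*t - sqrt 4*(x - 3))"
    by (rule airy_passage_bound[OF _ x]; simp)+
  moreover have "exp (1*t - sqrt 1*(x - 3)) <= exp u" "exp (4*t - sqrt 4*(x - 3)) <= exp (4*u)" using t by simp_all
  ultimately have "abs (airy_passage x t) <= 1/8*exp u" "abs (airy_passage x t) <= 1/8*exp (4*u)" by linarith+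
  then show ?thesis by (simp add: tent_def min_def del: exp_le_cancel_iff)
qed

lemma airy_passage_measurable [measurable]:
  assumes [measurable]: "f \<in> bmeas M" "h \<in> bmeas M"
  shows "(%x. airy_passage (f x) (h x)) \<in> bmeas M" unfolding airy_passage_def by measurable

definition boundary_correction :: "real => real => real => real" where
  "boundary_correction c s s' = (LBINT v. ind {0<..} v * (passage s' v * airy_tilt (curve_time s) (curve_level c s + c + v)))"

lemma boundary_kernel_split:
  assumes s': "0 < s'"
  shows "boundary_kernel c s s' = airy_passage (curve_level c s + c) (s' - curve_time s) + boundary_correction c s s'"
proof -
  define x where "x = curve_level c s + c"
  define f where "f v = passage s' v * airy_tilt (curve_time s) (x - v)" for v
  have f: "Leb1 f" unfolding f_def[abs_def] by (rule passage_airy_tilt_hyperbola(2)[OF s', of 1]) simp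
  then have [measurable]: "f \<in> bmeas borel" by simp
  have halves: "Leb1 (%v. ind {0<..} v * f v)" "Leb1 (%v. ind {..<0} v * f v)" by (rule L1_bound[OF f]; auto simp: indicator_def)+
  have "airy_passage x (s' - curve_time s) = integral\<^sup>L lborel f" unfolding f_def[abs_def] by (rule passage_airy_tilt_integral[OF s', symmetric])
  also have "... = (LBINT v. ind {0<..} v * f v + ind {..<0} v * f v)"
  proof (rule integral_cong_AE)
    show "AE v in lborel. f v = ind {0<..} v * f v + ind {..<0} v * f v"
      using AE_lborel_singleton[of 0] by eventually_elim (auto simp: indicator_def)
  qed measurable
  also have "... = (LBINT v. ind {0<..} v * f v) + (LBINT v. ind {..<0} v * f v)" using halves by simp
  also have "(LBINT v. ind {..<0} v * f v) = abs (-1) *\<^sub>R (LBINT v. ind {..<0} (0 + -1 * v)*f (0 + -1 * v))"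
    by (rule lborel_integral_real_affine) simp
  also have "... = (LBINT v. - (ind {0<..} v * (passage s' v * airy_tilt (curve_time s) (x + v))))"
    by (auto intro!: LINT_cong simp: f_def passage_minus indicator_def)
  also have "... = - boundary_correction c s s'" unfolding boundary_correction_def x_def by simp
  finally show ?thesis using s' unfolding boundary_kernel_def entry_def f_def x_def by (simp add: add_diff_eq)
qed

definition curve_decay :: "real => real" where "curve_decay s = exp (-4*max 0 s - 6*max 0 (-s))"

lemma curve_decay_tilt: "b = 2 \<or> b = 3 ==> curve_decay s*exp (b * s) <= 1"
  unfolding curve_decay_def exp_add[symmetric] by (cases "0 <= s") auto

definition row_majorant :: "real => real => real" where
  "row_majorant b r = 1/8*(ind {..0} r*exp ((6 - b)*r)) + 1/32*(ind {0<..} r*(exp (-b*r)/sqrt r))"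

lemma row_majorant_integral:
  assumes b: "b = 2 \<or> b = 3"
  shows "Leb1 (row_majorant b)" and "integral\<^sup>L lborel (row_majorant b) <= 1/4"
proof -
  have left: "Leb_has (%r. ind {..0} r*exp ((6 - b)*r)) (exp ((6 - b)*0)/(6 - b))" using b by (intro has_bochner_integral_exp_left) auto
  have b_ge_1: "1 <= b" using b by auto
  have int: "Leb1 (%r. 1/8*(ind {..0} r*exp ((6 - b)*r)))" "Leb1 (%r. 1/32*(ind {0<..} r*(exp (-b*r)/sqrt r)))"
    by (rule integrable_mult_right[OF left[unfolded Leb_iff, THEN conjunct1]], rule integrable_mult_right[OF exp_div_sqrt_integral(1)[OF b_ge_1]])
  show "Leb1 (row_majorant b)" unfolding row_majorant_def[abs_def] by (intro L1_add int)
  have "integral\<^sup>L lborel (row_majorant b) = (LBINT r. 1/8*(ind {..0} r*exp ((6 - b)*r))) + (LBINT r. 1/32*(ind {0<..} r*(exp (-b*r)/sqrt r)))"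
    unfolding row_majorant_def[abs_def] by (intro LINT_add int)
  also have "... = 1/8*(exp ((6 - b)*0)/(6 - b)) + 1/32*(LBINT r. ind {0<..} r*(exp (-b*r)/sqrt r))"
    using Leb_eq[OF left] by (simp only: integral_mult_right_zero)
  also have "... <= 1/8*(1/3) + 1/32*3"
  proof (intro add_mono mult_left_mono)
    show "exp ((6 - b)*0)/(6 - b) <= 1/3" using b by auto
  qed (use exp_div_sqrt_integral(2)[OF b_ge_1] in auto)
  finally show "integral\<^sup>L lborel (row_majorant b) <= 1/4" by simp
qed

definition boundary_weight :: "real => real" where
  "boundary_weight s = (if s <= 0 then exp (4 * s) else 1 + 1/sqrt s)"
definition flat_weight :: "real => real" where
  "flat_weight s = (if s <= 0 then 1 else 1 + 1/sqrt s)"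

lemma boundary_weight_nonneg: "0 <= boundary_weight s" by (simp add: boundary_weight_def)
lemma boundary_weight_le_flat: "boundary_weight s <= flat_weight s" by (simp add: boundary_weight_def flat_weight_def)
lemma flat_weight_ge_1: "1 <= flat_weight s" by (simp add: flat_weight_def)

lemma weight_measurable [measurable]: "boundary_weight \<in> bmeas borel" "flat_weight \<in> bmeas borel"
  unfolding boundary_weight_def[abs_def] flat_weight_def[abs_def] by measurable

lemma flat_weight_integrable: "Leb1 (%s. ind {x<..y} s*flat_weight s)"
proof (rule L1_bound)
  show "Leb1 (%s. ind {x<..y} s + ind {0<..y} s*(1/sqrt s))"
  proof (intro L1_add inv_sqrt_integrable integrable_real_indicator)
    show "emeasure lborel {x<..y} < \<infinity>" by (cases "x <= y") auto
  qed simp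
qed (auto intro!: AE_I2 simp: flat_weight_def indicator_def)

lemma boundary_weight_integrable: "Leb1 (%s. ind {..y} s*boundary_weight s)"
proof (rule L1_bound)
  have left: "Leb_has (%r::real. ind {..0} r*exp (4*r)) (exp (4*0)/4)" by (rule has_bochner_integral_exp_left) simp
  have right: "Leb1 (ind {0<..y} :: real => real)" by (rule integrable_real_indicator) (cases "0 <= y"; simp)+
  show "Leb1 (%s. ind {..0} s*exp (4 * s) + (ind {0<..y} s + ind {0<..y} s*(1/sqrt s)))"
    using left by (intro L1_add inv_sqrt_integrable right) (simp add: Leb_iff)
qed (auto intro!: AE_I2 simp: boundary_weight_def indicator_def)

lemma row_majorant_le_weight:
  assumes r: "0 < r"
  shows "row_majorant 2 r + 1/8 <= boundary_weight r"
proof -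
  have "exp (-2*r)/sqrt r <= 1/sqrt r" using r by (intro divide_right_mono) auto
  moreover have "0 < 1/sqrt r" using r by simp
  moreover have "row_majorant 2 r = 1/32*(exp (-2*r)/sqrt r)" "boundary_weight r = 1 + 1/sqrt r"
    using r by (simp_all add: row_majorant_def boundary_weight_def)
  ultimately show ?thesis by linarith
qed

context
  fixes c :: real
  assumes c_ge: "3/2 <= c"
begin

lemma abs_boundary_kernel_nonpos_le:
  assumes s': "s' <= 0"
  shows "abs (boundary_kernel c s s') <= 3/32*curve_decay s*exp (6 * s')"
proof -
  have "abs (airy_tilt (curve_time s) (curve_level c s + curve_level c s'))
    <= 1/32*exp (-4*curve_time s - 2*(curve_level c s + curve_level c s' - 3))"
    by (rule airy_tilt_bound) (use c_ge in \<open>auto simp: curve_level_def\<close>)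
  also have "exp (-4*curve_time s - 2*(curve_level c s + curve_level c s' - 3)) <= exp ((-4*max 0 s - 6*max 0 (-s)) + 6 * s')"
    using c_ge s' by (simp add: curve_time_def curve_level_def)
  also have "... = curve_decay s*exp (6 * s')" unfolding exp_add curve_decay_def ..
  finally show ?thesis using s' by (simp add: boundary_kernel_def entry_def abs_mult)
qed

lemma abs_boundary_correction_le:
  assumes s': "0 < s'"
  shows "abs (boundary_correction c s s') <= 1/32*curve_decay s/sqrt s'"
proof -
  let ?f = "%v. ind {0<..} v * (passage s' v * airy_tilt (curve_time s) (curve_level c s + c + v))"
  have half: "Leb_has (%v. ind {0..} v * passage s' v) (1/sqrt (pi * s'))" by (rule passage_halfline_integral[OF s'])
  have decay_le: "abs (?f v) <= 1/32*curve_decay s*(ind {0..} v * passage s' v)" for v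
  proof (cases "0 < v")
    case True
    have "abs (airy_tilt (curve_time s) (curve_level c s + c + v)) <= 1/32*exp (-4*curve_time s - 2*(curve_level c s + c + v - 3))"
      by (rule airy_tilt_bound) (use c_ge True in \<open>auto simp: curve_level_def\<close>)
    also have "... <= 1/32*curve_decay s" using c_ge True by (simp add: curve_time_def curve_level_def curve_decay_def)
    finally have "passage s' v * abs (airy_tilt (curve_time s) (curve_level c s + c + v)) <= passage s' v * (1/32*curve_decay s)"
      using True passage_nonneg[OF s', of v] by (intro mult_left_mono) auto
    then show ?thesis using True passage_nonneg[OF s', of v] by (simp add: abs_mult mult.commute)
  next
    case False
    then show ?thesis using passage_nonneg[OF s', of v] by (auto simp: indicator_def curve_decay_def)
  qed
  have majorant: "Leb1 (%v. 1/32*curve_decay s*(ind {0..} v * passage s' v))"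
    using half by (intro integrable_mult_right) (simp add: Leb_iff)
  have int: "Leb1 ?f" by (rule integrable_dominated[OF majorant]) (use decay_le in auto)
  have "abs (boundary_correction c s s') <= (LBINT v. abs (?f v))" unfolding boundary_correction_def by (rule integral_abs_bound)
  also have "... <= (LBINT v. 1/32*curve_decay s*(ind {0..} v * passage s' v))" by (intro integral_mono integrable_abs majorant int decay_le)
  also have "... = 1/32*curve_decay s*(1/sqrt (pi * s'))" unfolding integral_mult_right_zero Leb_eq[OF half] ..
  also have "... <= 1/32*curve_decay s*(1/sqrt s')" using s' pi_gt3 by (intro mult_left_mono divide_left_mono) (auto simp: curve_decay_def)
  finally show ?thesis by simp
qed

lemma boundary_row_le:
  assumes b: "b = 2 \<or> b = 3"
  shows "tilted b (boundary_kernel c) s r <= row_majorant b r + 1/8*tilted b tent_kernel s r"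
proof -
  have tilt: "exp (-b*(r - s)) = exp (-b*r)*exp (b * s)" unfolding exp_add[symmetric] by (simp add: algebra_simps)
  show ?thesis
  proof (cases "r <= 0")
    case True
    have "tilted b (boundary_kernel c) s r <= 3/32*curve_decay s*exp (6*r)*exp (-b*(r - s))"
      unfolding tilted_def by (intro mult_right_mono abs_boundary_kernel_nonpos_le True) simp
    also have "... = 3/32*(exp (6*r)*exp (-b*r))*(curve_decay s*exp (b * s))" unfolding tilt by (simp only: mult_ac)
    also have "... <= 3/32*(exp (6*r)*exp (-b*r))*1" using curve_decay_tilt[OF b] by (intro mult_left_mono) auto
    also have "exp (6*r)*exp (-b*r) = exp ((6 - b)*r)" unfolding exp_add[symmetric] by (simp add: algebra_simps)
    also have "3/32*exp ((6 - b)*r)*1 <= row_majorant b r" using True by (simp add: row_majorant_def)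
    finally show ?thesis by (simp add: add_increasing2)
  next
    case False
    then have r: "0 < r" by simp
    have "abs (airy_passage (curve_level c s + c) (r - curve_time s)) <= 1/8*tent (r - s)"
      by (rule airy_passage_le_tent) (use c_ge in \<open>auto simp: curve_level_def curve_time_def\<close>)
    then have "abs (boundary_kernel c s r) <= 1/32*curve_decay s/sqrt r + 1/8*tent (r - s)"
      unfolding boundary_kernel_split[OF r] using abs_boundary_correction_le[OF r, of s] by linarith
    then have "tilted b (boundary_kernel c) s r <= (1/32*curve_decay s/sqrt r + 1/8*tent (r - s))*exp (-b*(r - s))"
      unfolding tilted_def by (intro mult_right_mono) auto
    also have "... = 1/32*(exp (-b*r)/sqrt r)*(curve_decay s*exp (b * s)) + 1/8*tilted b tent_kernel s r"
      unfolding distrib_right tilt tilted_def abs_of_nonneg[OF tent_nonneg] by simp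
    also have "1/32*(exp (-b*r)/sqrt r)*(curve_decay s*exp (b * s)) <= 1/32*(exp (-b*r)/sqrt r)*1"
      using curve_decay_tilt[OF b] r by (intro mult_left_mono) auto
    also have "1/32*(exp (-b*r)/sqrt r)*1 = row_majorant b r" using r by (simp add: row_majorant_def)
    finally show ?thesis by simp
  qed
qed

lemma boundary_kernel_row_measurable [measurable]: "boundary_kernel c s \<in> bmeas borel"
  using measurable_compose[OF _ boundary_kernel_measurable[of c], of "%r. (s, r)" borel] by simp

lemma boundary_row:
  assumes b: "b = 2 \<or> b = 3"
  shows "Leb1 (tilted b (boundary_kernel c) s)" and "integral\<^sup>L lborel (tilted b (boundary_kernel c) s) <= 1/2"
proof -
  have majorant: "Leb1 (%r. row_majorant b r + 1/8*tilted b tent_kernel s r)"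
    by (intro L1_add integrable_mult_right row_majorant_integral tent_row b)
  note row = tilted_majorized[OF boundary_kernel_row_measurable majorant boundary_row_le[OF b]]
  show "Leb1 (tilted b (boundary_kernel c) s)" by (rule row(1))
  have "integral\<^sup>L lborel (tilted b (boundary_kernel c) s) <= (LBINT r. row_majorant b r + 1/8*tilted b tent_kernel s r)" by (rule row(2))
  also have "... = integral\<^sup>L lborel (row_majorant b) + 1/8*integral\<^sup>L lborel (tilted b tent_kernel s)"
    using row_majorant_integral(1)[OF b] tent_row(1)[OF b, of s] by simp
  also have "... <= 1/4 + 1/8*(3/2)" by (intro add_mono mult_left_mono row_majorant_integral tent_row b) auto
  finally show "integral\<^sup>L lborel (tilted b (boundary_kernel c) s) <= 1/2" by simp
qed

lemma abs_boundary_kernel_le: "abs (boundary_kernel c s s') <= boundary_weight s'*exp (2*(s' - s))"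
proof -
  have "tilted 2 (boundary_kernel c) s s' <= boundary_weight s'"
  proof (cases "s' <= 0")
    case True
    have "tilted 2 (boundary_kernel c) s s' <= 3/32*curve_decay s*exp (6 * s')*exp (-2*(s' - s))"
      unfolding tilted_def by (intro mult_right_mono abs_boundary_kernel_nonpos_le True) simp
    also have "... = 3/32*exp (4 * s')*(curve_decay s*exp (2 * s))"
    proof -
      have "exp (6 * s')*exp (-2*(s' - s)) = exp (4 * s')*exp (2 * s)" unfolding exp_add[symmetric] by (simp add: algebra_simps)
      then show ?thesis unfolding mult.assoc by (simp only: mult_ac)
    qed
    also have "... <= 3/32*exp (4 * s')*1" using curve_decay_tilt[of 2 s] by (intro mult_left_mono) auto
    also have "... <= boundary_weight s'" using True by (simp add: boundary_weight_def)
    finally show ?thesis .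
  next
    case False
    have "tilted 2 (boundary_kernel c) s s' <= row_majorant 2 s' + 1/8*tilted 2 tent_kernel s s'" by (rule boundary_row_le) simp
    also have "tilted 2 tent_kernel s s' <= exp (2*(s' - s))*exp (-2*(s' - s))"
      unfolding tilted_def abs_of_nonneg[OF tent_nonneg] by (intro mult_right_mono tent_le) auto
    also have "exp (2*(s' - s))*exp (-2*(s' - s)) = 1" by (simp flip: exp_add)
    finally show ?thesis using False row_majorant_le_weight[of s'] by simp
  qed
  from mult_right_mono[OF this, of "exp (2*(s' - s))"] show ?thesis by (simp add: tilted_def mult.assoc flip: exp_add)
qed

lemma row_kernel_boundary: "row_kernel (boundary_kernel c) 2 (1/2) boundary_weight"
proof unfold_locales
  show "Leb1 (%s. ind {x<..y} s*boundary_weight s)" for x y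
    by (rule L1_bound[OF boundary_weight_integrable[of y]]) (use boundary_weight_nonneg in \<open>auto simp: indicator_def\<close>)
qed (use boundary_kernel_measurable boundary_weight_nonneg boundary_row[of 2] abs_boundary_kernel_le in auto)

lemma row_kernel_boundary_flat: "row_kernel (boundary_kernel c) 2 (1/2) flat_weight"
proof unfold_locales
  show "abs (boundary_kernel c s s') <= flat_weight s'*exp (2*(s' - s))" for s s'
    using order_trans[OF abs_boundary_kernel_le mult_right_mono[OF boundary_weight_le_flat]] by simp
  show "0 <= flat_weight s" for s using flat_weight_ge_1[of s] by linarith
qed (use boundary_kernel_measurable boundary_row[of 2] flat_weight_integrable in auto)

definition stationary_kernel :: "real => real => real" where "stationary_kernel s s' = airy_passage (2*c) (s' - s)"

lemma stationary_kernel_shift: "stationary_kernel (s + h) (s' + h) = stationary_kernel s s'" by (simp add: stationary_kernel_def)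

lemma abs_stationary_kernel_le: "abs (stationary_kernel s s') <= 1/8*tent (s' - s)"
  unfolding stationary_kernel_def by (rule airy_passage_le_tent) (use c_ge in auto)

lemma row_kernel_stationary: "row_kernel stationary_kernel 2 (1/2) flat_weight"
proof unfold_locales
  show meas: "(%p. stationary_kernel (fst p) (snd p)) \<in> bmeas (borel \<Otimes>\<^sub>M borel)" unfolding stationary_kernel_def by measurable
  show "0 <= flat_weight s" for s using flat_weight_ge_1[of s] by linarith
  show "abs (stationary_kernel s s') <= flat_weight s'*exp (2*(s' - s))" for s s'
  proof -
    have "abs (stationary_kernel s s') <= 1/8*exp (2*(s' - s))" using abs_stationary_kernel_le[of s s'] tent_le[of 2 "s' - s"] by linarith
    also have "... <= flat_weight s'*exp (2*(s' - s))" using flat_weight_ge_1[of s'] by (intro mult_right_mono) auto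
    finally show ?thesis .
  qed
  fix s
  have tent_le: "tilted 2 stationary_kernel s r <= 1/8*tilted 2 tent_kernel s r" for r
    using mult_right_mono[OF abs_stationary_kernel_le[of s r], of "exp (-2*(r - s))"] by (simp add: tilted_def abs_of_nonneg[OF tent_nonneg])
  have majorant: "Leb1 (%r. 1/8*tilted 2 tent_kernel s r)" by (intro integrable_mult_right tent_row) simp
  have "stationary_kernel s \<in> bmeas borel" unfolding stationary_kernel_def by measurable
  note row = tilted_majorized[OF this majorant tent_le]
  show "Leb1 (tilted 2 stationary_kernel s)" by (rule row(1))
  have "integral\<^sup>L lborel (tilted 2 stationary_kernel s) <= (LBINT r. 1/8*tilted 2 tent_kernel s r)" by (rule row(2))
  also have "... <= 1/8*(3/2)" unfolding integral_mult_right_zero by (intro mult_left_mono tent_row) auto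
  finally show "integral\<^sup>L lborel (tilted 2 stationary_kernel s) <= 1/2" by simp
qed (use flat_weight_integrable in auto)

abbreviation (input) gap :: "real => real => real" where "gap s r == boundary_kernel c s r - stationary_kernel s r"

definition gap_majorant :: "real => real" where "gap_majorant r = row_majorant 2 r + 1/8*(ind {..0} r*exp (2*r))"

lemma gap_majorant_integral: "Leb1 gap_majorant" "integral\<^sup>L lborel gap_majorant <= 1/2"
proof -
  have left: "Leb_has (%r::real. ind {..0} r*exp (2*r)) (exp (2*0)/2)" by (rule has_bochner_integral_exp_left) simp
  then show "Leb1 gap_majorant"
    unfolding gap_majorant_def[abs_def] by (intro L1_add row_majorant_integral integrable_mult_right) (auto simp: Leb_iff)
  have "integral\<^sup>L lborel gap_majorant = integral\<^sup>L lborel (row_majorant 2) + 1/8*(exp (2*0)/2)"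
    using left row_majorant_integral(1)[of 2] Leb_eq[OF left] unfolding gap_majorant_def[abs_def] by (simp add: Leb_iff)
  then show "integral\<^sup>L lborel gap_majorant <= 1/2" using row_majorant_integral(2)[of 2] by simp
qed

lemma gap_majorant_le_flat: "gap_majorant r <= flat_weight r"
proof (cases "r <= 0")
  case True
  then have "exp (4*r) <= 1" "exp (2*r) <= 1" by auto
  then have "1/8*exp (4*r) + 1/8*exp (2*r) <= 1" by linarith
  then show ?thesis using True by (simp add: gap_majorant_def row_majorant_def flat_weight_def)
next
  case False
  then show ?thesis using row_majorant_le_weight[of r] boundary_weight_le_flat[of r] by (simp add: gap_majorant_def)
qed

lemma tilted_gap_le:
  assumes s: "0 < s"
  shows "tilted 2 gap s r <= exp (-s)*gap_majorant r"
proof (cases "r <= 0")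
  case True
  have decay: "curve_decay s = exp (-4 * s)" using s by (simp add: curve_decay_def)
  have "abs (gap s r) <= 3/32*exp (-4 * s)*exp (6*r) + 1/8*exp (4*(r - s))"
    using abs_boundary_kernel_nonpos_le[OF True, of s] abs_stationary_kernel_le[of s r] tent_le[of 4 "r - s"] unfolding decay by linarith
  then have "tilted 2 gap s r <= (3/32*exp (-4 * s)*exp (6*r) + 1/8*exp (4*(r - s)))*exp (-2*(r - s))"
    unfolding tilted_def by (intro mult_right_mono) auto
  also have "... = exp (-2 * s)*(3/32*exp (4*r) + 1/8*exp (2*r))"
  proof -
    have "exp (-4 * s)*exp (6*r)*exp (-2*(r - s)) = exp (-2 * s)*exp (4*r)" "exp (4*(r - s))*exp (-2*(r - s)) = exp (-2 * s)*exp (2*r)"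
      unfolding exp_add[symmetric] by (simp_all add: algebra_simps)
    then show ?thesis by (simp add: distrib_right distrib_left mult.assoc)
  qed
  also have "... <= exp (-s)*gap_majorant r" using s True by (intro mult_mono) (auto simp: gap_majorant_def row_majorant_def)
  finally show ?thesis .
next
  case False
  then have r: "0 < r" by simp
  have decay: "curve_decay s = exp (-4 * s)" using s by (simp add: curve_decay_def)
  have "gap s r = boundary_correction c s r"
    unfolding boundary_kernel_split[OF r] stationary_kernel_def using s by (simp add: curve_time_def curve_level_def)
  then have "tilted 2 gap s r <= 1/32*exp (-4 * s)/sqrt r*exp (-2*(r - s))"
    using abs_boundary_correction_le[OF r, of s] unfolding decay tilted_def by (intro mult_right_mono) auto
  also have "... = exp (-2 * s)*(1/32*(exp (-2*r)/sqrt r))"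
  proof -
    have "exp (-4 * s)*exp (-2*(r - s)) = exp (-2 * s)*exp (-2*r)" unfolding exp_add[symmetric] by (simp add: algebra_simps)
    then show ?thesis by simp
  qed
  also have "... <= exp (-s)*gap_majorant r" using s r by (intro mult_mono) (auto simp: gap_majorant_def row_majorant_def)
  finally show ?thesis .
qed

lemma abs_gap_le: "abs (gap s s') <= 2*exp (-s)*flat_weight s'*exp (2*(s' - s))"
proof (cases "s <= 0")
  case True
  interpret B: row_kernel "boundary_kernel c" 2 "1/2" flat_weight by (rule row_kernel_boundary_flat)
  interpret S: row_kernel stationary_kernel 2 "1/2" flat_weight by (rule row_kernel_stationary)
  have "abs (gap s s') <= 2*1*flat_weight s'*exp (2*(s' - s))" using B.K_le[of s s'] S.K_le[of s s'] by linarith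
  also have "... <= 2*exp (-s)*flat_weight s'*exp (2*(s' - s))" using True B.m_nonneg by (intro mult_right_mono mult_left_mono) auto
  finally show ?thesis .
next
  case False
  then have "tilted 2 gap s s' <= exp (-s)*gap_majorant s'" by (intro tilted_gap_le) simp
  also have "... <= exp (-s)*flat_weight s'" by (intro mult_left_mono gap_majorant_le_flat) simp
  also have "... <= 2*exp (-s)*flat_weight s'" using flat_weight_ge_1[of s'] by simp
  finally have "tilted 2 gap s s'*exp (2*(s' - s)) <= 2*exp (-s)*flat_weight s'*exp (2*(s' - s))" by (intro mult_right_mono) auto
  then show ?thesis by (simp add: tilted_def mult.assoc flip: exp_add)
qed

lemma gap_row_le: "integral\<^sup>L lborel (tilted 2 gap s) <= 2*exp (-s)"
proof -
  interpret B: row_kernel "boundary_kernel c" 2 "1/2" flat_weight by (rule row_kernel_boundary_flat)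
  interpret S: row_kernel stationary_kernel 2 "1/2" flat_weight by (rule row_kernel_stationary)
  have int: "Leb1 (tilted 2 gap s)" by (rule tilted_diff_integrable[OF _ _ B.row_integrable S.row_integrable]) measurable
  show ?thesis
  proof (cases "s <= 0")
    case True
    have "integral\<^sup>L lborel (tilted 2 gap s) <= (LBINT r. tilted 2 (boundary_kernel c) s r + tilted 2 stationary_kernel s r)"
      by (intro integral_mono int L1_add B.row_integrable S.row_integrable) (simp add: tilted_def flip: distrib_right)
    also have "... <= 1/2 + 1/2" using B.row_le[of s] S.row_le[of s] B.row_integrable[of s] S.row_integrable[of s] by simp
    also have "... <= 2*exp (-s)" using True one_le_exp_iff[of "-s"] by linarith
    finally show ?thesis .
  next
    case False
    then have "integral\<^sup>L lborel (tilted 2 gap s) <= (LBINT r. exp (-s)*gap_majorant r)"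
      by (intro integral_mono int integrable_mult_right gap_majorant_integral tilted_gap_le) auto
    also have "... <= exp (-s)*2" unfolding integral_mult_right_zero using gap_majorant_integral(2) by (intro mult_left_mono) auto
    finally show ?thesis by simp
  qed
qed

lemma abs_capped_gap_le:
  "abs (row_kernel.capped (boundary_kernel c) n l s s' - row_kernel.capped stationary_kernel n l s s')
  <= 2*((1/2) ^ n + real n*(1/2) ^ (n - 1))*flat_weight s'*exp (-s)*exp (2*(s' - s))"
proof (rule abs_capped_diff_le[OF row_kernel_boundary_flat row_kernel_stationary _ _ abs_gap_le gap_row_le])
  have fast: "2 + 1 = (3::real)" by simp
  show "Leb1 (tilted (2 + 1) (boundary_kernel c) s)" "integral\<^sup>L lborel (tilted (2 + 1) (boundary_kernel c) s) <= 1/2" for s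
    unfolding fast by (rule boundary_row; simp)+
qed

end

section \<open>Convolution powers\<close>

lemma gauss_char:
  assumes t: "0 < t"
  shows "(LBINT v. of_real (exp (-v\<^sup>2/(4*t)))*exp (\<i> * of_real u * of_real v)) = (of_real (sqrt (4*pi*t)*exp (-t*u^2)) :: complex)"
proof -
  have "exp (-v\<^sup>2/(4*t)) = sqrt (4*pi*t)*heat t v" for v using t by (simp add: heat_def)
  then have "(LBINT v. of_real (exp (-v\<^sup>2/(4*t)))*exp (\<i> * of_real u * of_real v))
    = of_real (sqrt (4*pi*t))*(LBINT v. of_real (heat t v)*exp (\<i> * of_real u * of_real v))"
    by (subst integral_mult_right_zero[symmetric]) (simp only: of_real_mult mult.assoc)
  also have "... = of_real (sqrt (4*pi*t))*exp (of_real t*(\<i> * of_real u)^2)" unfolding heat_char[OF t] ..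
  also have "exp (of_real t*(\<i> * of_real u)^2) = (of_real (exp (-t*u^2)) :: complex)"
    by (simp add: power_mult_distrib exp_of_real[symmetric])
  finally show ?thesis by simp
qed

context
  fixes ph H :: "real => complex" and et :: real
  assumes ph: "Leb1 ph" and H: "!!v. of_real (2*pi)*H v = (LBINT xi. ph xi*exp (\<i> * of_real xi * of_real v))"
begin

text \<open>Damping by a Gaussian of variance \<open>2 t\<close> smooths the transform at scale \<open>1 / \<surd>t\<close>.\<close>
lemma Fourier_gauss_smoothed:
  assumes t: "0 < t"
  shows "(LBINT v. of_real (exp (-v\<^sup>2/(4*t)))*(H v * exp (-(\<i> * of_real et * of_real v))))
  = of_real (1/sqrt pi)*(LBINT y. of_real (exp (-y\<^sup>2))*ph (et + 1/sqrt t*y))" (is "?I = _")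
proof -
  have [measurable]: "ph \<in> bmeas borel" using borel_measurable_integrable[OF ph] by simp
  let ?F = "%v xi. of_real (exp (-v\<^sup>2/(4*t)))*(ph xi*exp (\<i> * of_real (xi - et) * of_real v))"
  have pos: "0 < 1/(4*t)" using t by simp
  have shift: "of_real (2*pi)*(H v * exp (-(\<i> * of_real et * of_real v))) = (LBINT xi. ph xi*exp (\<i> * of_real (xi - et) * of_real v))" for v
    unfolding mult.assoc[symmetric] H integral_mult_left_zero[symmetric] by (simp add: algebra_simps flip: exp_add exp_minus)
  have "of_real (2*pi)*?I = (LBINT v. of_real (exp (-v\<^sup>2/(4*t)))*(of_real (2*pi)*(H v * exp (-(\<i> * of_real et * of_real v)))))"
    by (subst integral_mult_right_zero[symmetric]) (simp only: mult_ac)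
  also have "... = (LBINT v. (LBINT xi. ?F v xi))" unfolding shift by simp
  also have "... = (LBINT xi. (LBINT v. ?F v xi))"
  proof (rule Fubini_dominated(2)[OF sigma_finite_lborel sigma_finite_lborel])
    show "norm (?F v xi) <= exp (-(1/(4*t)) * v^2)*norm (ph xi)" for v xi by (simp add: norm_mult norm_exp_eq_Re)
  qed (use gauss_integrable[OF pos] integrable_norm[OF ph] in \<open>measurable\<close>)
  also have "... = (LBINT xi. of_real (sqrt (4*pi*t))*(ph xi * of_real (exp (-t*(xi - et)^2))))"
  proof (intro LINT_cong refl)
    fix xi
    have "(LBINT v. ?F v xi) = ph xi*(LBINT v. of_real (exp (-v\<^sup>2/(4*t)))*exp (\<i> * of_real (xi - et) * of_real v))"
      by (subst integral_mult_right_zero[symmetric]) (simp only: mult_ac)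
    then show "(LBINT v. ?F v xi) = of_real (sqrt (4*pi*t))*(ph xi * of_real (exp (-t*(xi - et)^2)))"
      unfolding gauss_char[OF t] by (simp only: of_real_mult mult_ac)
  qed
  also have "... = of_real (sqrt (4*pi*t))*(LBINT xi. ph xi * of_real (exp (-t*(xi - et)^2)))" by (rule integral_mult_right_zero)
  also have "(LBINT xi. ph xi * of_real (exp (-t*(xi - et)^2)))
    = abs (1/sqrt t) *\<^sub>R (LBINT y. ph (et + 1/sqrt t*y) * of_real (exp (-t*(et + 1/sqrt t*y - et)^2)))"
    by (rule lborel_integral_real_affine) (use t in simp)
  also have "... = of_real (1/sqrt t)*(LBINT y. of_real (exp (-y\<^sup>2))*ph (et + 1/sqrt t*y))"
    using t by (simp add: power_divide mult.commute scaleR_conv_of_real)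
  also have "of_real (sqrt (4*pi*t))*(of_real (1/sqrt t)*(LBINT y. of_real (exp (-y\<^sup>2))*ph (et + 1/sqrt t*y)))
    = of_real (2*pi)*(of_real (1/sqrt pi)*(LBINT y. of_real (exp (-y\<^sup>2))*ph (et + 1/sqrt t*y)))"
  proof -
    have "sqrt (4*pi*t)*(1/sqrt t) = 2 * sqrt pi" using t by (simp add: real_sqrt_mult)
    also have "... = 2*pi*(1/sqrt pi)" by (simp add: field_simps)
    finally show ?thesis unfolding mult.assoc[symmetric] of_real_mult[symmetric] by (simp only:)
  qed
  finally show ?thesis by (subst (asm) mult_left_cancel) simp_all
qed

lemma Fourier_inversion:
  assumes cont: "!!xi. isCont ph xi" and B: "!!xi. norm (ph xi) <= B" and int: "Leb1 H"
  shows "(LBINT v. H v * exp (-(\<i> * of_real et * of_real v))) = ph et"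
proof -
  have [measurable]: "ph \<in> bmeas borel" "H \<in> bmeas borel" using borel_measurable_integrable[OF ph] borel_measurable_integrable[OF int] by simp_all
  let ?H = "%v. H v * exp (-(\<i> * of_real et * of_real v))"
  let ?I = "%n. LBINT v. of_real (exp (-v\<^sup>2/(4*real (Suc n))))*?H v"
  have norm_H: "norm (?H v) = norm (H v)" for v by (simp add: norm_mult norm_exp_eq_Re)
  have "?I ----> (LBINT v. ?H v)"
  proof (rule integral_dominated_convergence[where w="%v. norm (H v)"])
    show "AE v in lborel. (%n. of_real (exp (-v\<^sup>2/(4*real (Suc n))))*?H v) ----> ?H v"
    proof (intro AE_I2)
      fix v
      have "(%n. exp (-v\<^sup>2/(4*real (Suc n)))) ----> 1" by real_asymp
      from tendsto_mult[OF tendsto_of_real[OF this] tendsto_const[of "?H v"]]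
      show "(%n. of_real (exp (-v\<^sup>2/(4*real (Suc n))))*?H v) ----> ?H v" by simp
    qed
    show "AE v in lborel. norm (of_real (exp (-v\<^sup>2/(4*real (Suc n))))*?H v) <= norm (H v)" for n
      unfolding norm_mult[of "of_real _"] norm_H by (intro AE_I2 mult_left_le_one_le) auto
  qed (use int in auto)
  moreover have "?I ----> of_real (1/sqrt pi)*(LBINT y. of_real (exp (-y\<^sup>2))*ph et)"
    unfolding Fourier_gauss_smoothed[OF of_nat_0_less_iff[THEN iffD2, OF zero_less_Suc]]
  proof (intro tendsto_mult tendsto_const integral_dominated_convergence[where w="%y. exp (-1*y^2)*B"])
    show "Leb1 (%y. exp (-1*y^2)*B)" by (intro integrable_mult_left gauss_integrable) simp
    show "AE y in lborel. (%n. of_real (exp (-y\<^sup>2))*ph (et + 1/sqrt (real (Suc n))*y)) ----> of_real (exp (-y\<^sup>2))*ph et"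
    proof (intro AE_I2 tendsto_mult tendsto_const)
      fix y
      have "(%n. et + 1/sqrt (real (Suc n))*y) ----> et" by real_asymp
      then show "(%n. ph (et + 1/sqrt (real (Suc n))*y)) ----> ph et" by (rule isCont_tendsto_compose[OF cont])
    qed
    show "AE y in lborel. norm (of_real (exp (-y\<^sup>2))*ph (et + 1/sqrt (real (Suc n))*y)) <= exp (-1*y^2)*B" for n
      by (intro AE_I2) (simp add: norm_mult B)
  qed measurable
  moreover have "of_real (1/sqrt pi)*(LBINT y. of_real (exp (-y\<^sup>2))*ph et) = ph et"
  proof -
    have "(LBINT y. of_real (exp (-y\<^sup>2))*ph et) = of_real (LBINT y. exp (-1*y^2))*ph et" by (simp flip: integral_complex_of_real)
    also have "(LBINT y. exp (-1*y^2)) = sqrt pi" using gauss_integral[of 1] by simp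
    finally show ?thesis by (simp only: mult.assoc[symmetric] of_real_mult[symmetric]) simp
  qed
  ultimately show ?thesis by (auto intro: LIMSEQ_unique)
qed

end

definition airy_transform :: "real => real => real => complex" where
  "airy_transform bt x xi = airy_integrand 0 x (hyperbola bt xi)"

context
  fixes bt :: real
  assumes bt: "0 < bt"
begin

lemma airy_passage_transform:
  "of_real (2*pi*airy_passage x v) = (LBINT xi. airy_transform bt x xi*exp (of_real v * Complex bt xi))"
  unfolding airy_passage_hyperbola[OF bt] airy_transform_def airy_integrand_def exp_add[symmetric]
  by (simp add: hyperbola_sq[OF bt] algebra_simps)

lemma airy_transform_bounded:
  obtains B where "!!xi. norm (airy_transform bt x xi) <= B" "0 <= B"
proof -
  obtain B where B: "!!r. 0 <= r ==> (bt - x)*r + 0*r^2 - 2/3*r ^ 3 <= B" using cubic_bounded_above[OF bt, of "bt - x" 0] by blast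
  have "norm (airy_transform bt x xi) <= exp B" for xi unfolding airy_transform_def norm_airy_integrand_hyperbola[OF bt]
    using B[of "Re (hyperbola bt xi)"] less_imp_le[OF hyperbola_Re_pos[OF bt]] by (simp add: mult.commute)
  then show ?thesis by (rule that) simp
qed

lemma airy_transform_integrable: "Leb1 (airy_transform bt x)"
  unfolding airy_transform_def[abs_def] by (rule airy_integrand_hyperbola_integrable[OF bt])

lemma isCont_airy_transform: "isCont (airy_transform bt x) xi"
proof -
  have "continuous_on UNIV (airy_transform bt x)"
    unfolding airy_transform_def airy_integrand_def by (intro continuous_intros continuous_on_hyperbola bt) auto
  then show ?thesis by (simp add: continuous_on_eq_continuous_at)
qed

lemma airy_passage_Laplace:
  assumes int: "Leb1 (%v. abs (airy_passage x v)*exp (-bt * v))"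
  shows "(LBINT v. of_real (airy_passage x v)*exp (-(of_real v * Complex bt et))) = airy_transform bt x et"
proof -
  define H where "H v = (of_real (airy_passage x v * exp (-bt * v)) :: complex)" for v
  obtain B where B: "!!xi. norm (airy_transform bt x xi) <= B" using airy_transform_bounded by blast
  have Complex_eq: "Complex bt xi = of_real bt + \<i> * of_real xi" for xi by (simp add: complex_eq_iff)
  have "of_real (2*pi)*H v = (LBINT xi. airy_transform bt x xi*exp (\<i> * of_real xi * of_real v))" for v
  proof -
    have "of_real (2*pi)*H v = of_real (2*pi*airy_passage x v)*exp (-(of_real bt * of_real v))" by (simp add: H_def exp_of_real[symmetric])
    also have "... = (LBINT xi. airy_transform bt x xi*exp (of_real v * Complex bt xi)*exp (-(of_real bt * of_real v)))"
      unfolding airy_passage_transform by (rule integral_mult_left_zero[symmetric])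
    also have "... = (LBINT xi. airy_transform bt x xi*exp (\<i> * of_real xi * of_real v))"
      by (simp add: Complex_eq mult.assoc algebra_simps flip: exp_add)
    finally show ?thesis .
  qed
  moreover have "Leb1 H"
  proof (rule L1_bound[OF int])
    show "H \<in> bmeas lborel" unfolding H_def[abs_def] by measurable
  qed (simp add: H_def norm_mult abs_mult)
  ultimately have "(LBINT v. H v * exp (-(\<i> * of_real et * of_real v))) = airy_transform bt x et"
    by (intro Fourier_inversion[OF airy_transform_integrable _ isCont_airy_transform B])
  moreover have "H v * exp (-(\<i> * of_real et * of_real v)) = of_real (airy_passage x v)*exp (-(of_real v * Complex bt et))" for v
    by (simp add: H_def Complex_eq exp_of_real[symmetric] algebra_simps flip: exp_add)
  ultimately show ?thesis by simp
qed

lemma convolve_transform: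
  fixes k :: "real => real" and ph P :: "real => complex"
  assumes [measurable]: "k \<in> bmeas borel" and k: "Leb1 (%v. abs (k v)*exp (-bt * v))" and P: "Leb1 P"
  and transform: "!!xi. (LBINT v. of_real (k v)*exp (-(of_real v * Complex bt xi))) = ph xi"
  shows "(LBINT r. of_real (k (r - s))*(LBINT xi. P xi*exp (of_real (s' - r)*Complex bt xi)))
  = (LBINT xi. ph xi*P xi*exp (of_real (s' - s)*Complex bt xi))"
proof -
  have [measurable]: "P \<in> bmeas borel" using borel_measurable_integrable[OF P] by simp
  let ?F = "%r xi. of_real (k (r - s))*(P xi*exp (of_real (s' - r)*Complex bt xi))"
  have split: "exp (of_real (s' - r)*Complex bt xi) = exp (of_real (s' - s)*Complex bt xi)*exp (-(of_real (r - s)*Complex bt xi))" for r xi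
    unfolding exp_add[symmetric] by (simp add: algebra_simps)
  have "(LBINT r. of_real (k (r - s))*(LBINT xi. P xi*exp (of_real (s' - r)*Complex bt xi))) = (LBINT r. (LBINT xi. ?F r xi))" by simp
  also have "... = (LBINT xi. (LBINT r. ?F r xi))"
  proof (rule Fubini_dominated(2)[OF sigma_finite_lborel sigma_finite_lborel])
    show "norm (?F r xi) <= exp (bt*(s' - s))*(abs (k (r - s))*exp (-bt*(r - s)))*norm (P xi)" for r xi
      by (subst split) (simp add: norm_mult norm_exp_eq_Re mult_ac flip: minus_mult_left)
    have "Leb1 (%r. abs (k (-s + 1*r))*exp (-bt*(-s + 1*r)))" by (rule lborel_integrable_real_affine[OF k]) simp
    then show "Leb1 (%r. exp (bt*(s' - s))*(abs (k (r - s))*exp (-bt*(r - s))))" by (intro integrable_mult_right) simp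
    show "Leb1 (%xi. norm (P xi))" by (rule integrable_norm[OF P])
  qed measurable
  also have "... = (LBINT xi. ph xi*P xi*exp (of_real (s' - s)*Complex bt xi))"
  proof (intro LINT_cong refl)
    fix xi
    have "(LBINT r. of_real (k (r - s))*exp (-(of_real (r - s)*Complex bt xi)))
      = abs 1 *\<^sub>R (LBINT v. of_real (k (s + 1 * v - s))*exp (-(of_real (s + 1 * v - s)*Complex bt xi)))"
      by (rule lborel_integral_real_affine) simp
    also have "... = ph xi" using transform[of xi] by simp
    finally have "P xi*exp (of_real (s' - s)*Complex bt xi)*(LBINT r. of_real (k (r - s))*exp (-(of_real (r - s)*Complex bt xi)))
      = P xi*exp (of_real (s' - s)*Complex bt xi)*ph xi" by simp
    moreover have "?F r xi = P xi*exp (of_real (s' - s)*Complex bt xi)*(of_real (k (r - s))*exp (-(of_real (r - s)*Complex bt xi)))" for r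
      by (subst split) (simp only: mult_ac)
    ultimately have "(LBINT r. ?F r xi) = P xi*exp (of_real (s' - s)*Complex bt xi)*ph xi" by (simp only: integral_mult_right_zero)
    then show "(LBINT r. ?F r xi) = ph xi*P xi*exp (of_real (s' - s)*Complex bt xi)" by (simp only: mult_ac)
  qed
  finally show ?thesis .
qed

lemma airy_transform_power_integrable: "Leb1 (%xi. airy_transform bt x xi ^ Suc n)"
proof -
  obtain B where B: "!!xi. norm (airy_transform bt x xi) <= B" "0 <= B" using airy_transform_bounded by blast
  have [measurable]: "airy_transform bt x \<in> bmeas borel" using borel_measurable_integrable[OF airy_transform_integrable] by simp
  show ?thesis
  proof (rule L1_bound[OF integrable_mult_right[OF integrable_norm[OF airy_transform_integrable], of "B ^ n"]])
    have "norm (airy_transform bt x xi) ^ n*norm (airy_transform bt x xi) <= B ^ n*norm (airy_transform bt x xi)" for xi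
      using B by (intro mult_right_mono power_mono) auto
    then show "AE xi in lborel. norm (airy_transform bt x xi ^ Suc n) <= norm (B ^ n*norm (airy_transform bt x xi))"
      using B(2) by (simp add: norm_mult norm_power mult.commute)
  qed measurable
qed

end

lemma stationary_power_transform:
  assumes c_ge: "3/2 <= c"
  shows "of_real (2*pi*row_kernel.power (stationary_kernel c) n s s')
  = (LBINT xi. airy_transform 2 (2*c) xi ^ Suc n*exp (of_real (s' - s)*Complex 2 xi))"
proof -
  interpret S: row_kernel "stationary_kernel c" 2 "1/2" flat_weight by (rule row_kernel_stationary[OF c_ge])
  have pos: "(0::real) < 2" by simp
  have int: "Leb1 (%v. abs (airy_passage (2*c) v)*exp (-2 * v))"
    using S.row_integrable[of 0] by (simp add: tilted_def[abs_def] stationary_kernel_def[OF c_ge])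
  show ?thesis
  proof (induction n arbitrary: s)
    case 0
    have "S.power 0 s s' = airy_passage (2*c) (s' - s)" unfolding S.power.simps by (rule stationary_kernel_def[OF c_ge])
    then show ?case using airy_passage_transform[OF pos, of "2*c" "s' - s"] by simp
  next
    case (Suc n)
    have "2*pi*S.power (Suc n) s s' = (LBINT r. airy_passage (2*c) (r - s)*(2*pi*S.power n r s'))"
      unfolding S.power.simps stationary_kernel_def[OF c_ge] by (subst integral_mult_right_zero[symmetric]) (simp only: mult_ac)
    then have "of_real (2*pi*S.power (Suc n) s s') = (LBINT r. of_real (airy_passage (2*c) (r - s)) * (of_real (2*pi*S.power n r s') :: complex))"
      by (simp only: integral_complex_of_real[symmetric] of_real_mult)
    also have "... = (LBINT xi. airy_transform 2 (2*c) xi*airy_transform 2 (2*c) xi ^ Suc n*exp (of_real (s' - s)*Complex 2 xi))"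
      unfolding Suc by (rule convolve_transform[OF pos _ int airy_transform_power_integrable[OF pos] airy_passage_Laplace[OF pos int]]) measurable
    finally show ?case by (simp only: power_Suc mult.assoc)
  qed
qed

lemma hyperbola_scale:
  assumes "0 < l" "0 < bt"
  shows "hyperbola (l*bt) (l*xi) = of_real (sqrt l)*hyperbola bt xi" unfolding hyperbola_def[of "l*bt"]
proof (rule csqrt_unique)
  have "(of_real (sqrt l)*hyperbola bt xi)^2 = of_real ((sqrt l)^2)*Complex bt xi"
    unfolding power_mult_distrib hyperbola_sq[OF assms(2)] by (simp only: of_real_power)
  also have "... = Complex (l*bt) (l*xi)" using assms by (simp add: complex_eq_iff)
  finally show "(of_real (sqrt l)*hyperbola bt xi)^2 = Complex (l*bt) (l*xi)" .
  show "0 < Re (of_real (sqrt l)*hyperbola bt xi) \<or> Re (of_real (sqrt l)*hyperbola bt xi) = 0 \<and> 0 <= Im (of_real (sqrt l)*hyperbola bt xi)"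
    using assms hyperbola_Re_pos[of bt xi] by simp
qed

text \<open>Dilating the hyperbola by \<open>n\<^bsup>2/3\<^esup>\<close> multiplies the exponent \<open>w\<^sup>3/3 - w x\<close> by \<open>n\<close>.\<close>
lemma airy_transform_power:
  fixes n :: nat
  assumes bt: "0 < bt"
  defines "l \<equiv> real (Suc n) powr (2/3)"
  shows "airy_transform (l*bt) (x*l) (l*xi) = airy_transform bt x xi ^ Suc n"
proof -
  define w where "w = hyperbola bt xi"
  have l: "0 < l" by (simp add: l_def)
  have root: "sqrt l = real (Suc n) powr (1/3)" by (simp add: l_def powr_half_sqrt[symmetric] powr_powr del: of_nat_Suc)
  have cube: "sqrt l ^ 3 = real (Suc n)" unfolding root by (simp add: powr_power del: of_nat_Suc)
  have "l * sqrt l = sqrt l ^ 3" using l by (simp add: power3_eq_cube)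
  with cube have prod: "l * sqrt l = real (Suc n)" by simp
  have "hyperbola (l*bt) (l*xi) = of_real (sqrt l)*w" unfolding w_def by (rule hyperbola_scale[OF l bt])
  then have "airy_transform (l*bt) (x*l) (l*xi) = exp (of_real (sqrt l ^ 3)*(w ^ 3/3) - of_real (l * sqrt l)*(w * of_real x))"
    by (simp add: airy_transform_def airy_integrand_def power_mult_distrib mult_ac)
  also have "... = exp (of_nat (Suc n)*(w ^ 3/3 - w * of_real x))" unfolding cube prod by (simp only: of_real_of_nat_eq right_diff_distrib)
  also have "... = airy_transform bt x xi ^ Suc n" unfolding exp_of_nat_mult by (simp add: airy_transform_def airy_integrand_def w_def)
  finally show ?thesis .
qed

lemma stationary_power_diag:
  assumes c_ge: "3/2 <= c"
  shows "row_kernel.power (stationary_kernel c) n 0 0 = real (Suc n) powr (-2/3)*airy_passage (2*c*real (Suc n) powr (2/3)) 0"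
proof -
  define l where "l = real (Suc n) powr (2/3)"
  have l: "0 < l" "0 < l*2" by (simp_all add: l_def)
  have "(of_real (2*pi*airy_passage (2*c*l) 0) :: complex) = (LBINT xi. airy_transform (l*2) (2*c*l) xi)"
    using airy_passage_transform[OF l(2), of "2*c*l" 0] by simp
  also have "... = abs l *\<^sub>R (LBINT xi. airy_transform (l*2) (2*c*l) (0 + l*xi))"
    by (rule lborel_integral_real_affine) (use l in simp)
  also have "... = of_real l * of_real (2*pi*row_kernel.power (stationary_kernel c) n 0 0)"
    unfolding stationary_power_transform[OF c_ge] using l airy_transform_power[of 2 n "2*c", folded l_def]
    by (simp add: scaleR_conv_of_real)
  finally have "2*pi*airy_passage (2*c*l) 0 = l*(2*pi*row_kernel.power (stationary_kernel c) n 0 0)"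
    by (simp only: of_real_mult[symmetric] of_real_eq_iff)
  then have "row_kernel.power (stationary_kernel c) n 0 0 = inverse l*airy_passage (2*c*l) 0" using l by (simp add: field_simps)
  also have "inverse l = real (Suc n) powr (-2/3)" unfolding l_def using powr_minus[of "real (Suc n)" "2/3"] by simp
  finally show ?thesis unfolding l_def .
qed

definition decay_rate :: "real => nat => real" where
  "decay_rate c n = real (Suc n) powr (-5/3)*airy_passage (2*real (Suc n) powr (2/3)*c) 0"

lemma stationary_capped_diag:
  assumes c_ge: "3/2 <= c"
  shows "row_kernel.capped (stationary_kernel c) n l l l = decay_rate c n"
proof -
  interpret S: row_kernel "stationary_kernel c" 2 "1/2" flat_weight by (rule row_kernel_stationary[OF c_ge])
  define N where "N = real (Suc n)"
  have N: "0 < N" by (simp add: N_def)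
  note shift = stationary_kernel_shift[OF c_ge]
  have "S.capped n l l l = S.capped n 0 0 0" using S.capped_shift[OF shift, of n 0 l 0 0] by simp
  also have "... = S.power n 0 0*inverse N" using S.power_cycle[OF shift, of n] N by (simp add: N_def divide_inverse)
  also have "... = (N powr (-2/3)*N powr (-1))*airy_passage (2*c*N powr (2/3)) 0"
    unfolding stationary_power_diag[OF c_ge] N_def[symmetric] using powr_minus[of N 1] N by simp
  also have "N powr (-2/3)*N powr (-1) = N powr (-5/3)" unfolding powr_add[symmetric] by simp
  also have "2*c*N powr (2/3) = 2*N powr (2/3)*c" by (simp only: mult_ac)
  finally show ?thesis unfolding N_def decay_rate_def .
qed

lemma summable_decay_rate:
  assumes c_ge: "3/2 <= c"
  shows "summable (decay_rate c)"
proof (rule summable_comparison_test'[where N=0])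
  interpret S: row_kernel "stationary_kernel c" 2 "1/2" flat_weight by (rule row_kernel_stationary[OF c_ge])
  show "summable (%n. flat_weight 0*(1/2) ^ n)" by (intro summable_mult summable_geometric) simp
  show "norm (decay_rate c n) <= flat_weight 0*(1/2) ^ n" for n
    using S.capped_le[of n 0 0 0] unfolding stationary_capped_diag[OF c_ge] by (simp add: mult.commute)
qed

lemma airy1_kappa_eq:
  assumes c_ge: "3/2 <= c"
  shows "airy1_kappa c = (\<Sum>n. decay_rate c n)"
proof -
  have "real (Suc n) powr (-5/3)*deriv Airy_Ai (2*real (Suc n) powr (2/3)*c) = (-1/2)*decay_rate c n" for n
    unfolding deriv_Airy_Ai decay_rate_def by simp
  then show ?thesis unfolding airy1_kappa_def using suminf_mult[OF summable_decay_rate[OF c_ge], of "-1/2"] by simp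
qed

section \<open>Conclusion\<close>

lemma trpow_cut_boundary_kernel:
  assumes c_ge: "3/2 <= c"
  shows "trpow lborel (cut_boundary_kernel L c) n = row_kernel.capped_trace (boundary_kernel c) n L"
proof -
  interpret B: row_kernel "boundary_kernel c" 2 "1/2" boundary_weight by (rule row_kernel_boundary[OF c_ge])
  have "kpow lborel (cut_boundary_kernel L c) n s s' = ind {..L} s*ind {..L} s'*B.capped n L s s'" for s s'
  proof (induction n arbitrary: s')
    case (Suc n)
    have "kpow lborel (cut_boundary_kernel L c) (Suc n) s s'
      = (LBINT r. ind {..L} s*ind {..L} s'*(B.capped n L s r*(ind {..L} r*B.capped 0 L r s')))"
      unfolding kpow.simps kcomp_def Suc by (intro LINT_cong refl) (simp add: cut_boundary_kernel_def indicator_def)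
    also have "... = ind {..L} s*ind {..L} s'*B.capped (Suc n) L s s'" unfolding integral_mult_right_zero B.capped_semigroup by simp
    finally show ?case .
  qed (simp add: cut_boundary_kernel_def)
  then have "kpow lborel (cut_boundary_kernel L c) n s s = ind {..L} s*B.capped n L s s" for s by (simp add: indicator_def)
  then show ?thesis unfolding trpow_def ktrace_def B.capped_trace_def by simp
qed

definition boundary_trace :: "real => nat => real => real" where
  "boundary_trace c n L = row_kernel.capped_trace (boundary_kernel c) n L/real (Suc n)"

context
  fixes c :: real
  assumes c_ge: "3/2 <= c"
begin

lemma abs_boundary_capped_trace_le:
  "abs (row_kernel.capped_trace (boundary_kernel c) n L) <= (LBINT s. ind {..L} s*boundary_weight s)*(1/2) ^ n"
  by (rule row_kernel.abs_capped_trace_le[OF row_kernel_boundary[OF c_ge] boundary_weight_integrable])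

lemma summable_boundary_trace: "summable (%n. boundary_trace c n L)"
proof (rule summable_comparison_test'[where N=0])
  let ?I = "LBINT s. ind {..L} s*boundary_weight s"
  show "summable (%n. ?I*(1/2) ^ n)" by (intro summable_mult summable_geometric) simp
  fix n
  let ?T = "row_kernel.capped_trace (boundary_kernel c) n L"
  have "abs ?T/real (Suc n) <= abs ?T/1" by (intro divide_left_mono) auto
  then show "norm (boundary_trace c n L) <= ?I*(1/2) ^ n"
    using abs_boundary_capped_trace_le[of n L] by (simp add: boundary_trace_def abs_divide)
qed

lemma airy1_process_eq_exp:
  assumes X: "is_airy1_process M X" and L: "0 < L"
  shows "measure M {om \<in> space M. \<forall>s\<in>{0..L}. X s om <= c} = exp (-(\<Sum>n. boundary_trace c n L))"
proof -
  have c_pos: "0 < c" using c_ge by simp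
  interpret weighted_measure lborel "curve_g L c" "curve_k L" by (rule weighted_measure_curve[OF L c_pos])
  obtain C where C: "kernel C (cut_boundary_kernel L c)" using dominated_cut_boundary_kernel[OF L c_pos] by (auto simp: dominated_def)
  have "measure M {om \<in> space M. \<forall>s\<in>{0..L}. X s om <= c} = fredholm lborel (cut_boundary_kernel L c)"
    unfolding airy1_process_fredholm[OF X L c_pos] by (rule fredholm_limit_kernel[OF L c_pos])
  also have "... = exp (-(\<Sum>n. trpow lborel (cut_boundary_kernel L c) n/(real n + 1)))"
    using abs_boundary_capped_trace_le by (intro fredholm_eq_exp[OF C, where q="1/2"]) (auto simp: trpow_cut_boundary_kernel[OF c_ge])
  finally show ?thesis by (simp add: trpow_cut_boundary_kernel[OF c_ge] boundary_trace_def add.commute)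
qed

definition trace_error :: "nat => real" where "trace_error n = 4*((1/2) ^ n + real n*(1/2) ^ (n - 1))"

lemma trace_error_nonneg: "0 <= trace_error n" by (simp add: trace_error_def)

lemma summable_trace_error: "summable trace_error"
proof -
  have "summable (%n. diffs (%_. 1) n*(1/2 :: real) ^ n)" by (rule termdiff_converges[where K=1]) (auto intro: summable_geometric)
  then have "summable (%n. real (Suc n)*(1/2) ^ (Suc n - 1))" by (simp add: diffs_def)
  then have "summable (%n. real n*(1/2) ^ (n - 1))" by (subst (asm) summable_Suc_iff[of "%n. real n*(1/2) ^ (n - 1)"])
  then show ?thesis unfolding trace_error_def[abs_def] by (intro summable_mult summable_add summable_geometric) auto
qed

lemma boundary_capped_diag:
  assumes l: "1 <= l"
  shows "abs (row_kernel.capped (boundary_kernel c) n l l l - decay_rate c n) <= trace_error n*exp (-l)"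
proof -
  have "abs (row_kernel.capped (boundary_kernel c) n l l l - decay_rate c n)
    <= 2*((1/2) ^ n + real n*(1/2) ^ (n - 1))*flat_weight l*exp (-l)*exp (2*(l - l))"
    using abs_capped_gap_le[OF c_ge, of n l l l] unfolding stationary_capped_diag[OF c_ge] .
  also have "... <= 2*((1/2) ^ n + real n*(1/2) ^ (n - 1))*2*exp (-l)*exp (2*(l - l))"
    using l by (intro mult_right_mono mult_left_mono) (auto simp: flat_weight_def)
  finally show ?thesis by (simp add: trace_error_def)
qed

lemma boundary_trace_increment:
  assumes L: "1 <= L1" "L1 <= L2"
  shows "abs (boundary_trace c n L2 - boundary_trace c n L1 - decay_rate c n*(L2 - L1)) <= trace_error n*exp (-L1)"
proof -
  interpret B: row_kernel "boundary_kernel c" 2 "1/2" boundary_weight by (rule row_kernel_boundary[OF c_ge])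
  let ?d = "%l. ind {L1<..L2} l*B.capped n l l l - ind {L1<..L2} l*decay_rate c n"
  have tail: "Leb_has (%l. ind {L1..} l*exp (-1*l)) (exp (-1*L1)/1)" by (rule has_bochner_integral_exp_right) simp
  have majorant: "Leb1 (%l. trace_error n*(ind {L1..} l*exp (-1*l)))" using tail by (intro integrable_mult_right) (simp add: Leb_iff)
  have const: "Leb1 (%l. ind {L1<..L2} l*decay_rate c n)" by (intro integrable_mult_left integrable_real_indicator) (use L in auto)
  note int = L1_diff[OF B.diag_integrable const]
  have "boundary_trace c n L2 - boundary_trace c n L1 = (LBINT l. ind {L1<..L2} l*B.capped n l l l)"
    using B.capped_trace_diff[OF L(2) boundary_weight_integrable, of n] by (simp add: boundary_trace_def flip: diff_divide_distrib)
  moreover have "decay_rate c n*(L2 - L1) = (LBINT l. ind {L1<..L2} l*decay_rate c n)" using L by simp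
  ultimately have "abs (boundary_trace c n L2 - boundary_trace c n L1 - decay_rate c n*(L2 - L1)) = abs (integral\<^sup>L lborel ?d)"
    by (simp only: LINT_diff[OF B.diag_integrable const])
  also have "... <= (LBINT l. abs (?d l))" by (rule integral_abs_bound)
  also have "... <= (LBINT l. trace_error n*(ind {L1..} l*exp (-1*l)))"
  proof (rule integral_mono[OF integrable_abs[OF int] majorant])
    show "abs (?d l) <= trace_error n*(ind {L1..} l*exp (-1*l))" for l
      using boundary_capped_diag[of l n] trace_error_nonneg[of n] L by (auto simp: indicator_def)
  qed
  also have "... = trace_error n*exp (-L1)" using Leb_eq[OF tail] by simp
  finally show ?thesis .
qed

lemma boundary_trace_series_increment:
  assumes L: "1 <= L1" "L1 <= L2"
  shows "abs (((\<Sum>n. boundary_trace c n L2) - airy1_kappa c*L2) - ((\<Sum>n. boundary_trace c n L1) - airy1_kappa c*L1))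
  <= suminf trace_error*exp (-L1)"
proof -
  let ?d = "%n. boundary_trace c n L2 - boundary_trace c n L1 - decay_rate c n*(L2 - L1)"
  note traces = summable_boundary_trace[of L2] summable_boundary_trace[of L1] and rate = summable_decay_rate[OF c_ge]
  have "(\<Sum>n. boundary_trace c n L2) - (\<Sum>n. boundary_trace c n L1) - airy1_kappa c*(L2 - L1) = suminf ?d"
    unfolding airy1_kappa_eq[OF c_ge] suminf_diff[OF traces] suminf_mult2[OF rate]
    by (rule suminf_diff[OF summable_diff[OF traces] summable_mult2[OF rate]])
  moreover have "abs (suminf ?d) <= suminf trace_error*exp (-L1)"
  proof -
    have error: "summable (%n. trace_error n*exp (-L1))" by (intro summable_mult2 summable_trace_error)
    have "summable (%n. abs (?d n))" by (rule summable_comparison_test'[OF error, where N=0]) (use boundary_trace_increment[OF L] in simp)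
    then have "abs (suminf ?d) <= (\<Sum>n. trace_error n*exp (-L1))"
      by (intro order_trans[OF summable_rabs suminf_le] boundary_trace_increment[OF L] error)
    then show ?thesis unfolding suminf_mult2[OF summable_trace_error, symmetric] .
  qed
  ultimately show ?thesis by (simp add: algebra_simps)
qed

end

lemma exponential_Cauchy_limit:
  fixes f :: "real => real"
  assumes f: "!!x y. 1 <= x ==> x <= y ==> abs (f y - f x) <= B*exp (-x)"
  obtains l where "!!x. 1 <= x ==> abs (l - f x) <= B*exp (-x)"
proof -
  have "Cauchy (%n. f (real (Suc n)))"
  proof (rule metric_CauchyI)
    fix e :: real assume e: "0 < e"
    have "(%n. B*exp (-real (Suc n))) ----> 0" by real_asymp
    then have "\<forall>\<^sub>F n in sequentially. B*exp (-real (Suc n)) < e/2" using e by (intro order_tendstoD) auto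
    then obtain N where N: "B*exp (-real (Suc N)) < e/2" by (auto simp: eventually_sequentially)
    have half: "dist (f (real (Suc m))) (f (real (Suc N))) < e/2" if "N <= m" for m
      using f[of "real (Suc N)" "real (Suc m)"] N that by (simp add: dist_real_def)
    have "dist (f (real (Suc m))) (f (real (Suc n))) < e" if "N <= m" "N <= n" for m n
      by (rule dist_triangle_half_l[OF half[OF that(1)] half[OF that(2)]])
    then show "\<exists>M. \<forall>m\<ge>M. \<forall>n\<ge>M. dist (f (real (Suc m))) (f (real (Suc n))) < e" by blast
  qed
  then obtain l where l: "(%n. f (real (Suc n))) ----> l" by (auto simp: Cauchy_convergent_iff convergent_def)
  have "abs (l - f x) <= B*exp (-x)" if x: "1 <= x" for x
  proof (rule tendsto_upperbound)
    show "(%n. abs (f (real (Suc n)) - f x)) ----> abs (l - f x)" by (intro tendsto_intros l)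
    show "\<forall>\<^sub>F n in sequentially. abs (f (real (Suc n)) - f x) <= B*exp (-x)"
      using eventually_ge_at_top[of "nat \<lceil>x\<rceil>"]
    proof eventually_elim
      case (elim n)
      then have "x <= real (Suc n)" by linarith
      from f[OF x this] show ?case .
    qed
  qed simp
  then show ?thesis by (rule that)
qed

theorem theorem1p1:
  fixes M :: "'a measure" and X :: "real \<Rightarrow> 'a \<Rightarrow> real" and c :: real
  assumes "is_airy1_process M X"
    and "c \<ge> 3 / 2"
  shows "\<exists>C::real. \<exists>g :: real \<Rightarrow> real. g \<in> O[at_top](\<lambda>L. exp (- L)) \<and>
           (\<forall>\<^sub>F L in at_top.
              measure M {\<omega> \<in> space M. \<forall>s\<in>{0..L}. X s \<omega> \<le> c}
                = C * exp (- airy1_kappa c * L + g L))"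
proof -
  define f where "f L = (\<Sum>n. boundary_trace c n L) - airy1_kappa c*L" for L
  obtain l where l: "!!L. 1 <= L ==> abs (l - f L) <= suminf trace_error*exp (-L)"
    using exponential_Cauchy_limit[OF boundary_trace_series_increment[OF assms(2)], folded f_def] by blast
  have "(%L. l - f L) \<in> O[at_top](%L. exp (-L))"
    by (rule bigoI[where c="suminf trace_error"], rule eventually_mono[OF eventually_ge_at_top[of 1]]) (use l in simp)
  moreover have "\<forall>\<^sub>F L in at_top. measure M {om \<in> space M. \<forall>s\<in>{0..L}. X s om <= c}
    = exp (-l)*exp (- airy1_kappa c*L + (l - f L))" using eventually_gt_at_top[of 0]
  proof eventually_elim
    case (elim L)
    show ?case unfolding airy1_process_eq_exp[OF assms(2,1) elim] f_def by (simp flip: exp_add)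
  qed
  ultimately show ?thesis by blast
qed

end
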